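(* There exist real-valued functions $u_1, u_2 \in C(\mathbb{R} : Z_{4,2})$, with $u_1 \neq 0$ and $u_2 \neq 0$, which are solutions of the Benjamin-Ono equation $$\partial_t u + \mathcal{H}\partial_x^2 u + u\,\partial_x u = 0, \qquad t, x \in \mathbb{R}$$ (each with its own initial data $u_j(\cdot,0)$), such that $u_1 \neq u_2$ and, for any $T>0$, $$u_1 - u_2 \in L^{\infty}([-T,T] : Z_{4,4}).$$
   Context: $\mathcal{H}$ denotes the Hilbert transform in the $x$ variable, $\mathcal{H} f(x) = \frac{1}{\pi}\lim_{\epsilon\downarrow 0}\int_{|y|\ge \epsilon}\frac{f(x-y)}{y}\,dy$, i.e. $\widehat{\mathcal{H}f}(\xi) = -i\,\mathrm{sgn}(\xi)\widehat{f}(\xi)$. For $s, r\in\mathbb{R}$, $H^s(\mathbb{R}) = (1-\partial_x^2)^{-s/2}L^2(\mathbb{R})$ is the $L^2$-based Sobolev space and $Z_{s,r} = H^s(\mathbb{R}) \cap L^2(|x|^{2r}dx)$, with the natural norm $\|f\|_{H^s} + \||x|^r f\|_{L^2}$. For a Banach space $X$ of functions of $x$, $C(\mathbb{R}:X)$ denotes the continuous curves $t\mapsto u(\cdot,t)$ from $\mathbb{R}$ into $X$, and $L^\infty([-T,T]:X)$ the (essentially) bounded curves from $[-T,T]$ into $X$. All solutions considered are real-valued. *)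

theory Defs
  imports "HOL-Analysis.Analysis"
begin

definition square_integrable :: "(real \<Rightarrow> 'a::{banach, second_countable_topology}) \<Rightarrow> bool" where
  "square_integrable f \<longleftrightarrow>
     f \<in> borel_measurable lborel \<and> integrable lborel (\<lambda>x. (norm (f x))\<^sup>2)"

definition L2_norm :: "(real \<Rightarrow> 'a::{banach, second_countable_topology}) \<Rightarrow> real" where
  "L2_norm f = sqrt (LINT x|lborel. (norm (f x))\<^sup>2)"

(* The Plancherel transform as a relation, since it is determined only almost everywhere:
   F is the L2-limit of the Fourier integrals of f truncated to [-R, R].  The unitary
   normalisation makes Plancherel's identity hold with constant 1. *)
definition has_fourier_transform :: "(real \<Rightarrow> real) \<Rightarrow> (real \<Rightarrow> complex) \<Rightarrow> bool" where
  "has_fourier_transform f F \<longleftrightarrow>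
     square_integrable f \<and> square_integrable F \<and>
     ((\<lambda>R. \<integral>\<^sup>+ \<xi>. ennreal ((norm (complex_of_real (1 / sqrt (2 * pi)) *
              (LINT x:{-R..R}|lborel. exp (- \<i> * complex_of_real (x * \<xi>)) * complex_of_real (f x))
              - F \<xi>))\<^sup>2) \<partial>lborel) \<longlongrightarrow> 0) at_top"

(* f = (1 - d^2/dx^2)^(-s/2) g as a Fourier multiplier on L2, for s >= 0. *)
definition is_bessel_potential :: "real \<Rightarrow> (real \<Rightarrow> real) \<Rightarrow> (real \<Rightarrow> real) \<Rightarrow> bool" where
  "is_bessel_potential s g f \<longleftrightarrow>
     (\<exists>G F. has_fourier_transform g G \<and> has_fourier_transform f F \<and>
        (AE \<xi> in lborel. F \<xi> = complex_of_real ((1 + \<xi>\<^sup>2) powr (- s / 2)) * G \<xi>))"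

(* The real-valued part of H^s, for s >= 0 (where H^s is contained in L2).  Elements are
   functions rather than almost-everywhere classes. *)
definition sobolev :: "real \<Rightarrow> (real \<Rightarrow> real) set" where
  "sobolev s = {f. \<exists>g. is_bessel_potential s g f}"

(* Any two choices of g agree almost everywhere. *)
definition sobolev_norm :: "real \<Rightarrow> (real \<Rightarrow> real) \<Rightarrow> real" where
  "sobolev_norm s f = L2_norm (SOME g. is_bessel_potential s g f)"

definition weighted_sobolev :: "real \<Rightarrow> real \<Rightarrow> (real \<Rightarrow> real) set" where
  "weighted_sobolev s r = {f \<in> sobolev s. square_integrable (\<lambda>x. \<bar>x\<bar> powr r * f x)}"

definition weighted_sobolev_norm :: "real \<Rightarrow> real \<Rightarrow> (real \<Rightarrow> real) \<Rightarrow> real" where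
  "weighted_sobolev_norm s r f = sobolev_norm s f + L2_norm (\<lambda>x. \<bar>x\<bar> powr r * f x)"

(* Curves are written u t x, time first.  A function space is given by its carrier X and
   its norm N. *)
definition continuous_curve ::
    "(real \<Rightarrow> real) set \<Rightarrow> ((real \<Rightarrow> real) \<Rightarrow> real) \<Rightarrow> (real \<Rightarrow> real \<Rightarrow> real) \<Rightarrow> bool" where
  "continuous_curve X N u \<longleftrightarrow>
     (\<forall>t. u t \<in> X) \<and> (\<forall>t\<^sub>0. ((\<lambda>t. N (\<lambda>x. u t x - u t\<^sub>0 x)) \<longlongrightarrow> 0) (at t\<^sub>0))"

(* L-infinity in the Bochner sense: strongly measurable (an almost-everywhere limit in norm
   of X-valued simple functions) and essentially bounded. *)
definition Linfty_curve ::
    "real set \<Rightarrow> (real \<Rightarrow> real) set \<Rightarrow> ((real \<Rightarrow> real) \<Rightarrow> real) \<Rightarrow> (real \<Rightarrow> real \<Rightarrow> real) \<Rightarrow> bool" where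
  "Linfty_curve I X N v \<longleftrightarrow>
     (\<forall>t\<in>I. v t \<in> X) \<and>
     (\<exists>\<sigma>. (\<forall>n. simple_function (lebesgue_on I) (\<sigma> n) \<and> (\<forall>t\<in>I. \<sigma> n t \<in> X)) \<and>
          (AE t in lebesgue_on I. (\<lambda>n. N (\<lambda>x. \<sigma> n t x - v t x)) \<longlonglongrightarrow> 0)) \<and>
     (\<exists>B. AE t in lebesgue_on I. N (v t) \<le> B)"

definition has_hilbert_transform :: "(real \<Rightarrow> real) \<Rightarrow> real \<Rightarrow> real \<Rightarrow> bool" where
  "has_hilbert_transform f h x \<longleftrightarrow>
     (\<forall>\<epsilon>>0. set_integrable lborel {y. \<epsilon> \<le> \<bar>y\<bar>} (\<lambda>y. f (x - y) / y)) \<and>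
     ((\<lambda>\<epsilon>. 1 / pi * (LINT y:{y. \<epsilon> \<le> \<bar>y\<bar>}|lborel. f (x - y) / y)) \<longlongrightarrow> h) (at_right 0)"

(* Classical solutions: all derivatives and the principal value exist at every point.
   For curves that are continuous into H^4 (in their continuous representatives) this is the
   same as solving the equation in the distributional or in the strong L2 sense, because
   H^4 embeds into C^3 and the equation then gives a time derivative that is continuous
   into H^2. *)
definition benjamin_ono_solution :: "(real \<Rightarrow> real \<Rightarrow> real) \<Rightarrow> bool" where
  "benjamin_ono_solution u \<longleftrightarrow>
     (\<exists>u_t u_x u_xx Hu_xx. \<forall>t x.
        ((\<lambda>\<tau>. u \<tau> x) has_real_derivative u_t t x) (at t) \<and>
        (u t has_real_derivative u_x t x) (at x) \<and>
        (u_x t has_real_derivative u_xx t x) (at x) \<and>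
        has_hilbert_transform (u_xx t) (Hu_xx t x) x \<and>
        u_t t x + Hu_xx t x + u t x * u_x t x = 0)"

end

theory Submission
  imports Defs "HOL-Probability.Probability"
begin

text \<open>Take a solution \<open>u\<^sub>1 = u\<close> of mean zero and its translate \<open>u\<^sub>2(t, x) = u(t, x + 1)\<close>. For
mean zero the \<open>x\<^sup>-\<^sup>2\<close> and \<open>x\<^sup>-\<^sup>3\<close> terms in the tail of \<open>u\<close> vanish, and the \<open>x\<^sup>-\<^sup>4\<close> term is the same for both,
so \<open>u\<^sub>1 - u\<^sub>2 = O(x\<^sup>-\<^sup>5)\<close>.

Everything happens on the Fourier half-line: \<open>u\<close> is (up to a constant) the Fourier synthesis of
\<open>2(p + p\<^sup>~)\<close> with \<open>p\<close> supported on \<open>\<xi> \<ge> 0\<close>, \<open>p\<^sup>~(\<xi>) = cnj p(-\<xi>)\<close>, and \<open>p(0, \<xi>) = \<xi>\<^sup>2 e\<^sup>-\<^sup>\<xi>\<close>. Tails of \<open>u\<close> are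
jumps of the derivatives of \<open>p\<close> at \<open>\<xi> = 0\<close>. The equation is \<open>\<partial>\<^sub>t p = M p\<close> for the skew operator
\<open>M\<close> of the Lax pair \<open>(L, M)\<close>. If \<open>h\<close> solves \<open>\<partial>\<^sub>t h = M h\<close>, then so do \<open>L h\<close> and \<open>A h = i h' - 2 t L h\<close>,
and both the \<open>L\<^sup>2\<close> norm of \<open>h\<close> and \<open>h(t, 0)\<close> are conserved. Conservation of the norms of \<open>L\<^sup>k p\<close>, fed
through a factorial majorant, gives exponential decay of \<open>p\<close> uniformly on bounded time intervals,
hence global solutions (Picard iteration in exponentially weighted spaces; negative times by
complex conjugation). Conservation of boundary values for words in \<open>A\<close> and \<open>L\<close> gives \<open>p(t, 0) = 0\<close>,
\<open>p'(t, 0)\<close> imaginary and \<open>p''(t, 0)\<close> real, which are exactly the cancellations needed for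
\<open>x\<^sup>2 u\<close> and \<open>x\<^sup>4 (u\<^sub>1 - u\<^sub>2)\<close> to be square integrable.\<close>

section \<open>Convolution of exponentially decaying functions\<close>

text \<open>The nonlinearity costs one factor of the frequency, so a Picard iteration cannot close
  with a fixed weight. Exponential decay of \<open>p\<close> means that \<open>u\<close> is analytic
  in a strip, and the lost factor is bought by letting the strip shrink linearly in time. That gives
  local solutions only; the obstacle is a collapse of the strip. The norms of \<open>L^k h\<close>
  prevent it: initially they are at most \<open>K R^k k!\<close>, they stay so, and majorants turn
  this back into bounds of the same kind for the moments of \<open>h\<close>. The conversion starts
  from the fact that the norms of \<open>p\<close> and \<open>L p\<close> control the integral of
  \<open>|p|\<close>, so that \<open>L\<close> and multiplication by \<xi> are comparable.

  The local step also needs decay of the \<xi>-derivatives of \<open>p\<close>. They are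
  combinations of words in \<open>A\<close> and \<open>L\<close> applied to \<open>p\<close>; each
  word solves the linear flow, so one a priori bound serves them all.

  The datum is real with a double zero at 0. Hence the boundary values of words with at most two
  letters can be evaluated at time 0, where \<open>A\<close> is just \<open>i\<close> times the
  derivative.\<close>

type_synonym cfun = "real => complex"

notation has_vector_derivative (infix "hvd" 50)

lemmas L_integrable_add = Bochner_Integration.integrable_add
 and L_integrable_bound = Bochner_Integration.integrable_bound
 and L_integrable_diff = Bochner_Integration.integrable_diff
 and L_integrable_max = Bochner_Integration.integrable_max
 and L_integral_add = Bochner_Integration.integral_add
 and L_integral_cnj = Bochner_Integration.integral_cnj
 and L_integral_cong = Bochner_Integration.integral_cong
 and L_integral_cong_AE = Bochner_Integration.integral_cong_AE
 and L_integral_diff = Bochner_Integration.integral_diff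
 and L_integral_nonneg = Bochner_Integration.integral_nonneg
 and L_integral_of_real = Bochner_Integration.integral_of_real

abbreviation decay :: "real => real => real" where
 "decay \<sigma> x \<equiv> exp (- \<sigma> * \<bar>x\<bar>)"

abbreviation phase :: "real => complex" where
 "phase r \<equiv> exp (\<i> * of_real r)"

abbreviation meas :: "(real => 'a::topological_space) => bool" where
 "meas f \<equiv> f \<in> borel_measurable borel"

abbreviation lborel2 :: "(real * real) measure" where
 "lborel2 \<equiv> lborel \<Otimes>\<^sub>M lborel"

abbreviation at_half :: "real => real filter" where
 "at_half x \<equiv> at x within {0..}"

section \<open>Functions with exponential decay\<close>

lemma integrable_exp_abs:
 assumes "\<sigma> > (0::real)"
 shows "integrable lborel (\<lambda>x::real. decay \<sigma> x)"
proof -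
 have 0: "has_bochner_integral lborel (\<lambda>x::real. indicator {0..} x *\<^sub>R (exp (- \<bar>x\<bar>))) 1"
  using has_bochner_integral_I0i_power_exp_m'[of 0] by (rule has_bochner_integral_cong[THEN iffD1, rotated -1]) (auto simp: indicator_def)
 have "has_bochner_integral lborel (\<lambda>x::real. exp (- \<bar>x\<bar>)) (2 *\<^sub>R 1)" by (rule has_bochner_integral_even_function[OF 0]) simp
 then have "integrable lborel (\<lambda>x::real. exp (- \<bar>x\<bar>))" by (simp add: has_bochner_integral_iff)
 from lborel_integrable_real_affine[OF this, of \<sigma> 0] assms
 show ?thesis by (simp add: abs_mult)
qed

lemma borel_measurable_cnj [measurable (raw)]:
 "f \<in> borel_measurable M ==> (\<lambda>x. cnj (f x)) \<in> borel_measurable M"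
 by (rule measurable_compose[OF _ borel_measurable_continuous_onI]) (auto intro: continuous_intros)

text \<open>The set \<open>I\<close> of times is a parameter because all bounds are needed uniformly in time.\<close>
definition expd :: "real set => (real => cfun) => bool" where
 "expd I F \<longleftrightarrow> (\<forall>t\<in>I. meas (F t)) \<and>
  (\<exists>C \<sigma>. \<sigma> > 0 \<and> (\<forall>t\<in>I. \<forall>x. norm (F t x) \<le> C * decay \<sigma> x))"

text \<open>With a one-point set of times every lemma about families yields its static
  version.\<close>

abbreviation edec :: "cfun => bool" where
 "edec f \<equiv> expd {0} (\<lambda>_. f)"

text \<open>Images under the Fourier transform of operations in physical space: \<open>conv\<close>
  is the product, \<open>crefl\<close> complex conjugation, \<open>pos\<close> the Szego projection,
  and \<open>mulx\<close> is -i d/dx.\<close>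

definition conv :: "cfun => cfun => cfun" where
 "conv f g x = (LBINT y. f (x-y) * g y)"
definition crefl :: "cfun => cfun" where
 "crefl f x = cnj (f (- x))"
definition pos :: "cfun => cfun" where
 "pos f x = (if 0 \<le> x then f x else 0)"
definition mulx :: "cfun => cfun" where
 "mulx f x = of_real x * f x"
definition herm :: "cfun => cfun" where
 "herm p x = p x + crefl p x"

lemma expdI:
 assumes "!!t. t \<in> I ==> meas (F t)" "\<sigma> > 0"
  "!!t x. t \<in> I ==> norm (F t x) \<le> C * decay \<sigma> x"
 shows "expd I F" using assms unfolding expd_def by blast

lemma expdE:
 assumes "expd I F"
 obtains C \<sigma> where "C > 0" "\<sigma> > 0"
  "!!t x. t \<in> I ==> norm (F t x) \<le> C * decay \<sigma> x"
proof -
 from assms obtain C \<sigma> where *: "\<sigma> > 0" "!!t x. t \<in> I ==> norm (F t x) \<le> C * decay \<sigma> x" unfolding expd_def by blast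
 have "norm (F t x) \<le> (\<bar>C\<bar>+1) * decay \<sigma> x" if "t \<in> I" for t x
  by (rule order.trans[OF *(2)[OF that]]) (auto intro!: mult_right_mono)
 with *(1) show ?thesis by (intro that[of "\<bar>C\<bar>+1" \<sigma>]) auto
qed

lemma expd_common:
 assumes "expd I F" "expd I G"
 obtains C \<sigma> where "C > 0" "\<sigma> > 0"
  "!!t x. t \<in> I ==> norm (F t x) \<le> C * decay \<sigma> x"
  "!!t x. t \<in> I ==> norm (G t x) \<le> C * decay \<sigma> x"
proof -
 obtain C1 s1 where 1: "C1 > 0" "s1 > 0" "!!t x. t \<in> I ==> norm (F t x) \<le> C1 * exp (- s1*\<bar>x\<bar>)" using expdE[OF assms(1)] by blast
 obtain C2 s2 where 2: "C2 > 0" "s2 > 0" "!!t x. t \<in> I ==> norm (G t x) \<le> C2 * exp (- s2*\<bar>x\<bar>)" using expdE[OF assms(2)] by blast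
 have *: "a * decay b x \<le> max C1 C2 * exp (- min s1 s2 * \<bar>x\<bar>)"
  if "a \<le> max C1 C2" "min s1 s2 \<le> b" "0 < a" for a b x using that 1(1) by (intro mult_mono) (auto intro!: mult_right_mono)
 show ?thesis
 proof (rule that[of "max C1 C2" "min s1 s2"])
  show "norm (F t x) \<le> max C1 C2 * exp (- min s1 s2 * \<bar>x\<bar>)" if "t \<in> I" for t x
   using 1 by (intro order_trans[OF 1(3)[OF that] *]) auto
  show "norm (G t x) \<le> max C1 C2 * exp (- min s1 s2 * \<bar>x\<bar>)" if "t \<in> I" for t x
   using 2 by (intro order_trans[OF 2(3)[OF that] *]) auto
 qed (use 1 2 in auto)
qed

lemma edecE:
 assumes "edec f"
 obtains C \<sigma> where "C > 0" "\<sigma> > 0" "!!x. norm (f x) \<le> C * decay \<sigma> x"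
proof -
 obtain C \<sigma> where *: "C > 0" "\<sigma> > 0" "!!t x. t \<in> {0::real} ==> norm (f x) \<le> C * decay \<sigma> x"
  by (rule expdE[OF assms]) blast
 show ?thesis by (rule that[OF *(1,2) *(3)[OF singletonI]])
qed

lemma edec_common:
 assumes "edec f" "edec g"
 obtains C \<sigma> where "C > 0" "\<sigma> > 0"
  "!!x. norm (f x) \<le> C * decay \<sigma> x" "!!x. norm (g x) \<le> C * decay \<sigma> x"
proof -
 obtain C \<sigma> where *: "C > 0" "\<sigma> > 0" "!!t x. t \<in> {0::real} ==> norm (f x) \<le> C * decay \<sigma> x"
  "!!t x. t \<in> {0::real} ==> norm (g x) \<le> C * decay \<sigma> x" by (rule expd_common[OF assms]) blast
 show ?thesis by (rule that[OF *(1,2) *(3)[OF singletonI] *(4)[OF singletonI]])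
qed

lemma expd_measurable [measurable_dest]: "expd I F ==> t \<in> I ==> meas (F t)" by (simp add: expd_def)

lemma expd_slice: "expd I F ==> t \<in> I ==> edec (F t)" unfolding expd_def by blast

lemma expd_const: "edec f ==> expd I (\<lambda>_. f)" unfolding expd_def by blast

lemma expd_subset: "expd I F ==> J \<subseteq> I ==> expd J F" unfolding expd_def by blast

lemma expd_cong: "expd I F ==> (!!t. t \<in> I ==> F t = G t) ==> expd I G" unfolding expd_def by simp

lemma expd_add: assumes "expd I F" "expd I G" shows "expd I (\<lambda>t x. F t x + G t x)"
proof -
 obtain C \<sigma> where *: "C > 0" "\<sigma> > 0"
  "!!t x. t \<in> I ==> norm (F t x) \<le> C * decay \<sigma> x"
  "!!t x. t \<in> I ==> norm (G t x) \<le> C * decay \<sigma> x" using expd_common[OF assms] by blast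
 show ?thesis
 proof (rule expdI[of _ _ \<sigma> "2*C"])
  fix t x assume t: "t \<in> I"
  show "norm (F t x + G t x) \<le> 2*C * decay \<sigma> x" using *(3,4)[OF t, of x] norm_triangle_ineq[of "F t x" "G t x"] by simp
  show "meas (\<lambda>x. F t x + G t x)" using assms t by (intro borel_measurable_add) (auto simp: expd_def)
 qed (use * in auto)
qed

lemma expd_scale:
 assumes "expd I F" "!!t. t \<in> I ==> norm (c t) \<le> B"
 shows "expd I (\<lambda>t x. c t * F t x)"
proof -
 obtain C \<sigma> where *: "C > 0" "\<sigma> > 0"
  "!!t x. t \<in> I ==> norm (F t x) \<le> C * decay \<sigma> x" using expdE[OF assms(1)] by blast
 show ?thesis
 proof (rule expdI[of _ _ \<sigma> "B*C"])
  fix t x assume t: "t \<in> I"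
  show "norm (c t * F t x) \<le> B*C * decay \<sigma> x"
   using mult_mono[OF assms(2)[OF t] *(3)[OF t, of x]] order_trans[OF norm_ge_zero assms(2)[OF t]] by (simp add: norm_mult mult.assoc)
  show "meas (\<lambda>x. c t * F t x)" using assms t by (intro borel_measurable_times) (auto simp: expd_def)
 qed (use * in auto)
qed

lemma expd_cmult: "expd I F ==> expd I (\<lambda>t x. c * F t x)" by (rule expd_scale[of _ _ "\<lambda>_. c" "norm c"]) auto

lemma expd_uminus: "expd I F ==> expd I (\<lambda>t x. - F t x)" using expd_cmult[of I F "-1"] by simp

lemma expd_diff: "expd I F ==> expd I G ==> expd I (\<lambda>t x. F t x - G t x)"
 using expd_add[of I F "\<lambda>t x. - G t x"] expd_uminus[of I G] by simp

lemma expd_crefl: assumes "expd I F" shows "expd I (\<lambda>t. crefl (F t))"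
proof -
 obtain C \<sigma> where *: "C > 0" "\<sigma> > 0"
  "!!t x. t \<in> I ==> norm (F t x) \<le> C * decay \<sigma> x" using expdE[OF assms(1)] by blast
 show ?thesis
 proof (rule expdI[of _ _ \<sigma> C])
  fix t x assume t: "t \<in> I"
  have [measurable]: "meas (F t)" using assms t by (simp add: expd_def)
  show "meas (crefl (F t))" unfolding crefl_def[abs_def] by measurable
  show "norm (crefl (F t) x) \<le> C * decay \<sigma> x" using *(3)[OF t, of "-x"] by (simp add: crefl_def)
 qed (use * in auto)
qed

lemma expd_pos: assumes "expd I F" shows "expd I (\<lambda>t. pos (F t))"
proof -
 obtain C \<sigma> where *: "C > 0" "\<sigma> > 0"
  "!!t x. t \<in> I ==> norm (F t x) \<le> C * decay \<sigma> x" using expdE[OF assms(1)] by blast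
 show ?thesis
 proof (rule expdI[of _ _ \<sigma> C])
  fix t x assume t: "t \<in> I"
  have [measurable]: "meas (F t)" using assms t by (simp add: expd_def)
  show "meas (pos (F t))" unfolding pos_def[abs_def] by measurable
  show "norm (pos (F t) x) \<le> C * decay \<sigma> x" using *(1) *(3)[OF t, of "x"] by (cases "0 \<le> x") (auto simp: pos_def)
 qed (use * in auto)
qed

lemma abs_mult_exp_le: assumes "\<sigma> > (0::real)" shows "\<bar>x\<bar> * decay \<sigma> x \<le> 2/\<sigma> * decay (\<sigma>/2) x"
proof -
 have "\<sigma>/2*\<bar>x\<bar> \<le> exp (\<sigma>/2*\<bar>x\<bar>)" using exp_ge_add_one_self[of "\<sigma>/2*\<bar>x\<bar>"] by linarith
 then have "\<sigma>/2*\<bar>x\<bar> * decay \<sigma> x \<le> exp (\<sigma>/2*\<bar>x\<bar>) * decay \<sigma> x" by (intro mult_right_mono) auto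
 also have "... = decay (\<sigma>/2) x" by (simp flip: exp_add add: field_simps)
 finally have "2/\<sigma>*(\<sigma>/2*\<bar>x\<bar> * decay \<sigma> x) \<le> 2/\<sigma> * decay (\<sigma>/2) x"
  using assms by (intro mult_left_mono) auto
 then show ?thesis using assms by (simp add: field_simps)
qed

lemma expd_mulx: assumes "expd I F" shows "expd I (\<lambda>t. mulx (F t))"
proof -
 obtain C \<sigma> where *: "C > 0" "\<sigma> > 0"
  "!!t x. t \<in> I ==> norm (F t x) \<le> C * decay \<sigma> x" using expdE[OF assms(1)] by blast
 show ?thesis
 proof (rule expdI[of _ _ "\<sigma>/2" "C*(2/\<sigma>)"])
  fix t x assume t: "t \<in> I"
  have [measurable]: "meas (F t)" using assms t by (simp add: expd_def)
  show "meas (mulx (F t))" unfolding mulx_def[abs_def] by measurable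
  have "norm (mulx (F t) x) = \<bar>x\<bar> * norm (F t x)" by (simp add: mulx_def norm_mult)
  also have "... \<le> \<bar>x\<bar>*(C * decay \<sigma> x)" by (intro mult_left_mono *(3) t) auto
  also have "... \<le> C*(2/\<sigma>) * decay (\<sigma>/2) x"
   using mult_left_mono[OF abs_mult_exp_le[OF *(2), of x], of C] *(1) by (simp add: mult_ac)
  finally show "norm (mulx (F t) x) \<le> C*(2/\<sigma>) * decay (\<sigma>/2) x" .
 qed (use * in auto)
qed

text \<open>Since |x - y| + |y| dominates both |x| and |y|, half of the rate can be kept as decay in
  \<open>x\<close> while the other half serves the integration over \<open>y\<close>. This is why
  convolution halves the rate but preserves the class.\<close>

lemma exp_conv_le:
 assumes "\<sigma> > (0::real)"
 shows "decay \<sigma> (x-y) * decay \<sigma> y \<le> decay (\<sigma>/2) x * decay (\<sigma>/2) y"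
proof -
 have "\<bar>x\<bar>+\<bar>y\<bar> \<le> 2*(\<bar>x-y\<bar>+\<bar>y\<bar>)" by (auto simp: abs_if)
 then have "\<sigma>/2*(\<bar>x\<bar>+\<bar>y\<bar>) \<le> \<sigma>/2*(2*(\<bar>x-y\<bar>+\<bar>y\<bar>))" using assms by (intro mult_left_mono) auto
 then show ?thesis unfolding mult_exp_exp exp_le_cancel_iff by (simp add: algebra_simps)
qed

lemma edec_integrable:
 assumes "edec f" shows "integrable lborel f"
proof -
 obtain C \<sigma> where *: "C > 0" "\<sigma> > 0" "!!x. norm (f x) \<le> C * decay \<sigma> x" using edecE[OF assms] by blast
 show ?thesis
 proof (rule L_integrable_bound[OF integrable_mult_right[OF integrable_exp_abs[OF *(2)], of C]])
  show "f \<in> borel_measurable lborel" using assms by (auto simp: expd_def)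
  show "AE x in lborel. norm (f x) \<le> norm (C * decay \<sigma> x)" using * by (intro AE_I2) (simp add: abs_mult)
 qed
qed

lemma conv_dom:
 assumes "!!x. norm (f x) \<le> C * decay \<sigma> x" "!!x. norm (g x) \<le> C * decay \<sigma> x" "\<sigma> > 0" "C > 0"
 shows "norm (f (x-y) * g y :: complex) \<le> C*C * decay (\<sigma>/2) x * decay (\<sigma>/2) y"
proof -
 have "norm (f (x-y) * g y) \<le> (C * decay \<sigma> (x-y))*(C * decay \<sigma> y)" unfolding norm_mult using assms by (intro mult_mono) auto
 also have "... = C*C*(decay \<sigma> (x-y) * decay \<sigma> y)" by simp
 also have "... \<le> C*C*(decay (\<sigma>/2) x * decay (\<sigma>/2) y)" using assms by (intro mult_left_mono exp_conv_le) auto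
 finally show ?thesis by (simp add: mult.assoc)
qed

lemma conv_integrable:
 assumes "edec f" "edec g" shows "integrable lborel (\<lambda>y. f (x-y) * g y)"
proof -
 obtain C \<sigma> where *: "C > 0" "\<sigma> > 0"
  "!!x. norm (f x) \<le> C * decay \<sigma> x" "!!x. norm (g x) \<le> C * decay \<sigma> x" using edec_common[OF assms] by blast
 have [measurable]: "meas f" "meas g" using assms by (auto simp: expd_def)
 show ?thesis
 proof (rule L_integrable_bound[OF integrable_mult_right[OF integrable_exp_abs[of "\<sigma>/2"], of "C*C * decay (\<sigma>/2) x"]])
  show "AE y in lborel. norm (f (x-y) * g y)
    \<le> norm (C*C * decay (\<sigma>/2) x * decay (\<sigma>/2) y)" using conv_dom[OF *(3,4,2,1), of x] *(1) by (intro AE_I2) (simp add: abs_mult)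
 qed (use *(2) in auto)
qed

lemma conv_measurable:
 assumes [measurable]: "meas f" "meas g"
 shows "meas (conv f g)" unfolding conv_def[abs_def] by measurable

lemma expd_conv: assumes "expd I F" "expd I G" shows "expd I (\<lambda>t. conv (F t) (G t))"
proof -
 obtain C \<sigma> where *: "C > 0" "\<sigma> > 0"
  "!!t x. t \<in> I ==> norm (F t x) \<le> C * decay \<sigma> x"
  "!!t x. t \<in> I ==> norm (G t x) \<le> C * decay \<sigma> x" using expd_common[OF assms] by blast
 define A where "A = (LBINT y. decay (\<sigma>/2) y)"
 show ?thesis
 proof (rule expdI[of _ _ "\<sigma>/2" "C*C*A"])
  fix t x assume t: "t \<in> I"
  show "meas (conv (F t) (G t))" using assms t by (intro conv_measurable) (auto simp: expd_def)
  have "norm (conv (F t) (G t) x) \<le> (LBINT y. C*C * decay (\<sigma>/2) x * decay (\<sigma>/2) y)" unfolding conv_def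
  proof (rule order_trans[OF integral_norm_bound integral_mono])
   show "integrable lborel (\<lambda>y. norm (F t (x-y) * G t y))"
    using conv_integrable[OF expd_slice[OF assms(1) t] expd_slice[OF assms(2) t]] by (rule integrable_norm)
   show "integrable lborel (\<lambda>y. C*C * decay (\<sigma>/2) x * decay (\<sigma>/2) y)" using integrable_exp_abs[of "\<sigma>/2"] * by auto
  qed (rule conv_dom[OF *(3,4)[OF t] *(2,1)])
  then show "norm (conv (F t) (G t) x) \<le> C*C*A * decay (\<sigma>/2) x" by (simp add: A_def mult_ac)
 qed (use * in auto)
qed

lemma edec_conv: "edec f ==> edec g ==> edec (conv f g)" using expd_conv[of "{0}" "\<lambda>_. f" "\<lambda>_. g"] .
lemma edec_mulx: "edec f ==> edec (mulx f)" using expd_mulx[of "{0}" "\<lambda>_. f"] .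
lemma edec_crefl: "edec f ==> edec (crefl f)" using expd_crefl[of "{0}" "\<lambda>_. f"] .
lemma edec_pos: "edec f ==> edec (pos f)" using expd_pos[of "{0}" "\<lambda>_. f"] .
lemma expd_herm: "expd I F ==> expd I (\<lambda>t. herm (F t))" unfolding herm_def[abs_def] by (intro expd_add expd_crefl)
lemma edec_herm: "edec f ==> edec (herm f)" using expd_herm[of "{0}" "\<lambda>_. f"] .

lemmas expd_intros = expd_add expd_diff expd_uminus expd_cmult expd_crefl expd_pos expd_mulx expd_conv
 expd_herm edec_conv edec_mulx edec_crefl edec_pos edec_herm

section \<open>The algebra of convolution\<close>

lemma conv_commute: "conv f g = conv g f"
proof
 fix x
 show "conv f g x = conv g f x" unfolding conv_def by (subst lborel_integral_real_affine[of "-1" _ x]) (auto simp: mult.commute)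
qed

lemma conv_add_left: "edec f ==> edec g ==> edec h ==> conv (\<lambda>x. f x + g x) h x = conv f h x + conv g h x" unfolding conv_def distrib_right
 by (intro L_integral_add conv_integrable)
lemma conv_add_right: "edec f ==> edec g ==> edec h ==> conv h (\<lambda>x. f x + g x) x = conv h f x + conv h g x"
 by (subst (1 2 3) conv_commute) (rule conv_add_left)
lemma conv_cmult_left: "conv (\<lambda>x. c * f x) g x = c * conv f g x" unfolding conv_def mult.assoc by simp
lemma conv_cmult_right: "conv f (\<lambda>x. c * g x) x = c * conv f g x" unfolding conv_def mult.left_commute[of _ c] by simp
lemma conv_uminus_right: "conv f (\<lambda>x. - g x) x = - conv f g x" using conv_cmult_right[of _ "-1"] by simp
lemma conv_diff_left: "edec f ==> edec g ==> edec h ==> conv (\<lambda>x. f x - g x) h x = conv f h x - conv g h x"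
 unfolding conv_def left_diff_distrib by (intro L_integral_diff conv_integrable)
lemma conv_diff_right: "edec f ==> edec g ==> edec h ==> conv h (\<lambda>x. f x - g x) x = conv h f x - conv h g x"
 by (subst (1 2 3) conv_commute) (rule conv_diff_left)

lemma conv_cong_AE:
 assumes [measurable]: "meas f" "meas f'" "meas g"
  and eq: "!!x. x \<noteq> 0 ==> f x = f' x"
 shows "conv f g x = conv f' g x" unfolding conv_def
proof (rule integral_cong_AE)
 show "AE y in lborel. f (x-y) * g y = f' (x-y) * g y" using AE_lborel_singleton[of x] by eventually_elim (simp add: eq)
qed measurable

lemma integrable_pair_exp:
 fixes f :: "real => cfun"
 assumes [measurable]: "(\<lambda>z. f (fst z) (snd z)) \<in> borel_measurable (borel \<Otimes>\<^sub>M borel)"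
  and "\<sigma> > 0" and b: "!!x y. norm (f x y) \<le> C * decay \<sigma> x * decay \<sigma> y"
 shows "integrable lborel2 (\<lambda>z. f (fst z) (snd z))"
proof (rule L_integrable_bound)
 have i: "integrable lborel (\<lambda>x::real. decay \<sigma> x)" by (rule integrable_exp_abs[OF assms(2)])
 have "integrable lborel2 (\<lambda>(x::real, y::real). decay \<sigma> x * decay \<sigma> y)" using i by (intro lborel_pair.Fubini_integrable) auto
 then show "integrable lborel2 (\<lambda>z::real\<times>real. C*(decay \<sigma> (fst z) * decay \<sigma> (snd z)))"
  by (intro integrable_mult_right) (simp add: case_prod_unfold)
 show "AE z in lborel2. norm (f (fst z) (snd z)) \<le> norm (C*(decay \<sigma> (fst z) * decay \<sigma> (snd z)))"
  by (intro AE_I2 order_trans[OF b]) (simp add: mult.assoc)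
qed measurable

lemma lborel_fubini:
 fixes f :: "real => cfun"
 assumes "integrable lborel2 (\<lambda>z. f (fst z) (snd z))"
 shows "(LBINT y. LBINT x. f x y) = (LBINT x. LBINT y. f x y)" using lborel_pair.Fubini_integral[of f] assms by (simp add: case_prod_unfold)

lemma conv_assoc:
 assumes "edec f" "edec g" "edec h"
 shows "conv (conv f g) h = conv f (conv g h)"
proof
 fix x
 obtain C \<sigma> where *: "C > 0" "\<sigma> > 0"
  "!!x. norm (g x) \<le> C * decay \<sigma> x" "!!x. norm (h x) \<le> C * decay \<sigma> x" using edec_common[OF assms(2,3)] by blast
 obtain C' s' where f: "C' > 0" "s' > 0" "!!x. norm (f x) \<le> C' * decay s' x" using edecE[OF assms(1)] by blast
 have f': "norm (f x) \<le> C'" for x using f by (intro order_trans[OF f(3)]) auto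
 have [measurable]: "meas f" "meas g" "meas h" using assms by (auto simp: expd_def)
 \<comment> \<open>It suffices that \<open>f\<close> is bounded: the product
   \<open>g (z - y) * h y\<close> already decays in both variables.\<close>
 have int: "integrable lborel2 (\<lambda>z. f (x - fst z) * g (fst z - snd z) * h (snd z))"
 proof (rule integrable_pair_exp[of "\<lambda>z y. f (x-z) * g (z-y) * h y" "\<sigma>/2" "C'*(C*C)"])
  fix z y
  have "norm (f (x-z) * g (z-y) * h y) = norm (f (x-z)) * norm (g (z-y) * h y)" by (simp add: norm_mult)
  also have "... \<le> C'*(C*C * decay (\<sigma>/2) z * decay (\<sigma>/2) y)" using f(1) by (intro mult_mono f' conv_dom * ) auto
  finally show "norm (f (x-z) * g (z-y) * h y) \<le> C'*(C*C) * decay (\<sigma>/2) z * decay (\<sigma>/2) y" by (simp add: mult_ac)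
 qed (use * in auto)
 have "conv (conv f g) h x = (LBINT y. (LBINT z. f (x-z) * g (z-y)) * h y)" unfolding conv_def
 proof (intro L_integral_cong refl)
  fix y
  have "(LBINT ya. f (x-y-ya) * g ya) = (LBINT z. f (x-z) * g (z-y))" by (subst (2) lborel_integral_real_affine[of 1 _ y]) (auto simp: algebra_simps)
  then show "(LBINT ya. f (x-y-ya) * g ya) * h y = (LBINT z. f (x-z) * g (z-y)) * h y" by simp
 qed
 also have "... = (LBINT y. LBINT z. f (x-z) * g (z-y) * h y)" by simp
 also have "... = (LBINT z. LBINT y. f (x-z) * g (z-y) * h y)" by (rule lborel_fubini[OF int])
 also have "... = conv f (conv g h) x" unfolding conv_def by (simp add: mult.assoc)
 finally show "conv (conv f g) h x = conv f (conv g h) x" .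
qed

text \<open>The Leibniz rule, from x = (x - y) + y.\<close>

lemma mulx_conv:
 assumes "edec f" "edec g"
 shows "mulx (conv f g) x = conv (mulx f) g x + conv f (mulx g) x"
proof -
 have "mulx (conv f g) x = (LBINT y. of_real x * (f (x-y) * g y))" by (simp add: mulx_def conv_def)
 also have "... = (LBINT y. (mulx f (x-y) * g y + f (x-y) * mulx g y))" by (intro L_integral_cong) (auto simp: mulx_def algebra_simps)
 also have "... = conv (mulx f) g x + conv f (mulx g) x" unfolding conv_def by (intro L_integral_add conv_integrable expd_intros assms)
 finally show ?thesis .
qed

lemma crefl_conv: "crefl (conv f g) = conv (crefl f) (crefl g)"
proof
 fix x
 have "crefl (conv f g) x = (LBINT y. cnj (f (- x-y) * g y))" by (simp only: crefl_def conv_def L_integral_cnj)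
 also have "... = conv (crefl f) (crefl g) x"
  unfolding conv_def by (subst lborel_integral_real_affine[of "-1" _ 0]) (auto simp: crefl_def algebra_simps)
 finally show "crefl (conv f g) x = conv (crefl f) (crefl g) x" .
qed

lemma crefl_crefl [simp]: "crefl (crefl f) = f" by (simp add: crefl_def fun_eq_iff)
lemma crefl_mulx: "crefl (mulx f) x = - mulx (crefl f) x" by (simp add: crefl_def mulx_def)
lemma crefl_herm: "crefl (herm p) = herm p" by (simp add: crefl_def herm_def fun_eq_iff)

section \<open>Causal functions and the projection onto positive frequencies\<close>

definition causal :: "cfun => bool" where
 "causal f \<longleftrightarrow> (\<forall>x<0. f x = 0)"

lemma causal_pos [simp]: "causal (pos f)" by (simp add: causal_def pos_def)
lemma pos_causal [simp]: "causal f ==> pos f = f" by (auto simp: causal_def pos_def fun_eq_iff)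
lemma causal_mulx [simp]: "causal f ==> causal (mulx f)" by (simp add: causal_def mulx_def)
lemma causal_conv:
 assumes "causal f" "causal g" shows "causal (conv f g)" unfolding causal_def conv_def
proof (intro allI impI)
 fix x :: real assume "x < 0"
 then have "f (x-y) * g y = 0" for y using assms by (cases "y < 0") (auto simp: causal_def)
 then have "(\<lambda>y. f (x-y) * g y) = (\<lambda>y. 0)" by (rule ext)
 then show "(LBINT y. f (x-y) * g y) = 0" by (simp only: integral_zero)
qed

text \<open>For y < 0 the first factor vanishes and for y > 0 the second. Only y = 0 remains, a null
  set.\<close>

lemma conv_anticausal_zero:
 assumes [measurable]: "meas f" "meas g"
  and "!!x. x > 0 ==> f x = 0" "!!x. x > 0 ==> g x = 0" "x \<ge> 0"
 shows "conv f g x = 0" unfolding conv_def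
proof (rule integral_eq_zero_AE)
 show "AE y in lborel. f (x-y) * g y = 0" using AE_lborel_singleton[of 0]
 proof eventually_elim
  case (elim y) then show ?case using assms(3)[of "x-y"] assms(4)[of y] assms(5) by (cases "y < 0") auto
 qed
qed

text \<open>The discarded part of \<open>f\<close> has negative frequencies only, and multiplication
  by an antianalytic function cannot move them into the positive half-line.\<close>

lemma pos_conv_crefl_pos:
 assumes "edec b" "edec f" "causal b"
 shows "pos (conv (crefl b) (pos f)) x = pos (conv (crefl b) f) x"
proof (cases "x \<ge> 0")
 case True
 have "conv (crefl b) f x = conv (crefl b) (\<lambda>y. pos f y + (f y - pos f y)) x" by simp
 also have "... = conv (crefl b) (pos f) x + conv (crefl b) (\<lambda>y. f y - pos f y) x" by (intro conv_add_right expd_intros assms)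
 also have "conv (crefl b) (\<lambda>y. f y - pos f y) x = 0" by (intro conv_anticausal_zero)
   (use True assms edec_pos[OF assms(2)] edec_crefl[OF assms(1)] in \<open>auto simp: expd_def crefl_def causal_def pos_def\<close>)
 finally show ?thesis by (simp add: pos_def[of "conv _ _"])
qed (simp add: pos_def)

lemma pos_mulx: "pos (mulx f) = mulx (pos f)" by (auto simp: pos_def mulx_def)

section \<open>The inner product and adjoints\<close>

definition inn :: "cfun => cfun => complex" where
 "inn f g = (LBINT x. f x * cnj (g x))"

lemma edec_cnj: "edec f ==> edec (\<lambda>x. cnj (f x))" unfolding expd_def by auto

lemma edec_bounded: assumes "edec f" obtains B where "!!x. norm (f x) \<le> B" "B > 0"
proof -
 obtain C \<sigma> where *: "C > 0" "\<sigma> > 0" "!!x. norm (f x) \<le> C * decay \<sigma> x" using edecE[OF assms] by blast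
 show ?thesis by (rule that[of C]) (use * in \<open>auto intro!: order_trans[OF *(3)]\<close>)
qed

lemma expd_mult:
 assumes "expd I F" "expd I G" shows "expd I (\<lambda>t x. F t x * G t x)"
proof -
 obtain C \<sigma> where *: "C > 0" "\<sigma> > 0"
  "!!t x. t \<in> I ==> norm (F t x) \<le> C * decay \<sigma> x"
  "!!t x. t \<in> I ==> norm (G t x) \<le> C * decay \<sigma> x" using expd_common[OF assms] by blast
 show ?thesis
 proof (rule expdI[of _ _ \<sigma> "C*C"])
  fix t x assume t: "t \<in> I"
  have "norm (F t x * G t x) \<le> (C * decay \<sigma> x)*(C*1)" unfolding norm_mult using *
   by (intro mult_mono *(3)[OF t] order_trans[OF *(4)[OF t]] mult_left_mono) auto
  then show "norm (F t x * G t x) \<le> C*C * decay \<sigma> x" by (simp add: mult_ac)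
  show "meas (\<lambda>x. F t x * G t x)" using assms t by (intro borel_measurable_times) (auto simp: expd_def)
 qed (use * in auto)
qed

lemma inn_integrable: "edec f ==> edec g ==> integrable lborel (\<lambda>x. f x * cnj (g x))" by (intro edec_integrable expd_mult edec_cnj)

lemma inn_cnj: "inn g f = cnj (inn f g)" unfolding inn_def L_integral_cnj[symmetric] by (intro L_integral_cong) auto

text \<open>The adjoint of multiplication by a function is multiplication by its conjugate. Fubini
  applies because \<open>f\<close> and \<open>g\<close> decay; of \<open>a\<close> only boundedness
  is used.\<close>

lemma inn_conv:
 assumes "edec a" "edec f" "edec g"
 shows "inn (conv a f) g = inn f (conv (crefl a) g)"
proof -
 obtain C \<sigma> where *: "C > 0" "\<sigma> > 0"
  "!!x. norm (f x) \<le> C * decay \<sigma> x" "!!x. norm (g x) \<le> C * decay \<sigma> x" using edec_common[OF assms(2,3)] by blast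
 obtain B where B: "!!x. norm (a x) \<le> B" "B > 0" using edec_bounded[OF assms(1)] by blast
 have [measurable]: "meas a" "meas f" "meas g" using assms by (auto simp: expd_def)
 have int: "integrable lborel2 (\<lambda>z. a (snd z - fst z) * f (fst z) * cnj (g (snd z)))"
 proof (rule integrable_pair_exp[of "\<lambda>y x. a (x-y) * f y * cnj (g x)" \<sigma> "B*C*C"])
  fix y x
  have "norm (a (x-y) * f y * cnj (g x)) = norm (a (x-y)) * norm (f y) * norm (g x)" by (simp add: norm_mult)
  also have "... \<le> B*(C * decay \<sigma> y)*(C * decay \<sigma> x)" using B * by (intro mult_mono) auto
  finally show "norm (a (x-y) * f y * cnj (g x)) \<le> B*C*C * decay \<sigma> y * decay \<sigma> x" by (simp add: mult_ac)
 qed (use * in auto)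
 have "inn (conv a f) g = (LBINT x. LBINT y. a (x-y) * f y * cnj (g x))" unfolding inn_def conv_def by simp
 also have "... = (LBINT y. LBINT x. a (x-y) * f y * cnj (g x))" by (rule lborel_fubini[OF int])
 also have "... = (LBINT y. f y * cnj (conv (crefl a) g y))"
 proof (intro L_integral_cong refl)
  fix y
  have "f y * cnj (conv (crefl a) g y) = f y * (LBINT x. cnj (crefl a (y-x) * g x))" by (simp only: conv_def L_integral_cnj)
  also have "... = (LBINT x. f y * cnj (crefl a (y-x) * g x))" by simp
  also have "... = (LBINT x. a (x-y) * f y * cnj (g x))" by (intro L_integral_cong) (auto simp: crefl_def)
  finally show "(LBINT x. a (x-y) * f y * cnj (g x)) = f y * cnj (conv (crefl a) g y)" ..
 qed
 finally show ?thesis by (simp add: inn_def)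
qed

lemma inn_pos_left: "causal g ==> inn (pos f) g = inn f g" unfolding inn_def by (intro L_integral_cong) (auto simp: pos_def causal_def)
lemma inn_mulx: "inn (mulx f) g = inn f (mulx g)" unfolding inn_def mulx_def by (intro L_integral_cong) auto
lemma inn_add_left: "edec f ==> edec g ==> edec h ==> inn (\<lambda>x. f x + g x) h = inn f h + inn g h"
 unfolding inn_def distrib_right by (intro L_integral_add inn_integrable)
lemma inn_cmult_left: "inn (\<lambda>x. c * f x) h = c * inn f h" unfolding inn_def mult.assoc by simp
lemma inn_self_real: "Im (inn f f) = 0" using inn_cnj[of f f] by (metis cnj.simps(2) complex_cnj_cancel_iff neg_equal_zero)

section \<open>The Lax pair on the Fourier half-line\<close>

lemma has_vector_derivative_iff_quotient:
 "(f hvd D) (at t within S) \<longleftrightarrow> ((\<lambda>s. (f s - f t) /\<^sub>R (s-t)) \<longlongrightarrow> D) (at t within S)"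
proof -
 have "(f hvd D) (at t within S) \<longleftrightarrow>
  ((\<lambda>s. (f s - f t - (s-t) *\<^sub>R D) /\<^sub>R norm (s-t)) \<longlongrightarrow> 0) (at t within S)"
  unfolding has_vector_derivative_def has_derivative_within by (simp add: bounded_linear_scaleR_left diff_diff_eq divide_inverse)
 also have "... \<longleftrightarrow> ((\<lambda>s. norm ((f s - f t - (s-t) *\<^sub>R D) /\<^sub>R norm (s-t))) \<longlongrightarrow> 0) (at t within S)"
  by (rule tendsto_norm_zero_iff[symmetric])
 also have "... \<longleftrightarrow> ((\<lambda>s. norm ((f s - f t) /\<^sub>R (s-t) - D)) \<longlongrightarrow> 0) (at t within S)"
 proof (rule filterlim_cong[OF HOL.refl HOL.refl])
  have "norm ((f s - f t - (s-t) *\<^sub>R D) /\<^sub>R norm (s-t)) = norm ((f s - f t) /\<^sub>R (s-t) - D)" if "s \<noteq> t" for s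
  proof -
   have "(f s - f t) /\<^sub>R (s-t) - D = (f s - f t - (s-t) *\<^sub>R D) /\<^sub>R (s-t)" using that by (simp add: scaleR_diff_right)
   then show ?thesis by simp
  qed
  then show "\<forall>\<^sub>F s in at t within S. norm ((f s - f t - (s-t) *\<^sub>R D) /\<^sub>R norm (s-t)) = norm ((f s - f t) /\<^sub>R (s-t) - D)"
   by (auto simp: eventually_at_filter)
 qed
 also have "... \<longleftrightarrow> ((\<lambda>s. (f s - f t) /\<^sub>R (s-t)) \<longlongrightarrow> D) (at t within S)"
  by (subst tendsto_norm_zero_iff) (rule LIM_zero_iff)
 finally show ?thesis .
qed

lemma vector_derivative_bound:
 fixes f :: "real => 'a::real_normed_vector"
 assumes "convex I" "!!s. s \<in> I ==> (f hvd f' s) (at s within I)"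
  "!!s. s \<in> I ==> norm (f' s) \<le> B" "a \<in> I" "b \<in> I"
 shows "norm (f a - f b) \<le> B*\<bar>a-b\<bar>"
proof -
 have "norm (f a - f b) \<le> B * norm (a-b)"
 proof (rule differentiable_bound[where f' = "\<lambda>s h. h *\<^sub>R f' s"])
  show "onorm (\<lambda>h. h *\<^sub>R f' s) \<le> B" if "s \<in> I" for s
   using assms(3)[OF that] by (intro onorm_le) (simp add: mult.commute[of B] mult_left_mono)
 qed (use assms in \<open>auto simp: has_vector_derivative_def\<close>)
 then show ?thesis by simp
qed

text \<open>Derivatives are taken within \<open>I\<close> because end points of time intervals are
  included. The difference quotients are dominated by \<open>D\<close> through the mean value
  inequality on the convex set \<open>I\<close>.\<close>

lemma integral_has_vector_derivative_dominated:
 fixes F F' :: "real => cfun"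
 assumes I: "convex I" "t \<in> I"
  and der: "!!s x. s \<in> I ==> ((\<lambda>s. F s x) hvd F' s x) (at s within I)"
  and int: "!!s. s \<in> I ==> integrable lborel (F s)" and [measurable]: "meas (F' t)"
  and D: "integrable lborel D" "!!s x. s \<in> I ==> norm (F' s x) \<le> D x"
 shows "((\<lambda>s. LBINT x. F s x) hvd (LBINT x. F' t x)) (at t within I)"
 unfolding has_vector_derivative_iff_quotient tendsto_at_iff_sequentially
proof (intro allI impI)
 fix X assume X: "\<forall>i. X i \<in> I - {t}" "X \<longlonglongrightarrow> t"
 have 1: "(LBINT x. (F (X n) x - F t x) /\<^sub>R (X n - t)) =
   ((LBINT x. F (X n) x)-(LBINT x. F t x)) /\<^sub>R (X n - t)" for n using int[of "X n"] int[of t] X(1) I(2) by (simp add: L_integral_diff)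
 have "(\<lambda>n. LBINT x. (F (X n) x - F t x) /\<^sub>R (X n - t)) \<longlonglongrightarrow> (LBINT x. F' t x)"
 proof (rule integral_dominated_convergence[where w = D])
  show "AE x in lborel. (\<lambda>n. (F (X n) x - F t x) /\<^sub>R (X n - t)) \<longlonglongrightarrow> F' t x"
   using der[OF I(2), unfolded has_vector_derivative_iff_quotient tendsto_at_iff_sequentially] X by (auto simp: o_def)
  show "AE x in lborel. norm ((F (X n) x - F t x) /\<^sub>R (X n - t)) \<le> D x" for n
  proof (intro AE_I2)
   fix x
   have "norm (F (X n) x - F t x) \<le> D x * \<bar>X n - t\<bar>"
    using X(1) I D(2) der by (intro vector_derivative_bound[where I = I and f' = "\<lambda>s. F' s x"]) auto
   moreover have "X n \<noteq> t" using X(1) by blast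
   ultimately show "norm ((F (X n) x - F t x) /\<^sub>R (X n - t)) \<le> D x" by (simp add: divide_simps mult.commute)
  qed
  have "meas (F (X n))" for n using int[of "X n"] X(1) by auto
  moreover have "meas (F t)" using int[OF I(2)] by auto
  ultimately show "(\<lambda>x. (F (X n) x - F t x) /\<^sub>R (X n - t)) \<in> borel_measurable lborel" for n
   by (intro borel_measurable_scaleR borel_measurable_diff) auto
 qed (use D in auto)
 then show "((\<lambda>s. ((LBINT x. F s x)-(LBINT x. F t x)) /\<^sub>R (s-t)) \<circ> X) \<longlonglongrightarrow> (LBINT x. F' t x)"
  unfolding o_def 1 .
qed

lemma expd_integral_derivative:
 assumes "convex I" "t \<in> I" "expd I F" "expd I F'"
  and der: "!!s x. s \<in> I ==> ((\<lambda>s. F s x) hvd F' s x) (at s within I)"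
 shows "((\<lambda>s. LBINT x. F s x) hvd (LBINT x. F' t x)) (at t within I)"
proof -
 obtain C \<sigma> where *: "C > 0" "\<sigma> > 0"
  "!!t x. t \<in> I ==> norm (F' t x) \<le> C * decay \<sigma> x" using expdE[OF assms(4)] by blast
 show ?thesis by (rule integral_has_vector_derivative_dominated[OF assms(1,2) der _ _ integrable_mult_right[OF integrable_exp_abs[OF *(2)]] *(3)])
   (use assms in \<open>auto simp: expd_def intro!: edec_integrable intro: expd_slice[OF assms(3)]\<close>)
qed

lemma expd_shift: assumes "expd I F" shows "expd I (\<lambda>t y. F t (x-y))"
proof -
 obtain C \<sigma> where *: "C > 0" "\<sigma> > 0"
  "!!t x. t \<in> I ==> norm (F t x) \<le> C * decay \<sigma> x" using expdE[OF assms] by blast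
 show ?thesis
 proof (rule expdI[of _ _ \<sigma> "C * exp (\<sigma>*\<bar>x\<bar>)"])
  fix t y assume t: "t \<in> I"
  have [measurable]: "meas (F t)" using assms t by (simp add: expd_def)
  show "meas (\<lambda>y. F t (x-y))" by measurable
  have "\<sigma>*\<bar>y\<bar> \<le> \<sigma>*(\<bar>x\<bar>+\<bar>x-y\<bar>)" using *(2) by (intro mult_left_mono) auto
  then have "decay \<sigma> (x-y) \<le> exp (\<sigma>*\<bar>x\<bar>) * decay \<sigma> y"
   unfolding mult_exp_exp exp_le_cancel_iff by (simp add: algebra_simps)
  then have "C * decay \<sigma> (x-y) \<le> C*(exp (\<sigma>*\<bar>x\<bar>) * decay \<sigma> y)" using *(1) by (intro mult_left_mono) auto
  with *(3)[OF t, of "x-y"] show "norm (F t (x-y)) \<le> C * exp (\<sigma>*\<bar>x\<bar>) * decay \<sigma> y" by (simp add: mult.assoc)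
 qed (use * in auto)
qed

lemma conv_has_vector_derivative:
 assumes "convex I" "t \<in> I" "expd I F" "expd I F'" "expd I G" "expd I G'"
  and dF: "!!s x. s \<in> I ==> ((\<lambda>s. F s x) hvd F' s x) (at s within I)"
  and dG: "!!s x. s \<in> I ==> ((\<lambda>s. G s x) hvd G' s x) (at s within I)"
 shows "((\<lambda>s. conv (F s) (G s) x) hvd (conv (F' t) (G t) x + conv (F t) (G' t) x)) (at t within I)"
proof -
 have "((\<lambda>s. LBINT y. F s (x-y) * G s y) hvd
   (LBINT y. F t (x-y) * G' t y + F' t (x-y) * G t y)) (at t within I)"
  by (rule expd_integral_derivative[OF assms(1,2), where F' = "\<lambda>t y. F t (x-y) * G' t y + F' t (x-y) * G t y"])
   (intro expd_add expd_mult expd_shift assms has_vector_derivative_mult; assumption)+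
 also have "(LBINT y. F t (x-y) * G' t y + F' t (x-y) * G t y) = conv (F t) (G' t) x + conv (F' t) (G t) x" unfolding conv_def using assms
  by (intro L_integral_add conv_integrable) (auto intro: expd_slice)
 finally show ?thesis by (simp add: conv_def[symmetric, abs_def] add.commute)
qed

section \<open>Toeplitz operators and the Lax equation\<close>

text \<open>The Toeplitz operator with symbol \<open>a\<close> on the Hardy space, seen on the
  Fourier side.\<close>

definition toep :: "cfun => cfun => cfun" where
 "toep a h = pos (conv a h)"

text \<open>\<open>p\<close> is the positive-frequency half of \<open>u / 2\<close> and \<open>herm p\<close> the whole of it. Since Toeplitz operators
with causal symbols compose like convolutions, \<open>flow_op p p\<close> is the right-hand side of the Benjamin-Ono
equation.\<close>
definition lax_op :: "cfun => cfun => cfun" where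
 "lax_op p h x = mulx h x + toep (herm p) h x"

text \<open>With D = -i d/dx, v = \<open>herm p\<close> and q = \<open>crefl p\<close> this is -i
  (D^2 h + 2 P(v D h) + 2 P((D q) h)) in physical space. It is affine in the potential, and the last
  term is what makes the bracket symmetric.\<close>

definition flow_op :: "cfun => cfun => cfun" where
 "flow_op p h x = - \<i>*(mulx (mulx h) x + 2 * toep (herm p) (mulx h) x
   + 2 * toep (mulx (crefl p)) h x)"

text \<open>Linear in \<open>h\<close>, driven by the potential \<open>p\<close>. The nonlinear
  equation is the case h = p, so every conservation law of the linear flow applies to the solution
  itself.\<close>

definition flow :: "real set => (real => cfun) => (real => cfun) => bool" where
 "flow I p h \<longleftrightarrow> expd I h \<and> (\<forall>t\<in>I. causal (h t)) \<and>
  (\<forall>t\<in>I. \<forall>x. ((\<lambda>s. h s x) hvd flow_op (p t) (h t) x) (at t within I))"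

lemma expd_toep: "expd I F ==> expd I G ==> expd I (\<lambda>t. toep (F t) (G t))" unfolding toep_def by (intro expd_intros)
lemma edec_toep: "edec f ==> edec g ==> edec (toep f g)" unfolding toep_def by (intro expd_intros)
lemma expd_lax_op: "expd I p ==> expd I h ==> expd I (\<lambda>t. lax_op (p t) (h t))" unfolding lax_op_def[abs_def] by (intro expd_intros expd_toep)
lemma edec_lax_op: "edec p ==> edec h ==> edec (lax_op p h)" unfolding lax_op_def[abs_def] by (intro expd_intros edec_toep)
lemma expd_flow_op: "expd I p ==> expd I h ==> expd I (\<lambda>t. flow_op (p t) (h t))"
 unfolding flow_op_def[abs_def] by (intro expd_intros expd_toep)
lemma edec_flow_op: "edec p ==> edec h ==> edec (flow_op p h)" unfolding flow_op_def[abs_def] by (intro expd_intros edec_toep)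

lemmas edec_intros = expd_intros edec_toep edec_lax_op edec_flow_op

lemma causal_toep [simp]: "causal (toep a h)" by (simp add: toep_def)
lemma causal_lax_op [simp]: "causal h ==> causal (lax_op p h)" using causal_toep[of "herm p" h] causal_mulx[of h] by (simp add: causal_def lax_op_def)
lemma causal_flow_op [simp]: "causal h ==> causal (flow_op p h)"
 using causal_toep[of "herm p" "mulx h"] causal_toep[of "mulx (crefl p)" h] causal_mulx[of "mulx h"] causal_mulx[of h]
 by (simp add: causal_def flow_op_def)

lemma toep_add_right: "edec a ==> edec f ==> edec g ==> toep a (\<lambda>x. f x + g x) = (\<lambda>x. toep a f x + toep a g x)"
 by (auto simp: toep_def pos_def conv_add_right fun_eq_iff)
lemma toep_add_left: "edec a ==> edec b ==> edec f ==> toep (\<lambda>x. a x + b x) f = (\<lambda>x. toep a f x + toep b f x)"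
 by (auto simp: toep_def pos_def conv_add_left fun_eq_iff)
lemma toep_diff_left: "edec a ==> edec b ==> edec f ==> toep (\<lambda>x. a x - b x) f = (\<lambda>x. toep a f x - toep b f x)"
 by (auto simp: toep_def pos_def conv_diff_left fun_eq_iff)
lemma toep_cmult_right: "toep a (\<lambda>x. c * f x) = (\<lambda>x. c * toep a f x)" by (auto simp: toep_def pos_def conv_cmult_right fun_eq_iff)
lemma toep_cmult_left: "toep (\<lambda>x. c * a x) f = (\<lambda>x. c * toep a f x)" by (auto simp: toep_def pos_def conv_cmult_left fun_eq_iff)
lemma mulx_add: "mulx (\<lambda>x. f x + g x) = (\<lambda>x. mulx f x + mulx g x)" by (simp add: mulx_def fun_eq_iff algebra_simps)
lemma mulx_cmult: "mulx (\<lambda>x. c * f x) = (\<lambda>x. c * mulx f x)" by (simp add: mulx_def fun_eq_iff algebra_simps)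
lemma mulx_herm: "mulx (herm p) = (\<lambda>x. mulx p x + mulx (crefl p) x)" by (simp add: mulx_def herm_def fun_eq_iff algebra_simps)

lemma mulx_toep: "edec a ==> edec h ==> mulx (toep a h) = (\<lambda>x. toep (mulx a) h x + toep a (mulx h) x)"
 by (auto simp: toep_def pos_mulx[symmetric] fun_eq_iff pos_def mulx_conv)

text \<open>A product of two functions with nonnegative frequencies needs no projection.\<close>

lemma toep_toep_causal:
 assumes "edec a" "edec b" "edec h" "causal b" "causal h"
 shows "toep a (toep b h) = toep (conv a b) h" using assms by (simp add: toep_def causal_conv conv_assoc)

lemma toep_crefl_toep:
 assumes "edec a" "edec b" "edec h" "causal b"
 shows "toep (crefl b) (toep a h) = toep (conv (crefl b) a) h"
 using assms by (auto simp: toep_def fun_eq_iff pos_conv_crefl_pos edec_conv conv_assoc edec_crefl)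

lemma lax_op_cmult: "lax_op p (\<lambda>x. c * f x) x = c * lax_op p f x" by (simp add: lax_op_def mulx_cmult toep_cmult_right algebra_simps)

text \<open>Write T for \<open>toep\<close> and D for \<open>mulx\<close>. After the Leibniz rule
  everything cancels except T(D^2 p) - T(D^2 q) + 2 T(v) T(D p) + 2 T(D q) T(v). In the two products
  the inner symbol is causal or the outer one anticausal, so the operators multiply like their
  symbols; the product T(v) T(D q), for which this fails, has dropped out.\<close>

lemma lax_flow_commutator:
 assumes "edec p" "causal p" "edec h" "causal h"
 defines "v \<equiv> herm p" and "q \<equiv> crefl p"
 shows "flow_op p (lax_op p h) x - lax_op p (flow_op p h) x =
  - \<i> * toep (\<lambda>x. mulx (mulx p) x - mulx (mulx q) x + 2 * conv v (mulx v) x) h x"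
proof -
 have [simp]: "edec q" "edec v" unfolding q_def v_def using assms by (auto intro!: edec_intros)
 note [simp] = assms(1-4) and [simp] = edec_intros toep_add_right mulx_toep mulx_add mulx_cmult toep_cmult_right
 have v: "mulx v = (\<lambda>x. mulx p x + mulx q x)" unfolding v_def q_def by (rule mulx_herm)
 have 1: "toep v (toep (mulx p) h) = toep (conv v (mulx p)) h" by (rule toep_toep_causal) simp_all
 have q: "mulx q = crefl (\<lambda>x. - mulx p x)" using crefl_mulx[of p] by (auto simp: fun_eq_iff q_def crefl_def mulx_def)
 have 2: "toep (mulx q) (toep v h) = toep (conv (mulx q) v) h" unfolding q
 proof (rule toep_crefl_toep)
  show "causal (\<lambda>x. - mulx p x)" using assms(2) by (simp add: causal_def mulx_def)
  show "edec (\<lambda>x. - mulx p x)" by (intro edec_intros assms)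
 qed simp_all
 have 3: "toep v (toep (mulx v) h) = (\<lambda>x. toep v (toep (mulx p) h) x + toep v (toep (mulx q) h) x)" unfolding v by (simp add: toep_add_left)
 have 4: "toep (conv v (mulx v)) h = (\<lambda>x. toep (conv v (mulx p)) h x + toep (conv (mulx q) v) h x)"
 proof -
  have "conv v (mulx v) = (\<lambda>x. conv v (mulx p) x + conv (mulx q) v x)"
   unfolding v by (simp add: fun_eq_iff conv_add_right conv_commute[of v "mulx q"])
  then show ?thesis by (simp add: toep_add_left)
 qed
 have 5: "toep (mulx (mulx v)) h = (\<lambda>x. toep (mulx (mulx p)) h x + toep (mulx (mulx q)) h x)" unfolding v by (simp add: toep_add_left)
 define K where "K h = (\<lambda>x. mulx (mulx h) x + 2 * toep v (mulx h) x + 2 * toep (mulx q) h x)" for h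
 have "K (lax_op p h) x - lax_op p (K h) x =
  toep (mulx (mulx p)) h x - toep (mulx (mulx q)) h x + 2 * toep (conv v (mulx v)) h x"
  unfolding K_def lax_op_def[abs_def] v_def[symmetric] q_def[symmetric] by (simp add: 3 5) (simp add: 1 2 4 algebra_simps)
 moreover have "flow_op p h = (\<lambda>x. - \<i> * K h x)" for h by (simp add: fun_eq_iff flow_op_def K_def v_def q_def)
 ultimately have "flow_op p (lax_op p h) x - lax_op p (flow_op p h) x =
  - \<i>*(toep (mulx (mulx p)) h x - toep (mulx (mulx q)) h x + 2 * toep (conv v (mulx v)) h x)"
  by (simp only: lax_op_cmult right_diff_distrib[symmetric])
 also have "toep (mulx (mulx p)) h x - toep (mulx (mulx q)) h x + 2 * toep (conv v (mulx v)) h x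
  = toep (\<lambda>x. mulx (mulx p) x - mulx (mulx q) x + 2 * conv v (mulx v) x) h x" by (simp add: toep_add_left toep_diff_left toep_cmult_left)
 finally show ?thesis .
qed

text \<open>The two sides differ by the projection of q D q with q = \<open>crefl p\<close>, a
  product without positive frequencies.\<close>

lemma toep_self:
 assumes "edec p" "causal p"
 shows "toep (herm p) (mulx (herm p)) x = toep (herm p) (mulx p) x + toep (mulx (crefl p)) p x"
proof (cases "x \<ge> 0")
 case True
 note [simp] = assms edec_intros
 have 0: "conv (crefl p) (mulx (crefl p)) x = 0" by (rule conv_anticausal_zero)
   (use True assms edec_crefl[OF assms(1)] edec_mulx[OF edec_crefl[OF assms(1)]] in \<open>auto simp: expd_def crefl_def mulx_def causal_def\<close>)
 have "conv (herm p) (mulx (herm p)) x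
  = conv (herm p) (mulx p) x + conv (herm p) (mulx (crefl p)) x" by (simp add: mulx_herm conv_add_right)
 also have "conv (herm p) (mulx (crefl p)) x = conv p (mulx (crefl p)) x + conv (crefl p) (mulx (crefl p)) x"
  unfolding herm_def[abs_def] by (rule conv_add_left) simp_all
 finally show ?thesis using True 0 by (simp add: toep_def pos_def conv_commute)
qed (simp add: toep_def pos_def)

lemma flow_op_self:
 assumes "edec p" "causal p"
 shows "flow_op p p x = - \<i>*(mulx (mulx p) x + 2 * toep (herm p) (mulx (herm p)) x)"
 unfolding toep_self[OF assms] flow_op_def by (simp add: algebra_simps)

lemma mulx_conv_self:
 assumes "edec v" shows "mulx (conv v v) x = 2 * conv v (mulx v) x" using mulx_conv[OF assms assms, of x] conv_commute[of v "mulx v"] by simp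

text \<open>The convolution \<open>Y\<close> changes sign under \<open>crefl\<close>, so adding the
  reflected half to its positive part restores all of it. The result is exactly the symbol in
  \<open>lax_flow_commutator\<close>: this is the Lax equation.\<close>

lemma herm_flow_op_self:
 assumes "edec p" "causal p" "x \<noteq> 0"
 defines "v \<equiv> herm p" and "q \<equiv> crefl p"
 shows "herm (flow_op p p) x = - \<i>*(mulx (mulx p) x - mulx (mulx q) x + 2 * conv v (mulx v) x)"
proof -
 define Y where "Y = conv v (mulx v)"
 have "crefl Y x = - Y x"
 proof -
  have "crefl Y x = conv (crefl v) (crefl (mulx v)) x" unfolding Y_def by (simp only: crefl_conv)
  also have "crefl (mulx v) = (\<lambda>x. - mulx v x)" using crefl_mulx[of v] by (simp add: fun_eq_iff v_def crefl_herm)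
  also have "conv (crefl v) (\<lambda>x. - mulx v x) x = - Y x" by (simp add: conv_uminus_right v_def crefl_herm Y_def)
  finally show ?thesis .
 qed
 then have Y: "cnj (Y (- x)) = - Y x" by (simp add: crefl_def)
 have *: "flow_op p p y = - \<i>*(mulx (mulx p) y + 2 * pos Y y)" for y using flow_op_self[OF assms(1,2)] by (simp add: v_def Y_def toep_def)
 show ?thesis using assms(3) Y unfolding herm_def crefl_def q_def * by (auto simp: pos_def Y_def[symmetric] mulx_def crefl_def algebra_simps)
qed

lemma flowD:
 assumes "flow I p h"
 shows "expd I h" "!!t. t \<in> I ==> causal (h t)" "!!t. t \<in> I ==> edec (h t)"
  "!!t x. t \<in> I ==> ((\<lambda>s. h s x) hvd flow_op (p t) (h t) x) (at t within I)"
 using assms by (auto simp: flow_def expd_slice)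

lemma crefl_has_vector_derivative:
 assumes "((\<lambda>s. h s (- x)) hvd k (- x)) (at t within I)"
 shows "((\<lambda>s. crefl (h s) x) hvd crefl k x) (at t within I)"
 unfolding crefl_def using bounded_linear.has_vector_derivative[OF bounded_linear_cnj assms] .

lemma toep_has_vector_derivative:
 assumes "convex I" "t \<in> I" "expd I F" "expd I F'" "expd I G" "expd I G'"
  and dF: "!!s x. s \<in> I ==> ((\<lambda>s. F s x) hvd F' s x) (at s within I)"
  and dG: "!!s x. s \<in> I ==> ((\<lambda>s. G s x) hvd G' s x) (at s within I)"
 shows "((\<lambda>s. toep (F s) (G s) x) hvd (toep (F' t) (G t) x + toep (F t) (G' t) x)) (at t within I)"
 using conv_has_vector_derivative[OF assms] by (cases "x \<ge> 0") (auto simp: toep_def pos_def)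

lemma flow_lax_op:
 assumes I: "convex I" and p: "flow I p p" and h: "flow I p h"
 shows "flow I p (\<lambda>t. lax_op (p t) (h t))" unfolding flow_def
proof (intro conjI ballI allI)
 show "expd I (\<lambda>t. lax_op (p t) (h t))" by (intro expd_lax_op flowD(1)[OF p] flowD(1)[OF h])
 fix t assume t: "t \<in> I"
 show "causal (lax_op (p t) (h t))" using flowD(2)[OF h t] by simp
 fix x
 note ed [simp] = flowD(1,3)[OF p] flowD(1,3)[OF h]
 let ?v' = "\<lambda>t. herm (flow_op (p t) (p t))"
 have dv: "((\<lambda>s. herm (p s) x) hvd ?v' s x) (at s within I)" if "s \<in> I" for s x unfolding herm_def
  by (intro has_vector_derivative_add crefl_has_vector_derivative flowD(4)[OF p] that)
 have "((\<lambda>s. lax_op (p s) (h s) x) hvd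
  (of_real x * flow_op (p t) (h t) x +
   (toep (?v' t) (h t) x + toep (herm (p t)) (flow_op (p t) (h t)) x))) (at t within I)" unfolding lax_op_def mulx_def
  by (intro has_vector_derivative_add has_vector_derivative_mult_right toep_has_vector_derivative I t dv
    expd_intros expd_flow_op ed flowD(4)[OF h])
 \<comment> \<open>The time derivative of the Lax operator is a Toeplitz operator. Its symbol is
   identified with that of the commutator except at frequency 0, a point that the convolution does
   not see.\<close>
 also have "toep (?v' t) (h t) x = flow_op (p t) (lax_op (p t) (h t)) x - lax_op (p t) (flow_op (p t) (h t)) x"
 proof -
  let ?w = "\<lambda>x. - \<i>*(mulx (mulx (p t)) x - mulx (mulx (crefl (p t))) x + 2 * conv (herm (p t)) (mulx (herm (p t))) x)"
  have w: "edec ?w" "edec (?v' t)" using t by (auto intro!: edec_intros)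
  have "conv (?v' t) (h t) x = conv ?w (h t) x" for x
  proof (rule conv_cong_AE)
   show "herm (flow_op (p t) (p t)) x = ?w x" if "x \<noteq> 0" for x by (rule herm_flow_op_self) (use t that flowD(2)[OF p] in auto)
  qed (use w ed(4)[OF t] in \<open>auto simp: expd_def\<close>)
  then have "toep (?v' t) (h t) x = toep ?w (h t) x" by (simp add: toep_def pos_def)
  also have "... = - \<i> * toep (\<lambda>x. mulx (mulx (p t)) x - mulx (mulx (crefl (p t))) x + 2 * conv (herm (p t)) (mulx (herm (p t))) x) (h t) x"
   by (simp only: toep_cmult_left)
  also have "... = flow_op (p t) (lax_op (p t) (h t)) x - lax_op (p t) (flow_op (p t) (h t)) x"
   by (rule lax_flow_commutator[symmetric]) (use t flowD(2)[OF p] flowD(2)[OF h] in auto)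
  finally show ?thesis .
 qed
 finally show "((\<lambda>s. lax_op (p s) (h s) x) hvd flow_op (p t) (lax_op (p t) (h t)) x) (at t within I)"
  by (simp add: lax_op_def[of "p t" "flow_op (p t) (h t)"] mulx_def)
qed

section \<open>Conserved quantities\<close>

lemma inn_uminus_left: "inn (\<lambda>x. - f x) h = - inn f h" using inn_cmult_left[of "-1" f h] by simp

text \<open>The bracket in \<open>flow_op\<close> is symmetric: the adjoint of 2 T(v) D is 2 T(v) D
  + 2 T(D v), the adjoint of 2 T(D q) is - 2 T(D p), and D v = D p + D q. In the proof this appears
  as the cancellation of the imaginary parts of \<open>X\<close> and \<open>Z\<close>.\<close>

lemma flow_op_skew:
 assumes "edec p" "causal p" "edec h" "causal h"
 shows "Re (inn (flow_op p h) h) = 0"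
proof -
 note [simp] = assms edec_intros
 let ?v = "herm p" and ?q = "crefl p"
 define X where "X = inn (conv ?v (mulx h)) h"
 define Z where "Z = inn (conv (mulx ?q) h) h"
 have "inn (conv (mulx p) h) h = inn h (conv (crefl (mulx p)) h)" by (rule inn_conv) simp_all
 also have "crefl (mulx p) = (\<lambda>x. (- 1) * mulx ?q x)" by (simp add: fun_eq_iff crefl_mulx)
 also have "conv (\<lambda>x. (- 1) * mulx ?q x) h = (\<lambda>x. (- 1) * conv (mulx ?q) h x)" by (rule ext) (rule conv_cmult_left)
 also have "inn h (\<lambda>x. (- 1) * conv (mulx ?q) h x) = - cnj Z" by (subst inn_cnj) (simp add: inn_uminus_left Z_def)
 finally have Y: "inn (conv (mulx p) h) h = - cnj Z" .
 have "X = inn (mulx h) (conv ?v h)" unfolding X_def by (subst inn_conv) (simp_all add: crefl_herm)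
 then have cX: "cnj X = inn (conv ?v h) (mulx h)" by (simp add: inn_cnj[of "mulx h"])
 also have "... = inn (mulx (conv ?v h)) h" by (simp add: inn_mulx)
 also have "mulx (conv ?v h) = (\<lambda>x. (conv (mulx p) h x + conv (mulx ?q) h x) + conv ?v (mulx h) x)"
  by (simp add: fun_eq_iff mulx_conv mulx_herm conv_add_left)
 also have "inn ... h = (- cnj Z + Z)+X" by (simp add: inn_add_left X_def Z_def Y)
 finally have "Im X = - Im Z" by (simp add: complex_eq_iff)
 have 1: "inn (toep a f) h = inn (conv a f) h" for a f by (simp add: toep_def inn_pos_left)
 have "inn (flow_op p h) h = - \<i>*(inn (mulx (mulx h)) h + 2*X+2*Z)" unfolding flow_op_def[abs_def] inn_cmult_left
  by (simp add: inn_add_left inn_cmult_left 1 X_def Z_def)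
 moreover have "Im (inn (mulx (mulx h)) h) = 0" using inn_mulx[of "mulx h" h] inn_self_real[of "mulx h"] by metis
 ultimately show ?thesis using \<open>Im X = - Im Z\<close> by simp
qed

lemma flow_norm_const:
 assumes I: "convex I" and p: "flow I p p" and h: "flow I p h" and "s \<in> I" "t \<in> I"
 shows "inn (h s) (h s) = inn (h t) (h t)"
proof -
 have cn: "expd I (\<lambda>t x. cnj (F t x))" if "expd I F" for F using that unfolding expd_def by auto
 have "((\<lambda>s. inn (h s) (h s)) hvd 0) (at t within I)" if t: "t \<in> I" for t
 proof -
  have "((\<lambda>s. inn (h s) (h s)) hvd
   (LBINT x. h t x * cnj (flow_op (p t) (h t) x) + flow_op (p t) (h t) x * cnj (h t x))) (at t within I)" unfolding inn_def
  proof (rule expd_integral_derivative[OF I t, where F' = "\<lambda>t x. h t x * cnj (flow_op (p t) (h t) x) + flow_op (p t) (h t) x * cnj (h t x)"])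
   show "expd I (\<lambda>s x. h s x * cnj (h s x))" by (intro expd_mult cn flowD(1)[OF h])
   show "expd I (\<lambda>t x. h t x * cnj (flow_op (p t) (h t) x) + flow_op (p t) (h t) x * cnj (h t x))"
    by (intro expd_add expd_mult cn flowD(1)[OF h] flowD(1)[OF p] expd_flow_op)
   fix s x assume "s \<in> I"
   then show "((\<lambda>s. h s x * cnj (h s x)) hvd
    h s x * cnj (flow_op (p s) (h s) x) + flow_op (p s) (h s) x * cnj (h s x)) (at s within I)"
    by (intro has_vector_derivative_mult flowD(4)[OF h] bounded_linear.has_vector_derivative[OF bounded_linear_cnj])
  qed
  also have "(LBINT x. h t x * cnj (flow_op (p t) (h t) x) + flow_op (p t) (h t) x * cnj (h t x))
   = inn (h t) (flow_op (p t) (h t)) + inn (flow_op (p t) (h t)) (h t)" unfolding inn_def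
   by (intro L_integral_add inn_integrable flowD(3)[OF h t] edec_flow_op flowD(3)[OF p t])
  also have "... = 0" using flow_op_skew[OF flowD(3)[OF p t] flowD(2)[OF p t] flowD(3)[OF h t] flowD(2)[OF h t]]
   by (subst inn_cnj) (simp add: complex_eq_iff)
  finally show ?thesis .
 qed
 then obtain c where "!!x. x \<in> I ==> inn (h x) (h x) = c"
  using has_vector_derivative_zero_constant[OF I, of "\<lambda>s. inn (h s) (h s)"] by blast
 then show ?thesis using assms by auto
qed

text \<open>At frequency 0 the two terms with \<open>crefl p\<close> combine by the Leibniz rule to
  0 times a convolution. In the term with \<open>p\<close> the supports of the two factors meet only
  at y = 0, where \<open>mulx h\<close> vanishes.\<close>

lemma flow_op_zero:
 assumes "edec p" "causal p" "edec h" "causal h"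
 shows "flow_op p h 0 = 0"
proof -
 note [simp] = assms edec_intros
 have "(\<lambda>y. p (0-y) * mulx h y) = (\<lambda>y. 0)"
 proof
  fix y :: real
  show "p (0-y) * mulx h y = 0" using assms(2,4) by (cases y "0::real" rule: linorder_cases) (auto simp: causal_def mulx_def)
 qed
 then have "conv p (mulx h) 0 = 0" by (simp only: conv_def integral_zero)
 moreover have "conv (herm p) (mulx h) 0 = conv p (mulx h) 0 + conv (crefl p) (mulx h) 0" unfolding herm_def[abs_def] by (rule conv_add_left) simp_all
 moreover have "mulx (conv (crefl p) h) 0 = conv (mulx (crefl p)) h 0 + conv (crefl p) (mulx h) 0" by (rule mulx_conv) simp_all
 ultimately show ?thesis by (simp add: flow_op_def toep_def pos_def mulx_def[of _ 0] add_eq_0_iff2)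
qed

lemma flow_zero_const:
 assumes I: "convex I" and p: "flow I p p" and h: "flow I p h" and "s \<in> I" "t \<in> I"
 shows "h s 0 = h t 0"
proof -
 have "((\<lambda>s. h s 0) hvd 0) (at t within I)" if "t \<in> I" for t
  using flowD(4)[OF h that, of 0] flow_op_zero flowD(2,3)[OF p that] flowD(2,3)[OF h that] by simp
 then obtain c where "!!x. x \<in> I ==> h x 0 = c" using has_vector_derivative_zero_constant[OF I, of "\<lambda>s. h s 0"] by blast
 then show ?thesis using assms by auto
qed

section \<open>Derivatives in the frequency variable\<close>

text \<open>Sequential, as dominated convergence requires, and silent at frequency 0, where the
  functions may jump.\<close>

definition pcont :: "real set => (real => cfun) => bool" where
 "pcont I F \<longleftrightarrow> (\<forall>X Y t x. (\<forall>n. X n \<in> I) \<longrightarrow> t \<in> I \<longrightarrow> X \<longlonglongrightarrow> t \<longrightarrow> Y \<longlonglongrightarrow> x \<longrightarrow> x \<noteq> 0 \<longrightarrow>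
  (\<lambda>n. F (X n) (Y n)) \<longlonglongrightarrow> F t x)"

definition hc :: "real set => (real => cfun) => bool" where
 "hc I F \<longleftrightarrow> expd I F \<and> (\<forall>t\<in>I. causal (F t)) \<and> continuous_on (I \<times> {0..}) (\<lambda>(t, x). F t x)"

lemma hcD:
 assumes "hc I F"
 shows "expd I F" "!!t. t \<in> I ==> causal (F t)" "continuous_on (I \<times> {0..}) (\<lambda>(t, x). F t x)"
  "!!t. t \<in> I ==> edec (F t)" using assms by (auto simp: hc_def expd_slice)

lemma hc_tendsto:
 assumes "hc I F" "!!n. X n \<in> I" "t \<in> I" "X \<longlonglongrightarrow> t" "!!n. Y n \<ge> 0" "Y \<longlonglongrightarrow> x"
 shows "(\<lambda>n. F (X n) (Y n)) \<longlonglongrightarrow> F t x"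
proof -
 have "x \<ge> 0" using assms(5,6) by (intro LIMSEQ_le_const) auto
 then have "(\<lambda>n. (\<lambda>(t, x). F t x) (X n, Y n)) \<longlonglongrightarrow> (\<lambda>(t, x). F t x) (t, x)"
  by (intro continuous_on_tendsto_compose[OF hcD(3)[OF assms(1)]] tendsto_Pair assms always_eventually) (use assms in auto)
 then show ?thesis by simp
qed

lemma hc_pcont: assumes "hc I F" shows "pcont I F" unfolding pcont_def
proof (intro allI impI)
 fix X Y t x assume *: "\<forall>n. X n \<in> I" "t \<in> I" "X \<longlonglongrightarrow> t" "Y \<longlonglongrightarrow> x" "(x::real) \<noteq> 0"
 show "(\<lambda>n. F (X n) (Y n)) \<longlonglongrightarrow> F t x"
 proof (cases "x > 0")
  case True
  have "(\<lambda>n. F (X n) (max 0 (Y n))) \<longlonglongrightarrow> F t (max 0 x)" using * by (intro hc_tendsto[OF assms] tendsto_max) auto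
  moreover have "eventually (\<lambda>n. F (X n) (max 0 (Y n)) = F (X n) (Y n)) sequentially"
   using order_tendstoD(1)[OF *(4) True] by eventually_elim (simp add: max_def)
  ultimately show ?thesis using True by (simp add: tendsto_cong max_def)
 next
  case False
  then have "x < 0" using * by simp
  then have "eventually (\<lambda>n. 0 = F (X n) (Y n)) sequentially" using order_tendstoD(2)[OF *(4), of 0] hcD(2)[OF assms] *(1)
   by (auto elim!: eventually_mono simp: causal_def)
  moreover have "F t x = 0" using hcD(2)[OF assms *(2)] \<open>x < 0\<close> by (simp add: causal_def)
  ultimately show ?thesis using tendsto_cong[of "\<lambda>_. 0" "\<lambda>n. F (X n) (Y n)"] by auto
 qed
qed

lemma pcontD:
 "pcont I F ==> (!!n. X n \<in> I) ==> t \<in> I ==> X \<longlonglongrightarrow> t ==> Y \<longlonglongrightarrow> x ==> x \<noteq> 0 ==>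
  (\<lambda>n. F (X n) (Y n)) \<longlonglongrightarrow> F t x" unfolding pcont_def by blast

lemma pcont_crefl: assumes "pcont I F" shows "pcont I (\<lambda>t. crefl (F t))" unfolding pcont_def
proof (intro allI impI)
 fix X Y t x assume *: "\<forall>n. X n \<in> I" "t \<in> I" "X \<longlonglongrightarrow> t" "Y \<longlonglongrightarrow> x" "(x::real) \<noteq> 0"
 show "(\<lambda>n. crefl (F (X n)) (Y n)) \<longlonglongrightarrow> crefl (F t) x"
  unfolding crefl_def using * by (intro tendsto_cnj pcontD[OF assms] tendsto_minus) auto
qed

lemma pcont_add: "pcont I F ==> pcont I G ==> pcont I (\<lambda>t x. F t x + G t x)" unfolding pcont_def by (intro allI impI tendsto_add) auto

text \<open>The jumps of the factors sit at the single points y = 0 and y = x, so dominated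
  convergence gives continuity across frequency 0 as well.\<close>

lemma conv_continuous:
 assumes "expd I F" "expd I G" "pcont I F" "pcont I G"
 shows "continuous_on (I \<times> UNIV) (\<lambda>(t, x). conv (F t) (G t) x)"
proof (rule continuous_on_sequentiallyI)
 fix u a assume u: "\<forall>n. u n \<in> I \<times> (UNIV :: real set)" "a \<in> I \<times> (UNIV :: real set)" "u \<longlonglongrightarrow> a"
 obtain t x where a: "a = (t, x)" by (cases a)
 define X Y where "X n = fst (u n)" and "Y n = snd (u n)" for n
 have u': "u n = (X n, Y n)" for n by (simp add: X_def Y_def)
 have X: "!!n. X n \<in> I" "t \<in> I" "X \<longlonglongrightarrow> t" "Y \<longlonglongrightarrow> x"
  using u a tendsto_fst[OF u(3)] tendsto_snd[OF u(3)] by (auto simp: X_def[abs_def] Y_def[abs_def] mem_Times_iff)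
 obtain C \<sigma> where *: "C > 0" "\<sigma> > 0"
  "!!t x. t \<in> I ==> norm (F t x) \<le> C * decay \<sigma> x"
  "!!t x. t \<in> I ==> norm (G t x) \<le> C * decay \<sigma> x" using expd_common[OF assms(1,2)] by blast
 have [measurable]: "meas (F t)" "meas (G t)"
  "!!n. meas (F (X n))" "!!n. meas (G (X n))" using X assms by (auto simp: expd_def)
 have "(\<lambda>n. conv (F (X n)) (G (X n)) (Y n)) \<longlonglongrightarrow> conv (F t) (G t) x" unfolding conv_def
 proof (rule integral_dominated_convergence[where w = "\<lambda>y. C*(C * decay \<sigma> y)"])
  show "AE y in lborel. (\<lambda>n. F (X n) (Y n - y) * G (X n) y) \<longlonglongrightarrow> F t (x-y) * G t y"
   using AE_lborel_singleton[of 0] AE_lborel_singleton[of x]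
  proof eventually_elim
   case (elim y)
   have "(\<lambda>n. F (X n) (Y n - y)) \<longlonglongrightarrow> F t (x-y)"
    using elim by (intro pcontD[OF assms(3)] tendsto_diff X tendsto_const) auto
   moreover have "(\<lambda>n. G (X n) y) \<longlonglongrightarrow> G t y" using elim by (intro pcontD[OF assms(4)] X tendsto_const) auto
   ultimately show ?case by (rule tendsto_mult)
  qed
  show "AE y in lborel. norm (F (X n) (Y n - y) * G (X n) y) \<le> C*(C * decay \<sigma> y)" for n
  proof (intro AE_I2)
   fix y
   have "norm (F (X n) (Y n - y)) \<le> C" using * by (intro order_trans[OF *(3)[OF X(1)]]) auto
   then show "norm (F (X n) (Y n - y) * G (X n) y) \<le> C*(C * decay \<sigma> y)" unfolding norm_mult using * X by (intro mult_mono) auto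
  qed
 qed (use integrable_exp_abs[OF *(2)] in \<open>auto intro!: integrable_mult_right\<close>)
 then show "(\<lambda>n. (\<lambda>(t, x). conv (F t) (G t) x) (u n)) \<longlonglongrightarrow> (\<lambda>(t, x). conv (F t) (G t) x) a"
  by (simp add: u' a)
qed

lemma continuous_on_case_prod_cong:
 "continuous_on S (\<lambda>(t, x). F t x) ==> (!!t x. (t, x) \<in> S ==> F t x = G t x) ==> continuous_on S (\<lambda>(t, x). G t x)"
 by (subst continuous_on_cong[of S S _ "\<lambda>(t, x). F t x"]) auto

lemma hcI:
 "expd I F ==> (!!t. t \<in> I ==> causal (F t)) ==> continuous_on (I \<times> {0..}) (\<lambda>(t, x). F t x) ==> hc I F" by (simp add: hc_def)

lemma hc_cong: "hc I F ==> (!!t. t \<in> I ==> F t = G t) ==> hc I G"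
 by (rule hcI) (auto simp: hc_def intro: expd_cong continuous_on_case_prod_cong[of _ F])

lemma hc_subset: "hc I F ==> J \<subseteq> I ==> hc J F" by (rule hcI) (auto simp: hc_def intro: expd_subset continuous_on_subset)

lemma hc_zero: "hc I (\<lambda>_ _. 0)" by (rule hcI) (auto simp: expd_def causal_def intro!: exI[of _ 0] exI[of _ "1::real"])

lemma hc_add: "hc I F ==> hc I G ==> hc I (\<lambda>t x. F t x + G t x)"
 by (rule hcI) (auto simp: hc_def causal_def case_prod_unfold intro!: expd_add continuous_on_add)

lemma hc_scale:
 assumes "hc I F" "continuous_on I c" "compact I"
 shows "hc I (\<lambda>t x. c t * F t x)"
proof (rule hcI)
 obtain B where "!!t. t \<in> I ==> norm (c t) \<le> B"
  using compact_imp_bounded[OF compact_continuous_image[OF assms(2,3)]] by (auto simp: bounded_iff)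
 then show "expd I (\<lambda>t x. c t * F t x)" by (rule expd_scale[OF hcD(1)[OF assms(1)]])
 show "continuous_on (I \<times> {0..}) (\<lambda>(t, x). c t * F t x)" using hcD(3)[OF assms(1)] unfolding case_prod_unfold
  by (intro continuous_on_mult continuous_on_compose2[OF assms(2) continuous_on_fst]) (auto intro: continuous_intros)
qed (use hcD(2)[OF assms(1)] in \<open>auto simp: causal_def\<close>)

lemma hc_cmult: assumes "hc I F" shows "hc I (\<lambda>t x. c * F t x)"
 using hcD[OF assms] by (intro hcI expd_cmult) (auto simp: causal_def case_prod_unfold intro!: continuous_on_mult_left)

lemma hc_mulx: assumes "hc I F" shows "hc I (\<lambda>t. mulx (F t))" using hcD[OF assms] unfolding mulx_def[abs_def]
 by (intro hcI expd_mulx[unfolded mulx_def[abs_def]])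
  (auto simp: causal_def case_prod_unfold intro!: continuous_intros)

text \<open>The symbol is built from two causal functions, entering as \<open>f\<close> and
  \<open>crefl g\<close>. This form covers \<open>herm p\<close>, \<open>mulx (crefl p)\<close> and
  the symbol \<open>ext2 p\<close> of the Picard iteration.\<close>

lemma hc_toep:
 assumes "hc I f" "hc I g" "hc I h"
 shows "hc I (\<lambda>t. toep (\<lambda>x. f t x + crefl (g t) x) (h t))"
proof (rule hcI)
 note e = hcD(1)[OF assms(1)] hcD(1)[OF assms(2)] hcD(1)[OF assms(3)]
 show "expd I (\<lambda>t. toep (\<lambda>x. f t x + crefl (g t) x) (h t))" by (intro expd_toep expd_intros e)
 have "continuous_on (I \<times> UNIV) (\<lambda>(t, x). conv (\<lambda>x. f t x + crefl (g t) x) (h t) x)"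
  by (intro conv_continuous expd_intros e pcont_add pcont_crefl hc_pcont assms)
 then have "continuous_on (I \<times> {0..}) (\<lambda>(t, x). conv (\<lambda>x. f t x + crefl (g t) x) (h t) x)" by (rule continuous_on_subset) auto
 then show "continuous_on (I \<times> {0..}) (\<lambda>(t, x). toep (\<lambda>x. f t x + crefl (g t) x) (h t) x)"
  by (rule continuous_on_case_prod_cong) (auto simp: toep_def pos_def)
qed simp

section \<open>One-sided derivatives of Toeplitz operators\<close>

text \<open>Derivatives are one-sided at \<open>0\<close>: the functions vanish on the negative half-line and may jump there.\<close>
fun hcd :: "real set => nat => (real => cfun) => bool" where
 "hcd I 0 F = hc I F"
| "hcd I (Suc n) F = (hc I F \<and> (\<exists>G. hcd I n G \<and>
   (\<forall>t\<in>I. \<forall>x\<ge>0. (F t hvd G t x) (at_half x))))"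

lemma hcd_hc: "hcd I n F ==> hc I F" by (cases n) auto

lemma hcd_SucI:
 "hc I F ==> hcd I n G ==> (!!t x. t \<in> I ==> x \<ge> 0 ==> (F t hvd G t x) (at_half x)) ==> hcd I (Suc n) F" by auto

lemma hcd_mono: "hcd I n F ==> m \<le> n ==> hcd I m F"
proof (induction m arbitrary: n F)
 case (Suc m)
 then obtain n' where n: "n = Suc n'" "m \<le> n'" by (cases n) auto
 with Suc show ?case by fastforce
qed (simp add: hcd_hc)

lemma hcd_cong: "hcd I n F ==> (!!t. t \<in> I ==> F t = G t) ==> hcd I n G" by (cases n) (auto intro: hc_cong)

lemma hcd_subset: "hcd I n F ==> J \<subseteq> I ==> hcd J n F"
proof (induction n arbitrary: F)
 case (Suc n) then show ?case by (fastforce intro: hc_subset)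
qed (auto intro: hc_subset)

lemma hcd_zero: "hcd I n (\<lambda>_ _. 0)" by (induction n) (auto intro!: hc_zero exI[of _ "\<lambda>_ _. 0"])

lemma hcd_add: "hcd I n F ==> hcd I n G ==> hcd I n (\<lambda>t x. F t x + G t x)"
proof (induction n arbitrary: F G)
 case (Suc n)
 then obtain F' G' where
  "hcd I n F'" "\<forall>t\<in>I. \<forall>x\<ge>0. (F t hvd F' t x) (at_half x)"
  "hcd I n G'" "\<forall>t\<in>I. \<forall>x\<ge>0. (G t hvd G' t x) (at_half x)" by auto
 with Suc show ?case by (intro hcd_SucI[where G = "\<lambda>t x. F' t x + G' t x"] hc_add has_vector_derivative_add Suc.IH) auto
qed (auto intro: hc_add)

lemma hcd_scale: "hcd I n F ==> continuous_on I c ==> compact I ==> hcd I n (\<lambda>t x. c t * F t x)"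
proof (induction n arbitrary: F)
 case (Suc n)
 then obtain F' where
  "hcd I n F'" "\<forall>t\<in>I. \<forall>x\<ge>0. (F t hvd F' t x) (at_half x)" by auto
 with Suc show ?case by (intro hcd_SucI[where G = "\<lambda>t x. c t * F' t x"] hc_scale has_vector_derivative_mult_right Suc.IH) auto
qed (auto intro: hc_scale)

lemma hcd_cmult: "hcd I n F ==> hcd I n (\<lambda>t x. c * F t x)"
proof (induction n arbitrary: F)
 case (Suc n)
 then obtain F' where
  "hcd I n F'" "\<forall>t\<in>I. \<forall>x\<ge>0. (F t hvd F' t x) (at_half x)" by auto
 with Suc show ?case by (intro hcd_SucI[where G = "\<lambda>t x. c * F' t x"] hc_cmult has_vector_derivative_mult_right Suc.IH) auto
qed (auto intro: hc_cmult)

lemma mulx_has_vector_derivative: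
 "(f hvd f') (at x within S) ==> (mulx f hvd (f x + of_real x * f')) (at x within S)"
 unfolding mulx_def[abs_def] by (auto intro!: derivative_eq_intros)

lemma hcd_mulx: "hcd I n F ==> hcd I n (\<lambda>t. mulx (F t))"
proof (induction n arbitrary: F)
 case (Suc n)
 then obtain F' where *:
  "hcd I n F'" "\<forall>t\<in>I. \<forall>x\<ge>0. (F t hvd F' t x) (at_half x)" by auto
 show ?case
 proof (rule hcd_SucI[where G = "\<lambda>t x. F t x + mulx (F' t) x"])
  show "hcd I n (\<lambda>t x. F t x + mulx (F' t) x)" by (intro hcd_add Suc.IH *(1) hcd_mono[OF Suc.prems]) simp
  show "(mulx (F t) hvd F t x + mulx (F' t) x) (at_half x)" if "t \<in> I" "x \<ge> 0" for t x
   using mulx_has_vector_derivative *(2) that by (auto simp: mulx_def[of _ x])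
 qed (intro hc_mulx hcd_hc[OF Suc.prems])
qed (auto intro: hc_mulx)

lemma at_within_atLeast_Icc: "x < M ==> at (x::real) within {0..M} = at x within {0..}" by (rule at_within_nhd[where S = "{..<M}"]) auto

lemma at_within_atLeast_neq_bot: "x \<ge> 0 ==> at (x::real) within {0..} \<noteq> bot"
proof -
 assume "x \<ge> 0"
 have "at x within {x<..} \<noteq> bot" by simp
 moreover have "at x within {x<..} \<le> at x within {0..}" using \<open>x \<ge> 0\<close> by (intro at_le) auto
 ultimately show ?thesis by (metis bot.extremum_uniqueI)
qed

lemma has_vector_derivative_lint:
 fixes g :: "real => complex"
 assumes F: "!!x. x \<ge> 0 ==> F x = c+(LBINT s. indicator {0..x} s *\<^sub>R g s)"
  and g: "continuous_on {0..} g" and x: "x \<ge> 0"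
 shows "(F hvd g x) (at_half x)"
proof -
 have eq: "F y = c+integral {0..y} g" if "y \<ge> 0" for y
 proof -
  have "set_integrable lborel {0..y} g"
   using continuous_on_subset[OF g] by (intro borel_integrable_atLeastAtMost'[unfolded set_integrable_def[symmetric]]) auto
  from set_borel_integral_eq_integral(2)[OF this] F[OF that] show ?thesis by (simp add: set_lebesgue_integral_def)
 qed
 have "((\<lambda>u. c+integral {0..u} g) hvd 0 + g x) (at x within {0..x+1})"
  by (intro has_vector_derivative_add has_vector_derivative_const integral_has_vector_derivative continuous_on_subset[OF g]) (use x in auto)
 then have "((\<lambda>u. c+integral {0..u} g) hvd g x) (at_half x)" using at_within_atLeast_Icc[of x "x+1"] by simp
 then show ?thesis by (rule has_vector_derivative_transform[rotated -1]) (use x eq in auto)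
qed

text \<open>Because \<open>h\<close> jumps at 0, its distributional derivative is h' plus a point
  mass \<open>h 0\<close>, whence the term \<open>h 0 * b\<close>. The claim is integrated in the
  frequency, so that the point 0, where \<open>a\<close> may differ from \<open>b\<close>, does not
  matter.\<close>

lemma conv_increment:
 assumes a: "edec a" and h: "edec h" "causal h" and h': "edec h'" "causal h'" "continuous_on {0..} h'"
  and der: "!!x. x \<ge> 0 ==> (h hvd h' x) (at_half x)"
  and b: "!!x. x > 0 ==> a x = b x" and [measurable]: "meas b" and "\<xi> \<ge> 0"
 shows "conv a h \<xi> = conv a h 0 + (LBINT s. indicator {0..\<xi>} s *\<^sub>R (conv a h' s + h 0 * b s))"
proof -
 let ?L = "\<lambda>\<eta>. LBINT s. indicator {0..\<xi>} s *\<^sub>R h' (s-\<eta>)"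
 let ?b = "LBINT \<eta>. indicator {0..\<xi>} \<eta> *\<^sub>R b \<eta>" and ?c = "LBINT s. indicator {0..\<xi>} s *\<^sub>R conv a h' s"
 have [measurable]: "meas a" "meas h" "meas h'" using a h h' by (auto simp: expd_def)
 have FTC: "has_bochner_integral lborel (\<lambda>s. indicator {u..v} s *\<^sub>R h' s) (h v - h u)" if "0 \<le> u" "u \<le> v" for u v
 proof (rule has_bochner_integral_FTC_Icc)
  show "(h hvd h' x) (at x within {u..v})" if "u \<le> x" "x \<le> v" for x
   by (rule has_vector_derivative_within_subset[OF der]) (use that \<open>0 \<le> u\<close> in auto)
  show "continuous_on {u..v} h'" by (rule continuous_on_subset[OF h'(3)]) (use that in auto)
 qed (use that in auto)
 \<comment> \<open>The interval from -\<eta> to \<xi> - \<eta> lies to the right of 0, crosses the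
   jump, or lies to the left; only the second case picks up \<open>h 0\<close>.\<close>
 have inc: "h (\<xi>-\<eta>) - h (0-\<eta>) = ?L \<eta> + h 0 * of_real (indicator {0<..\<xi>} \<eta>)" for \<eta>
 proof -
  have sh: "?L \<eta> = (LBINT s. indicator {- \<eta>..\<xi>-\<eta>} s *\<^sub>R h' s)"
   by (subst lborel_integral_real_affine[of 1 _ \<eta>]) (auto intro!: L_integral_cong split: split_indicator simp: algebra_simps)
  consider "\<eta> \<le> 0" | "0 < \<eta>" "\<eta> \<le> \<xi>" | "\<xi> < \<eta>" by linarith
  then show ?thesis
  proof cases
   case 1
   then show ?thesis unfolding sh using FTC[of "- \<eta>" "\<xi>-\<eta>"] \<open>\<xi> \<ge> 0\<close> by (auto dest!: has_bochner_integral_integral_eq)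
  next
   case 2
   have "(LBINT s. indicator {- \<eta>..\<xi>-\<eta>} s *\<^sub>R h' s) = (LBINT s. indicator {0..\<xi>-\<eta>} s *\<^sub>R h' s)"
    using h'(2) 2 by (intro L_integral_cong) (auto simp: causal_def split: split_indicator)
   then show ?thesis unfolding sh using FTC[of "0" "\<xi>-\<eta>"] 2 h(2) by (auto dest!: has_bochner_integral_integral_eq simp: causal_def)
  next
   case 3
   have "(LBINT s. indicator {- \<eta>..\<xi>-\<eta>} s *\<^sub>R h' s) = (LINT (s::real)|lborel. 0)"
    using h'(2) 3 by (intro L_integral_cong) (auto simp: causal_def split: split_indicator)
   then show ?thesis unfolding sh using 3 h(2) \<open>\<xi> \<ge> 0\<close> by (auto simp: causal_def)
  qed
 qed
 obtain C \<sigma> where *: "C > 0" "\<sigma> > 0"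
  "!!x. norm (a x) \<le> C * decay \<sigma> x" "!!x. norm (h' x) \<le> C * decay \<sigma> x" using edec_common[OF a h'(1)] by blast
 have h'b: "norm (h' x) \<le> C" for x using * by (intro order_trans[OF *(4)]) auto
 have int: "integrable lborel2 (\<lambda>z. indicator {0..\<xi>} (fst z) *\<^sub>R h' (fst z - snd z) * a (snd z))"
 proof (rule integrable_pair_exp[of "\<lambda>s \<eta>. indicator {0..\<xi>} s *\<^sub>R h' (s-\<eta>) * a \<eta>" \<sigma> "exp (\<sigma>*\<xi>) * C*C"])
  fix s \<eta>
  have "norm (indicator {0..\<xi>} s *\<^sub>R h' (s-\<eta>) * a \<eta>) = indicator {0..\<xi>} s * norm (h' (s-\<eta>)) * norm (a \<eta>)"
   by (simp add: norm_mult)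
  also have "... \<le> (exp (\<sigma>*\<xi>) * decay \<sigma> s)*C*(C * decay \<sigma> \<eta>)"
   using * h'b by (intro mult_mono) (auto split: split_indicator simp: mult_exp_exp)
  finally show "norm (indicator {0..\<xi>} s *\<^sub>R h' (s-\<eta>) * a \<eta>) \<le> exp (\<sigma>*\<xi>) * C*C * decay \<sigma> s * decay \<sigma> \<eta>"
   by (simp add: mult_ac)
 qed (use * in auto)
 have ci: "integrable lborel (\<lambda>\<eta>. h (x-\<eta>) * a \<eta>)" for x by (rule conv_integrable[OF h(1) a])
 have ai: "integrable lborel a" by (rule edec_integrable[OF a])
 have i1: "integrable lborel (\<lambda>\<eta>. ?L \<eta> * a \<eta>)"
 proof -
  have "(\<lambda>\<eta>. ?L \<eta> * a \<eta>) = (\<lambda>\<eta>. h (\<xi>-\<eta>) * a \<eta> - h (0-\<eta>) * a \<eta> - h 0 * (indicator {0<..\<xi>} \<eta> *\<^sub>R a \<eta>))"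
   using inc by (auto simp: fun_eq_iff field_simps scaleR_conv_of_real)
  then show ?thesis using ci[of 0] by (auto intro!: L_integrable_diff ci integrable_mult_right integrable_mult_indicator ai)
 qed
 have "conv a h \<xi> - conv a h 0 = (LBINT \<eta>. h (\<xi>-\<eta>) * a \<eta> - h (0-\<eta>) * a \<eta>)"
  unfolding conv_commute[of a h] unfolding conv_def by (intro L_integral_diff[symmetric] ci)
 also have "... = (LBINT \<eta>. ?L \<eta> * a \<eta> + h 0 * (indicator {0<..\<xi>} \<eta> *\<^sub>R a \<eta>))"
  unfolding left_diff_distrib[symmetric] inc by (intro L_integral_cong) (auto simp: algebra_simps scaleR_conv_of_real)
 also have "... = (LBINT \<eta>. ?L \<eta> * a \<eta>) + h 0 * (LBINT \<eta>. indicator {0<..\<xi>} \<eta> *\<^sub>R a \<eta>)"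
  by (subst L_integral_add[OF i1])
   (auto intro!: integrable_mult_right integrable_mult_indicator ai simp only: integral_mult_right_zero sets_lborel greaterThanAtMost_borel)
 also have "(LBINT \<eta>. ?L \<eta> * a \<eta>) =
   (LBINT \<eta>. (LBINT s. indicator {0..\<xi>} s *\<^sub>R h' (s-\<eta>) * a \<eta>))" by (simp only: integral_mult_left_zero)
 also have "... = (LBINT s. (LBINT \<eta>. indicator {0..\<xi>} s *\<^sub>R h' (s-\<eta>) * a \<eta>))" by (rule lborel_fubini[OF int])
 also have "... = ?c" unfolding conv_commute[of a h'] by (simp add: conv_def)
 also have "(LBINT \<eta>. indicator {0<..\<xi>} \<eta> *\<^sub>R a \<eta>) = ?b"
  by (intro integral_cong_AE, measurable, use AE_lborel_singleton[of 0] in eventually_elim) (auto split: split_indicator simp: b)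
 finally have "conv a h \<xi> - conv a h 0 = ?c + h 0 * ?b" .
 moreover have "integrable lborel (\<lambda>\<eta>. indicator {0..\<xi>} \<eta> *\<^sub>R b \<eta>)"
 proof (rule integrable_cong_AE_imp)
  show "integrable lborel (\<lambda>\<eta>. indicator {0..\<xi>} \<eta> *\<^sub>R a \<eta>)" by (intro integrable_mult_indicator ai) auto
  show "AE \<eta> in lborel. indicator {0..\<xi>} \<eta> *\<^sub>R a \<eta> = indicator {0..\<xi>} \<eta> *\<^sub>R b \<eta>"
   using AE_lborel_singleton[of 0] by eventually_elim (auto split: split_indicator simp: b)
 qed measurable
 moreover have "integrable lborel (\<lambda>\<eta>. indicator {0..\<xi>} \<eta> *\<^sub>R conv a h' \<eta>)"
  by (intro integrable_mult_indicator edec_integrable edec_conv a h') auto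
 ultimately have "(LBINT s. indicator {0..\<xi>} s *\<^sub>R conv a h' s + h 0 * (indicator {0..\<xi>} s *\<^sub>R b s)) = conv a h \<xi> - conv a h 0"
  by (simp only: L_integral_add integrable_mult_right integral_mult_right_zero)
 moreover have "indicator {0..\<xi>} s *\<^sub>R conv a h' s + h 0 * (indicator {0..\<xi>} s *\<^sub>R b s)
   = indicator {0..\<xi>} s *\<^sub>R (conv a h' s + h 0 * b s)" for s by (simp add: scaleR_right_distrib)
 ultimately show ?thesis by (simp only: add_diff_cancel_left' diff_add_cancel add.commute[of "conv a h 0"])
qed

lemma toep_has_derivative:
 assumes "edec a" "edec h" "causal h" "edec h'" "causal h'" "continuous_on {0..} h'"
  "!!x. x \<ge> 0 ==> (h hvd h' x) (at_half x)"
  "!!x. x > 0 ==> a x = b x" "meas b" "continuous_on {0..} b"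
  "continuous_on {0..} (toep a h')" "x \<ge> 0"
 shows "(toep a h hvd toep a h' x + h 0 * b x) (at_half x)"
proof (rule has_vector_derivative_lint[where c = "toep a h 0"])
 show "toep a h \<xi> = toep a h 0 + (LBINT s. indicator {0..\<xi>} s *\<^sub>R (toep a h' s + h 0 * b s))" if "\<xi> \<ge> 0" for \<xi>
 proof -
  have "(LBINT s. indicator {0..\<xi>} s *\<^sub>R (toep a h' s + h 0 * b s)) = (LBINT s. indicator {0..\<xi>} s *\<^sub>R (conv a h' s + h 0 * b s))"
   by (intro L_integral_cong) (auto simp: toep_def pos_def split: split_indicator)
  with conv_increment[OF assms(1-9) that] that show ?thesis by (simp add: toep_def pos_def)
 qed
qed (use assms in \<open>auto intro!: continuous_intros\<close>)

lemma hc_slice_continuous: "hc I F ==> t \<in> I ==> continuous_on {0..} (F t)"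
 using continuous_on_compose2[OF hcD(3), of I F "{0..}" "\<lambda>x. (t, x)"]
  continuous_on_Pair[OF continuous_on_const continuous_on_id, of "{0..}" t] by (auto simp: image_subset_iff)

lemma toep_hc_has_derivative:
 assumes "hc I f" "hc I g" "hc I h" "hc I h'" "t \<in> I" "x \<ge> 0"
  and "!!x. x \<ge> 0 ==> (h t hvd h' t x) (at_half x)"
 shows "(toep (\<lambda>x. f t x + crefl (g t) x) (h t) hvd
  toep (\<lambda>x. f t x + crefl (g t) x) (h' t) x + h t 0 * f t x) (at_half x)"
proof (rule toep_has_derivative)
 show "edec (\<lambda>x. f t x + crefl (g t) x)" by (intro edec_intros hcD(4)[OF assms(1)] hcD(4)[OF assms(2)] assms(5))
 show "f t x + crefl (g t) x = f t x" if "x > 0" for x using hcD(2)[OF assms(2,5)] that by (simp add: crefl_def causal_def)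
 show "meas (f t)" using hcD(4)[OF assms(1,5)] by (simp add: expd_def)
 show "continuous_on {0..} (toep (\<lambda>x. f t x + crefl (g t) x) (h' t))" by (rule hc_slice_continuous[OF hc_toep[OF assms(1,2,4)] assms(5)])
qed (use assms hcD(2,4) hc_slice_continuous in auto)

lemma hc_value_continuous: assumes "hc I h" shows "continuous_on I (\<lambda>t. h t 0)"
 using continuous_on_compose2[OF hcD(3)[OF assms], of I "\<lambda>t. (t, 0)"]
  continuous_on_Pair[OF continuous_on_id continuous_on_const, of I 0] by (auto simp: image_subset_iff)

text \<open>All derivatives are put on \<open>h\<close>. The boundary terms
  \<open>h t 0 * f t x\<close> involve only the causal half of the symbol, so continuity is enough
  for \<open>g\<close>.\<close>

lemma hcd_toep:
 assumes "compact I" "hcd I n f" "hc I g" "hcd I n h"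
 shows "hcd I n (\<lambda>t. toep (\<lambda>x. f t x + crefl (g t) x) (h t))" using assms(2,4)
proof (induction n arbitrary: h)
 case 0 then show ?case using assms by (auto intro: hc_toep)
next
 case (Suc n)
 then obtain h' where *:
  "hcd I n h'" "\<forall>t\<in>I. \<forall>x\<ge>0. (h t hvd h' t x) (at_half x)" by auto
 have f: "hcd I n f" using Suc.prems(1) by (rule hcd_mono) simp
 note hc = hcd_hc[OF Suc.prems(1)] assms(3) hcd_hc[OF Suc.prems(2)] hcd_hc[OF *(1)]
 show ?case
 proof (rule hcd_SucI[where G = "\<lambda>t x. toep (\<lambda>x. f t x + crefl (g t) x) (h' t) x + h t 0 * f t x"])
  show "hc I (\<lambda>t. toep (\<lambda>x. f t x + crefl (g t) x) (h t))" by (intro hc_toep hc)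
  show "hcd I n (\<lambda>t x. toep (\<lambda>x. f t x + crefl (g t) x) (h' t) x + h t 0 * f t x)"
   by (intro hcd_add Suc.IH f *(1) hcd_scale hc_value_continuous hc assms(1))
  show "(toep (\<lambda>x. f t x + crefl (g t) x) (h t) hvd
   toep (\<lambda>x. f t x + crefl (g t) x) (h' t) x + h t 0 * f t x) (at_half x)"
   if "t \<in> I" "x \<ge> 0" for t x by (rule toep_hc_has_derivative[OF hc that]) (use * that in auto)
 qed
qed

lemma hcd_toep_hermitian:
 assumes "compact I" "hcd I n p" "hcd I n h"
 shows "hcd I n (\<lambda>t. toep (herm (p t)) (h t))" using hcd_toep[OF assms(1,2) hcd_hc[OF assms(2)] assms(3)] by (simp add: herm_def[abs_def])

text \<open>Written as \<open>0 + crefl g\<close>, this symbol fits the general Toeplitz lemmas with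
  vanishing causal half; the sign is that of \<open>crefl_mulx\<close>.\<close>

lemma mulx_crefl_eq: "mulx (crefl p) = (\<lambda>x. 0 + crefl (\<lambda>x. - 1 * mulx p x) x)" by (simp add: fun_eq_iff mulx_def crefl_def)

lemma hcd_toep_crefl:
 assumes "compact I" "hc I p" "hcd I n h"
 shows "hcd I n (\<lambda>t. toep (mulx (crefl (p t))) (h t))" unfolding mulx_crefl_eq
 by (rule hcd_toep[OF assms(1) hcd_zero _ assms(3)]) (intro hc_cmult hc_mulx assms)

lemma hcd_lax_op:
 assumes "compact I" "hcd I n p" "hcd I n h"
 shows "hcd I n (\<lambda>t. lax_op (p t) (h t))" unfolding lax_op_def[abs_def] by (intro hcd_add hcd_mulx hcd_toep_hermitian assms)

lemma hcd_flow_op: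
 assumes "compact I" "hcd I n p" "hcd I n h"
 shows "hcd I n (\<lambda>t. flow_op (p t) (h t))" unfolding flow_op_def[abs_def]
 by (intro hcd_cmult hcd_add hcd_mulx hcd_toep_hermitian hcd_toep_crefl assms hcd_hc[OF assms(2)])

section \<open>The Galilei operator\<close>

text \<open>Set to 0 on negative frequencies so that \<open>dx f\<close> is causal again and the
  operator can be iterated.\<close>

definition dx :: "cfun => cfun" where
 "dx f x = (if 0 \<le> x then vector_derivative f (at_half x) else 0)"

lemma dx_eqI: "x \<ge> 0 ==> (f hvd D) (at_half x) ==> dx f x = D"
 by (simp add: dx_def vector_derivative_within at_within_atLeast_neq_bot)

text \<open>One-sided derivatives are unique, so the derivative hidden behind the existential
  quantifier in \<open>hcd\<close> can be named.\<close>

lemma hcd_dx: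
 assumes "hcd I (Suc n) F"
 shows "hcd I n (\<lambda>t. dx (F t))"
  "!!t x. t \<in> I ==> x \<ge> 0 ==> (F t hvd dx (F t) x) (at_half x)"
proof -
 from assms obtain F' where *:
  "hcd I n F'" "!!t x. t \<in> I ==> x \<ge> 0 ==> (F t hvd F' t x) (at_half x)" by auto
 have eq: "F' t x = dx (F t) x" if "t \<in> I" for t x
 proof (cases "x \<ge> 0")
  case False then show ?thesis using hcD(2)[OF hcd_hc[OF *(1)] that] by (simp add: dx_def causal_def)
 qed (simp add: dx_eqI[OF _ *(2)[OF that]])
 then have "F' t = dx (F t)" if "t \<in> I" for t using that by (simp add: fun_eq_iff)
 then show "hcd I n (\<lambda>t. dx (F t))" by (rule hcd_cong[OF *(1)])
 show "!!t x. t \<in> I ==> x \<ge> 0 ==> (F t hvd dx (F t) x) (at_half x)" using *(2) eq by simp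
qed

lemma causal_dx [simp]: "causal (dx f)" by (simp add: causal_def dx_def)

text \<open>Nothing is assumed about the time derivative of h'. Integrate the equation in time,
  differentiate that integral in x, and recover the time derivative of h' from the resulting
  integral of \<open>k\<close>.\<close>

lemma mixed_partial:
 assumes h: "!!t x. t \<in> {a..b} ==> x \<ge> 0 ==> ((\<lambda>s. h s x) hvd m t x) (at t within {a..b})"
  and m: "!!t x. t \<in> {a..b} ==> x \<ge> 0 ==> (m t hvd k t x) (at_half x)"
  and k: "continuous_on ({a..b} \<times> {0..}) (\<lambda>(t, x). k t x)"
  and m_cont: "continuous_on ({a..b} \<times> {0..}) (\<lambda>(t, x). m t x)"
  and h': "!!t x. t \<in> {a..b} ==> x \<ge> 0 ==> (h t hvd h' t x) (at_half x)"
  and t: "t \<in> {a..b}" and x: "x \<ge> 0"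
 shows "((\<lambda>s. h' s x) hvd (k t x :: complex)) (at t within {a..b})"
proof -
 have mc: "continuous_on {a..s} (\<lambda>r. m r y)" if "s \<in> {a..b}" "y \<ge> 0" for s y
  by (rule continuous_on_compose2[OF m_cont[unfolded case_prod_unfold], of "{a..s}" "\<lambda>r. (r, y)", simplified])
   (use that in \<open>auto intro!: continuous_intros\<close>)
 have kc: "continuous_on {a..b} (\<lambda>r. k r y)" if "y \<ge> 0" for y
  by (rule continuous_on_compose2[OF k[unfolded case_prod_unfold], of "{a..b}" "\<lambda>r. (r, y)", simplified])
   (use that in \<open>auto intro!: continuous_intros\<close>)
 have eq: "h s y = h a y + integral (cbox a s) (\<lambda>r. m r y)" if "s \<in> {a..b}" "y \<ge> 0" for s y
 proof -
  have "((\<lambda>r. m r y) has_integral (h s y - h a y)) {a..s}" by (rule fundamental_theorem_of_calculus)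
    (use that in \<open>auto intro!: has_vector_derivative_within_subset[OF h]\<close>)
  then show ?thesis by (simp add: integral_unique)
 qed
 have eq': "h' s x = h' a x + integral {a..s} (\<lambda>r. k r x)" if s: "s \<in> {a..b}" for s
 proof (rule vector_derivative_unique_within[OF at_within_atLeast_neq_bot[OF x] h'[OF s x]])
  have "((\<lambda>y. h a y + integral (cbox a s) (\<lambda>r. m r y)) hvd
   h' a x + integral (cbox a s) (\<lambda>r. k r x)) (at_half x)"
  proof (intro has_vector_derivative_add h' x leibniz_rule_vector_derivative)
   show "continuous_on ({0..} \<times> cbox a s) (\<lambda>(x, t). k t x)"
    using continuous_on_compose2[OF k continuous_on_swap, of "{0..} \<times> cbox a s"] s
    by (auto simp: case_prod_unfold prod.swap_def image_subset_iff)
   show "(\<lambda>r. m r y) integrable_on cbox a s" if "y \<in> {0..}" for y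
    using mc[OF s, of y] that by (auto intro!: integrable_continuous_interval)
  qed (use m s x in auto)
  then have "((\<lambda>y. h a y + integral (cbox a s) (\<lambda>r. m r y)) hvd
   h' a x + integral {a..s} (\<lambda>r. k r x)) (at_half x)" by simp
  then show "(h s hvd h' a x + integral {a..s} (\<lambda>r. k r x)) (at_half x)"
   by (rule has_vector_derivative_transform[rotated -1]) (use eq[OF s] x in auto)
 qed
 have "((\<lambda>s. h' a x + integral {a..s} (\<lambda>r. k r x)) hvd 0 + k t x) (at t within {a..b})"
  by (intro has_vector_derivative_add has_vector_derivative_const integral_has_vector_derivative kc x t)
 then show ?thesis
  by (intro has_vector_derivative_transform[OF t, of "\<lambda>s. h' s x" "\<lambda>s. h' a x + integral {a..s} (\<lambda>r. k r x)"]) (simp_all add: eq'[symmetric])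
qed

text \<open>The Fourier picture of \<open>x - 2 t L\<close>, the Lax-pair analogue of the Galilei operator of the linear equation.\<close>
definition galilei_op :: "real => cfun => cfun => cfun" where
 "galilei_op t p h x = \<i> * dx h x + (- 2 * of_real t) * lax_op p h x"

lemma causal_galilei_op [simp]: "causal h ==> causal (galilei_op t p h)"
 using causal_dx[of h] causal_lax_op[of h p] by (simp add: causal_def galilei_op_def)

lemma hcd_galilei_op:
 assumes "compact I" "hcd I n p" "hcd I (Suc n) h"
 shows "hcd I n (\<lambda>t. galilei_op t (p t) (h t))" unfolding galilei_op_def[abs_def]
 by (intro hcd_add hcd_cmult hcd_dx hcd_scale hcd_lax_op assms hcd_mono[OF assms(3)] continuous_intros) auto

lemma flow_op_add: "edec p ==> edec f ==> edec g ==> flow_op p (\<lambda>x. f x + g x) x = flow_op p f x + flow_op p g x"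
 by (simp add: flow_op_def mulx_add toep_add_right edec_intros algebra_simps)
lemma flow_op_cmult: "flow_op p (\<lambda>x. c * f x) x = c * flow_op p f x" by (simp add: flow_op_def mulx_cmult toep_cmult_right algebra_simps)

text \<open>The commutator of the frequency derivative with the flow operator is - 2 i L. No
  boundary term survives: \<open>mulx h\<close> vanishes at 0, and the symbol
  \<open>mulx (crefl p)\<close> has no causal half.\<close>

lemma flow_op_has_derivative:
 assumes p: "hc I p" and h: "hcd I 1 h" and t: "t \<in> I" and x: "x \<ge> 0"
 shows "(flow_op (p t) (h t) hvd
  flow_op (p t) (dx (h t)) x - 2*\<i> * lax_op (p t) (h t) x) (at_half x)"
proof -
 have hh: "hc I h" using h by (rule hcd_hc)
 have dh: "hc I (\<lambda>t. dx (h t))" using hcd_dx(1)[of I 0 h] h by simp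
 have d: "(h t hvd dx (h t) x) (at_half x)" if "x \<ge> 0" for x using hcd_dx(2)[of I 0 h t x] h t that by simp
 note [simp] = hcD(4)[OF p t] hcD(4)[OF hh t] hcD(4)[OF dh t] edec_intros
 let ?g = "\<lambda>t x. h t x + mulx (dx (h t)) x"
 have 1: "(mulx (h t) hvd ?g t x) (at_half x)" if "x \<ge> 0" for x
  using mulx_has_vector_derivative[OF d[OF that]] by (simp add: mulx_def[of _ x])
 have 2: "(mulx (mulx (h t)) hvd (mulx (h t) x + mulx (?g t) x)) (at_half x)"
  using mulx_has_vector_derivative[OF 1[OF x]] by (simp add: mulx_def[of _ x])
 have 3: "(toep (\<lambda>x. p t x + crefl (p t) x) (mulx (h t)) hvd
   toep (\<lambda>x. p t x + crefl (p t) x) (?g t) x + mulx (h t) 0 * p t x) (at_half x)"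
  by (rule toep_hc_has_derivative[where I = I and h' = ?g]) (intro p hc_mulx hh hc_add dh t x 1; assumption)+
 have 4: "(toep (\<lambda>x. 0 + crefl (\<lambda>x. - 1 * mulx (p t) x) x) (h t) hvd
   toep (\<lambda>x. 0 + crefl (\<lambda>x. - 1 * mulx (p t) x) x) (dx (h t)) x + h t 0 * 0) (at_half x)"
  by (rule toep_hc_has_derivative[where I = I and f = "\<lambda>_ _. 0" and h' = "\<lambda>t. dx (h t)"]) (intro hc_zero hc_cmult hc_mulx p hh dh t x d; assumption)+
 have "(flow_op (p t) (h t) hvd
  - \<i>*((mulx (h t) x + mulx (?g t) x)+2*(toep (herm (p t)) (?g t) x)+2 * toep (mulx (crefl (p t))) (dx (h t)) x)) (at_half x)"
  unfolding flow_op_def[abs_def] by (intro has_vector_derivative_mult_right has_vector_derivative_add 2)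
   (use 3 4 in \<open>simp_all only: herm_def[abs_def] mulx_crefl_eq mulx_def[of _ 0] of_real_0 mult_zero_left mult_zero_right add_0_right\<close>)
 also have "- \<i>*((mulx (h t) x + mulx (?g t) x)+2*(toep (herm (p t)) (?g t) x)+2 * toep (mulx (crefl (p t))) (dx (h t)) x)
  = flow_op (p t) (dx (h t)) x - 2*\<i> * lax_op (p t) (h t) x" by (simp add: flow_op_def lax_op_def mulx_add toep_add_right algebra_simps)
 finally show ?thesis .
qed

lemma flow_galilei_op:
 assumes p: "flow {a..b} p p" and h: "flow {a..b} p h" and hp: "hcd {a..b} 1 p" and hh: "hcd {a..b} 1 h"
 shows "flow {a..b} p (\<lambda>t. galilei_op t (p t) (h t))" unfolding flow_def
proof (intro conjI ballI allI)
 have c: "compact {a..b}" by simp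
 have hp0: "hc {a..b} p" and hh0: "hc {a..b} h" using hp hh by (auto dest: hcd_hc)
 have dh: "hc {a..b} (\<lambda>t. dx (h t))" using hcd_dx(1)[of _ 0 h] hh by simp
 have A: "hcd {a..b} 0 (\<lambda>t. galilei_op t (p t) (h t))" using hcd_galilei_op[OF c, of 0 p h] hp0 hh by simp
 then show "expd {a..b} (\<lambda>t. galilei_op t (p t) (h t))" by (simp add: hc_def)
 fix t assume t: "t \<in> {a..b}"
 show "causal (galilei_op t (p t) (h t))" using flowD(2)[OF h t] by simp
 fix x
 note [simp] = flowD(3)[OF p t] flowD(3)[OF h t] hcD(4)[OF dh t] edec_intros
 let ?k = "\<lambda>t x. flow_op (p t) (dx (h t)) x + (- 2*\<i>) * lax_op (p t) (h t) x"
 show "((\<lambda>s. galilei_op s (p s) (h s) x) hvd flow_op (p t) (galilei_op t (p t) (h t)) x) (at t within {a..b})"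
 proof (cases "x \<ge> 0")
  case True
  have "((\<lambda>s. dx (h s) x) hvd ?k t x) (at t within {a..b})"
  proof (rule mixed_partial[where h = h and m = "\<lambda>t. flow_op (p t) (h t)"])
   have "hc {a..b} ?k" using hcd_flow_op[OF c, of 0 p "\<lambda>t. dx (h t)"] hcd_lax_op[OF c, of 0 p h] hp0 hh0 dh by (intro hc_add hc_cmult) auto
   then show "continuous_on ({a..b} \<times> {0..}) (\<lambda>(t, x). ?k t x)" by (rule hcD)
   show "continuous_on ({a..b} \<times> {0..}) (\<lambda>(t, x). flow_op (p t) (h t) x)"
    using hcd_flow_op[OF c, of 0 p h] hp0 hh0 by (intro hcD(3)) simp
  qed (use t True flowD(4)[OF h] flow_op_has_derivative[OF hp0 hh] hcd_dx(2)[of _ 0 h] hh in auto)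
  then have "((\<lambda>s. galilei_op s (p s) (h s) x) hvd
   (\<i> * ?k t x + ((- 2 * of_real t) * flow_op (p t) (lax_op (p t) (h t)) x + (- 2 * of_real 1) * lax_op (p t) (h t) x))) (at t within {a..b})"
   unfolding galilei_op_def by (intro has_vector_derivative_add has_vector_derivative_mult_right has_vector_derivative_mult
     has_vector_derivative_of_real has_vector_derivative_id flowD(4)[OF flow_lax_op[OF _ p h]] t) auto
  \<comment> \<open>Differentiating the explicit factor t gives - 2 L h, which cancels the
    commutator contribution i (- 2 i) L h.\<close>
  also have "\<i> * ?k t x + ((- 2 * of_real t) * flow_op (p t) (lax_op (p t) (h t)) x + (- 2 * of_real 1) * lax_op (p t) (h t) x) =
   flow_op (p t) (galilei_op t (p t) (h t)) x"
   unfolding galilei_op_def[abs_def] by (subst flow_op_add, simp_all only: flow_op_cmult) (simp_all add: algebra_simps)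
  finally show ?thesis .
 next
  case False
  have 0: "galilei_op s (p s) (h s) x = 0" if "s \<in> {a..b}" for s using causal_galilei_op[OF flowD(2)[OF h that]] False by (simp add: causal_def)
  have "flow_op (p t) (galilei_op t (p t) (h t)) x = 0"
   using causal_flow_op[OF causal_galilei_op[OF flowD(2)[OF h t]]] False by (simp add: causal_def)
  then show ?thesis using has_vector_derivative_transform[OF t, of "\<lambda>s. galilei_op s (p s) (h s) x" "\<lambda>_. 0" 0] 0 by simp
 qed
qed

section \<open>Weighted norms and a priori decay\<close>

lemma square_integrable_norm_mult:
 fixes f :: "real => 'a::{banach, second_countable_topology}" and g :: "real => 'b::{banach, second_countable_topology}"
 assumes "square_integrable f" "square_integrable g"
 shows "integrable lborel (\<lambda>x. norm (f x) * norm (g x))"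
proof (rule L_integrable_bound)
 have [measurable]: "meas f" "meas g" using assms by (auto simp: square_integrable_def)
 show "integrable lborel (\<lambda>x. (norm (f x))^2+(norm (g x))^2)" using assms by (auto simp: square_integrable_def)
 show "(\<lambda>x. norm (f x) * norm (g x)) \<in> borel_measurable lborel" by measurable
 show "AE x in lborel. norm (norm (f x) * norm (g x)) \<le> norm ((norm (f x))^2+(norm (g x))^2)"
 proof (intro AE_I2)
  fix x
  have "2*(norm (f x) * norm (g x)) \<le> (norm (f x))^2+(norm (g x))^2" using sum_squares_bound[of "norm (f x)" "norm (g x)"] by (simp add: mult_ac)
  moreover have "norm (f x) * norm (g x) \<ge> 0" by simp
  ultimately have "norm (f x) * norm (g x) \<le> (norm (f x))^2+(norm (g x))^2" by linarith
  then show "norm (norm (f x) * norm (g x)) \<le> norm ((norm (f x))^2+(norm (g x))^2)" by simp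
 qed
qed

lemma L2_norm_nonneg [simp]: "L2_norm f \<ge> 0" unfolding L2_norm_def by (intro real_sqrt_ge_zero L_integral_nonneg) auto

lemma L2_norm_squared: "(L2_norm f)^2 = (LBINT x. (norm (f x))^2)" unfolding L2_norm_def by (intro real_sqrt_pow2 L_integral_nonneg) auto

text \<open>The quadratic inequality in \<open>c\<close> holds for every real \<open>c\<close>;
  choosing \<open>c\<close> well makes it sharp, with separate choices when one of the norms is
  zero.\<close>

lemma L2_Cauchy_Schwarz:
 fixes f :: "real => 'a::{banach, second_countable_topology}" and g :: "real => 'b::{banach, second_countable_topology}"
 assumes "square_integrable f" "square_integrable g"
 shows "(LBINT x. norm (f x) * norm (g x)) \<le> L2_norm f * L2_norm g"
proof -
 define I where "I = (LBINT x. norm (f x) * norm (g x))"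
 have I: "integrable lborel (\<lambda>x. norm (f x) * norm (g x))" by (rule square_integrable_norm_mult[OF assms])
 have I0: "I \<ge> 0" unfolding I_def by (intro L_integral_nonneg) auto
 have *: "2*c*I \<le> c^2*(L2_norm f)^2+(L2_norm g)^2" for c
 proof -
  have "2*c*I = (LBINT x. 2*c*(norm (f x) * norm (g x)))" by (simp add: I_def)
  also have "... \<le> (LBINT x. c^2*(norm (f x))^2+(norm (g x))^2)"
  proof (rule integral_mono)
   show "2*c*(norm (f x) * norm (g x)) \<le> c^2*(norm (f x))^2+(norm (g x))^2" for x
    using sum_squares_bound[of "c * norm (f x)" "norm (g x)"] by (simp add: power_mult_distrib mult_ac)
  qed (use I assms in \<open>auto simp: square_integrable_def\<close>)
  also have "... = c^2*(L2_norm f)^2+(L2_norm g)^2" unfolding L2_norm_squared using assms by (subst L_integral_add) (auto simp: square_integrable_def)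
  finally show ?thesis .
 qed
 show ?thesis
 proof (cases "L2_norm f = 0")
  case True
  have "I \<le> 0"
  proof (rule ccontr)
   assume "\<not> I \<le> 0"
   \<comment> \<open>For this \<open>c\<close> the left side of the quadratic inequality exceeds the
     right by 1.\<close>
   then have "2*(((L2_norm g)^2+1)/(2*I))*I = (L2_norm g)^2+1" by simp
   with *[of "((L2_norm g)^2+1)/(2*I)"] True show False by simp
  qed
  then show ?thesis using True by (simp add: I_def)
 next
  case False
  then have p: "L2_norm f > 0" using L2_norm_nonneg[of f] by linarith
  have "2*(L2_norm g / L2_norm f)*I \<le> 2*(L2_norm g)^2" using *[of "L2_norm g / L2_norm f"] p by (simp add: power_divide)
  then have **: "L2_norm g * I \<le> L2_norm g * (L2_norm f * L2_norm g)" using p by (simp add: field_simps power2_eq_square)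
  show ?thesis
  proof (cases "L2_norm g = 0")
   case True
   have "I \<le> 0"
   proof (rule ccontr)
    assume "\<not> I \<le> 0"
    then have "I > 0" by simp
    define c where "c = I/(L2_norm f)^2"
    have "2*c*I \<le> c*I" using *[of c] True p by (simp add: c_def power2_eq_square)
    moreover have "c*I > 0" using \<open>I > 0\<close> p by (simp add: c_def)
    ultimately show False by linarith
   qed
   then show ?thesis using True by (simp add: I_def)
  next
   case False
   then have "L2_norm g > 0" using L2_norm_nonneg[of g] by linarith
   with ** show ?thesis by (simp add: I_def)
  qed
 qed
qed

lemma L2_triangle:
 fixes f g :: "real => 'a::{banach, second_countable_topology}"
 assumes "square_integrable f" "square_integrable g"
 shows "square_integrable (\<lambda>x. f x + g x)" "L2_norm (\<lambda>x. f x + g x) \<le> L2_norm f + L2_norm g"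
proof -
 have [measurable]: "meas f" "meas g" using assms by (auto simp: square_integrable_def)
 let ?h = "\<lambda>x. (norm (f x))^2+2*(norm (f x) * norm (g x))+(norm (g x))^2"
 have h: "integrable lborel ?h" using assms square_integrable_norm_mult[OF assms] by (auto simp: square_integrable_def)
 have le: "(norm (f x + g x))^2 \<le> ?h x" for x
 proof -
  have "(norm (f x + g x))^2 \<le> (norm (f x) + norm (g x))^2" by (intro power_mono norm_triangle_ineq) auto
  then show ?thesis by (simp add: power2_sum algebra_simps)
 qed
 show sq: "square_integrable (\<lambda>x. f x + g x)" unfolding square_integrable_def
 proof
  show "integrable lborel (\<lambda>x. (norm (f x + g x))^2)" by (rule L_integrable_bound[OF h]) (auto intro!: order_trans[OF le] simp: abs_le_iff)
 qed measurable
 have "(L2_norm (\<lambda>x. f x + g x))^2 \<le> (LBINT x. ?h x)"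
  unfolding L2_norm_squared using sq h le by (intro integral_mono) (auto simp: square_integrable_def)
 also have "... = (L2_norm f)^2+2*(LBINT x. norm (f x) * norm (g x))+(L2_norm g)^2"
  unfolding L2_norm_squared using assms square_integrable_norm_mult[OF assms] by (simp add: square_integrable_def)
 also have "... \<le> (L2_norm f + L2_norm g)^2" using L2_Cauchy_Schwarz[OF assms] by (simp add: power2_sum)
 finally show "L2_norm (\<lambda>x. f x + g x) \<le> L2_norm f + L2_norm g" by (rule power2_le_imp_le) simp
qed

lemma L2_norm_mono:
 fixes f :: "real => 'a::{banach, second_countable_topology}" and g :: "real => 'b::{banach, second_countable_topology}"
 assumes "square_integrable g" "meas f" "!!x. norm (f x) \<le> norm (g x)"
 shows "square_integrable f" "L2_norm f \<le> L2_norm g"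
proof -
 have le: "(norm (f x))^2 \<le> (norm (g x))^2" for x using assms(3) by (intro power_mono) auto
 show sq: "square_integrable f" unfolding square_integrable_def
 proof
  show "integrable lborel (\<lambda>x. (norm (f x))^2)"
  proof (rule L_integrable_bound)
   show "integrable lborel (\<lambda>x. (norm (g x))^2)" using assms(1) by (simp add: square_integrable_def)
   show "AE x in lborel. norm ((norm (f x))^2) \<le> norm ((norm (g x))^2)" using le by (intro AE_I2) simp
  qed (use assms(2) in measurable)
 qed (use assms(2) in simp)
 show "L2_norm f \<le> L2_norm g"
  unfolding L2_norm_def using sq assms(1) le by (intro real_sqrt_le_mono integral_mono) (auto simp: square_integrable_def)
qed

lemma L2_norm_cmult: "L2_norm (\<lambda>x. c * f x :: complex) = norm c * L2_norm f"
 unfolding L2_norm_def by (simp add: norm_mult power_mult_distrib real_sqrt_mult)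

lemma edec_square_integrable: assumes "edec f" shows "square_integrable f"
proof -
 have "integrable lborel (\<lambda>x. f x * cnj (f x))" by (rule inn_integrable[OF assms assms])
 then have "integrable lborel (\<lambda>x. norm (f x * cnj (f x)))" by (rule integrable_norm)
 then show ?thesis using assms by (simp add: square_integrable_def norm_mult power2_eq_square expd_def)
qed

lemma inn_self: assumes "edec f" shows "inn f f = of_real ((L2_norm f)^2)" unfolding inn_def L2_norm_squared
 by (subst integral_complex_of_real[symmetric]) (simp add: complex_norm_square flip: of_real_power)

section \<open>Weighted norms of convolutions\<close>

text \<open>Complex-valued, so that the lemmas on decay and convolution apply to absolute
  values.\<close>

definition absf :: "cfun => cfun" where
 "absf f x = of_real (norm (f x))"
definition wabs :: "cfun => cfun" where
 "wabs f x = of_real ((1+\<bar>x\<bar>) * norm (f x))"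
text \<open>Equivalent to the H^1 norm in physical space. One weight 1 + |\<xi>| is enough to
  dominate the integral of |f| and to make convolution bounded.\<close>

definition wnorm :: "cfun => real" where
 "wnorm f = L2_norm (wabs f)"
definition norm1 :: "cfun => real" where
 "norm1 f = (LBINT x. norm (f x))"

lemma edec_absf: "edec f ==> edec (absf f)" unfolding absf_def[abs_def] expd_def by (auto intro!: borel_measurable_of_real)
lemma wabs_eq: "wabs f = (\<lambda>x. absf f x + absf (mulx f) x)" by (simp add: fun_eq_iff wabs_def absf_def mulx_def norm_mult algebra_simps)
lemma edec_wabs: "edec f ==> edec (wabs f)" unfolding wabs_eq by (intro edec_intros edec_absf)
lemma norm1_nonneg [simp]: "norm1 f \<ge> 0" unfolding norm1_def by (intro L_integral_nonneg) auto
lemma wnorm_nonneg [simp]: "wnorm f \<ge> 0" by (simp add: wnorm_def)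

lemma integral_conv:
 assumes "edec f" "edec g"
 shows "(LBINT x. conv f g x) = (LBINT x. f x)*(LBINT x. g x)"
proof -
 obtain C \<sigma> where *: "C > 0" "\<sigma> > 0"
  "!!x. norm (f x) \<le> C * decay \<sigma> x" "!!x. norm (g x) \<le> C * decay \<sigma> x" using edec_common[OF assms] by blast
 have [measurable]: "meas f" "meas g" using assms by (auto simp: expd_def)
 have int: "integrable lborel2 (\<lambda>z. f (snd z - fst z) * g (fst z))"
 proof (rule integrable_pair_exp[of "\<lambda>y x. f (x-y) * g y" "\<sigma>/2" "C*C"])
  show "norm (f (x-y) * g y) \<le> C*C * decay (\<sigma>/2) y * decay (\<sigma>/2) x" for x y
   using conv_dom[OF *(3,4,2,1), of x y] by (simp add: mult_ac)
 qed (use * in auto)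
 have "(LBINT x. conv f g x) = (LBINT y. LBINT x. f (x-y) * g y)" unfolding conv_def by (rule lborel_fubini[OF int])
 also have "... = (LBINT y. (LBINT x. f x) * g y)"
 proof (intro L_integral_cong refl)
  fix y
  have "(LBINT x. f (x-y)) = (LBINT x. f x)" by (subst (2) lborel_integral_real_affine[of 1 _ "- y"]) auto
  then show "(LBINT x. f (x-y) * g y) = (LBINT x. f x) * g y" by simp
 qed
 finally show ?thesis by simp
qed

lemma norm_conv_le: assumes "edec f" "edec g"
 shows "norm (conv f g x) \<le> norm (conv (absf f) (absf g) x)" "conv (absf f) (absf g) x = of_real (LBINT y. norm (f (x-y)) * norm (g y))"
proof -
 show eq: "conv (absf f) (absf g) x = of_real (LBINT y. norm (f (x-y)) * norm (g y))"
  unfolding conv_def absf_def by (simp flip: integral_complex_of_real)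
 have "norm (conv f g x) \<le> (LBINT y. norm (f (x-y) * g y))" unfolding conv_def by (rule integral_norm_bound)
 also have "... = norm (conv (absf f) (absf g) x)"
  unfolding eq by (subst norm_of_real, subst abs_of_nonneg) (auto intro!: L_integral_nonneg simp: norm_mult)
 finally show "norm (conv f g x) \<le> norm (conv (absf f) (absf g) x)" .
qed

lemma edec_sqrt:
 assumes "edec f" shows "square_integrable (\<lambda>y. sqrt (norm (f (x-y))))"
proof -
 have "edec (\<lambda>y. f (x-y))" using expd_shift[of "{0}" "\<lambda>_. f"] assms by simp
 then have i: "integrable lborel (\<lambda>y. f (x-y))" and [measurable]: "meas (\<lambda>y. f (x-y))" by (rule edec_integrable, simp add: expd_def)
 show ?thesis unfolding square_integrable_def
 proof
  show "integrable lborel (\<lambda>y. (norm (sqrt (norm (f (x-y)))))^2)" using integrable_norm[OF i] by simp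
 qed measurable
qed

text \<open>Cauchy-Schwarz with |a| split into two square roots bounds the square of the convolution
  by \<open>norm1 a\<close> times the convolution of |a| with |f|^2; it remains to
  integrate.\<close>

lemma L2_Young:
 assumes "edec a" "edec f"
 shows "L2_norm (conv a f) \<le> norm1 a * L2_norm f"
proof -
 have [measurable]: "meas a" "meas f" using assms by (auto simp: expd_def)
 define F :: "real => complex" where "F x = of_real ((norm (f x))^2)" for x
 have F: "edec F"
 proof -
  have "F = (\<lambda>x. f x * cnj (f x))" by (simp add: F_def fun_eq_iff complex_norm_square flip: of_real_power)
  then show ?thesis by (auto intro!: expd_mult edec_cnj assms)
 qed
 have A: "edec (absf a)" by (rule edec_absf[OF assms(1)])
 have pw: "(norm (conv a f x))^2 \<le> norm1 a * Re (conv (absf a) F x)" for x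
 proof -
  have sh: "edec (\<lambda>y. a (x-y))" using expd_shift[of "{0}" "\<lambda>_. a"] assms by simp
  let ?u = "\<lambda>y. sqrt (norm (a (x-y)))" and ?v = "\<lambda>y. sqrt (norm (a (x-y))) * norm (f y)"
  have v2: "(norm (?v y))^2 = norm (a (x-y) * F y)" for y by (simp add: F_def norm_mult power_mult_distrib norm_power)
  have "integrable lborel (\<lambda>y. norm (a (x-y) * F y))" by (intro integrable_norm conv_integrable assms F)
  then have v: "square_integrable ?v" unfolding square_integrable_def v2 by auto
  have u: "square_integrable ?u" by (rule edec_sqrt[OF assms(1)])
  have "norm (conv a f x) \<le> (LBINT y. norm (a (x-y) * f y))" unfolding conv_def by (rule integral_norm_bound)
  also have "... = (LBINT y. norm (?u y) * norm (?v y))"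
   by (intro L_integral_cong) (auto simp: norm_mult abs_mult simp flip: power2_eq_square mult.assoc)
  also have "... \<le> L2_norm ?u * L2_norm ?v" by (rule L2_Cauchy_Schwarz[OF u v])
  finally have "(norm (conv a f x))^2 \<le> (L2_norm ?u * L2_norm ?v)^2" by (intro power_mono) auto
  also have "... = (L2_norm ?u)^2*(L2_norm ?v)^2" by (simp add: power_mult_distrib)
  also have "(L2_norm ?u)^2 = norm1 a" unfolding L2_norm_squared norm1_def by (subst (2) lborel_integral_real_affine[of "-1" _ x]) auto
  also have "(L2_norm ?v)^2 = Re (conv (absf a) F x)" unfolding L2_norm_squared v2 conv_def absf_def F_def
   by (simp add: norm_mult power2_eq_square integral_complex_of_real flip: of_real_mult)
  finally show ?thesis .
 qed
 have "(L2_norm (conv a f))^2 \<le> (LBINT x. norm1 a * Re (conv (absf a) F x))" unfolding L2_norm_squared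
  using edec_square_integrable[OF edec_conv[OF assms]] edec_integrable[OF edec_conv[OF A F]] pw
  by (intro integral_mono) (auto simp: square_integrable_def intro!: integrable_mult_right integrable_Re)
 also have "... = norm1 a * Re (LBINT x. conv (absf a) F x)" using edec_integrable[OF edec_conv[OF A F]] by (simp add: integral_Re)
 also have "(LBINT x. conv (absf a) F x) = of_real (norm1 a * (L2_norm f)^2)"
  unfolding integral_conv[OF A F] unfolding absf_def F_def norm1_def L2_norm_squared integral_complex_of_real by simp
 finally have "(L2_norm (conv a f))^2 \<le> (norm1 a * L2_norm f)^2" by (simp add: power2_eq_square mult_ac)
 then show ?thesis by (rule power2_le_imp_le) (simp)
qed

lemma integrable_inverse_1_plus_square': "integrable lborel (\<lambda>x::real. 1/(1+x^2))"
 and integral_inverse_1_plus_square': "(LBINT x. 1/(1+x^2)) = pi"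
proof -
 show "integrable lborel (\<lambda>x::real. 1/(1+x^2))" using integrable_inverse_1_plus_square by (simp add: set_integrable_def inverse_eq_divide)
 show "(LBINT x. 1/(1+x^2)) = pi" using LBINT_inverse_1_plus_square
  by (simp add: interval_lebesgue_integral_def set_lebesgue_integral_def inverse_eq_divide)
qed

text \<open>Cauchy-Schwarz against 1 / (\<kappa>^2 + x^2), whose integral is \<pi> / \<kappa>. The
  scale \<kappa> stays free because \<open>norm1_le_lax\<close> needs it large.\<close>

lemma norm1_le:
 assumes "edec f" "\<kappa> > 0"
 shows "(norm1 f)^2 \<le> pi*(\<kappa>*(L2_norm f)^2+(L2_norm (mulx f))^2/\<kappa>)"
proof -
 have [measurable]: "meas f" using assms by (auto simp: expd_def)
 let ?u = "\<lambda>x. 1 / sqrt (\<kappa>^2+x^2)" and ?v = "\<lambda>x. sqrt (\<kappa>^2+x^2) * norm (f x)"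
 have pos: "\<kappa>^2+x^2 > 0" for x using assms(2) by (intro add_pos_nonneg) auto
 have u2: "(norm (?u x))^2 = 1/\<kappa>^2*(1/(1+(1/\<kappa>*x)^2))" for x using pos[of x] assms(2) by (simp add: power_divide field_simps)
 have v2: "(norm (?v x))^2 = \<kappa>^2*(norm (f x))^2+(norm (mulx f x))^2" for x
  using pos[of x] by (simp add: power_mult_distrib mulx_def norm_mult algebra_simps)
 have iu: "integrable lborel (\<lambda>x. 1/(1+(1/\<kappa>*x)^2))"
  using lborel_integrable_real_affine[OF integrable_inverse_1_plus_square', of "1/\<kappa>" 0] assms(2) by simp
 have vv: "integrable lborel (\<lambda>x. (norm (f x))^2)" "integrable lborel (\<lambda>x. (norm (mulx f x))^2)"
  using edec_square_integrable[OF assms(1)] edec_square_integrable[OF edec_mulx[OF assms(1)]] by (auto simp: square_integrable_def)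
 have u: "square_integrable ?u" unfolding square_integrable_def u2 using integrable_mult_right[OF iu, of "1/\<kappa>^2"] by simp
 have v: "square_integrable ?v" unfolding square_integrable_def v2 using vv by auto
 have "norm1 f = (LBINT x. norm (?u x) * norm (?v x))" unfolding norm1_def
 proof (intro L_integral_cong refl)
  fix x show "norm (f x) = norm (?u x) * norm (?v x)" using pos[of x] assms(2) by (simp add: abs_mult)
 qed
 also have "... \<le> L2_norm ?u * L2_norm ?v" by (rule L2_Cauchy_Schwarz[OF u v])
 finally have "(norm1 f)^2 \<le> (L2_norm ?u * L2_norm ?v)^2" by (intro power_mono) auto
 also have "... = (L2_norm ?u)^2*(L2_norm ?v)^2" by (simp add: power_mult_distrib)
 also have "(L2_norm ?v)^2 = \<kappa>^2*(L2_norm f)^2+(L2_norm (mulx f))^2" unfolding L2_norm_squared v2 using vv by simp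
 also have "(L2_norm ?u)^2 = 1/\<kappa>^2*(\<kappa>*pi)"
 proof -
  have "pi = \<bar>1/\<kappa>\<bar> *\<^sub>R (LBINT x. 1/(1+(0+1/\<kappa>*x)^2))"
   unfolding integral_inverse_1_plus_square'[symmetric] by (rule lborel_integral_real_affine) (use assms in auto)
  then have "(LBINT x. 1/(1+(1/\<kappa>*x)^2)) = \<kappa>*pi" using assms(2) by (simp add: field_simps)
  then show ?thesis unfolding L2_norm_squared u2 integral_mult_right_zero by simp
 qed
 also have "1/\<kappa>^2*(\<kappa>*pi)*(\<kappa>^2*(L2_norm f)^2+(L2_norm (mulx f))^2) = pi*(\<kappa>*(L2_norm f)^2+(L2_norm (mulx f))^2/\<kappa>)"
  using assms(2) by (simp add: field_simps power2_eq_square)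
 finally show ?thesis .
qed

lemma L2_le_wnorm: "edec f ==> L2_norm f \<le> wnorm f"
 and L2_mulx_le_wnorm: "edec f ==> L2_norm (mulx f) \<le> wnorm f" unfolding wnorm_def
proof -
 assume f: "edec f"
 have [measurable]: "meas f" "meas (mulx f)" using f edec_mulx[OF f] by (auto simp: expd_def)
 show "L2_norm f \<le> L2_norm (wabs f)" by (rule L2_norm_mono[OF edec_square_integrable[OF edec_wabs[OF f]]])
   (auto simp: wabs_def norm_mult mult_le_cancel_right1 simp flip: of_real_mult)
 show "L2_norm (mulx f) \<le> L2_norm (wabs f)" by (rule L2_norm_mono[OF edec_square_integrable[OF edec_wabs[OF f]]])
   (auto simp: wabs_def mulx_def norm_mult mult_right_mono simp flip: of_real_mult)
qed

lemma wnorm_le: assumes "edec f" shows "wnorm f \<le> L2_norm f + L2_norm (mulx f)"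
proof -
 have a: "square_integrable (absf f)" "square_integrable (absf (mulx f))" by (intro edec_square_integrable edec_absf edec_mulx assms)+
 have "wnorm f \<le> L2_norm (absf f) + L2_norm (absf (mulx f))" unfolding wnorm_def wabs_eq by (rule L2_triangle[OF a])
 then show ?thesis by (simp add: L2_norm_def absf_def)
qed

lemma norm1_le_wnorm: assumes "edec f" shows "norm1 f \<le> 3 * wnorm f"
proof -
 have "(norm1 f)^2 \<le> pi*(1*(L2_norm f)^2+(L2_norm (mulx f))^2/1)" by (rule norm1_le[OF assms]) simp
 \<comment> \<open>Since \<pi> < 4, the square is at most 8 times that of \<open>wnorm f\<close>,
   which is below 3^2 = 9.\<close>
 also have "... \<le> 4*((wnorm f)^2+(wnorm f)^2)" using L2_le_wnorm[OF assms] L2_mulx_le_wnorm[OF assms] pi_less_4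
  by (intro mult_mono add_mono) (auto intro!: power_mono)
 also have "... \<le> (3 * wnorm f)^2" by (simp add: power_mult_distrib)
 finally show ?thesis by (rule power2_le_imp_le) simp
qed

lemma wnorm_add: assumes "edec f" "edec g" shows "wnorm (\<lambda>x. f x + g x) \<le> wnorm f + wnorm g"
proof -
 have "wnorm (\<lambda>x. f x + g x) \<le> L2_norm (\<lambda>x. wabs f x + wabs g x)" unfolding wnorm_def
 proof (rule L2_norm_mono(2))
  show "square_integrable (\<lambda>x. wabs f x + wabs g x)" by (intro edec_square_integrable edec_intros edec_wabs assms)
  show "meas (wabs (\<lambda>x. f x + g x))" using edec_wabs[OF expd_add[OF assms]] by (simp add: expd_def)
  fix x
  have "norm (wabs (\<lambda>x. f x + g x) x) = (1+\<bar>x\<bar>) * norm (f x + g x)" by (simp add: wabs_def norm_mult flip: of_real_add)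
  also have "... \<le> (1+\<bar>x\<bar>)*(norm (f x) + norm (g x))" by (intro mult_left_mono norm_triangle_ineq) auto
  also have "... = norm (wabs f x + wabs g x)" unfolding wabs_def of_real_add[symmetric] norm_of_real by (simp add: algebra_simps)
  finally show "norm (wabs (\<lambda>x. f x + g x) x) \<le> norm (wabs f x + wabs g x)" .
 qed
 also have "... \<le> wnorm f + wnorm g" unfolding wnorm_def by (intro L2_triangle edec_square_integrable edec_wabs assms)
 finally show ?thesis .
qed

lemma wnorm_mono:
 assumes "edec g" "meas f" "!!x. norm (f x) \<le> norm (g x)" shows "wnorm f \<le> wnorm g" unfolding wnorm_def
proof (rule L2_norm_mono(2)[OF edec_square_integrable[OF edec_wabs[OF assms(1)]]])
 show "meas (wabs f)" using assms(2) unfolding wabs_def[abs_def] by measurable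
 show "norm (wabs f x) \<le> norm (wabs g x)" for x
  using assms(3)[of x] by (simp add: wabs_def norm_mult mult_left_mono del: of_real_mult flip: of_real_mult)
qed

text \<open>The weight splits as 1 + |x| \<le> (1 + |x - y|) + (1 + |y|). Each weighted factor
  enters \<open>L2_Young\<close> against \<open>norm1\<close> of the other, which is at most 3 times
  its \<open>wnorm\<close>; hence 3 + 3.\<close>

lemma wnorm_conv:
 assumes "edec f" "edec g" shows "wnorm (conv f g) \<le> 6 * wnorm f * wnorm g"
proof -
 note [simp] = edec_absf[OF assms(1)] edec_absf[OF assms(2)] edec_wabs[OF assms(1)] edec_wabs[OF assms(2)] assms
 let ?h = "\<lambda>x. conv (absf g) (wabs f) x + conv (absf f) (wabs g) x"
 have n1: "norm1 (absf f) = norm1 f" for f by (simp add: norm1_def absf_def)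
 have "wnorm (conv f g) \<le> L2_norm ?h" unfolding wnorm_def
 proof (rule L2_norm_mono(2))
  show "square_integrable ?h" by (intro edec_square_integrable edec_intros) simp_all
  show "meas (wabs (conv f g))" using edec_wabs[OF edec_conv[OF assms]] by (simp add: expd_def)
  fix x
  have i: "integrable lborel (\<lambda>y. norm (f (x-y)) * norm (g y))" using integrable_norm[OF conv_integrable[OF assms]] by (simp add: norm_mult)
  have i1: "integrable lborel (\<lambda>y. ((1+\<bar>x-y\<bar>) * norm (f (x-y))) * norm (g y))"
   using integrable_norm[OF conv_integrable[of "wabs f" "absf g" x]] by (simp add: norm_mult wabs_def absf_def abs_mult del: of_real_mult)
  have i2: "integrable lborel (\<lambda>y. norm (f (x-y)) * ((1+\<bar>y\<bar>) * norm (g y)))"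
   using integrable_norm[OF conv_integrable[of "absf f" "wabs g" x]] by (simp add: norm_mult wabs_def absf_def abs_mult del: of_real_mult)
  have "norm (wabs (conv f g) x) = (1+\<bar>x\<bar>) * norm (conv f g x)" by (simp add: wabs_def del: of_real_mult)
  also have "... \<le> (1+\<bar>x\<bar>)*(LBINT y. norm (f (x-y)) * norm (g y))" using norm_conv_le[OF assms, of x] by (intro mult_left_mono) auto
  also have "... = (LBINT y. (1+\<bar>x\<bar>)*(norm (f (x-y)) * norm (g y)))" by simp
  also have "... \<le> (LBINT y. ((1+\<bar>x-y\<bar>) * norm (f (x-y))) * norm (g y) + norm (f (x-y)) * ((1+\<bar>y\<bar>) * norm (g y)))"
  proof (intro integral_mono L_integrable_add i1 i2 integrable_mult_right i)
   fix y
   have "(1+\<bar>x\<bar>)*(norm (f (x-y)) * norm (g y)) \<le> ((1+\<bar>x-y\<bar>)+(1+\<bar>y\<bar>))*(norm (f (x-y)) * norm (g y))"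
    by (intro mult_right_mono) auto
   then show "(1+\<bar>x\<bar>)*(norm (f (x-y)) * norm (g y)) \<le> ((1+\<bar>x-y\<bar>) * norm (f (x-y))) * norm (g y) + norm (f (x-y)) * ((1+\<bar>y\<bar>) * norm (g y))"
    by (simp add: algebra_simps)
  qed
  also have "... = (LBINT y. ((1+\<bar>x-y\<bar>) * norm (f (x-y))) * norm (g y))+(LBINT y. norm (f (x-y)) * ((1+\<bar>y\<bar>) * norm (g y)))"
   by (rule L_integral_add[OF i1 i2])
  also have "... = norm (?h x)"
  proof -
   have "?h x = of_real ((LBINT y. ((1+\<bar>x-y\<bar>) * norm (f (x-y))) * norm (g y))+(LBINT y. norm (f (x-y)) * ((1+\<bar>y\<bar>) * norm (g y))))"
    unfolding conv_commute[of "absf g"] unfolding conv_def wabs_def absf_def of_real_mult[symmetric] integral_complex_of_real by simp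
   then show ?thesis by (simp only: norm_of_real) (subst abs_of_nonneg, auto intro!: add_nonneg_nonneg L_integral_nonneg)
  qed
  finally show "norm (wabs (conv f g) x) \<le> norm (?h x)" .
 qed
 also have "... \<le> L2_norm (conv (absf g) (wabs f)) + L2_norm (conv (absf f) (wabs g))"
  by (intro L2_triangle edec_square_integrable edec_conv) simp_all
 also have "... \<le> norm1 g * wnorm f + norm1 f * wnorm g"
  using L2_Young[of "absf g" "wabs f"] L2_Young[of "absf f" "wabs g"] by (simp add: wnorm_def n1)
 also have "... \<le> (3 * wnorm g) * wnorm f + (3 * wnorm f) * wnorm g" by (intro add_mono mult_right_mono norm1_le_wnorm) simp_all
 finally show ?thesis by (simp add: algebra_simps)
qed

lemma norm_conv_le_L2: assumes "edec f" "edec g" shows "norm (conv f g x) \<le> L2_norm f * L2_norm g"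
proof -
 have sh: "edec (\<lambda>y. f (x-y))" using expd_shift[of "{0}" "\<lambda>_. f"] assms by simp
 have "norm (conv f g x) \<le> (LBINT y. norm (f (x-y) * g y))" unfolding conv_def by (rule integral_norm_bound)
 also have "... \<le> L2_norm (\<lambda>y. f (x-y)) * L2_norm g" unfolding norm_mult by (intro L2_Cauchy_Schwarz edec_square_integrable assms sh)
 also have "L2_norm (\<lambda>y. f (x-y)) = L2_norm f" unfolding L2_norm_def by (subst (2) lborel_integral_real_affine[of "-1" _ x]) auto
 finally show ?thesis .
qed

section \<open>Factorial majorants\<close>

text \<open>Pascal's rule, arranged as the induction step of a Leibniz formula. It serves both the
  powers of \<open>mulx\<close> and the derivatives in \<open>leibniz_jet\<close>.\<close>

lemma binomial_sum_step:
 fixes F :: "nat => nat => 'a::comm_semiring_1"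
 shows "(\<Sum>i\<le>n. of_nat (n choose i) * (F (Suc i) (n-i) + F i (Suc (n-i)))) =
  (\<Sum>i\<le>Suc n. of_nat (Suc n choose i) * F i (Suc n - i))"
proof -
 have "(\<Sum>i\<le>Suc n. of_nat (Suc n choose i) * F i (Suc n - i)) =
  F 0 (Suc n) + (\<Sum>i\<le>n. of_nat (n choose i) * F (Suc i) (n-i) + of_nat (n choose Suc i) * F (Suc i) (n-i))"
  by (subst sum.atMost_Suc_shift) (simp add: algebra_simps)
 also have "... = (\<Sum>i\<le>n. of_nat (n choose i) * F (Suc i) (n-i)) +
  (F 0 (Suc n) + (\<Sum>i\<le>n. of_nat (n choose Suc i) * F (Suc i) (n-i)))" by (simp add: sum.distrib algebra_simps)
 also have "F 0 (Suc n) + (\<Sum>i\<le>n. of_nat (n choose Suc i) * F (Suc i) (n-i)) = (\<Sum>i\<le>Suc n. of_nat (n choose i) * F i (Suc n - i))"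
  by (subst sum.atMost_Suc_shift) simp
 also have "... = (\<Sum>i\<le>n. of_nat (n choose i) * F i (Suc (n-i)))" by (simp add: Suc_diff_le binomial_eq_0)
 finally show ?thesis by (simp add: sum.distrib algebra_simps)
qed

text \<open>The hockey-stick identity for binomial coefficients, multiplied by
  \<open>fact k\<close>.\<close>

lemma sum_fact_quotient: "(\<Sum>m\<le>j. fact (m+k) / fact m :: real) = fact (j+k+1) / (fact j * (real k + 1))"
proof (induction j)
 case 0 then show ?case by (simp add: field_simps)
next
 case (Suc j)
 have "(\<Sum>m\<le>Suc j. fact (m+k) / fact m :: real) = fact (j+k+1) / (fact j * (real k + 1)) + fact (j+k+1) / fact (Suc j)" using Suc by simp
 also have "... = fact (j+k+1) * (real j + real k + 2)/(fact (Suc j) * (real k + 1))" by (simp add: divide_simps) (simp add: algebra_simps)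
 also have "fact (j+k+1) * (real j + real k + 2) = fact (Suc j + k+1)" by (simp add: algebra_simps)
 finally show ?case .
qed

lemma sum_binomial_fact:
 "(\<Sum>i\<le>j. real (j choose i) * fact i * fact (j-i+k)) = fact (j+k+1) / (real k + 1)"
proof -
 have "(\<Sum>i\<le>j. real (j choose i) * fact i * fact (j-i+k)) = (\<Sum>i\<le>j. fact j * (fact (j-i+k) / fact (j-i)))"
  by (intro sum.cong) (auto simp: binomial_fact)
 also have "... = fact j * (\<Sum>i\<le>j. fact (j-i+k) / fact (j-i))" by (simp only: sum_distrib_left)
 also have "(\<Sum>i\<le>j. fact (j-i+k) / fact (j-i) :: real) = (\<Sum>i\<le>j. fact (i+k) / fact i)"
  by (rule sum.reindex_bij_witness[of _ "\<lambda>i. j-i" "\<lambda>i. j-i"]) auto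
 finally show ?thesis unfolding sum_fact_quotient by simp
qed

text \<open>A binomial convolution of factorials costs no more than the next factorial. This lets
  the majorants absorb the quadratic term.\<close>

lemma sum_binomial_fact_le:
 "(\<Sum>i\<le>j. real (j choose i) * fact i * fact (j-i+k)) \<le> fact (j+k+1)"
 unfolding sum_binomial_fact by (subst pos_divide_le_eq) (auto simp: mult_le_cancel_left1 simp del: fact_Suc)

text \<open>Meant for a j k = norm of \<xi>^j L^k h: \<open>rec\<close> trades a factor \<xi> for an
  L plus a convolution. In the induction step both terms carry the same factorial, so it closes as
  soon as X \<ge> R + c B. The bound on \<open>b\<close> is conditional because for h = p the
  sequence \<open>b\<close> is the column k = 0 itself.\<close>

lemma majorant_rows:
 fixes a :: "nat => nat => real" and b :: "nat => real"
 assumes rec: "!!j k. a (Suc j) k \<le> a j (Suc k) + c*(\<Sum>i\<le>j. real (j choose i) * b i * a (j-i) k)"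
  and base: "!!k. a 0 k \<le> K*R^k * fact k"
  and b: "!!j. (!!i. i \<le> j ==> a i 0 \<le> K*X^i * fact i) ==> b j \<le> B*X^j * fact j"
  and nn: "!!j k. a j k \<ge> 0" "!!j. b j \<ge> 0" "c \<ge> 0" "K \<ge> 0" "R > 0" "B \<ge> 0" "X \<ge> R+c*B"
 shows "a j k \<le> K*R^k*X^j * fact (j+k)"
proof (induction j arbitrary: k rule: less_induct)
 case (less j)
 have "0 < R+c*B" using nn by (intro add_pos_nonneg mult_nonneg_nonneg) auto
 then have X: "X > 0" "X \<ge> 0" using nn(7) by linarith+
 show ?case
 proof (cases j)
  case 0 then show ?thesis using base[of k] by simp
 next
  case (Suc n)
  have IH: "a i k \<le> K*R^k*X^i * fact (i+k)" if "i \<le> n" for i k using less that Suc by simp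
  have b': "b i \<le> B*X^i * fact i" if "i \<le> n" for i using IH[where k = 0] that by (intro b) auto
  have "(\<Sum>i\<le>n. real (n choose i) * b i * a (n-i) k) \<le>
   (\<Sum>i\<le>n. real (n choose i) * (B*X^i * fact i)*(K*R^k*X^(n-i)*fact (n-i+k)))"
   by (intro sum_mono mult_mono mult_nonneg_nonneg b' IH) (use nn X in auto)
  also have "... = B*K*R^k*X^n*(\<Sum>i\<le>n. real (n choose i) * fact i * fact (n-i+k))" unfolding sum_distrib_left
  proof (intro sum.cong refl)
   fix i assume "i \<in> {..n}"
   then have "X^n = X^i*X^(n-i)" by (simp flip: power_add)
   then show "real (n choose i) * (B*X^i * fact i)*(K*R^k*X^(n-i)*fact (n-i+k)) =
    B*K*R^k*X^n*(real (n choose i) * fact i * fact (n-i+k))" by simp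
  qed
  also have "... \<le> B*K*R^k*X^n*fact (n+k+1)" using nn X by (intro mult_left_mono sum_binomial_fact_le) auto
  finally have "a (Suc n) k \<le> K*R ^ Suc k * X^n*fact (n + Suc k) + c*(B*K*R^k*X^n*fact (n+k+1))"
   using nn by (intro order_trans[OF rec] add_mono IH mult_left_mono) auto
  also have "... = (K*R^k*X^n * fact (Suc n + k))*(R+c*B)" by (simp add: algebra_simps)
  also have "... \<le> (K*R^k*X^n * fact (Suc n + k))*X" using nn X by (intro mult_left_mono) auto
  finally show ?thesis by (simp add: Suc mult_ac)
 qed
qed

text \<open>The reverse trade: the moments are known and the powers of L are sought.\<close>

lemma majorant_columns:
 fixes a :: "nat => nat => real" and b :: "nat => real"
 assumes rec: "!!j k. a j (Suc k) \<le> a (Suc j) k + c*(\<Sum>i\<le>j. real (j choose i) * b i * a (j-i) k)"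
  and base: "!!j. a j 0 \<le> K*R^j * fact j"
  and b: "!!j. b j \<le> B*R^j * fact j"
  and nn: "!!j k. a j k \<ge> 0" "!!j. b j \<ge> 0" "c \<ge> 0" "K \<ge> 0" "R > 0" "B \<ge> 0" "X \<ge> R+c*B"
 shows "a j k \<le> K*R^j*X^k * fact (j+k)"
proof (induction k arbitrary: j)
 case 0 then show ?case using base[of j] by simp
next
 case (Suc k)
 have "0 < R+c*B" using nn by (intro add_pos_nonneg mult_nonneg_nonneg) auto
 then have X: "X > 0" "X \<ge> 0" using nn(7) by linarith+
 have "(\<Sum>i\<le>j. real (j choose i) * b i * a (j-i) k) \<le>
  (\<Sum>i\<le>j. real (j choose i) * (B*R^i * fact i)*(K*R^(j-i)*X^k * fact (j-i+k)))"
  by (intro sum_mono mult_mono mult_nonneg_nonneg b Suc) (use nn X in auto)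
 also have "... = B*K*R^j*X^k*(\<Sum>i\<le>j. real (j choose i) * fact i * fact (j-i+k))" unfolding sum_distrib_left
 proof (intro sum.cong refl)
  fix i assume "i \<in> {..j}"
  then have "R^j = R^i*R^(j-i)" by (simp flip: power_add)
  then show "real (j choose i) * (B*R^i * fact i)*(K*R^(j-i)*X^k * fact (j-i+k)) =
   B*K*R^j*X^k*(real (j choose i) * fact i * fact (j-i+k))" by simp
 qed
 also have "... \<le> B*K*R^j*X^k * fact (j+k+1)" using nn X by (intro mult_left_mono sum_binomial_fact_le) auto
 finally have "a j (Suc k) \<le> K*R ^ Suc j * X^k * fact (Suc j + k) + c*(B*K*R^j*X^k * fact (j+k+1))"
  using nn by (intro order_trans[OF rec] add_mono Suc mult_left_mono) auto
 also have "... = (K*R^j*X^k * fact (j + Suc k))*(R+c*B)" by (simp add: algebra_simps)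
 also have "... \<le> (K*R^j*X^k * fact (j + Suc k))*X" using nn X by (intro mult_left_mono) auto
 finally show ?case by (simp add: mult_ac)
qed

section \<open>Moments\<close>

lemma mulx_funpow: "(mulx ^^ j) f x = of_real x^j * f x" by (induction j arbitrary: x) (auto simp: mulx_def)

lemma edec_mulx_funpow: "edec f ==> edec ((mulx ^^ j) f)" by (induction j) (auto intro: edec_mulx)

lemma mulx_funpow_conv:
 assumes "edec f" "edec g"
 shows "(mulx ^^ j) (conv f g) x = (\<Sum>i\<le>j. of_nat (j choose i) * conv ((mulx ^^ i) f) ((mulx ^^ (j-i)) g) x)"
proof (induction j arbitrary: x)
 case (Suc j)
 have e: "edec ((mulx ^^ i) f)" "edec ((mulx ^^ i) g)" for i using assms by (auto intro: edec_mulx_funpow)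
 have "(mulx ^^ Suc j) (conv f g) x = of_real x * (\<Sum>i\<le>j. of_nat (j choose i) * conv ((mulx ^^ i) f) ((mulx ^^ (j-i)) g) x)"
  using Suc by (simp add: mulx_def[of _ x])
 also have "... = (\<Sum>i\<le>j. of_nat (j choose i) * mulx (conv ((mulx ^^ i) f) ((mulx ^^ (j-i)) g)) x)"
  by (simp add: sum_distrib_left mulx_def mult_ac)
 also have "... = (\<Sum>i\<le>j. of_nat (j choose i) * (conv ((mulx ^^ Suc i) f) ((mulx ^^ (j-i)) g) x
   + conv ((mulx ^^ i) f) ((mulx ^^ Suc (j-i)) g) x))" by (simp add: mulx_conv e)
 also have "... = (\<Sum>i\<le>Suc j. of_nat (Suc j choose i) * conv ((mulx ^^ i) f) ((mulx ^^ (Suc j - i)) g) x)" by (rule binomial_sum_step)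
 finally show ?case .
qed simp

lemma wnorm_cmult: "wnorm (\<lambda>x. c * f x) = norm c * wnorm f"
proof -
 have "wabs (\<lambda>x. c * f x) = (\<lambda>x. of_real (norm c) * wabs f x)" by (simp add: wabs_def fun_eq_iff norm_mult mult_ac)
 then show ?thesis by (simp add: wnorm_def L2_norm_cmult)
qed

lemma edec_zero: "edec (\<lambda>x. 0)" using hcD(4)[OF hc_zero, of 0 "{0}"] by simp

lemma edec_sum: "(!!i. i \<in> A ==> edec (f i)) ==> edec (\<lambda>x. \<Sum>i\<in>A. f i x)"
 by (induction A rule: infinite_finite_induct) (auto intro: edec_zero expd_add)

lemma wnorm_sum: "(!!i. i \<in> A ==> edec (f i)) ==> wnorm (\<lambda>x. \<Sum>i\<in>A. f i x) \<le> (\<Sum>i\<in>A. wnorm (f i))"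
proof (induction A rule: infinite_finite_induct)
 case (insert i A)
 then have "wnorm (\<lambda>x. f i x + (\<Sum>i\<in>A. f i x)) \<le> wnorm (f i) + wnorm (\<lambda>x. \<Sum>i\<in>A. f i x)"
  by (intro wnorm_add edec_sum) auto
 with insert show ?case by auto
qed (auto simp: wnorm_def L2_norm_def wabs_def)

lemma wnorm_uminus_arg: "wnorm f = wnorm (\<lambda>x. f (- x))"
 unfolding wnorm_def L2_norm_def by (subst lborel_integral_real_affine[of "-1" _ 0]) (auto simp: wabs_def norm_mult)

lemma norm_crefl_mulx_funpow: "norm ((mulx ^^ i) (crefl p) x) = norm ((mulx ^^ i) p (- x))" by (simp add: mulx_funpow crefl_def norm_mult norm_power)

lemma wnorm_crefl_funpow: "wnorm ((mulx ^^ i) (crefl p)) = wnorm ((mulx ^^ i) p)"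
 by (subst (2) wnorm_uminus_arg) (simp add: wnorm_def L2_norm_def wabs_def norm_mult norm_crefl_mulx_funpow)

lemma wnorm_herm_funpow:
 assumes "edec p" shows "wnorm ((mulx ^^ i) (herm p)) \<le> 2 * wnorm ((mulx ^^ i) p)"
proof -
 have "(mulx ^^ i) (herm p) = (\<lambda>x. (mulx ^^ i) p x + (mulx ^^ i) (crefl p) x)" by (simp add: fun_eq_iff mulx_funpow herm_def algebra_simps)
 then show ?thesis using wnorm_add[OF edec_mulx_funpow[OF assms] edec_mulx_funpow[OF edec_crefl[OF assms]], of i i] by (simp add: wnorm_crefl_funpow)
qed

text \<open>The constant 12 is 6 from \<open>wnorm_conv\<close> times 2 for the two halves of
  \<open>herm p\<close>.\<close>

lemma wnorm_mulx_toep: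
 assumes "edec p" "edec g"
 shows "wnorm ((mulx ^^ j) (toep (herm p) g)) \<le>
  12*(\<Sum>i\<le>j. real (j choose i) * wnorm ((mulx ^^ i) p) * wnorm ((mulx ^^ (j-i)) g))"
proof -
 let ?v = "herm p"
 note e [simp] = assms edec_intros edec_mulx_funpow
 let ?S = "\<lambda>x. \<Sum>i\<le>j. of_nat (j choose i) * conv ((mulx ^^ i) ?v) ((mulx ^^ (j-i)) g) x"
 have "wnorm ((mulx ^^ j) (toep ?v g)) \<le> wnorm ?S"
 proof (rule wnorm_mono)
  show "edec ?S" by (intro edec_sum edec_intros edec_mulx_funpow assms)
  show "meas ((mulx ^^ j) (toep ?v g))" using edec_mulx_funpow[OF edec_toep[OF edec_herm[OF assms(1)] assms(2)], of j] by (simp add: expd_def)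
  show "norm ((mulx ^^ j) (toep ?v g) x) \<le> norm (?S x)" for x unfolding mulx_funpow_conv[OF edec_herm[OF assms(1)] assms(2), symmetric]
   by (simp add: mulx_funpow toep_def pos_def norm_mult)
 qed
 also have "... \<le> (\<Sum>i\<le>j. wnorm (\<lambda>x. of_nat (j choose i) * conv ((mulx ^^ i) ?v) ((mulx ^^ (j-i)) g) x))"
  by (intro wnorm_sum edec_intros edec_mulx_funpow assms)
 also have "... \<le> (\<Sum>i\<le>j. 12*(real (j choose i) * wnorm ((mulx ^^ i) p) * wnorm ((mulx ^^ (j-i)) g)))"
 proof (intro sum_mono)
  fix i
  have "wnorm (conv ((mulx ^^ i) ?v) ((mulx ^^ (j-i)) g)) \<le> 6 * wnorm ((mulx ^^ i) ?v) * wnorm ((mulx ^^ (j-i)) g)" by (rule wnorm_conv) simp_all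
  also have "... \<le> 6*(2 * wnorm ((mulx ^^ i) p)) * wnorm ((mulx ^^ (j-i)) g)" by (intro mult_right_mono mult_left_mono wnorm_herm_funpow) simp_all
  finally have "real (j choose i) * wnorm (conv ((mulx ^^ i) ?v) ((mulx ^^ (j-i)) g)) \<le>
   real (j choose i) * (6*(2 * wnorm ((mulx ^^ i) p)) * wnorm ((mulx ^^ (j-i)) g))" by (rule mult_left_mono) simp
  then show "wnorm (\<lambda>x. of_nat (j choose i) * conv ((mulx ^^ i) ?v) ((mulx ^^ (j-i)) g) x) \<le>
    12*(real (j choose i) * wnorm ((mulx ^^ i) p) * wnorm ((mulx ^^ (j-i)) g))" by (simp add: wnorm_cmult mult_ac)
 qed
 finally show ?thesis by (simp only: sum_distrib_left)
qed

lemma wnorm_uminus: "wnorm (\<lambda>x. - f x) = wnorm f" using wnorm_cmult[of "-1" f] by simp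

text \<open>L g = \<xi> g + T(v) g, read in both directions: the first inequality feeds
  \<open>majorant_columns\<close>, the second \<open>majorant_rows\<close>.\<close>

lemma wnorm_lax_step:
 assumes "edec p" "edec g"
 defines "E \<equiv> \<lambda>j. 12*(\<Sum>i\<le>j. real (j choose i) * wnorm ((mulx ^^ i) p) * wnorm ((mulx ^^ (j-i)) g))"
 shows "wnorm ((mulx ^^ j) (lax_op p g)) \<le> wnorm ((mulx ^^ Suc j) g) + E j"
  "wnorm ((mulx ^^ Suc j) g) \<le> wnorm ((mulx ^^ j) (lax_op p g)) + E j"
proof -
 let ?T = "(mulx ^^ j) (toep (herm p) g)"
 note e [simp] = assms(1,2) edec_intros edec_mulx_funpow
 have 1: "(mulx ^^ j) (lax_op p g) = (\<lambda>x. (mulx ^^ Suc j) g x + ?T x)"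
  unfolding fun_eq_iff mulx_funpow lax_op_def mulx_def by (simp add: algebra_simps)
 show "wnorm ((mulx ^^ j) (lax_op p g)) \<le> wnorm ((mulx ^^ Suc j) g) + E j"
  unfolding 1 using wnorm_add[of "(mulx ^^ Suc j) g" ?T] wnorm_mulx_toep[OF assms(1,2), of j]
  by (simp only: E_def) (use assms in \<open>force intro: edec_intros edec_mulx_funpow\<close>)
 have 2: "(mulx ^^ Suc j) g = (\<lambda>x. (mulx ^^ j) (lax_op p g) x + - ?T x)" unfolding 1 by simp
 have "wnorm ((mulx ^^ Suc j) g) \<le> wnorm ((mulx ^^ j) (lax_op p g)) + wnorm (\<lambda>x. - ?T x)"
  by (subst 2, rule wnorm_add) (intro edec_intros edec_mulx_funpow assms)+
 then show "wnorm ((mulx ^^ Suc j) g) \<le> wnorm ((mulx ^^ j) (lax_op p g)) + E j"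
  using wnorm_mulx_toep[OF assms(1,2), of j] unfolding wnorm_uminus E_def by linarith
qed

lemma power_div_fact_le_exp: assumes "(y::real) \<ge> 0" shows "y^n / fact n \<le> exp y"
proof -
 have s: "(\<lambda>n. y^n /\<^sub>R fact n) sums exp y" by (rule exp_converges)
 have "sum (\<lambda>n. y^n /\<^sub>R fact n) {n} \<le> suminf (\<lambda>n. y^n /\<^sub>R fact n)"
  by (rule sum_le_suminf[OF sums_summable[OF s]]) (use assms in auto)
 then show ?thesis using sums_unique[OF s] by (simp add: divide_inverse mult.commute)
qed

text \<open>Sum the moment bounds with weights 1 / ((2 Z)^j j!): the left side becomes an
  exponential, the right side a geometric series with sum 2 K.\<close>

lemma moment_exp_bound:
 assumes "y \<ge> 0" "Z > 0" "!!j. \<bar>x\<bar>^j*y \<le> K*Z^j * fact j"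
 shows "y \<le> 2*K * exp (- (1/(2*Z))*\<bar>x::real\<bar>)"
proof -
 define u where "u = \<bar>x\<bar>/(2*Z)"
 have s1: "(\<lambda>n. (u^n /\<^sub>R fact n)*y) sums (exp u * y)" by (intro sums_mult2 exp_converges)
 have s2: "(\<lambda>n. K*(1/2)^n) sums (K*(1/(1-1/2)))" by (intro sums_mult geometric_sums) auto
 have s3: "(u^n /\<^sub>R fact n)*y \<le> K*(1/2)^n" for n
 proof -
  have "(u^n /\<^sub>R fact n)*y = (\<bar>x\<bar>^n*y)/((2*Z)^n * fact n)" by (simp add: u_def power_divide field_simps)
  also have "... \<le> (K*Z^n * fact n)/((2*Z)^n * fact n)" using assms by (intro divide_right_mono) auto
  also have "... = K*(1/2)^n" using assms(2) by (simp add: power_mult_distrib power_divide)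
  finally show ?thesis .
 qed
 have "exp u * y \<le> K*(1/(1-1/2))" by (rule sums_le[OF s3 s1 s2])
 then have "exp (- u) * (exp u * y) \<le> exp (- u) * (2*K)" by (intro mult_left_mono) auto
 then show ?thesis by (simp add: u_def mult_ac flip: exp_add mult.assoc)
qed

lemma edec_moments:
 assumes "edec f" obtains K R where "K > 0" "R > 0"
  "!!j. wnorm ((mulx ^^ j) f) \<le> K*R^j * fact j" "!!j x. \<bar>x\<bar>^j * norm (f x) \<le> K*R^j * fact j"
proof -
 obtain C \<sigma> where *: "C > 0" "\<sigma> > 0" "!!x. norm (f x) \<le> C * decay \<sigma> x" using edecE[OF assms] by blast
 define g :: "real => complex" where "g x = of_real (decay (\<sigma>/2) x)" for x
 have g: "edec g" by (rule expdI[of _ _ "\<sigma>/2" 1]) (use * in \<open>auto simp: g_def[abs_def]\<close>)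
 have pw: "norm ((mulx ^^ j) f x) \<le> C*(2/\<sigma>)^j * fact j * norm (g x)" for j x
 proof -
  have "(\<sigma>/2*\<bar>x\<bar>)^j / fact j \<le> exp (\<sigma>/2*\<bar>x\<bar>)" using * by (intro power_div_fact_le_exp) auto
  then have "\<bar>x\<bar>^j \<le> (2/\<sigma>)^j * fact j * exp (\<sigma>/2*\<bar>x\<bar>)"
   using *(2) by (simp add: power_mult_distrib power_divide field_simps)
  then have "\<bar>x\<bar>^j * norm (f x) \<le> ((2/\<sigma>)^j * fact j * exp (\<sigma>/2*\<bar>x\<bar>))*(C * decay \<sigma> x)"
   using * by (intro mult_mono) auto
  also have "... = C*(2/\<sigma>)^j * fact j * (exp (\<sigma>/2*\<bar>x\<bar>) * decay \<sigma> x)" by simp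
  also have "exp (\<sigma>/2*\<bar>x\<bar>) * decay \<sigma> x = norm (g x)" by (simp add: g_def mult_exp_exp)
  finally show ?thesis by (simp add: mulx_funpow norm_mult norm_power)
 qed
 show ?thesis
 \<comment> \<open>One constant for both bounds: \<open>wnorm g\<close> for the norms, and 1 for the
   pointwise bound, since |g| \<le> 1.\<close>
 proof (rule that[of "C*(1 + wnorm g)" "2/\<sigma>"])
  show "wnorm ((mulx ^^ j) f) \<le> C*(1 + wnorm g)*(2/\<sigma>)^j * fact j" for j
  proof -
   have "wnorm ((mulx ^^ j) f) \<le> wnorm (\<lambda>x. of_real (C*(2/\<sigma>)^j * fact j) * g x)"
   proof (rule wnorm_mono)
    show "meas ((mulx ^^ j) f)" using edec_mulx_funpow[OF assms, of j] by (simp add: expd_def)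
    show "norm ((mulx ^^ j) f x) \<le> norm (of_real (C*(2/\<sigma>)^j * fact j) * g x)" for x
     unfolding norm_mult norm_of_real using pw[of j x] * by (simp add: abs_mult)
   qed (intro edec_intros g)
   also have "... = C*(2/\<sigma>)^j * fact j * wnorm g" unfolding wnorm_cmult norm_of_real using * by (simp add: abs_mult)
   also have "... \<le> C*(2/\<sigma>)^j * fact j * (1 + wnorm g)" using * by (intro mult_left_mono) auto
   finally show ?thesis by (simp add: mult_ac)
  qed
  show "\<bar>x\<bar>^j * norm (f x) \<le> C*(1 + wnorm g)*(2/\<sigma>)^j * fact j" for j x
  proof -
   have "\<bar>x\<bar>^j * norm (f x) \<le> C*(2/\<sigma>)^j * fact j * norm (g x)" using pw[of j x] by (simp add: mulx_funpow norm_mult norm_power)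
   also have "... \<le> C*(2/\<sigma>)^j * fact j * (1 + wnorm g)"
   proof (intro mult_left_mono)
    have "norm (g x) \<le> 1" using * by (simp add: g_def)
    then show "norm (g x) \<le> 1 + wnorm g" using wnorm_nonneg[of g] by linarith
   qed (use * in auto)
   finally show ?thesis by (simp add: mult_ac)
  qed
 qed (use * in \<open>auto intro!: mult_pos_pos add_pos_nonneg\<close>)
qed

lemma edec_lax_funpow: "edec p ==> edec h ==> edec ((lax_op p ^^ k) h)" by (induction k) (auto intro: edec_lax_op)
text \<open>Used at time 0, where the decay of \<open>p\<close> and \<open>h\<close> bounds their
  moments and \<open>majorant_columns\<close> passes to the powers of L.\<close>

lemma lax_funpow_initial_bound:
 assumes "edec p" "edec h" obtains K R where "K > 0" "R > 0" "!!k. wnorm ((lax_op p ^^ k) h) \<le> K*R^k * fact k"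
proof -
 obtain K1 R1 where 1: "K1 > 0" "R1 > 0" "!!j. wnorm ((mulx ^^ j) p) \<le> K1*R1^j * fact j" using edec_moments[OF assms(1)] by metis
 obtain K2 R2 where 2: "K2 > 0" "R2 > 0" "!!j. wnorm ((mulx ^^ j) h) \<le> K2*R2^j * fact j" using edec_moments[OF assms(2)] by metis
 define R where "R = max R1 R2"
 have R: "R > 0" "R1 \<le> R" "R2 \<le> R" using 1 2 by (auto simp: R_def)
 have "wnorm ((mulx ^^ j) ((lax_op p ^^ k) h)) \<le> K2*R^j*(R+12*K1)^k * fact (j+k)" for j k
 proof (rule majorant_columns[where b = "\<lambda>i. wnorm ((mulx ^^ i) p)" and c = 12 and B = K1])
  show "wnorm ((mulx ^^ j) ((lax_op p ^^ Suc k) h)) \<le> wnorm ((mulx ^^ Suc j) ((lax_op p ^^ k) h)) +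
   12*(\<Sum>i\<le>j. real (j choose i) * wnorm ((mulx ^^ i) p) * wnorm ((mulx ^^ (j-i)) ((lax_op p ^^ k) h)))" for j k
   using wnorm_lax_step(1)[OF assms(1) edec_lax_funpow[OF assms], of j k] by simp
  show "wnorm ((mulx ^^ j) ((lax_op p ^^ 0) h)) \<le> K2*R^j * fact j" for j
   using 2 R by (simp, intro order_trans[OF 2(3)] mult_right_mono mult_left_mono power_mono) auto
  show "wnorm ((mulx ^^ j) p) \<le> K1*R^j * fact j" for j using 1 R by (intro order_trans[OF 1(3)] mult_right_mono mult_left_mono power_mono) auto
 qed (use 1 2 R in auto)
 from this[of 0] show ?thesis using 1 2 R by (intro that[of K2 "R+12*K1"]) auto
qed

section \<open>From conserved norms to exponential decay\<close>

lemma norm1_herm: assumes "edec p" shows "norm1 (herm p) \<le> 2 * norm1 p"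
proof -
 have i: "integrable lborel (\<lambda>x. norm (p x))" using edec_integrable[OF assms] by simp
 have i': "integrable lborel (\<lambda>x. norm (p (- x)))" using lborel_integrable_real_affine[OF i, of "-1" 0] by simp
 have "norm1 (herm p) \<le> (LBINT x. norm (p x) + norm (p (- x)))" unfolding norm1_def
 proof (rule integral_mono)
  show "integrable lborel (\<lambda>x. norm (herm p x))" using edec_integrable[OF edec_herm[OF assms]] by simp
  show "norm (herm p x) \<le> norm (p x) + norm (p (- x))" for x using norm_triangle_ineq[of "p x" "crefl p x"] by (simp add: herm_def crefl_def)
 qed (intro L_integrable_add i i')
 also have "... = norm1 p + (LBINT x. norm (p (- x)))" using i i' by (simp add: norm1_def)
 also have "(LBINT x. norm (p (- x))) = norm1 p" unfolding norm1_def by (subst (2) lborel_integral_real_affine[of "-1" _ 0]) auto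
 finally show ?thesis by simp
qed

lemma L2_toep: assumes "edec a" "edec g" shows "L2_norm (toep a g) \<le> norm1 a * L2_norm g"
proof -
 have "L2_norm (toep a g) \<le> L2_norm (conv a g)"
  using edec_toep[OF assms] by (intro L2_norm_mono(2) edec_square_integrable edec_conv assms) (auto simp: expd_def toep_def pos_def)
 also have "... \<le> norm1 a * L2_norm g" by (rule L2_Young[OF assms])
 finally show ?thesis .
qed

lemma L2_mulx_le_lax:
 assumes "edec p" "edec g"
 shows "L2_norm (mulx g) \<le> L2_norm (lax_op p g) + 2 * norm1 p * L2_norm g"
proof -
 let ?T = "toep (herm p) g"
 have eq: "mulx g = (\<lambda>x. lax_op p g x + - ?T x)" by (simp add: fun_eq_iff lax_op_def)
 have "L2_norm (mulx g) \<le> L2_norm (lax_op p g) + L2_norm (\<lambda>x. - ?T x)"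
  by (subst eq, rule L2_triangle(2)) (intro edec_square_integrable edec_intros assms)+
 also have "L2_norm (\<lambda>x. - ?T x) = L2_norm ?T" by (simp add: L2_norm_def)
 also have "... \<le> norm1 (herm p) * L2_norm g" by (intro L2_toep edec_intros assms)
 also have "... \<le> 2 * norm1 p * L2_norm g" by (intro mult_right_mono norm1_herm assms) auto
 finally show ?thesis by simp
qed

text \<open>Bounds the integral of |p| by two conserved quantities. It makes multiplication by \<xi>
  and L comparable with constants independent of time.\<close>

lemma norm1_le_lax:
 assumes "edec p"
 shows "(norm1 p)^2 \<le> 2*pi*((16*pi*(L2_norm p)^2+1)*(L2_norm p)^2+2*(L2_norm (lax_op p p))^2)"
proof -
 \<comment> \<open>Inserting \<open>L2_mulx_le_lax\<close> brings back m^2 with the factor 8 \<pi>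
   P^2 / \<kappa>. This \<kappa> makes the factor at most 1/2, so the term is absorbed on the
   left.\<close>
 define P Q m \<kappa> where "P = L2_norm p" and "Q = L2_norm (lax_op p p)" and "m = norm1 p" and "\<kappa> = 16*pi*P^2+1"
 have k: "\<kappa> \<ge> 1" "\<kappa> > 0" using pi_gt_zero by (auto simp: \<kappa>_def add_nonneg_pos)
 have nn: "P \<ge> 0" "Q \<ge> 0" "m \<ge> 0" by (auto simp: P_def Q_def m_def)
 have "m^2 \<le> pi*(\<kappa>*P^2+(L2_norm (mulx p))^2/\<kappa>)" unfolding m_def P_def by (rule norm1_le[OF assms k(2)])
 also have "(L2_norm (mulx p))^2 \<le> (Q+2*m*P)^2" using L2_mulx_le_lax[OF assms assms] by (intro power_mono) (auto simp: P_def Q_def m_def)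
 also have "... \<le> 2*Q^2+8*m^2*P^2" using sum_squares_bound[of Q "2*m*P"] by (simp add: power2_sum power_mult_distrib mult_ac)
 finally have "m^2 \<le> pi*(\<kappa>*P^2+(2*Q^2+8*m^2*P^2)/\<kappa>)" using k by (simp add: divide_right_mono)
 also have "... = pi*(\<kappa>*P^2)+pi*(2*Q^2)/\<kappa>+m^2*(8*pi*P^2/\<kappa>)" by (simp add: add_divide_distrib algebra_simps)
 also have "... \<le> pi*(\<kappa>*P^2)+pi*(2*Q^2)+m^2*(1/2)"
 proof (intro add_mono mult_left_mono)
  show "pi*(2*Q^2)/\<kappa> \<le> pi*(2*Q^2)" using divide_left_mono[of 1 \<kappa> "pi*(2*Q^2)"] k by simp
  show "8*pi*P^2/\<kappa> \<le> 1/2" using k by (simp add: divide_le_eq \<kappa>_def)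
 qed (use k in auto)
 finally have "m^2 \<le> 2*(pi*(\<kappa>*P^2)+pi*(2*Q^2))" by simp
 then show ?thesis by (simp add: m_def P_def Q_def \<kappa>_def algebra_simps)
qed

lemma flow_lax_funpow:
 assumes "convex I" "flow I p p" "flow I p h" shows "flow I p (\<lambda>t. (lax_op (p t) ^^ k) (h t))"
 by (induction k) (auto simp: assms intro: flow_lax_op[OF assms(1,2)])

lemma flow_L2_const:
 assumes I: "convex I" and p: "flow I p p" and h: "flow I p h" and "s \<in> I" "t \<in> I"
 shows "L2_norm (h s) = L2_norm (h t)"
proof -
 have "(L2_norm (h s))^2 = (L2_norm (h t))^2"
  using flow_norm_const[OF assms] inn_self[OF flowD(3)[OF h assms(4)]] inn_self[OF flowD(3)[OF h assms(5)]]
  by (simp flip: of_real_eq_iff[where 'a = complex])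
 then show ?thesis by (simp add: power2_eq_iff_nonneg)
qed

text \<open>The L2 norms of L^k h are conserved. The weight in \<open>wnorm\<close> amounts to one
  more L, up to a term with \<open>M\<close>, the time-independent bound on the integral of
  |p|.\<close>

lemma flow_base_bound:
 assumes p: "edec p0" and K: "!!k. wnorm ((lax_op p0 ^^ k) h0) \<le> K*R^k * fact k" "K > 0" "R > 0" and h0: "edec h0"
  and M: "M = sqrt (2*pi*((16*pi*(L2_norm p0)^2+1)*(L2_norm p0)^2+2*(L2_norm (lax_op p0 p0))^2))"
  and I: "convex I" "0 \<in> I" "t \<in> I" and fl: "flow I p p" "flow I p h" "p 0 = p0" "h 0 = h0"
 shows "wnorm ((lax_op (p t) ^^ k) (h t)) \<le> (K*(1+2*M+R))*(2*R)^k * fact k"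
proof -
 let ?g = "\<lambda>k. (lax_op (p t) ^^ k) (h t)"
 have ep: "edec (p t)" "edec (h t)" using flowD(3) fl I by auto
 have M0: "M \<ge> 0" unfolding M by (intro real_sqrt_ge_zero mult_nonneg_nonneg add_nonneg_nonneg) auto
 have L: "L2_norm (?g k) \<le> K*R^k * fact k" for k
 proof -
  have "L2_norm (?g k) = L2_norm ((lax_op p0 ^^ k) h0)" using flow_L2_const[OF I(1) fl(1) flow_lax_funpow[OF I(1) fl(1,2)] I(3,2), of k] fl by simp
  also have "... \<le> wnorm ((lax_op p0 ^^ k) h0)" by (intro L2_le_wnorm edec_lax_funpow p h0)
  finally show ?thesis using K(1)[of k] by linarith
 qed
 have m: "norm1 (p t) \<le> M"
 proof -
  have "L2_norm (p t) = L2_norm p0" using flow_L2_const[OF I(1) fl(1,1) I(3,2)] fl by simp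
  moreover have "L2_norm (lax_op (p t) (p t)) = L2_norm (lax_op p0 p0)"
   using flow_L2_const[OF I(1) fl(1) flow_lax_op[OF I(1) fl(1,1)] I(3,2)] fl by simp
  ultimately have "(norm1 (p t))^2 \<le> 2*pi*((16*pi*(L2_norm p0)^2+1)*(L2_norm p0)^2+2*(L2_norm (lax_op p0 p0))^2)"
   using norm1_le_lax[OF ep(1)] by simp
  then show ?thesis unfolding M by (rule real_le_rsqrt)
 qed
 have "wnorm (?g k) \<le> L2_norm (?g k) + L2_norm (mulx (?g k))" by (intro wnorm_le edec_lax_funpow ep)
 also have "L2_norm (mulx (?g k)) \<le> L2_norm (lax_op (p t) (?g k)) + 2 * norm1 (p t) * L2_norm (?g k)" by (intro L2_mulx_le_lax edec_lax_funpow ep)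
 also have "L2_norm (lax_op (p t) (?g k)) \<le> K*R ^ Suc k * fact (Suc k)" using L[of "Suc k"] by simp
 also have "2 * norm1 (p t) * L2_norm (?g k) \<le> 2*M*(K*R^k * fact k)" using m M0 by (intro mult_mono L) auto
 also have "L2_norm (?g k) \<le> K*R^k * fact k" by (rule L)
 finally have "wnorm (?g k) \<le> K*R^k * fact k * (1+R * real (Suc k) + 2*M)" by (simp add: algebra_simps)
 also have "... \<le> K*R^k * fact k * ((1+2*M+R)*2^k)"
 proof (intro mult_left_mono)
  \<comment> \<open>The factor k + 1 from \<open>fact (Suc k)\<close> is hidden in 2^k, which turns
    the rate R into 2 R.\<close>
  have k: "real (Suc k) \<le> 2^k" by (induction k) auto
  have "1+2*M \<le> (1+2*M)*2^k" using M0 by (simp add: mult_le_cancel_left1)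
  moreover have "R * real (Suc k) \<le> R*2^k" using K(3) k by (intro mult_left_mono) auto
  ultimately show "1+R * real (Suc k) + 2*M \<le> (1+2*M+R)*2^k" by (simp add: algebra_simps)
 qed (use K in auto)
 finally show ?thesis by (simp add: power_mult_distrib mult_ac)
qed

lemma flow_moments:
 assumes p0: "edec p0" and h0: "edec h0"
 obtains K X where "K > 0" "X > 0"
  "!!s p h t j. flow {0..s} p p ==> flow {0..s} p h ==> p 0 = p0 ==> h 0 = h0 ==> t \<in> {0..s} ==>
   wnorm ((mulx ^^ j) (p t)) \<le> K*X^j * fact j \<and> wnorm ((mulx ^^ j) (h t)) \<le> K*X^j * fact j"
proof -
 obtain K1 R1 where 1: "K1 > 0" "R1 > 0" "!!k. wnorm ((lax_op p0 ^^ k) p0) \<le> K1*R1^k * fact k" using lax_funpow_initial_bound[OF p0 p0] by metis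
 obtain K2 R2 where 2: "K2 > 0" "R2 > 0" "!!k. wnorm ((lax_op p0 ^^ k) h0) \<le> K2*R2^k * fact k" using lax_funpow_initial_bound[OF p0 h0] by metis
 define M where "M = sqrt (2*pi*((16*pi*(L2_norm p0)^2+1)*(L2_norm p0)^2+2*(L2_norm (lax_op p0 p0))^2))"
 have M0: "M \<ge> 0" unfolding M_def by (intro real_sqrt_ge_zero mult_nonneg_nonneg add_nonneg_nonneg) auto
 define A1 A2 where "A1 = K1*(1+2*M+R1)" and "A2 = K2*(1+2*M+R2)"
 have A: "A1 > 0" "A2 > 0" unfolding A1_def A2_def using 1 2 M0 by (auto intro!: mult_pos_pos add_pos_nonneg)
 define X1 where "X1 = 2*R1+12*A1"
 define X where "X = max X1 (2*R2+12*A1)"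
 have X: "X1 > 0" "X1 \<le> X" "X > 0" "2*R2+12*A1 \<le> X" using 1 A by (auto simp: X1_def X_def)
 show ?thesis
 proof (rule that[of "max A1 A2" X])
  fix s p h t j
  assume fl: "flow {0..s} p p" "flow {0..s} p h" "p 0 = p0" "h 0 = h0" and t: "t \<in> {0..s}"
  have I: "convex {0..s}" "0 \<in> {0..s}" using t by auto
  have ep: "edec (p t)" "edec (h t)" using flowD(3) fl t by auto
  \<comment> \<open>First h = p: the sequence \<open>b\<close> is then the column k = 0, and its
    conditional bound is a tautology.\<close>
  have P: "wnorm ((mulx ^^ j) ((lax_op (p t) ^^ k) (p t))) \<le> A1*(2*R1)^k*X1^j * fact (j+k)" for j k
  proof (rule majorant_rows[where b = "\<lambda>i. wnorm ((mulx ^^ i) (p t))" and c = 12 and B = A1])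
   show "wnorm ((mulx ^^ Suc j) ((lax_op (p t) ^^ k) (p t))) \<le> wnorm ((mulx ^^ j) ((lax_op (p t) ^^ Suc k) (p t))) +
    12*(\<Sum>i\<le>j. real (j choose i) * wnorm ((mulx ^^ i) (p t)) * wnorm ((mulx ^^ (j-i)) ((lax_op (p t) ^^ k) (p t))))" for j k
    using wnorm_lax_step(2)[OF ep(1) edec_lax_funpow[OF ep(1,1)], of j k] by simp
   show "wnorm ((mulx ^^ 0) ((lax_op (p t) ^^ k) (p t))) \<le> A1*(2*R1)^k * fact k" for k
    using flow_base_bound[OF p0 1(3,1,2) p0 M_def I t fl(1,1,3,3), of k] by (simp add: A1_def)
   show "wnorm ((mulx ^^ j) (p t)) \<le> A1*X1^j * fact j"
    if "!!i. i \<le> j ==> wnorm ((mulx ^^ i) ((lax_op (p t) ^^ 0) (p t))) \<le> A1*X1^i * fact i" for j using that[of j] by simp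
  qed (use 1 A in \<open>auto simp: X1_def\<close>)
  have P': "wnorm ((mulx ^^ j) (p t)) \<le> A1*X^j * fact j" for j
  proof -
   have "wnorm ((mulx ^^ j) (p t)) \<le> A1*X1^j * fact j" using P[of j 0] by simp
   also have "... \<le> A1*X^j * fact j" using A X by (intro mult_right_mono mult_left_mono power_mono) auto
   finally show ?thesis .
  qed
  \<comment> \<open>The moments of \<open>p\<close> are known by now, so for \<open>h\<close> the
    recursion is linear.\<close>
  have H: "wnorm ((mulx ^^ j) ((lax_op (p t) ^^ k) (h t))) \<le> A2*(2*R2)^k*X^j * fact (j+k)" for j k
  proof (rule majorant_rows[where b = "\<lambda>i. wnorm ((mulx ^^ i) (p t))" and c = 12 and B = A1])
   show "wnorm ((mulx ^^ Suc j) ((lax_op (p t) ^^ k) (h t))) \<le> wnorm ((mulx ^^ j) ((lax_op (p t) ^^ Suc k) (h t))) +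
    12*(\<Sum>i\<le>j. real (j choose i) * wnorm ((mulx ^^ i) (p t)) * wnorm ((mulx ^^ (j-i)) ((lax_op (p t) ^^ k) (h t))))" for j k
    using wnorm_lax_step(2)[OF ep(1) edec_lax_funpow[OF ep(1,2)], of j k] by simp
   show "wnorm ((mulx ^^ 0) ((lax_op (p t) ^^ k) (h t))) \<le> A2*(2*R2)^k * fact k" for k
    using flow_base_bound[OF p0 2(3,1,2) h0 M_def I t fl, of k] by (simp add: A2_def)
  qed (use 2 A X P' in auto)
  have "A1*X^j * fact j \<le> max A1 A2 * X^j * fact j" "A2*X^j * fact j \<le> max A1 A2 * X^j * fact j" using X by (auto intro!: mult_right_mono)
  with P'[of j] H[of j 0] show "wnorm ((mulx ^^ j) (p t)) \<le> max A1 A2 * X^j * fact j \<and> wnorm ((mulx ^^ j) (h t)) \<le> max A1 A2 * X^j * fact j"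
   by simp
 qed (use A X in auto)
qed

text \<open>Cauchy-Schwarz turns L2 moments of the factors into pointwise moments of the
  convolution. The extra factor \<xi> of the nonlinearity only shifts one factorial, and the
  resulting (j + 2)! / 2 is at most 4^j j!.\<close>

lemma conv_moment_bound:
 assumes "edec f" "edec g" "!!j. L2_norm ((mulx ^^ j) f) \<le> A*X^j * fact j" "!!j. L2_norm ((mulx ^^ j) g) \<le> A*X^j * fact j"
  and "A > 0" "X > 0"
 shows "\<bar>x\<bar>^j * norm (conv f (mulx g) x) \<le> A*A*X*(4*X)^j * fact j"
proof -
 note e = assms(1,2) edec_mulx_funpow
 have "\<bar>x\<bar>^j * norm (conv f (mulx g) x) = norm ((mulx ^^ j) (conv f (mulx g)) x)" by (simp add: mulx_funpow norm_mult norm_power)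
 also have "... \<le> (\<Sum>i\<le>j. norm (of_nat (j choose i) * conv ((mulx ^^ i) f) ((mulx ^^ (j-i)) (mulx g)) x))"
  unfolding mulx_funpow_conv[OF assms(1) edec_mulx[OF assms(2)]] by (rule norm_sum)
 also have "... \<le> (\<Sum>i\<le>j. A*A*X ^ Suc j * (real (j choose i) * fact i * fact (j-i+1)))"
 proof (intro sum_mono)
  fix i assume "i \<in> {..j}"
  then have X: "X ^ Suc j = X^i*X ^ Suc (j-i)" by (simp flip: power_add)
  have e2: "(mulx ^^ (j-i)) (mulx g) = (mulx ^^ Suc (j-i)) g" by (simp add: funpow_swap1)
  have "norm (conv ((mulx ^^ i) f) ((mulx ^^ Suc (j-i)) g) x) \<le> L2_norm ((mulx ^^ i) f) * L2_norm ((mulx ^^ Suc (j-i)) g)"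
   by (intro norm_conv_le_L2 edec_mulx_funpow edec_mulx assms)
  also have "L2_norm ((mulx ^^ i) f) * L2_norm ((mulx ^^ Suc (j-i)) g) \<le> (A*X^i * fact i)*(A*X ^ Suc (j-i) * fact (Suc (j-i)))"
   using assms by (intro mult_mono assms) auto
  also have "... = A*A*X ^ Suc j * (fact i * fact (j-i+1))" unfolding X by simp
  finally have "real (j choose i) * norm (conv ((mulx ^^ i) f) ((mulx ^^ (j-i)) (mulx g)) x) \<le>
   real (j choose i) * (A*A*X ^ Suc j * (fact i * fact (j-i+1)))" unfolding e2 by (rule mult_left_mono) simp
  then show "norm (of_nat (j choose i) * conv ((mulx ^^ i) f) ((mulx ^^ (j-i)) (mulx g)) x) \<le>
   A*A*X ^ Suc j * (real (j choose i) * fact i * fact (j-i+1))" by (simp add: norm_mult mult_ac)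
 qed
 also have "... = A*A*X ^ Suc j * (fact (j+1+1) / (real 1 + 1))" unfolding sum_distrib_left[symmetric] sum_binomial_fact ..
 also have "... \<le> A*A*X ^ Suc j * (4^j * fact j)"
 proof (intro mult_left_mono)
  have "(real j + 1)*(real j + 2) \<le> 2*4^j"
  proof (induction j)
   case (Suc j)
   have "(real (Suc j) + 1)*(real (Suc j) + 2) \<le> 4*((real j + 1)*(real j + 2))" by (simp add: algebra_simps)
   with Suc show ?case by simp
  qed simp
  then have "(real j + 1)*(real j + 2) * fact j \<le> 2*4^j * fact j" by (rule mult_right_mono) simp
  then show "fact (j+1+1) / (real 1 + 1) \<le> 4^j*(fact j :: real)" by (simp add: algebra_simps)
 qed (use assms in auto)
 finally show ?thesis by (simp add: power_mult_distrib mult_ac)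
qed

text \<open>The moment bounds are in L2. Pointwise bounds come from integrating the equation in time
  after the oscillation exp (- i t x^2) has been removed, because the remaining terms are
  convolutions. The constants depend on the initial values and \<open>T\<close> only, not on the
  solution or on \<open>s\<close>; the continuation argument rests on that.\<close>

lemma flow_apriori:
 assumes p0: "edec p0" and h0: "edec h0" and T: "T \<ge> 0"
 obtains B \<sigma> where "B > 0" "\<sigma> > 0"
  "!!s p h t x. s \<le> T ==> flow {0..s} p p ==> flow {0..s} p h ==> p 0 = p0 ==> h 0 = h0 ==> t \<in> {0..s} ==>
   norm (h t x) \<le> B * decay \<sigma> x"
proof -
 obtain K X where KX: "K > 0" "X > 0"
  "!!s p h t j. flow {0..s} p p ==> flow {0..s} p h ==> p 0 = p0 ==> h 0 = h0 ==> t \<in> {0..s} ==>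
   wnorm ((mulx ^^ j) (p t)) \<le> K*X^j * fact j \<and> wnorm ((mulx ^^ j) (h t)) \<le> K*X^j * fact j" using flow_moments[OF p0 h0] by metis
 obtain K0 Y where Y: "K0 > 0" "Y > 0" "!!j x. \<bar>x\<bar>^j * norm (h0 x) \<le> K0*Y^j * fact j" using edec_moments[OF h0] by metis
 \<comment> \<open>Twice \<open>K\<close>, so that the bound also covers both halves of
   \<open>herm p\<close>.\<close>
 define A where "A = 2*K"
 define Z where "Z = max Y (4*X)"
 define K' where "K' = K0+T*(4*(A*A*X))"
 have Z: "Z > 0" "Y \<le> Z" "4*X \<le> Z" using Y KX by (auto simp: Z_def)
 have A: "A > 0" using KX by (simp add: A_def)
 have K': "K' > 0" unfolding K'_def using Y KX A T by (intro add_pos_nonneg) auto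
 show ?thesis
 proof (rule that[of "2*K'" "1/(2*Z)"])
  fix s p h t x
  assume s: "s \<le> T" and fl: "flow {0..s} p p" "flow {0..s} p h" "p 0 = p0" "h 0 = h0" and t: "t \<in> {0..s}"
  show "norm (h t x) \<le> 2*K' * exp (- (1/(2*Z))*\<bar>x\<bar>)"
  proof (rule moment_exp_bound[OF _ Z(1)])
   fix j
   define e where "e r = exp (r *\<^sub>R (\<i> * of_real (x^2)))" for r
   have e: "(e hvd \<i> * of_real (x^2) * e r) (at r within S)" for r S unfolding e_def[abs_def]
    by (rule has_vector_derivative_eq_rhs, rule exp_scaleR_has_vector_derivative_right) simp
   have ne: "norm (e r) = 1" for r using norm_exp_i_times[of "r*x^2"] by (simp add: e_def scaleR_conv_of_real mult_ac)
   define r where "r u = - 2*\<i>*(toep (herm (p u)) (mulx (h u)) x + toep (mulx (crefl (p u))) (h u) x)" for u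
   have der: "((\<lambda>u. of_real x^j*(e u * h u x)) hvd of_real x^j*(e u * r u)) (at u within {0..s})"
    if u: "u \<in> {0..s}" for u
   proof -
    have "((\<lambda>u. of_real x^j*(e u * h u x)) hvd
     of_real x^j*(e u * flow_op (p u) (h u) x + \<i> * of_real (x^2) * e u * h u x)) (at u within {0..s})"
     by (intro has_vector_derivative_mult_right has_vector_derivative_mult e flowD(4)[OF fl(2)] u)
    also have "e u * flow_op (p u) (h u) x + \<i> * of_real (x^2) * e u * h u x = e u * r u"
     by (simp add: flow_op_def r_def mulx_def[of _ x] power2_eq_square algebra_simps)
    finally show ?thesis .
   qed
   have b: "norm (of_real x^j*(e u * r u)) \<le> 4*(A*A*X)*(4*X)^j * fact j" if u: "u \<in> {0..s}" for u
   proof -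
    have ep: "edec (p u)" "edec (h u)" using flowD(3) fl u by auto
    have mom: "wnorm ((mulx ^^ j) (p u)) \<le> K*X^j * fact j" "wnorm ((mulx ^^ j) (h u)) \<le> K*X^j * fact j" for j
     using KX(3)[OF fl u, of j] by auto
    have KA: "K*X^j * fact j \<le> A*X^j * fact j" for j unfolding A_def using KX by (intro mult_right_mono) auto
    have 1: "L2_norm ((mulx ^^ j) (h u)) \<le> A*X^j * fact j" for j
     using L2_le_wnorm[OF edec_mulx_funpow[OF ep(2)], of j] mom[of j] KA[of j] by linarith
    have 2: "L2_norm ((mulx ^^ j) (crefl (p u))) \<le> A*X^j * fact j" for j
     using L2_le_wnorm[OF edec_mulx_funpow[OF edec_crefl[OF ep(1)]], of j] mom[of j] KA[of j] by (simp add: wnorm_crefl_funpow)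
    have 3: "L2_norm ((mulx ^^ j) (herm (p u))) \<le> A*X^j * fact j" for j
     using L2_le_wnorm[OF edec_mulx_funpow[OF edec_herm[OF ep(1)]], of j] mom(1)[of j]
      wnorm_herm_funpow[OF ep(1), of j] by (simp add: A_def)
    have c1: "\<bar>x\<bar>^j * norm (conv (herm (p u)) (mulx (h u)) x) \<le> A*A*X*(4*X)^j * fact j"
     by (rule conv_moment_bound[OF edec_herm[OF ep(1)] ep(2) 3 1 A KX(2)])
    have c2: "\<bar>x\<bar>^j * norm (conv (h u) (mulx (crefl (p u))) x) \<le> A*A*X*(4*X)^j * fact j"
     by (rule conv_moment_bound[OF ep(2) edec_crefl[OF ep(1)] 1 2 A KX(2)])
    have pp: "norm (pos f x) \<le> norm (f x)" for f x by (simp add: pos_def)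
    have "norm (of_real x^j*(e u * r u)) = 2*(\<bar>x\<bar>^j * norm (toep (herm (p u)) (mulx (h u)) x + toep (mulx (crefl (p u))) (h u) x))"
     by (simp add: norm_mult ne norm_power r_def)
    also have "... \<le> 2*(\<bar>x\<bar>^j*(norm (conv (herm (p u)) (mulx (h u)) x) + norm (conv (h u) (mulx (crefl (p u))) x)))"
     unfolding toep_def conv_commute[of "h u"] by (intro mult_left_mono order_trans[OF norm_triangle_ineq] add_mono pp) auto
    also have "... \<le> 2*(A*A*X*(4*X)^j * fact j + A*A*X*(4*X)^j * fact j)"
     unfolding distrib_left[of "\<bar>x\<bar>^j"] by (intro mult_left_mono add_mono c1 c2) auto
    finally show ?thesis by (simp add: mult_ac)
   qed
   have t0: "0 \<in> {0..s}" using t by auto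
   have "norm (of_real x^j*(e t * h t x) - of_real x^j*(e 0 * h 0 x)) \<le> (4*(A*A*X)*(4*X)^j * fact j)*\<bar>t-0\<bar>"
    by (rule vector_derivative_bound[OF _ der b t t0]) auto
   also have "... \<le> (4*(A*A*X)*(4*X)^j * fact j)*T" using t s A KX by (intro mult_left_mono) auto
   finally have d: "norm (of_real x^j*(e t * h t x) - of_real x^j*(e 0 * h 0 x)) \<le> T*(4*(A*A*X))*(4*X)^j * fact j" by (simp add: mult_ac)
   have "\<bar>x\<bar>^j * norm (h t x) = norm (of_real x^j*(e t * h t x))" by (simp add: norm_mult ne norm_power)
   also have "... \<le> norm (of_real x^j*(e 0 * h 0 x)) + norm (of_real x^j*(e t * h t x) - of_real x^j*(e 0 * h 0 x))"
    by (metis norm_triangle_sub add.commute)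
   also have "norm (of_real x^j*(e 0 * h 0 x)) = \<bar>x\<bar>^j * norm (h0 x)" by (simp add: norm_mult ne norm_power fl(4))
   also have "... \<le> K0*Y^j * fact j" by (rule Y(3))
   also note d
   also have "K0*Y^j * fact j + T*(4*(A*A*X))*(4*X)^j * fact j \<le> K0*Z^j * fact j + T*(4*(A*A*X))*Z^j * fact j"
    using Y KX A T Z by (intro add_mono mult_right_mono mult_left_mono power_mono) auto
   finally show "\<bar>x\<bar>^j * norm (h t x) \<le> K'*Z^j * fact j" by (simp add: K'_def algebra_simps)
  qed simp
 qed (use K' Z in auto)
qed

section \<open>Local solutions by Picard iteration\<close>

text \<open>For v = p + crefl p the projections of v^2 and of (p + 2 crefl p) p agree, because the
  square of \<open>crefl p\<close> has no positive frequencies. So the quadratic term is a Toeplitz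
  operator with symbol \<open>ext2 p\<close> applied to \<open>p\<close>.\<close>

abbreviation ext2 :: "cfun => cfun" where
 "ext2 f \<equiv> \<lambda>x. f x + crefl (\<lambda>x. 2 * f x) x"

text \<open>\<open>gauss_jet i \<theta>\<close> is the \<open>i\<close>-th derivative of the linear propagator. At \<open>i = 0\<close> the term with
\<open>gauss_jet (i - 1)\<close> carries the factor \<open>0\<close>.\<close>
fun gauss_jet :: "nat => real => cfun" where
 "gauss_jet 0 \<theta> x = exp (- \<i> * of_real (\<theta>*x^2))"
| "gauss_jet (Suc i) \<theta> x = - 2*\<i> * of_real \<theta> * (of_real x * gauss_jet i \<theta> x + of_nat i * gauss_jet (i-1) \<theta> x)"

lemma continuous_on_pair_compose:
 assumes "continuous_on (S \<times> T) (\<lambda>(t, x). F t x)" "continuous_on U f" "continuous_on U g"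
  "!!z. z \<in> U ==> f z \<in> S" "!!z. z \<in> U ==> g z \<in> T"
 shows "continuous_on U (\<lambda>z. F (f z) (g z))"
proof -
 have "continuous_on U (\<lambda>z. (\<lambda>(t, x). F t x) (f z, g z))"
  by (rule continuous_on_compose2[OF assms(1) continuous_on_Pair[OF assms(2,3)]]) (use assms(4,5) in auto)
 then show ?thesis by simp
qed

lemma gauss_jet_has_derivative: "(gauss_jet i \<theta> hvd gauss_jet (Suc i) \<theta> x) (at x within S)"
proof (induction i arbitrary: x rule: less_induct)
 case (less i)
 show ?case
 proof (cases i)
  case 0
  have d: "((\<lambda>x. - \<i> * of_real (\<theta>*x^2)) hvd - \<i> * of_real (\<theta>*(2*x))) (at x within S)"
   by (intro has_vector_derivative_mult_right has_vector_derivative_of_real)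
    (auto intro!: derivative_eq_intros simp flip: has_real_derivative_iff_has_vector_derivative)
  have "(exp \<circ> (\<lambda>x. - \<i> * of_real (\<theta>*x^2)) hvd
   (- \<i> * of_real (\<theta>*(2*x))) * exp (- \<i> * of_real (\<theta>*x^2))) (at x within S)"
   by (rule field_vector_diff_chain_within[OF d]) (rule DERIV_subset[OF DERIV_exp], simp)
  then show ?thesis unfolding 0 by (simp add: o_def mult_ac)
 next
  case (Suc k)
  have k: "(gauss_jet k \<theta> hvd gauss_jet (Suc k) \<theta> x) (at x within S)" using less[of k] Suc by simp
  have k1: "((\<lambda>x. of_nat k * gauss_jet (k-1) \<theta> x) hvd of_nat k * gauss_jet k \<theta> x) (at x within S)"
  proof (cases k)
   case (Suc l)
   then show ?thesis using less[of l] \<open>i = Suc k\<close> by (intro has_vector_derivative_mult_right) auto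
  qed simp
  have k0: "((\<lambda>x. of_real x * gauss_jet k \<theta> x) hvd gauss_jet k \<theta> x + of_real x * gauss_jet (Suc k) \<theta> x) (at x within S)"
   using mulx_has_vector_derivative[OF k] by (simp add: mulx_def[abs_def])
  have "(gauss_jet (Suc k) \<theta> hvd
    - 2*\<i> * of_real \<theta> * ((gauss_jet k \<theta> x + of_real x * gauss_jet (Suc k) \<theta> x) + of_nat k * gauss_jet k \<theta> x)) (at x within S)"
   unfolding gauss_jet.simps(2)[abs_def] by (intro has_vector_derivative_mult_right has_vector_derivative_add k0[unfolded gauss_jet.simps(2)] k1)
  also have "- 2*\<i> * of_real \<theta> * ((gauss_jet k \<theta> x + of_real x * gauss_jet (Suc k) \<theta> x) + of_nat k * gauss_jet k \<theta> x)
   = gauss_jet (Suc (Suc k)) \<theta> x" unfolding gauss_jet.simps(2)[of "Suc k"] by (simp add: algebra_simps del: gauss_jet.simps)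
  finally show ?thesis by (simp only: Suc)
 qed
qed

lemma continuous_on_gauss_jet [continuous_intros]:
 "continuous_on S f ==> continuous_on S g ==> continuous_on S (\<lambda>z. gauss_jet i (f z) (g z))"
proof (induction i rule: less_induct)
 case (less i)
 then show ?case by (cases i) (auto intro!: continuous_intros)
qed

text \<open>Each derivative brings down a factor \<theta> x, or \<theta> \<le> 1 when it falls on an
  earlier x. The growth is therefore in \<theta> x and not in x alone.\<close>

lemma gauss_jet_bound_poly: "\<exists>C\<ge>0. \<forall>\<theta>\<in>{0..1}. \<forall>x\<ge>0. norm (gauss_jet i \<theta> x) \<le> C*(1+\<theta>*x)^i"
proof (induction i rule: less_induct)
 case (less i)
 show ?case
 proof (cases i)
  case 0
  have "norm (exp (- \<i> * of_real (\<theta>*x^2))) = 1" for \<theta> x using norm_exp_i_times[of "- (\<theta>*x^2)"] by simp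
  then show ?thesis unfolding 0 by (intro exI[of _ 1]) (simp only: gauss_jet.simps, simp)
 next
  case (Suc k)
  obtain C1 where C1: "C1 \<ge> 0" "!!\<theta> x. \<theta> \<in> {0..1} ==> x \<ge> 0 ==> norm (gauss_jet k \<theta> x) \<le> C1*(1+\<theta>*x)^k"
   using less[of k] Suc by auto
  obtain C2 where C2: "C2 \<ge> 0" "!!\<theta> x. \<theta> \<in> {0..1} ==> x \<ge> 0 ==> norm (gauss_jet (k-1) \<theta> x) \<le> C2*(1+\<theta>*x)^(k-1)"
  proof -
   have "k-1 < i" using Suc by simp
   from less[OF this] that show ?thesis by blast
  qed
  show ?thesis
  proof (intro exI conjI ballI allI impI)
   show "2*(C1 + real k * C2) \<ge> 0" using C1 C2 by simp
   fix \<theta> x :: real assume t: "\<theta> \<in> {0..1}" "x \<ge> 0"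
   let ?y = "1+\<theta>*x"
   have y: "?y \<ge> 1" "?y \<ge> 0" using t by (auto simp: add_nonneg_nonneg)
   have "norm (gauss_jet i \<theta> x) = 2*(\<theta> * norm (of_real x * gauss_jet k \<theta> x + of_nat k * gauss_jet (k-1) \<theta> x))"
    using t unfolding Suc gauss_jet.simps(2) by (simp add: norm_mult)
   also have "... \<le> 2*(\<theta>*(x * norm (gauss_jet k \<theta> x) + real k * norm (gauss_jet (k-1) \<theta> x)))"
    using t by (intro mult_left_mono order_trans[OF norm_triangle_ineq]) (auto simp: norm_mult)
   also have "... = 2*(\<theta>*x * norm (gauss_jet k \<theta> x) + real k * (\<theta> * norm (gauss_jet (k-1) \<theta> x)))"
    by (simp add: algebra_simps)
   also have "... \<le> 2*(?y*(C1*?y^k) + real k * (1*(C2*?y^(k-1))))" using t y C1 C2 by (intro mult_left_mono add_mono mult_mono) auto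
   also have "... \<le> 2*(C1 + real k * C2)*?y^i"
   proof -
   have "C2*?y^(k-1) \<le> C2*?y^i" unfolding Suc using C2 y by (intro mult_left_mono power_increasing) auto
   then have "2*(?y*(C1*?y^k) + real k * (1*(C2*?y^(k-1)))) \<le> 2*(?y*(C1*?y^k) + real k * (C2*?y^i))" by (simp add: mult_left_mono)
   also have "... = 2*(C1 + real k * C2)*?y^i" unfolding Suc by (simp add: algebra_simps)
   finally show ?thesis .
   qed
   finally show "norm (gauss_jet i \<theta> x) \<le> 2*(C1 + real k * C2)*?y^i" .
  qed
 qed
qed

text \<open>A polynomial in \<theta> x costs at most exp (\<theta> x), that is one unit of
  exponential rate per unit of time. A weight that shrinks faster than that can pay for it.\<close>

lemma gauss_jet_bound: obtains C where "C \<ge> 1" "!!i \<theta> x. i \<le> J ==> \<theta> \<in> {0..1} ==> x \<ge> 0 ==> norm (gauss_jet i \<theta> x) \<le> C * exp (\<theta>*x)"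
proof -
 obtain c where c: "!!i. c i \<ge> 0" "!!i \<theta> x. \<theta> \<in> {0..1} ==> x \<ge> 0 ==> norm (gauss_jet i \<theta> x) \<le> c i * (1+\<theta>*x)^i"
  using gauss_jet_bound_poly by metis
 define C where "C = 1+(\<Sum>i\<le>J. c i * (fact i * exp 1))"
 show ?thesis
 proof (rule that[of C])
  show "C \<ge> 1" unfolding C_def using c(1) by (auto intro!: sum_nonneg mult_nonneg_nonneg)
  fix i and \<theta> x :: real assume *: "i \<le> J" "\<theta> \<in> {0..1}" "x \<ge> 0"
  have "(1+\<theta>*x)^i / fact i \<le> exp (1+\<theta>*x)" using * by (intro power_div_fact_le_exp) auto
  then have "(1+\<theta>*x)^i \<le> fact i * exp 1 * exp (\<theta>*x)" by (simp add: field_simps mult_exp_exp)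
  then have "norm (gauss_jet i \<theta> x) \<le> c i * (fact i * exp 1 * exp (\<theta>*x))"
   using c(1)[of i] by (intro order_trans[OF c(2)] mult_left_mono) (use * in auto)
  also have "... = (c i * (fact i * exp 1)) * exp (\<theta>*x)" by simp
  also have "c i * (fact i * exp 1) \<le> (\<Sum>i\<le>J. c i * (fact i * exp 1))" using * c(1) by (intro member_le_sum[of i]) auto
  also have "... \<le> C" by (simp add: C_def)
  finally show "norm (gauss_jet i \<theta> x) \<le> C * exp (\<theta>*x)" by (simp add: mult_right_mono)
 qed
qed

text \<open>\<open>f k\<close> plays the k-th derivative of \<open>f 0\<close>. Keeping the members
  of the jet as independent data separates the estimates from differentiability.\<close>

definition leibniz_jet :: "nat => real => (nat => real => complex) => real => complex" where
 "leibniz_jet j \<theta> f x = (\<Sum>i\<le>j. of_nat (j choose i) * (gauss_jet i \<theta> x * f (j-i) x))"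

lemma leibniz_jet_has_derivative:
 assumes "!!k. k \<le> j ==> (f k hvd f (Suc k) x) (at x within S)"
 shows "(leibniz_jet j \<theta> f hvd leibniz_jet (Suc j) \<theta> f x) (at x within S)"
proof -
 have "(leibniz_jet j \<theta> f hvd
   (\<Sum>i\<le>j. of_nat (j choose i) * (gauss_jet i \<theta> x * f (Suc (j-i)) x + gauss_jet (Suc i) \<theta> x * f (j-i) x))) (at x within S)"
  unfolding leibniz_jet_def[abs_def]
  by (intro has_vector_derivative_sum has_vector_derivative_mult_right has_vector_derivative_mult gauss_jet_has_derivative assms) auto
 also have "(\<Sum>i\<le>j. of_nat (j choose i) * (gauss_jet i \<theta> x * f (Suc (j-i)) x + gauss_jet (Suc i) \<theta> x * f (j-i) x)) = leibniz_jet (Suc j) \<theta> f x"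
  using binomial_sum_step[of j "\<lambda>i k. gauss_jet i \<theta> x * f k x"] by (simp add: leibniz_jet_def add.commute del: gauss_jet.simps)
 finally show ?thesis .
qed

lemma leibniz_jet_norm:
 assumes "!!i. i \<le> j ==> norm (gauss_jet i \<theta> x) \<le> C" "!!k. k \<le> j ==> norm (f k x) \<le> D" "C \<ge> 0"
 shows "norm (leibniz_jet j \<theta> f x) \<le> 2^j*(C*D)"
proof -
 have "norm (leibniz_jet j \<theta> f x) \<le> (\<Sum>i\<le>j. real (j choose i) * (C*D))" unfolding leibniz_jet_def using assms
  by (intro order_trans[OF norm_sum] sum_mono) (auto simp: norm_mult intro!: mult_left_mono mult_mono)
 also have "... = 2^j*(C*D)" by (simp flip: sum_distrib_right of_nat_sum add: choose_row_sum)
 finally show ?thesis .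
qed

lemma leibniz_jet_diff: "leibniz_jet j \<theta> f x - leibniz_jet j \<theta> g x = leibniz_jet j \<theta> (\<lambda>k x. f k x - g k x) x"
 by (simp add: leibniz_jet_def sum_subtractf[symmetric] algebra_simps)

text \<open>The Duhamel integral is moved to the fixed interval from 0 to 1, so that joint
  continuity in t and x follows from continuity of the integrand.\<close>

lemma integral_unit_rescale:
 fixes g :: "real => complex"
 assumes g: "continuous_on {0..t} g" and t: "t \<ge> 0"
 shows "integral {0..t} g = t *\<^sub>R integral {0..1} (\<lambda>s. g (t * s))"
proof -
 define G where "G u = integral {0..u} g" for u
 have "((\<lambda>s. t *\<^sub>R g (t * s)) has_integral (G \<circ> (*) t) 1 - (G \<circ> (*) t) 0) {0..1}"
 proof (rule fundamental_theorem_of_calculus)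
  fix s :: real assume s: "s \<in> {0..1}"
  have im: "(*) t ` {0..1} \<subseteq> {0..t}" using t by (auto simp: mult_left_le)
  then have ts: "t * s \<in> {0..t}" using s by blast
  have "(G hvd g (t * s)) (at (t * s) within {0..t})" unfolding G_def[abs_def] by (rule integral_has_vector_derivative[OF g ts])
  then have "(G hvd g (t * s)) (at (t * s) within (*) t ` {0..1})"
   by (rule has_vector_derivative_within_subset[OF _ im])
  then show "(G \<circ> (*) t hvd t *\<^sub>R g (t * s)) (at s within {0..1})"
   by (intro vector_diff_chain_within) (auto intro!: derivative_eq_intros)
 qed auto
 then have "integral {0..1} (\<lambda>s. t *\<^sub>R g (t * s)) = (G \<circ> (*) t) 1 - (G \<circ> (*) t) 0" by (rule integral_unique)
 also have "... = integral {0..t} g" by (simp add: G_def)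
 finally show ?thesis by (simp only: integral_cmul)
qed

text \<open>Integrating x exp (- a (t - r) x) in time gives at most 1/a, uniformly in x: this gain
  pays for the factor x of the nonlinearity.\<close>

lemma exp_weight_integral:
 assumes "a > 0" "x \<ge> 0" "t \<ge> (0::real)" "c \<ge> 0"
 obtains v where "((\<lambda>r. (x+c) * exp (- (a*(t-r)*x))) has_integral v) {0..t}" "v \<le> 1/a+c*t"
proof -
 let ?f = "\<lambda>r. (x+c) * exp (- (a*(t-r)*x))"
 have c1: "continuous_on {0..t} ?f" by (intro continuous_intros)
 have 1: "((\<lambda>r. x * exp (- (a*(t-r)*x))) has_integral (exp (- (a*(t-t)*x)) / a - exp (- (a*(t-0)*x)) / a)) {0..t}"
  by (rule fundamental_theorem_of_calculus)
   (use assms in \<open>auto intro!: derivative_eq_intros simp flip: has_real_derivative_iff_has_vector_derivative\<close>)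
 have 2: "((\<lambda>r. c) has_integral c * t) {0..t}" using has_integral_const_real[of c 0 t] assms by (simp add: mult.commute)
 have "integral {0..t} ?f \<le> (exp (- (a*(t-t)*x)) / a - exp (- (a*(t-0)*x)) / a)+c*t"
 proof (rule has_integral_le[OF integrable_integral has_integral_add[OF 1 2]])
  show "?f integrable_on {0..t}" by (rule integrable_continuous_interval[OF c1])
  show "?f r \<le> x * exp (- (a*(t-r)*x)) + c" if "r \<in> {0..t}" for r
  proof -
   have "exp (- (a*(t-r)*x)) \<le> 1" using that assms by simp
   then have "c * exp (- (a*(t-r)*x)) \<le> c" using assms by (simp add: mult_left_le)
   then show ?thesis by (simp add: distrib_right)
  qed
 qed
 also have "... \<le> 1/a+c*t" using assms by (simp add: field_simps)
 finally show ?thesis by (intro that[OF integrable_integral[OF integrable_continuous_interval[OF c1]]])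
qed

section \<open>The Duhamel map in shrinking exponential weights\<close>

text \<open>\<sigma> is the initial width, \<kappa> the rate at which it shrinks, \<tau> the time at
  which half of it is used up, \<open>J\<close> the number of frequency derivatives carried along,
  \<open>C\<close> the constant of \<open>gauss_jet_bound\<close>. The rate must exceed the unit
  rate lost to derivatives of the propagator, so \<kappa> \<ge> 2 leaves at least 1.\<close>

locale picard =
 fixes \<sigma> \<kappa> \<tau> C :: real and J :: nat
 assumes C: "C \<ge> 1" "!!i \<theta> x. i \<le> J ==> \<theta> \<in> {0..1} ==> x \<ge> 0 ==> norm (gauss_jet i \<theta> x) \<le> C * exp (\<theta>*x)"
  and \<sigma>: "\<sigma> > 0" and \<kappa>: "\<kappa> \<ge> 2" and \<tau>: "\<tau> = \<sigma>/(2*\<kappa>)" and \<tau>1: "\<tau> \<le> 1"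
begin

lemma \<tau>_pos: "\<tau> > 0" unfolding \<tau> using \<sigma> \<kappa> by auto

abbreviation I where "I \<equiv> {0..\<tau>}"

text \<open>The width of the exponential weight shrinks at rate \<open>\<kappa>\<close>. This recovers in time the factor \<open>x\<close> lost by the
nonlinearity, so that the Duhamel map is a contraction for large \<open>\<kappa>\<close>.\<close>
definition w :: "real => real => real" where
 "w t x = (1+x^2) * exp ((\<sigma>-\<kappa>*t)*x)"

lemma w_pos [simp]: "w t x > 0" unfolding w_def by (intro mult_pos_pos add_pos_nonneg) auto

lemma rate_pos: assumes "t \<in> I" shows "\<sigma>-\<kappa>*t \<ge> \<sigma>/2"
proof -
 have "\<kappa>*t \<le> \<kappa>*\<tau>" using assms \<kappa> by (intro mult_left_mono) auto
 also have "\<kappa>*\<tau> = \<sigma>/2" using \<kappa> by (simp add: \<tau>)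
 finally show ?thesis by simp
qed

lemma w_ratio: "w t x = w r x * exp (- (\<kappa>*(t-r)*x))" unfolding w_def mult.assoc mult_exp_exp by (simp add: algebra_simps)

definition wb :: "real => (real => cfun) => bool" where
 "wb \<alpha> f \<longleftrightarrow> (\<forall>t\<in>I. causal (f t)) \<and> continuous_on (I \<times> {0..}) (\<lambda>(t, x). f t x) \<and>
  (\<forall>t\<in>I. \<forall>x\<ge>0. norm (f t x) * w t x \<le> \<alpha>)"

lemma wbD:
 assumes "wb \<alpha> f" "t \<in> I"
 shows "causal (f t)" "x \<ge> 0 ==> norm (f t x) * w t x \<le> \<alpha>" "\<alpha> \<ge> 0"
  "norm (f t x) \<le> \<alpha>/(1+x^2) * decay (\<sigma>-\<kappa>*t) x"
proof -
 show "causal (f t)" using assms by (auto simp: wb_def)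
 show "norm (f t x) * w t x \<le> \<alpha>" if "x \<ge> 0" for x using assms that by (auto simp: wb_def)
 from order_trans[OF _ this[of 0]] show \<alpha>: "\<alpha> \<ge> 0" by (simp add: less_imp_le)
 show "norm (f t x) \<le> \<alpha>/(1+x^2) * decay (\<sigma>-\<kappa>*t) x"
 proof (cases "x \<ge> 0")
  case True
  have "norm (f t x) \<le> \<alpha> / w t x" using assms True by (auto simp: wb_def pos_le_divide_eq)
  also have "... = \<alpha>/(1+x^2) * decay (\<sigma>-\<kappa>*t) x" using True by (simp add: w_def exp_minus divide_inverse)
    (simp add: exp_minus[symmetric] algebra_simps)
  finally show ?thesis .
 next
  case False then show ?thesis using \<open>causal (f t)\<close> \<alpha> by (simp add: causal_def add_nonneg_nonneg)
 qed
qed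

lemma wb_hc: assumes "wb \<alpha> f" shows "hc I f"
proof (rule hcI)
 show "expd I f"
 proof (rule expdI[of _ _ "\<sigma>/2" \<alpha>])
  fix t x assume t: "t \<in> I"
  have c: "continuous_on {0..} (f t)" using assms continuous_on_compose2[of "I \<times> {0..}" "\<lambda>(t, x). f t x" "{0..}" "\<lambda>x. (t, x)"]
    continuous_on_Pair[OF continuous_on_const continuous_on_id, of "{0..}" t] t by (auto simp: wb_def image_subset_iff)
  have "f t = (\<lambda>x. indicator {0..} x *\<^sub>R f t x)" using wbD(1)[OF assms t] by (auto simp: fun_eq_iff causal_def indicator_def)
  moreover have "meas (\<lambda>x. indicator {0..} x *\<^sub>R f t x)" by (rule borel_measurable_continuous_on_indicator[OF _ c]) simp
  ultimately show "meas (f t)" by simp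
  have "\<alpha>/(1+x^2) * decay (\<sigma>-\<kappa>*t) x \<le> \<alpha>/1 * decay (\<sigma>/2) x"
  proof (intro mult_mono divide_left_mono)
   show "decay (\<sigma>-\<kappa>*t) x \<le> decay (\<sigma>/2) x" using rate_pos[OF t] unfolding exp_le_cancel_iff by (intro mult_right_mono) auto
  qed (use wbD(3)[OF assms t] in \<open>auto intro!: divide_nonneg_pos add_pos_nonneg\<close>)
  with wbD(4)[OF assms t] show "norm (f t x) \<le> \<alpha> * decay (\<sigma>/2) x" by (auto intro: order_trans)
 qed (use \<sigma> in auto)
qed (use assms in \<open>auto simp: wb_def\<close>)

lemma wb_mono: "wb \<alpha> f ==> \<alpha> \<le> \<beta> ==> wb \<beta> f" unfolding wb_def by (auto intro: order_trans)

text \<open>The factor 1 + x^2 makes this an algebra norm: the exponentials multiply by the triangle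
  inequality, and 1/(1 + x^2) convolved with itself is at most 4 \<pi> / (1 + x^2). The remaining 3
  comes from the coefficients 1 and 2 in \<open>ext2\<close>.\<close>

lemma toep_wb:
 assumes a: "wb \<alpha> a" and c: "wb \<gamma> c" and t: "t \<in> I" and x: "x \<ge> 0"
 shows "norm (toep (ext2 (a t)) (c t) x) * w t x \<le> 12*pi*\<alpha>*\<gamma>"
proof -
 define \<omega> where "\<omega> = \<sigma>-\<kappa>*t"
 have \<omega>: "\<omega> > 0" using rate_pos[OF t] \<sigma> by (simp add: \<omega>_def)
 let ?b = "\<lambda>x. a t x + crefl (\<lambda>x. 2 * a t x) x"
 have \<alpha>: "\<alpha> \<ge> 0" "\<gamma> \<ge> 0" using wbD(3)[OF a t] wbD(3)[OF c t] by auto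
 have pp: "1+z^2 > 0" for z :: real by (intro add_pos_nonneg) auto
 have b: "norm (?b z) \<le> 3*\<alpha>/(1+z^2)*decay \<omega> z" for z
 proof -
  have "norm (?b z) \<le> norm (a t z) + 2 * norm (a t (- z))" by (rule order_trans[OF norm_triangle_ineq]) (simp add: crefl_def norm_mult)
  also have "... \<le> \<alpha>/(1+z^2)*decay \<omega> z+2*(\<alpha>/(1+z^2)*decay \<omega> z)"
   using wbD(4)[OF a t, of z] wbD(4)[OF a t, of "- z"] unfolding \<omega>_def by (intro add_mono mult_left_mono) auto
  finally show ?thesis by simp
 qed
 note i = integrable_inverse_1_plus_square'
 have i': "integrable lborel (\<lambda>y. 1/(1+(x-y)^2))" using lborel_integrable_real_affine[OF i, of "-1" x] by simp
 have v': "(LBINT y. 1/(1+(x-y)^2)) = pi" using lborel_integral_real_affine[of "-1" "\<lambda>y. 1/(1+y^2)" x] integral_inverse_1_plus_square' by simp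
 have pw: "norm (?b (x-y) * c t y) \<le> (3*\<alpha>*\<gamma> * exp (- \<omega>*x))*(2/(1+x^2))*(1/(1+y^2)+1/(1+(x-y)^2))" for y
 proof -
  have "norm (?b (x-y) * c t y) \<le> (3*\<alpha>/(1+(x-y)^2)*decay \<omega> (x-y))*(\<gamma>/(1+y^2)*decay \<omega> y)"
   unfolding norm_mult using wbD(4)[OF c t, of y] \<alpha> pp[of "x-y"] unfolding \<omega>_def[symmetric] by (intro mult_mono b) auto
  also have "... = (3*\<alpha>*\<gamma>)*(decay \<omega> (x-y)*decay \<omega> y)*(1/((1+(x-y)^2)*(1+y^2)))" by simp
  also have "... \<le> (3*\<alpha>*\<gamma>) * exp (- \<omega>*x) * ((2/(1+x^2))*(1/(1+y^2)+1/(1+(x-y)^2)))"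
  proof (intro mult_mono mult_left_mono)
   have "\<omega>*x \<le> \<omega>*(\<bar>x-y\<bar>+\<bar>y\<bar>)" using \<omega> by (intro mult_left_mono) auto
   then show "decay \<omega> (x-y)*decay \<omega> y \<le> exp (- \<omega>*x)" unfolding mult_exp_exp exp_le_cancel_iff by (simp add: algebra_simps)
   \<comment> \<open>This square is the defect in x^2 \<le> 2 (x - y)^2 + 2 y^2.\<close>
   have "(2*y-x)^2 \<ge> 0" by simp
   then have X: "1+x^2 \<le> 2*((1+(x-y)^2)+(1+y^2))" by (simp add: power2_eq_square algebra_simps)
   have gen: "1/(a*b) \<le> 2/X*(1/b+1/a)" if "X \<le> 2*(a+b)" "X > 0" "a > 0" "b > 0" for a b X :: real
   proof -
    have "1*(1/(a*b)) \<le> (2*(a+b)/X)*(1/(a*b))" using that by (intro mult_right_mono) (auto simp: pos_le_divide_eq)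
    also have "... = 2/X*(1/b+1/a)" using that by (simp add: field_simps)
    finally show ?thesis by simp
   qed
   show "1/((1+(x-y)^2)*(1+y^2)) \<le> 2/(1+x^2)*(1/(1+y^2)+1/(1+(x-y)^2))" by (rule gen[OF X pp pp pp])
  qed (use \<alpha> pp[of y] pp[of "x-y"] in auto)
  finally show ?thesis by (simp only: mult.assoc)
 qed
 have e: "edec ?b" "edec (c t)" using hcD(4)[OF wb_hc[OF a] t] hcD(4)[OF wb_hc[OF c] t] by (auto intro!: edec_intros)
 have "norm (conv ?b (c t) x) \<le> (LBINT y. norm (?b (x-y) * c t y))" unfolding conv_def by (rule integral_norm_bound)
 also have "... \<le> (LBINT y. (3*\<alpha>*\<gamma> * exp (- \<omega>*x))*(2/(1+x^2))*(1/(1+y^2)+1/(1+(x-y)^2)))"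
  by (intro integral_mono integrable_norm conv_integrable e pw integrable_mult_right L_integrable_add i i')
 also have "... = (3*\<alpha>*\<gamma> * exp (- \<omega>*x))*(2/(1+x^2))*(pi+pi)"
  unfolding integral_mult_right_zero L_integral_add[OF i i'] integral_inverse_1_plus_square' v' ..
 finally have "norm (toep ?b (c t) x) \<le> 12*pi*\<alpha>*\<gamma>*(exp (- \<omega>*x) / (1+x^2))" using x by (simp add: toep_def pos_def mult_ac)
 then have "norm (toep ?b (c t) x) * w t x \<le> 12*pi*\<alpha>*\<gamma>*(exp (- \<omega>*x) / (1+x^2)) * w t x"
  by (rule mult_right_mono) (simp add: less_imp_le)
 also have "exp (- \<omega>*x) / (1+x^2) * w t x = 1" using pp[of x] by (simp add: w_def \<omega>_def mult_exp_exp flip: distrib_right)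
 then have "12*pi*\<alpha>*\<gamma>*(exp (- \<omega>*x) / (1+x^2)) * w t x = 12*pi*\<alpha>*\<gamma>" by (simp only: mult.assoc)
 finally show ?thesis .
qed

text \<open>The \<open>j\<close>-th derivative of a truncated convolution: each derivative that crosses the truncation at \<open>0\<close>
leaves a boundary term.\<close>
definition QQ :: "(nat => real => cfun) => (nat => real => cfun) => nat => real => cfun" where
 "QQ a c j r x = toep (ext2 (a 0 r)) (c j r) x + (\<Sum>l<j. c l r 0 * a (j-1-l) r x)"

lemma QQ_hc:
 assumes "!!j. j \<le> J ==> hc I (a j)" "!!j. j \<le> J ==> hc I (c j)" "j \<le> J"
 shows "hc I (QQ a c j)"
proof -
 have s: "hc I (\<lambda>r x. \<Sum>l<k. c l r 0 * a (j-1-l) r x)" if "k \<le> j" for k using that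
 proof (induction k)
  case 0 then show ?case using hc_zero by simp
 next
  case (Suc k)
  have "hc I (\<lambda>r x. c k r 0 * a (j-1-k) r x)" using Suc assms(3) by (intro hc_scale assms hc_value_continuous) auto
  then show ?case using Suc by (auto intro!: hc_add)
 qed
 show ?thesis unfolding QQ_def[abs_def] by (intro hc_add hc_toep hc_cmult s assms) auto
qed

lemma QQ_bound:
 assumes a: "!!j. j \<le> J ==> wb \<alpha> (a j)" and c: "!!j. j \<le> J ==> wb \<gamma> (c j)" and j: "j \<le> J" and t: "t \<in> I" and x: "x \<ge> 0"
 shows "norm (QQ a c j t x) * w t x \<le> (12*pi+J)*\<alpha>*\<gamma>"
proof -
 have \<alpha>: "\<alpha> \<ge> 0" "\<gamma> \<ge> 0" using wbD(3)[OF a[of 0] t] wbD(3)[OF c[of 0] t] by auto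
 have "norm (\<Sum>l<j. c l t 0 * a (j-1-l) t x) * w t x \<le> (\<Sum>l<j. norm (c l t 0 * a (j-1-l) t x) * w t x)"
  unfolding sum_distrib_right[symmetric] by (intro mult_right_mono norm_sum) (simp add: less_imp_le)
 also have "... \<le> (\<Sum>l<j. \<alpha>*\<gamma>)"
 proof (intro sum_mono)
  fix l assume l: "l \<in> {..<j}"
  have "norm (c l t 0) \<le> \<gamma>" using wbD(2)[OF c[of l] t, where x = 0] l j by (simp add: w_def)
  then have "norm (c l t 0) * (norm (a (j-1-l) t x) * w t x) \<le> \<gamma>*\<alpha>"
   using l j x \<alpha> by (intro mult_mono wbD(2)[OF a t]) (auto simp: less_imp_le)
  then show "norm (c l t 0 * a (j-1-l) t x) * w t x \<le> \<alpha>*\<gamma>" by (simp add: norm_mult mult_ac)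
 qed
 also have "... = real j * (\<alpha>*\<gamma>)" by simp
 also have "... \<le> real J * (\<alpha>*\<gamma>)" using j \<alpha> by (intro mult_right_mono) auto
 finally have s: "norm (\<Sum>l<j. c l t 0 * a (j-1-l) t x) * w t x \<le> real J * (\<alpha>*\<gamma>)" .
 have "norm (QQ a c j t x) * w t x \<le> norm (toep (ext2 (a 0 t)) (c j t) x) * w t x + norm (\<Sum>l<j. c l t 0 * a (j-1-l) t x) * w t x"
  unfolding QQ_def distrib_right[symmetric] by (intro mult_right_mono norm_triangle_ineq) (simp add: less_imp_le)
 also have "... \<le> 12*pi*\<alpha>*\<gamma> + real J * (\<alpha>*\<gamma>)" by (intro add_mono s toep_wb a c j t x) simp
 finally show ?thesis by (simp add: algebra_simps)
qed

lemma QQ_diff: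
 assumes "!!j. j \<le> J ==> hc I (a j)" "!!j. j \<le> J ==> hc I (c j)" "j \<le> J" "t \<in> I"
 shows "QQ a a j t x - QQ c c j t x =
  QQ (\<lambda>j t x. a j t x - c j t x) a j t x + QQ c (\<lambda>j t x. a j t x - c j t x) j t x"
proof -
 note e = hcD(4)[OF assms(1) assms(4)] hcD(4)[OF assms(2) assms(4)]
 let ?A = "\<lambda>a x. a t x + crefl (\<lambda>x. 2 * a t x) x"
 have A: "edec (?A f)" if "edec (f t)" for f using that by (auto intro!: edec_intros)
 have 1: "?A (\<lambda>t x. a 0 t x - c 0 t x) = (\<lambda>x. ?A (a 0) x - ?A (c 0) x)" by (simp add: crefl_def fun_eq_iff algebra_simps)
 have 2: "toep (\<lambda>x. ?A (a 0) x - ?A (c 0) x) (a j t) x = toep (?A (a 0)) (a j t) x - toep (?A (c 0)) (a j t) x"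
  using assms(3) by (subst toep_diff_left) (auto intro!: A e)
 have 3: "toep (?A (c 0)) (\<lambda>x. a j t x - c j t x) x = toep (?A (c 0)) (a j t) x - toep (?A (c 0)) (c j t) x"
  using conv_diff_right[of "a j t" "c j t" "?A (c 0)" x] e assms(3) A[of "c 0"] by (simp add: toep_def pos_def)
 show ?thesis unfolding QQ_def 1 2 3 by (simp add: sum_subtractf[symmetric] sum.distrib[symmetric] algebra_simps)
qed

text \<open>The j-th derivative of - i x times the quadratic term: x has one derivative, so two
  terms of the Leibniz rule survive. For j = 0 the index j - 1 is 0, and so is its factor.\<close>

definition nn :: "(nat => real => cfun) => nat => real => cfun" where
 "nn q j r x = - \<i>*(of_real x * QQ q q j r x + of_nat j * QQ q q (j-1) r x)"

lemma nn_continuous: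
 assumes "!!j. j \<le> J ==> hc I (q j)" "j \<le> J"
 shows "continuous_on (I \<times> {0..}) (\<lambda>(t, x). nn q j t x)"
proof -
 have "continuous_on (I \<times> {0..}) (\<lambda>z. QQ q q j (fst z) (snd z))" "continuous_on (I \<times> {0..}) (\<lambda>z. QQ q q (j-1) (fst z) (snd z))"
  using hcD(3)[OF QQ_hc[where j = j, OF assms(1,1)]] hcD(3)[OF QQ_hc[where j = "j-1", OF assms(1,1)]] assms(2) by (auto simp: case_prod_unfold)
 then show ?thesis unfolding nn_def case_prod_unfold by (intro continuous_intros)
qed

text \<open>Between the times r and t the weight gains exp (- \<kappa> (t - r) x) and the propagator
  loses exp ((t - r) x). With the net rate \<kappa> - 1 the factor x + J integrates to at most
  1/(\<kappa> - 1) + J \<tau>.\<close>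

lemma Duhamel_bound:
 fixes x G :: real
 assumes g: "!!k r. k \<le> J ==> r \<in> I ==> norm (g k r x) * w r x \<le> (x+J)*G"
  and gc: "!!k. k \<le> J ==> continuous_on I (\<lambda>r. g k r x)"
  and j: "j \<le> J" and t: "t \<in> I" and x: "x \<ge> 0" and G: "G \<ge> 0"
 shows "norm (integral {0..t} (\<lambda>r. leibniz_jet j (t-r) (\<lambda>k. g k r) x)) * w t x \<le> 2^J*C*G*(1/(\<kappa>-1)+J*\<tau>)"
proof -
 obtain v where v: "((\<lambda>r. (x+J) * exp (- ((\<kappa>-1)*(t-r)*x))) has_integral v) {0..t}" "v \<le> 1/(\<kappa>-1)+J*t"
  by (rule exp_weight_integral[of "\<kappa>-1" x t "real J"]) (use \<kappa> t x in auto)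
 have pw: "norm (leibniz_jet j (t-r) (\<lambda>k. g k r) x) \<le> (2^J*C*G / w t x)*((x+J) * exp (- ((\<kappa>-1)*(t-r)*x)))"
  if r: "r \<in> {0..t}" for r
 proof -
  have rI: "r \<in> I" "t-r \<in> {0..1}" using r t \<tau>1 by auto
  have "norm (leibniz_jet j (t-r) (\<lambda>k. g k r) x) \<le> 2^j*((C * exp ((t-r)*x))*((x+J)*G / w r x))"
  proof (rule leibniz_jet_norm)
   show "norm (g k r x) \<le> (x + real J)*G / w r x" if "k \<le> j" for k using g[of k r] that j rI by (simp add: pos_le_divide_eq)
  qed (use C j x rI in auto)
  also have "... \<le> 2^J*((C * exp ((t-r)*x))*((x+J)*G / w r x))"
   using j C G x by (intro mult_right_mono power_increasing) (auto intro!: mult_nonneg_nonneg divide_nonneg_pos)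
  also have "... = 2^J*((C * exp ((t-r)*x))*((x+J)*G*(exp (- (\<kappa>*(t-r)*x)) / w t x)))" using w_ratio[of t x r] by simp
  also have "... = (2^J*C*G / w t x)*((x+J)*(exp ((t-r)*x) * exp (- (\<kappa>*(t-r)*x))))" by (simp add: mult_ac)
  also have "exp ((t-r)*x) * exp (- (\<kappa>*(t-r)*x)) = exp (- ((\<kappa>-1)*(t-r)*x))" unfolding mult_exp_exp by (simp add: algebra_simps)
  finally show ?thesis .
 qed
 have cont: "continuous_on {0..t} (\<lambda>r. leibniz_jet j (t-r) (\<lambda>k. g k r) x)" unfolding leibniz_jet_def using t j
  by (intro continuous_intros continuous_on_subset[OF gc]) auto
 have "norm (integral {0..t} (\<lambda>r. leibniz_jet j (t-r) (\<lambda>k. g k r) x)) \<le> integral {0..t} (\<lambda>r. (2^J*C*G / w t x)*((x+J) * exp (- ((\<kappa>-1)*(t-r)*x))))"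
  by (intro integral_norm_bound_integral integrable_continuous_interval cont pw continuous_intros) (use less_imp_neq[OF w_pos] in auto)
 also have "... = (2^J*C*G / w t x) * v" using integral_unique[OF has_integral_mult_right[OF v(1)]] by simp
 also have "... \<le> (2^J*C*G / w t x)*(1/(\<kappa>-1)+J*\<tau>)"
 proof (intro mult_left_mono order_trans[OF v(2)] add_left_mono)
  show "t \<le> \<tau>" using t by simp
 qed (use C G in \<open>auto intro!: divide_nonneg_pos mult_nonneg_nonneg\<close>)
 finally show ?thesis by (simp add: field_simps pos_le_divide_eq)
qed

abbreviation ljet where "ljet q j t r x \<equiv> leibniz_jet j (t-r) (\<lambda>k. nn q k r) x"

text \<open>Variation of constants for the whole jet: component \<open>j\<close> is the j-th
  derivative of the Duhamel formula, cut off to the half-line.\<close>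

definition Phi :: "(nat => real => complex) => (nat => real => cfun) => nat => real => cfun" where
 "Phi d q j t x = (if 0 \<le> x then leibniz_jet j t d x + integral {0..t} (\<lambda>r. ljet q j t r x) else 0)"

definition data :: "real => (nat => real => complex) => bool" where
 "data B d \<longleftrightarrow> (\<forall>j\<le>J. continuous_on {0..} (d j) \<and> (\<forall>x\<ge>0. norm (d j x) * ((1+x^2) * exp (\<sigma>*x)) \<le> B)) \<and>
  (\<forall>j<J. \<forall>x\<ge>0. (d j hvd d (Suc j) x) (at_half x))"

lemma nn_slice_continuous:
 assumes "!!j. j \<le> J ==> hc I (q j)" "j \<le> J" "x \<ge> 0"
 shows "continuous_on I (\<lambda>r. nn q j r x)"
 by (rule continuous_on_pair_compose[OF nn_continuous[OF assms(1,2)] continuous_on_id continuous_on_const])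
  (use assms(3) in auto)

lemma Phi_continuous:
 assumes q: "!!j. j \<le> J ==> hc I (q j)" and d: "data B d" and j: "j \<le> J"
 shows "continuous_on (I \<times> {0..}) (\<lambda>(t, x). Phi d q j t x)"
proof -
 have dc: "continuous_on (I \<times> {0..}) (\<lambda>z. d k (snd z))" if "k \<le> J" for k
  by (rule continuous_on_compose2[of "{0..}" "d k"]) (use d that in \<open>auto simp: data_def intro!: continuous_intros\<close>)
 have nc: "continuous_on ((I \<times> {0..}) \<times> cbox 0 1) (\<lambda>z. nn q k (fst (fst z) * snd z) (snd (fst z)))" if "k \<le> J" for k
  by (rule continuous_on_pair_compose[OF nn_continuous[OF q that]])
   (auto intro!: continuous_intros intro: mult_left_le order_trans[OF mult_left_le])
 have "continuous_on (I \<times> {0..}) (\<lambda>z. leibniz_jet j (fst z) d (snd z) +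
  fst z *\<^sub>R integral (cbox 0 1) (\<lambda>s. leibniz_jet j (fst z - fst z * s) (\<lambda>k. nn q k (fst z * s)) (snd z)))"
 proof (intro continuous_on_add continuous_on_scaleR integral_continuous_on_param)
  show "continuous_on (I \<times> {0..}) (\<lambda>z. leibniz_jet j (fst z) d (snd z))"
   unfolding leibniz_jet_def by (intro continuous_intros dc) (use j in auto)
  show "continuous_on ((I \<times> {0..}) \<times> cbox 0 1) (\<lambda>(z, s). leibniz_jet j (fst z - fst z * s) (\<lambda>k. nn q k (fst z * s)) (snd z))"
   unfolding leibniz_jet_def case_prod_unfold by (intro continuous_intros nc) (use j in auto)
 qed (intro continuous_intros)
 then show ?thesis unfolding case_prod_unfold
 proof (rule continuous_on_eq)
  fix z assume z: "z \<in> I \<times> {0::real..}"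
  have "continuous_on {0..fst z} (\<lambda>r. leibniz_jet j (fst z - r) (\<lambda>k. nn q k r) (snd z))" unfolding leibniz_jet_def using z j
   by (intro continuous_intros continuous_on_subset[OF nn_slice_continuous[OF q]]) auto
  from integral_unit_rescale[OF this]
  show "leibniz_jet j (fst z) d (snd z) + fst z *\<^sub>R integral (cbox 0 1) (\<lambda>s. leibniz_jet j (fst z - fst z * s) (\<lambda>k. nn q k (fst z * s)) (snd z))
   = Phi d q j (fst z) (snd z)" using z by (auto simp: Phi_def)
 qed
qed

lemma nn_bound:
 fixes x D u :: real
 assumes q: "!!j. j \<le> J ==> norm (R j) * u \<le> D" "k \<le> J" "x \<ge> 0" "D \<ge> 0" "u > 0"
 shows "norm (- \<i>*(of_real x * R k + of_nat k * R (k-1))) * u \<le> (x+J)*D"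
proof -
 have "norm (- \<i>*(of_real x * R k + of_nat k * R (k-1))) * u \<le> (x * norm (R k) + real k * norm (R (k-1)))*u"
  using assms by (intro mult_right_mono) (auto simp: norm_mult intro!: order_trans[OF norm_triangle_ineq])
 also have "... = x*(norm (R k) * u) + real k * (norm (R (k-1)) * u)" by (simp add: algebra_simps)
 also have "... \<le> x*D + real J * D" using assms by (intro add_mono mult_mono q) auto
 finally show ?thesis by (simp add: algebra_simps)
qed

lemma cancel_weight: "(e::real) \<noteq> 0 ==> J'*((C*t)*(B/e))*(e*k) = J'*C*B*(t*k)" by simp

lemma Phi_bound:
 assumes q: "!!j. j \<le> J ==> wb \<rho> (q j)" and d: "data B d" and j: "j \<le> J"
 shows "wb (2^J*C*(B+(12*pi+J)*\<rho>*\<rho>*(1/(\<kappa>-1)+J*\<tau>))) (Phi d q j)" unfolding wb_def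
proof (intro conjI ballI allI impI)
 show "continuous_on (I \<times> {0..}) (\<lambda>(t, x). Phi d q j t x)" by (rule Phi_continuous[OF wb_hc[OF q] d j])
 fix t assume t: "t \<in> I"
 show "causal (Phi d q j t)" by (simp add: causal_def Phi_def)
 fix x :: real assume x: "x \<ge> 0"
 have \<rho>: "\<rho> \<ge> 0" using wbD(3)[OF q[of 0] t] by simp
 have "norm (d 0 0) * ((1+0^2) * exp (\<sigma>*0)) \<le> B" using d unfolding data_def by blast
 then have B: "B \<ge> 0" using order_trans[OF norm_ge_zero[of "d 0 0"]] by simp
 have 1: "norm (leibniz_jet j t d x) * w t x \<le> 2^J*C*B"
 proof -
  let ?e = "(1+x^2) * exp (\<sigma>*x)"
  have e: "?e > 0" by (intro mult_pos_pos add_pos_nonneg) auto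
  have "norm (leibniz_jet j t d x) \<le> 2^j*((C * exp (t*x))*(B/?e))"
  proof (rule leibniz_jet_norm)
   show "norm (d k x) \<le> B/?e" if "k \<le> j" for k using d that j x e by (auto simp: data_def pos_le_divide_eq)
  qed (use C j x t \<tau>1 in auto)
  also have "... \<le> 2^J*((C * exp (t*x))*(B/?e))"
   using j C B e by (intro mult_right_mono power_increasing) (auto intro!: mult_nonneg_nonneg divide_nonneg_pos)
  finally have "norm (leibniz_jet j t d x) * w t x \<le> 2^J*((C * exp (t*x))*(B/?e)) * w t x" by (intro mult_right_mono) (auto simp: less_imp_le)
  also have "... = 2^J*((C * exp (t*x))*(B/?e))*(?e * exp (- (\<kappa>*t*x)))"
  proof -
   have "w t x = ?e * exp (- (\<kappa>*t*x))" using w_ratio[of t x 0] by (simp add: w_def)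
   then show ?thesis by (simp only:)
  qed
  also have "... = 2^J*C*B*(exp (t*x) * exp (- (\<kappa>*t*x)))" by (rule cancel_weight) (use less_imp_neq[OF e] in simp)
  also have "... \<le> 2^J*C*B*1"
  proof (rule mult_left_mono)
   \<comment> \<open>The loss exp (t x) of the propagator is covered by the shrinking of the
     weight.\<close>
   have "1*(t*x) \<le> \<kappa>*(t*x)" using \<kappa> t x by (intro mult_right_mono) auto
   then show "exp (t*x) * exp (- (\<kappa>*t*x)) \<le> 1" unfolding mult_exp_exp by (simp add: mult.assoc)
  qed (use C B in auto)
  finally show ?thesis by simp
 qed
 have 2: "norm (integral {0..t} (\<lambda>r. ljet q j t r x)) * w t x \<le> 2^J*C*((12*pi+J)*\<rho>*\<rho>)*(1/(\<kappa>-1)+J*\<tau>)"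
 proof (rule Duhamel_bound)
  show "norm (nn q k r x) * w r x \<le> (x + real J)*((12*pi + real J)*\<rho>*\<rho>)" if "k \<le> J" "r \<in> I" for k r
   unfolding nn_def using that x \<rho> by (intro nn_bound[of "\<lambda>j. QQ q q j r x"] QQ_bound q) auto
  show "continuous_on I (\<lambda>r. nn q k r x)" if "k \<le> J" for k by (rule nn_slice_continuous[OF wb_hc[OF q] that x])
 qed (use j t x \<rho> in auto)
 have "norm (Phi d q j t x) * w t x \<le> norm (leibniz_jet j t d x) * w t x + norm (integral {0..t} (\<lambda>r. ljet q j t r x)) * w t x"
  unfolding distrib_right[symmetric] using x by (intro mult_right_mono) (auto simp: Phi_def less_imp_le intro: norm_triangle_ineq)
 also have "... \<le> 2^J*C*B+2^J*C*((12*pi+J)*\<rho>*\<rho>)*(1/(\<kappa>-1)+J*\<tau>)" by (intro add_mono 1 2)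
 finally show "norm (Phi d q j t x) * w t x \<le> 2^J*C*(B+(12*pi+J)*\<rho>*\<rho>*(1/(\<kappa>-1)+J*\<tau>))" by (simp add: distrib_left mult.assoc)
qed

lemma Phi_diff_bound:
 assumes q: "!!j. j \<le> J ==> wb \<rho> (q j)" and q': "!!j. j \<le> J ==> wb \<rho> (q' j)"
  and dq: "!!j. j \<le> J ==> wb \<delta> (\<lambda>t x. q j t x - q' j t x)"
  and j: "j \<le> J" and t: "t \<in> I" and x: "x \<ge> 0"
 shows "norm (Phi d q j t x - Phi d q' j t x) * w t x \<le> 2^J*C*(2*(12*pi+J)*\<rho>*\<delta>)*(1/(\<kappa>-1)+J*\<tau>)"
proof -
 have \<rho>: "\<rho> \<ge> 0" "\<delta> \<ge> 0" using wbD(3)[OF q[of 0] t] wbD(3)[OF dq[of 0] t] by auto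
 let ?g = "\<lambda>k r x. nn q k r x - nn q' k r x"
 have c: "continuous_on {0..t} (\<lambda>r. leibniz_jet j (t-r) (\<lambda>k. nn p k r) x)" if "!!j. j \<le> J ==> hc I (p j)" for p
  unfolding leibniz_jet_def using t j x by (intro continuous_intros continuous_on_subset[OF nn_slice_continuous[OF that]]) auto
 have "Phi d q j t x - Phi d q' j t x = integral {0..t} (\<lambda>r. ljet q j t r x - ljet q' j t r x)"
  using x by (simp add: Phi_def Henstock_Kurzweil_Integration.integral_diff[OF integrable_continuous_interval[OF c[OF wb_hc[OF q]]] integrable_continuous_interval[OF c[OF wb_hc[OF q']]]])
 also have "... = integral {0..t} (\<lambda>r. leibniz_jet j (t-r) (\<lambda>k. ?g k r) x)" by (simp only: leibniz_jet_diff)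
 also have "norm ... * w t x \<le> 2^J*C*(2*(12*pi+J)*\<rho>*\<delta>)*(1/(\<kappa>-1)+J*\<tau>)"
 proof (rule Duhamel_bound[ where g = ?g])
  show "continuous_on I (\<lambda>r. ?g k r x)" if "k \<le> J" for k
   by (intro continuous_intros nn_slice_continuous[OF wb_hc[OF q] that x] nn_slice_continuous[OF wb_hc[OF q'] that x])
  fix k r assume k: "k \<le> J" and r: "r \<in> I"
  let ?d = "\<lambda>j t x. q j t x - q' j t x"
  define R where "R j = QQ ?d q j r x + QQ q' ?d j r x" for j
  have R: "QQ q q j r x - QQ q' q' j r x = R j" if "j \<le> J" for j unfolding R_def by (rule QQ_diff[OF wb_hc[OF q] wb_hc[OF q'] that r])
  have "?g k r x = - \<i>*(of_real x * R k + of_nat k * R (k-1))" using R[of k] R[of "k-1"] k by (simp add: nn_def algebra_simps flip: R)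
  moreover have "norm (R j) * w r x \<le> 2*(12*pi+J)*\<rho>*\<delta>" if "j \<le> J" for j
  proof -
   have "norm (R j) * w r x \<le> norm (QQ ?d q j r x) * w r x + norm (QQ q' ?d j r x) * w r x"
    unfolding R_def distrib_right[symmetric] by (intro mult_right_mono norm_triangle_ineq) (simp add: less_imp_le)
   also have "... \<le> (12*pi+J)*\<delta>*\<rho>+(12*pi+J)*\<rho>*\<delta>" by (intro add_mono QQ_bound q q' dq that r x)
   finally show ?thesis by (simp add: algebra_simps)
  qed
  ultimately show "norm (?g k r x) * w r x \<le> (x + real J)*(2*(12*pi + real J)*\<rho>*\<delta>)"
   using k x \<rho> by (simp only:) (intro nn_bound, auto)
 qed (use j t x \<rho> in auto)
 finally show ?thesis .
qed

text \<open>The boundary term of the Toeplitz operator is precisely the new summand l = j.\<close>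

lemma QQ_has_derivative:
 assumes q: "!!j. j \<le> J ==> hc I (q j)"
  and der: "!!j t x. j < J ==> t \<in> I ==> x \<ge> 0 ==> (q j t hvd q (Suc j) t x) (at_half x)"
  and j: "j < J" and t: "t \<in> I" and x: "x \<ge> 0"
 shows "(QQ q q j t hvd QQ q q (Suc j) t x) (at_half x)"
proof -
 have 1: "(toep (ext2 (q 0 t)) (q j t) hvd
  toep (ext2 (q 0 t)) (q (Suc j) t) x + q j t 0 * q 0 t x) (at_half x)"
  by (rule toep_hc_has_derivative[where I = I and f = "q 0" and g = "\<lambda>t x. 2 * q 0 t x" and h = "q j" and h' = "q (Suc j)"])
   (intro q hc_cmult t x der j; use j in simp)+
 have "(QQ q q j t hvd
  (toep (ext2 (q 0 t)) (q (Suc j) t) x + q j t 0 * q 0 t x)+(\<Sum>l<j. q l t 0 * q (Suc (j-1-l)) t x)) (at_half x)"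
  unfolding QQ_def[abs_def] using j t x by (intro has_vector_derivative_add 1 has_vector_derivative_sum has_vector_derivative_mult_right der) auto
 also have "(toep (ext2 (q 0 t)) (q (Suc j) t) x + q j t 0 * q 0 t x)+(\<Sum>l<j. q l t 0 * q (Suc (j-1-l)) t x)
  = QQ q q (Suc j) t x"
 proof -
  have "(\<Sum>l<j. q l t 0 * q (Suc (j-1-l)) t x) = (\<Sum>l<j. q l t 0 * q (j-l) t x)" by (intro sum.cong) (auto simp: Suc_diff_Suc)
  then show ?thesis by (simp add: QQ_def)
 qed
 finally show ?thesis .
qed

lemma nn_has_derivative:
 assumes q: "!!j. j \<le> J ==> hc I (q j)"
  and der: "!!j t x. j < J ==> t \<in> I ==> x \<ge> 0 ==> (q j t hvd q (Suc j) t x) (at_half x)"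
  and j: "j < J" and t: "t \<in> I" and x: "x \<ge> 0"
 shows "(nn q j t hvd nn q (Suc j) t x) (at_half x)"
proof -
 have 1: "((\<lambda>x. of_real x * QQ q q j t x) hvd QQ q q j t x + of_real x * QQ q q (Suc j) t x) (at_half x)"
  using mulx_has_vector_derivative[OF QQ_has_derivative[where q = q, OF q der j t x]] by (simp add: mulx_def[abs_def])
 have 2: "((\<lambda>x. of_nat j * QQ q q (j-1) t x) hvd of_nat j * QQ q q j t x) (at_half x)"
 proof (cases j)
  case (Suc k)
  then show ?thesis using QQ_has_derivative[where q = q, OF q der _ t x, of k] j by (intro has_vector_derivative_mult_right) auto
 qed simp
 have "(nn q j t hvd - \<i>*((QQ q q j t x + of_real x * QQ q q (Suc j) t x) + of_nat j * QQ q q j t x)) (at_half x)"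
  unfolding nn_def[abs_def] by (intro has_vector_derivative_mult_right has_vector_derivative_add 1 2)
 then show ?thesis by (simp add: nn_def algebra_simps)
qed

text \<open>Genuine jets are mapped to genuine jets, which keeps the iteration inside
  \<open>jets\<close>.\<close>

lemma Phi_has_derivative:
 assumes q: "!!j. j \<le> J ==> hc I (q j)"
  and der: "!!j t x. j < J ==> t \<in> I ==> x \<ge> 0 ==> (q j t hvd q (Suc j) t x) (at_half x)"
  and d: "data B d" and j: "j < J" and t: "t \<in> I" and x: "x \<ge> 0"
 shows "(Phi d q j t hvd Phi d q (Suc j) t x) (at_half x)"
proof -
 have nc: "continuous_on ({0..} \<times> cbox 0 t) (\<lambda>z. nn q k (snd z) (fst z))" if "k \<le> J" for k
  by (rule continuous_on_pair_compose[OF nn_continuous[OF q that]]) (use t in \<open>auto intro!: continuous_intros\<close>)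
 have 2: "((\<lambda>x. integral (cbox 0 t) (\<lambda>r. ljet q j t r x)) hvd
   integral (cbox 0 t) (\<lambda>r. ljet q (Suc j) t r x)) (at_half x)"
 proof (rule leibniz_rule_vector_derivative)
  show "((\<lambda>x. ljet q j t r x) hvd ljet q (Suc j) t r x) (at_half x)"
   if "x \<in> {0..}" "r \<in> cbox 0 t" for x r using that t j by (intro leibniz_jet_has_derivative nn_has_derivative[where q = q, OF q der]) auto
  show "(\<lambda>r. ljet q j t r x) integrable_on cbox 0 t" if "x \<in> {0..}" for x unfolding leibniz_jet_def cbox_interval using that t j
   by (intro integrable_continuous_interval continuous_intros continuous_on_subset[OF nn_slice_continuous[OF q]]) auto
  show "continuous_on ({0..} \<times> cbox 0 t) (\<lambda>(x, r). ljet q (Suc j) t r x)"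
   unfolding leibniz_jet_def case_prod_unfold using j by (intro continuous_intros nc) auto
 qed (use x in auto)
 have "((\<lambda>x. leibniz_jet j t d x + integral (cbox 0 t) (\<lambda>r. ljet q j t r x)) hvd
  leibniz_jet (Suc j) t d x + integral (cbox 0 t) (\<lambda>r. ljet q (Suc j) t r x)) (at_half x)"
  using d j x by (intro has_vector_derivative_add 2 leibniz_jet_has_derivative) (auto simp: data_def)
 then show ?thesis using x by (intro has_vector_derivative_transform[of x "{0..}" "Phi d q j t"]) (auto simp: Phi_def)
qed

end

section \<open>The fixed point as a bounded continuous function\<close>

lemma continuous_on_nat_prod:
 fixes f :: "nat => 'a::{first_countable_topology, t2_space} => 'b::topological_space"
 assumes "!!j. continuous_on UNIV (f j)"
 shows "continuous_on UNIV (\<lambda>(j, z). f j z)"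
proof (rule continuous_on_sequentiallyI)
 fix u :: "nat => nat \<times> 'a" and a :: "nat \<times> 'a" assume u: "u \<longlonglongrightarrow> a"
 have 1: "(\<lambda>n. fst (u n)) \<longlonglongrightarrow> fst a" and 2: "(\<lambda>n. snd (u n)) \<longlonglongrightarrow> snd a"
  using u by (auto intro: tendsto_fst tendsto_snd)
 have ev: "eventually (\<lambda>n. fst (u n) = fst a) sequentially" using 1 by (simp add: tendsto_discrete)
 have "(\<lambda>n. f (fst a) (snd (u n))) \<longlonglongrightarrow> f (fst a) (snd a)" by (rule continuous_on_tendsto_compose[OF assms 2]) auto
 moreover have "eventually (\<lambda>n. f (fst a) (snd (u n)) = (\<lambda>(j, z). f j z) (u n)) sequentially"
  using ev by eventually_elim (simp add: case_prod_unfold)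
 ultimately show "(\<lambda>n. (\<lambda>(j, z). f j z) (u n)) \<longlonglongrightarrow> (\<lambda>(j, z). f j z) a"
  by (simp add: case_prod_unfold tendsto_cong)
qed

text \<open>The square of the anticausal half drops out on the half-line, and the two mixed products
  coincide.\<close>

lemma conv_herm_self:
 assumes "edec p" "causal p" "x \<ge> 0"
 shows "conv (herm p) (herm p) x = toep (ext2 p) p x"
proof -
 note [simp] = assms(1) edec_intros
 have 0: "conv (crefl p) (crefl p) x = 0" by (rule conv_anticausal_zero)
   (use assms edec_crefl[OF assms(1)] in \<open>auto simp: expd_def crefl_def causal_def\<close>)
 have c: "crefl (\<lambda>x. 2 * p x) = (\<lambda>x. 2 * crefl p x)" by (simp add: crefl_def fun_eq_iff)
 have h: "herm p = (\<lambda>x. p x + crefl p x)" by (simp add: herm_def fun_eq_iff)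
 have "conv (herm p) (herm p) x = conv p p x + 2 * conv (crefl p) p x"
  unfolding h by (simp add: conv_add_left conv_add_right 0 conv_commute[of p "crefl p"])
 also have "... = toep (ext2 p) p x" unfolding c using assms(3) by (simp add: toep_def pos_def conv_add_left conv_cmult_left)
 finally show ?thesis .
qed

text \<open>From 2 v D v = D (v^2). This separates the oscillating linear part from the nonlinearity
  - i \<xi> P(v^2), the form to which variation of constants applies.\<close>

lemma flow_op_self_alt:
 assumes "edec p" "causal p" "x \<ge> 0"
 shows "flow_op p p x = - \<i> * of_real (x^2) * p x + - \<i>*(of_real x * toep (ext2 p) p x)"
proof -
 have "2 * conv (herm p) (mulx (herm p)) x = mulx (conv (herm p) (herm p)) x" by (rule mulx_conv_self[symmetric]) (intro edec_intros assms)
 then show ?thesis unfolding flow_op_self[OF assms(1,2)] using assms(3) conv_herm_self[OF assms]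
  by (simp add: toep_def[of "herm p"] pos_def[of "conv (herm p) _"] mulx_def[of _ x] power2_eq_square algebra_simps)
qed

text \<open>Makes the integral condition that defines \<open>jets\<close> a closed one.\<close>

lemma bounded_linear_integral_bcontfun:
 fixes g :: "real => 'a::topological_space" and c :: "real => real"
 assumes "continuous_on {a..b} g" "continuous_on {a..b} c"
 shows "bounded_linear (\<lambda>F :: 'a \<Rightarrow>\<^sub>C complex. integral {a..b} (\<lambda>y. c y *\<^sub>R apply_bcontfun F (g y)))"
proof -
 have ct: "continuous_on {a..b} (\<lambda>y. c y *\<^sub>R apply_bcontfun F (g y))" for F :: "'a \<Rightarrow>\<^sub>C complex"
  by (intro continuous_intros assms continuous_on_compose2[OF continuous_on_apply_bcontfun[of UNIV F] assms(1)]) auto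
 note int = integrable_continuous_interval[OF ct]
 obtain K where K': "\<forall>y\<in>{a..b}. \<bar>c y\<bar> \<le> K"
  using compact_imp_bounded[OF compact_continuous_image[OF assms(2) compact_Icc]] by (auto simp: bounded_iff)
 then have K: "\<bar>c y\<bar> \<le> K" if "y \<in> {a..b}" for y using that by blast
 show ?thesis
 proof (rule bounded_linear_intro)
  show "integral {a..b} (\<lambda>y. c y *\<^sub>R apply_bcontfun (F+G) (g y)) = integral {a..b} (\<lambda>y. c y *\<^sub>R apply_bcontfun F (g y))+integral {a..b} (\<lambda>y. c y *\<^sub>R apply_bcontfun G (g y))" for F G :: "'a \<Rightarrow>\<^sub>C complex"
   by (simp add: scaleR_right_distrib Henstock_Kurzweil_Integration.integral_add[OF int int])
  show "integral {a..b} (\<lambda>y. c y *\<^sub>R apply_bcontfun (r *\<^sub>R F) (g y)) = r *\<^sub>R integral {a..b} (\<lambda>y. c y *\<^sub>R apply_bcontfun F (g y))" for r and F :: "'a \<Rightarrow>\<^sub>C complex"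
   by (simp add: mult.commute flip: integral_cmul)
  show "norm (integral {a..b} (\<lambda>y. c y *\<^sub>R apply_bcontfun F (g y))) \<le> norm F * (K * max 0 (b-a))" for F :: "'a \<Rightarrow>\<^sub>C complex"
  proof (cases "a \<le> b")
   case True
   have "norm (integral {a..b} (\<lambda>y. c y *\<^sub>R apply_bcontfun F (g y))) \<le> K * norm F * (b-a)"
   proof (rule integral_bound[OF True ct])
    fix y assume "y \<in> {a..b}"
    then have "\<bar>c y\<bar> * norm (apply_bcontfun F (g y)) \<le> K * norm F"
     using order_trans[OF abs_ge_zero K] by (intro mult_mono K norm_bounded) auto
    then show "norm (c y *\<^sub>R apply_bcontfun F (g y)) \<le> K * norm F" by simp
   qed
   then show ?thesis using True by (simp add: mult_ac max_def)
  qed simp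
 qed
qed

lemma complete_bcontfun: "uniform_space_class.complete (UNIV :: ('a::topological_space \<Rightarrow>\<^sub>C 'b::complete_space) set)"
 unfolding complete_def
proof (intro allI impI, elim conjE)
 fix f :: "nat => 'a \<Rightarrow>\<^sub>C 'b" assume "Cauchy f"
 then obtain g where "uniform_limit UNIV f g sequentially" using uniformly_convergent_eq_cauchy[of "\<lambda>_. True" f]
  unfolding Cauchy_def uniform_limit_sequentially_iff by (metis dist_fun_lt_imp_dist_val_lt)
 from uniform_limit_bcontfunE[OF this sequentially_bot]
 obtain l where "f \<longlonglongrightarrow> l" by metis
 then show "\<exists>l\<in>UNIV. f \<longlonglongrightarrow> l" by blast
qed

context picard
begin

text \<open>The whole jet is stored as one bounded continuous function of (j, t, x), already
  multiplied by the weight. The uniform norm is then the weighted norm, and the Banach fixed point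
  theorem applies to all derivatives at once.\<close>

definition comp :: "(nat \<times> real \<times> real) \<Rightarrow>\<^sub>C complex => nat => real => cfun" where
 "comp F j t x = (if 0 \<le> x then (1 / w t x) *\<^sub>R apply_bcontfun F (j, t, x) else 0)"

lemma continuous_on_w [continuous_intros]: "continuous_on S f ==> continuous_on S g ==> continuous_on S (\<lambda>z. w (f z) (g z))"
 unfolding w_def by (intro continuous_intros)

lemma w_nonzero [simp]: "w t x \<noteq> 0" using w_pos[of t x] by linarith

lemma comp_wb: "wb (norm F) (comp F j)" unfolding wb_def
proof (intro conjI ballI allI impI)
 have "continuous_on (I \<times> {0..}) (\<lambda>z. (1 / w (fst z) (snd z)) *\<^sub>R apply_bcontfun F (j, fst z, snd z))"
  by (intro continuous_intros continuous_on_compose2[OF continuous_on_apply_bcontfun[of UNIV F]]) auto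
 then show "continuous_on (I \<times> {0..}) (\<lambda>(t, x). comp F j t x)"
  unfolding case_prod_unfold by (rule continuous_on_eq) (auto simp: comp_def)
 show "causal (comp F j t)" for t by (simp add: causal_def comp_def)
 fix t x :: real assume "x \<ge> 0"
 then have "norm (comp F j t x) * w t x = norm (apply_bcontfun F (j, t, x))" using w_pos[of t x] by (simp add: comp_def abs_of_pos)
 also have "... \<le> norm F" by (rule norm_bounded)
 finally show "norm (comp F j t x) * w t x \<le> norm F" .
qed

lemma comp_diff: "comp (F-G) j t x = comp F j t x - comp G j t x" by (simp add: comp_def scaleR_diff_right)

definition cl :: "real => real" where "cl t = max 0 (min \<tau> t)"

lemma cl_in [simp]: "cl t \<in> I" "t \<in> I ==> cl t = t" using \<tau>_pos by (auto simp: cl_def)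

text \<open>Times are clamped to \<open>I\<close>, frequencies to the half-line, and components
  above \<open>J\<close> are 0, because a bounded continuous function has to be given on the whole
  product.\<close>

definition bcf :: "(nat => real => cfun) => (nat \<times> real \<times> real) \<Rightarrow>\<^sub>C complex" where
 "bcf q = Bcontfun (\<lambda>(j, t, x). if j \<le> J then w (cl t) (max 0 x) *\<^sub>R q j (cl t) (max 0 x) else 0)"

lemma bcf_apply:
 assumes q: "!!j. j \<le> J ==> wb \<alpha> (q j)"
 shows "apply_bcontfun (bcf q) (j, t, x) = (if j \<le> J then w (cl t) (max 0 x) *\<^sub>R q j (cl t) (max 0 x) else 0)"
  "norm (bcf q) \<le> \<alpha>"
proof -
 have a: "\<alpha> \<ge> 0" using wbD(3)[where t = 0, OF q[of 0]] \<tau>_pos by simp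
 let ?f = "\<lambda>j z. if j \<le> J then w (cl (fst z)) (max 0 (snd z)) *\<^sub>R q j (cl (fst z)) (max 0 (snd z)) else 0"
 have bd: "norm (?f j z) \<le> \<alpha>" for j z
  using wbD(2)[where x = "max 0 (snd z)", OF q[of j] cl_in(1)[of "fst z"]] a w_pos[of "cl (fst z)" "max 0 (snd z)"]
  by (auto simp: mult.commute abs_of_pos)
 have c: "continuous_on UNIV (?f j)" for j
 proof (cases "j \<le> J")
  case True
  have "continuous_on UNIV (\<lambda>z. w (cl (fst z)) (max 0 (snd z)) *\<^sub>R q j (cl (fst z)) (max 0 (snd z)))" unfolding cl_def
   by (intro continuous_intros continuous_on_pair_compose[of I "{0..}" "q j"]) (use q[OF True] \<tau>_pos in \<open>auto simp: wb_def\<close>)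
  with True show ?thesis by simp
 qed auto
 have bd': "norm ((\<lambda>(j, z). ?f j z) y) \<le> \<alpha>" for y using bd[of "fst y" "snd y"] by (simp only: case_prod_unfold)
 have "(\<lambda>(j, z). ?f j z) \<in> bcontfun" by (rule bcontfun_normI[OF continuous_on_nat_prod[OF c] bd'])
 then have eq: "apply_bcontfun (bcf q) = (\<lambda>(j, z). ?f j z)"
  unfolding bcf_def by (subst Bcontfun_inverse[symmetric]) (auto simp: case_prod_unfold)
 then show "apply_bcontfun (bcf q) (j, t, x) = (if j \<le> J then w (cl t) (max 0 x) *\<^sub>R q j (cl t) (max 0 x) else 0)" by simp
 show "norm (bcf q) \<le> \<alpha>" by (rule norm_bound) (simp only: eq bd')
qed

lemma comp_bcf:
 assumes q: "!!j. j \<le> J ==> wb \<alpha> (q j)" and "j \<le> J" "t \<in> I"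
 shows "comp (bcf q) j t x = q j t x" using wbD(1)[OF q[OF assms(2)] assms(3)] assms(2,3) by (auto simp: comp_def bcf_apply(1)[OF q] causal_def)

text \<open>Families in which each component is the derivative of the previous one. The integral form makes this a
closed condition in the uniform norm.\<close>
definition jets :: "real => ((nat \<times> real \<times> real) \<Rightarrow>\<^sub>C complex) set" where
 "jets \<rho> = cball 0 \<rho> \<inter> (\<Inter>j\<in>{..<J}. \<Inter>t\<in>I. \<Inter>x\<in>{0..}.
  {F. comp F j t x - comp F j t 0 = integral {0..x} (comp F (Suc j) t)})"

lemma closed_jets: "closed (jets \<rho>)" unfolding jets_def
proof (intro closed_Int closed_cball closed_INT ballI)
 fix j t and x :: real assume x: "x \<in> {0..}"
 have 1: "continuous_on UNIV (\<lambda>F. comp F j t x - comp F j t 0)"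
 proof -
  have "bounded_linear (\<lambda>F :: (nat \<times> real \<times> real) \<Rightarrow>\<^sub>C complex. apply_bcontfun F z)" for z
   by (rule bounded_linear_intro[where K = 1]) (auto intro: norm_bounded)
  note c = linear_continuous_on[OF this]
  have "continuous_on UNIV (\<lambda>F :: (nat \<times> real \<times> real) \<Rightarrow>\<^sub>C complex. (1 / w t x) *\<^sub>R apply_bcontfun F (j, t, x) - (1 / w t 0) *\<^sub>R apply_bcontfun F (j, t, 0))"
   by (intro continuous_on_diff continuous_on_scaleR continuous_on_const c)
  then show ?thesis using x unfolding comp_def by simp
 qed
 have "bounded_linear (\<lambda>F :: (nat \<times> real \<times> real) \<Rightarrow>\<^sub>C complex. integral {0..x} (\<lambda>y. (1 / w t y) *\<^sub>R apply_bcontfun F (Suc j, t, y)))"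
  by (rule bounded_linear_integral_bcontfun) (auto intro!: continuous_intros)
 then have 2: "continuous_on UNIV (\<lambda>F. integral {0..x} (comp F (Suc j) t))"
 proof -
  assume "bounded_linear (\<lambda>F :: (nat \<times> real \<times> real) \<Rightarrow>\<^sub>C complex. integral {0..x} (\<lambda>y. (1 / w t y) *\<^sub>R apply_bcontfun F (Suc j, t, y)))"
  moreover have "integral {0..x} (comp F (Suc j) t) = integral {0..x} (\<lambda>y. (1 / w t y) *\<^sub>R apply_bcontfun F (Suc j, t, y))" for F
   by (rule integral_cong) (simp add: comp_def)
  ultimately show ?thesis by (simp add: linear_continuous_on)
 qed
 show "closed {F. comp F j t x - comp F j t 0 = integral {0..x} (comp F (Suc j) t)}" by (rule closed_Collect_eq[OF 1 2])
qed

lemma comp_slice_continuous: "t \<in> I ==> continuous_on {0..} (comp F j t)" by (rule hc_slice_continuous[OF wb_hc[OF comp_wb]])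

lemma jets_derivative:
 assumes "F \<in> jets \<rho>" "j < J" "t \<in> I" "x \<ge> 0"
 shows "(comp F j t hvd comp F (Suc j) t x) (at_half x)"
proof -
 have eq: "comp F j t y = comp F j t 0 + integral {0..y} (comp F (Suc j) t)" if "y \<ge> 0" for y
 proof -
  have "comp F j t y - comp F j t 0 = integral {0..y} (comp F (Suc j) t)" using assms that unfolding jets_def by blast
  then show ?thesis by (simp only: diff_eq_eq add.commute)
 qed
 have "((\<lambda>u. comp F j t 0 + integral {0..u} (comp F (Suc j) t)) hvd 0 + comp F (Suc j) t x) (at x within {0..x+1})"
  by (intro has_vector_derivative_add has_vector_derivative_const integral_has_vector_derivative
    continuous_on_subset[OF comp_slice_continuous[OF assms(3)]]) (use assms in auto)
 then have "((\<lambda>u. comp F j t 0 + integral {0..u} (comp F (Suc j) t)) hvd comp F (Suc j) t x) (at_half x)"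
  using at_within_atLeast_Icc[of x "x+1"] by simp
 note D = this
 have eq': "comp F j t y = comp F j t 0 + integral {0..y} (comp F (Suc j) t)" if "y \<in> {0..}" for y using eq[of y] that by simp
 have "x \<in> {0..}" using assms(4) by simp
 then show ?thesis by (rule has_vector_derivative_transform[OF _ eq' D])
qed

text \<open>The radius is twice the size 2^J C B of the linear part. The smallness condition is used
  twice: it keeps the quadratic part below the linear one, and it makes 1/2 a Lipschitz
  constant.\<close>

lemma fixed_point:
 assumes B: "B > 0" and d: "data B d"
  and \<rho>: "\<rho> = 2 ^ Suc J * C*B" and small: "(12*pi+J)*\<rho>^2*(1/(\<kappa>-1)+J*\<tau>) \<le> B/2"
 obtains q where "!!j. j \<le> J ==> hc I (q j)"
  "!!j t x. j < J ==> t \<in> I ==> x \<ge> 0 ==> (q j t hvd q (Suc j) t x) (at_half x)"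
  "!!j t x. j \<le> J ==> t \<in> I ==> q j t x = Phi d q j t x"
proof -
 define \<delta> where "\<delta> = 1/(\<kappa>-1) + real J * \<tau>"
 have \<delta>: "\<delta> \<ge> 0" using \<kappa> \<tau>_pos by (simp add: \<delta>_def)
 have \<rho>0: "\<rho> > 0" unfolding \<rho> using B C by simp
 define T where "T F = bcf (Phi d (comp F))" for F
 have wbc: "wb \<rho> (comp F j)" if "F \<in> jets \<rho>" for F j using wb_mono[OF comp_wb, of F \<rho> j] that by (simp add: jets_def)
 have wbP: "wb \<rho> (Phi d (comp F) j)" if "F \<in> jets \<rho>" "j \<le> J" for F j
 proof (rule wb_mono[OF Phi_bound[OF wbc[OF that(1)] d that(2)]])
  have "2^J*C*(B+(12*pi + real J)*\<rho>*\<rho>*(1/(\<kappa>-1) + real J * \<tau>)) \<le> 2^J*C*(B+B)"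
  proof (intro mult_left_mono add_left_mono)
   have "(12*pi + real J)*\<rho>*\<rho>*(1/(\<kappa>-1) + real J * \<tau>) = (12*pi+J)*\<rho>^2*(1/(\<kappa>-1)+J*\<tau>)"
    by (simp add: power2_eq_square)
   then show "(12*pi + real J)*\<rho>*\<rho>*(1/(\<kappa>-1) + real J * \<tau>) \<le> B" using small B by linarith
  qed (use C in auto)
  then show "2^J*C*(B+(12*pi + real J)*\<rho>*\<rho>*(1/(\<kappa>-1) + real J * \<tau>)) \<le> \<rho>" by (simp add: \<rho>)
 qed
 have "\<exists>!F\<in>jets \<rho>. T F = F"
 proof (rule Banach_fix[OF complete_closed_subset[OF closed_jets subset_UNIV complete_bcontfun], where c = "1/2"])
  have "comp 0 j t = (\<lambda>_. 0)" for j t by (simp add: comp_def fun_eq_iff zero_bcontfun.rep_eq)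
  then have "0 \<in> jets \<rho>" using \<rho>0 by (auto simp: jets_def)
  then show "jets \<rho> \<noteq> {}" by blast
  show "T ` jets \<rho> \<subseteq> jets \<rho>"
  proof (intro subsetI, elim imageE)
   fix G F assume G: "G = T F" and F: "F \<in> jets \<rho>"
   have cP: "comp (T F) j t x = Phi d (comp F) j t x" if "j \<le> J" "t \<in> I" for j t x unfolding T_def by (rule comp_bcf[OF wbP[OF F] that])
   have "norm (T F) \<le> \<rho>" unfolding T_def by (rule bcf_apply(2)[OF wbP[OF F]])
   moreover have "comp (T F) j t x - comp (T F) j t 0 = integral {0..x} (comp (T F) (Suc j) t)"
    if "j < J" "t \<in> I" "x \<ge> 0" for j t x
   proof -
    have "(Phi d (comp F) (Suc j) t has_integral (Phi d (comp F) j t x - Phi d (comp F) j t 0)) {0..x}"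
    proof (rule fundamental_theorem_of_calculus)
     fix y assume y: "y \<in> {0..x}"
     have "(Phi d (comp F) j t hvd Phi d (comp F) (Suc j) t y) (at y within {0..})" using that y jets_derivative[OF F] d
      by (intro Phi_has_derivative[where q = "comp F"]) (auto intro: wb_hc comp_wb)
     then show "(Phi d (comp F) j t hvd Phi d (comp F) (Suc j) t y) (at y within {0..x})"
      by (rule has_vector_derivative_within_subset) auto
    qed (use that in auto)
    then have "integral {0..x} (Phi d (comp F) (Suc j) t) = Phi d (comp F) j t x - Phi d (comp F) j t 0" by (rule integral_unique)
    moreover have "comp (T F) (Suc j) t = Phi d (comp F) (Suc j) t" using cP that by (auto simp: fun_eq_iff)
    ultimately show ?thesis using cP that by simp
   qed
   ultimately show "G \<in> jets \<rho>" by (auto simp: jets_def G)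
  qed
  fix F G assume F: "F \<in> jets \<rho>" and G: "G \<in> jets \<rho>"
  have df: "wb (norm (F-G)) (\<lambda>t x. comp F j t x - comp G j t x)" for j
  proof -
   have "comp (F-G) j = (\<lambda>t x. comp F j t x - comp G j t x)" by (simp add: fun_eq_iff comp_diff)
   with comp_wb[of "F-G" j] show ?thesis by simp
  qed
  have pt: "norm (apply_bcontfun (T F - T G) z) \<le> 1/2 * norm (F-G)" for z
  proof -
   obtain j t x where z: "z = (j, t, x)" by (cases z) auto
   show ?thesis
   proof (cases "j \<le> J")
    case True
    let ?t = "cl t" and ?x = "max 0 x"
    have "apply_bcontfun (T F - T G) z = w ?t ?x *\<^sub>R (Phi d (comp F) j ?t ?x - Phi d (comp G) j ?t ?x)"
     using True unfolding z T_def by (simp add: bcf_apply(1)[OF wbP[OF F]] bcf_apply(1)[OF wbP[OF G]] scaleR_diff_right)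
    then have "norm (apply_bcontfun (T F - T G) z) = norm (Phi d (comp F) j ?t ?x - Phi d (comp G) j ?t ?x) * w ?t ?x"
     using w_pos[of ?t ?x] by (simp add: abs_of_pos)
    also have "... \<le> 2^J*C*(2*(12*pi+J)*\<rho> * norm (F-G))*(1/(\<kappa>-1)+J*\<tau>)"
     by (rule Phi_diff_bound[OF wbc[OF F] wbc[OF G] df True]) (assumption | rule cl_in(1) max.cobounded1)+
    \<comment> \<open>The factor 2^(J+1) C is \<rho> / B, after which the smallness condition gives
      1/2.\<close>
    also have "... = (2 ^ Suc J * C*B)*(12*pi+J)*\<rho>*\<delta>/B * norm (F-G)" using B by (simp add: \<delta>_def)
    also have "... = ((12*pi+J)*\<rho>^2*\<delta>)/B * norm (F-G)" by (simp only: \<rho>[symmetric]) (simp add: power2_eq_square mult_ac)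
    also have "... \<le> (B/2)/B * norm (F-G)" using small B unfolding \<delta>_def by (intro mult_right_mono divide_right_mono) auto
    finally show ?thesis using B by simp
   next
    case False
    then show ?thesis unfolding z T_def by (simp add: bcf_apply(1)[OF wbP[OF F]] bcf_apply(1)[OF wbP[OF G]])
   qed
  qed
  show "dist (T F) (T G) \<le> 1/2 * dist F G" unfolding dist_norm by (rule norm_bound) (rule pt)
 qed auto
 then obtain F where F: "F \<in> jets \<rho>" "T F = F" by blast
 show ?thesis
 proof (rule that[of "comp F"])
  show "hc I (comp F j)" for j by (rule wb_hc[OF comp_wb])
  show "comp F j t x = Phi d (comp F) j t x" if "j \<le> J" "t \<in> I" for j t x
  proof -
   have "comp (T F) j t x = Phi d (comp F) j t x" unfolding T_def by (rule comp_bcf[OF wbP[OF F(1)] that])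
   then show ?thesis by (simp add: F(2))
  qed
 qed (rule jets_derivative[OF F(1)])
qed

lemma fixed_point_flow:
 assumes q: "!!j. j \<le> J ==> hc I (q j)"
  and der: "!!j t x. j < J ==> t \<in> I ==> x \<ge> 0 ==> (q j t hvd q (Suc j) t x) (at_half x)"
  and fp: "!!j t x. j \<le> J ==> t \<in> I ==> q j t x = Phi d q j t x"
 shows "hcd I J (q 0)" "flow I (q 0) (q 0)" "x \<ge> 0 ==> q 0 0 x = d 0 x"
proof -
 have "hcd I k (q (J-k))" if "k \<le> J" for k using that
 proof (induction k)
  case (Suc k)
  then have "Suc (J - Suc k) = J-k" by simp
  with Suc der[of "J - Suc k"] show ?case by (intro hcd_SucI[where G = "q (J-k)"] q) auto
 qed (use q in auto)
 from this[of J] show "hcd I J (q 0)" by simp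
 show "q 0 0 x = d 0 x" if "x \<ge> 0" using fp[of 0 0 x] that \<tau>_pos by (simp add: Phi_def leibniz_jet_def)
 have hq: "hc I (q 0)" by (rule q) simp
 show "flow I (q 0) (q 0)" unfolding flow_def
 proof (intro conjI ballI allI)
  show "expd I (q 0)" by (rule hcD(1)[OF hq])
  fix t assume t: "t \<in> I"
  show ca: "causal (q 0 t)" by (rule hcD(2)[OF hq t])
  have ed: "edec (q 0 t)" by (rule hcD(4)[OF hq t])
  fix x
  show "((\<lambda>s. q 0 s x) hvd flow_op (q 0 t) (q 0 t) x) (at t within I)"
  proof (cases "x \<ge> 0")
   case False
   have "flow_op (q 0 t) (q 0 t) x = 0" using causal_flow_op[OF ca] False by (simp add: causal_def)
   moreover have "q 0 s x = 0" if "s \<in> I" for s using hcD(2)[OF hq that] False by (simp add: causal_def)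
   ultimately show ?thesis using has_vector_derivative_transform[OF t, of "\<lambda>s. q 0 s x" "\<lambda>_. 0" 0] by simp
  next
   case True
   let ?E = "\<lambda>\<theta>. exp (\<theta> *\<^sub>R (- \<i> * of_real (x^2)))"
   have E: "gauss_jet 0 \<theta> x = ?E \<theta>" for \<theta> by (simp add: scaleR_conv_of_real mult_ac)
   have Ed: "?E (t-r) = ?E t * ?E (- r)" for t r unfolding mult_exp_exp scaleR_left_distrib[symmetric] by simp
   have nc: "continuous_on I (\<lambda>r. nn q 0 r x)" by (rule nn_slice_continuous[OF q]) (use True in auto)
   have c2: "continuous_on I (\<lambda>r. ?E (- r) * nn q 0 r x)" by (intro continuous_intros nc)
   \<comment> \<open>The propagator splits as E (s - r) = E s * E (- r). So s leaves the integrand,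
     and the integral can be differentiated by the fundamental theorem.\<close>
   have eq: "q 0 s x = ?E s * (d 0 x + integral {0..s} (\<lambda>r. ?E (- r) * nn q 0 r x))" if s: "s \<in> I" for s
   proof -
    have "q 0 s x = ?E s * d 0 x + integral {0..s} (\<lambda>r. ?E (s-r) * nn q 0 r x)"
     unfolding fp[of 0 s x, OF le0 s] using True by (simp add: Phi_def leibniz_jet_def E del: gauss_jet.simps)
    also have "integral {0..s} (\<lambda>r. ?E (s-r) * nn q 0 r x) = ?E s * integral {0..s} (\<lambda>r. ?E (- r) * nn q 0 r x)"
     unfolding Ed mult.assoc by simp
    finally show ?thesis by (simp add: distrib_left)
   qed
   have dE: "(?E hvd (- \<i> * of_real (x^2)) * ?E t) (at t within I)"
    by (rule has_vector_derivative_eq_rhs, rule exp_scaleR_has_vector_derivative_right) simp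
   have "((\<lambda>s. ?E s * (d 0 x + integral {0..s} (\<lambda>r. ?E (- r) * nn q 0 r x))) hvd
     ?E t * (0 + ?E (- t) * nn q 0 t x)+((- \<i> * of_real (x^2)) * ?E t)*(d 0 x + integral {0..t} (\<lambda>r. ?E (- r) * nn q 0 r x))) (at t within I)"
    by (intro has_vector_derivative_mult dE has_vector_derivative_add has_vector_derivative_const integral_has_vector_derivative c2 t)
   also have "?E t * (0 + ?E (- t) * nn q 0 t x)+((- \<i> * of_real (x^2)) * ?E t)*(d 0 x + integral {0..t} (\<lambda>r. ?E (- r) * nn q 0 r x))
    = nn q 0 t x + - \<i> * of_real (x^2) * q 0 t x" unfolding eq[OF t] using Ed[of t t] by (simp add: mult.assoc[symmetric])
   also have "... = flow_op (q 0 t) (q 0 t) x" unfolding flow_op_self_alt[OF ed ca True] by (simp add: nn_def QQ_def)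
   finally show ?thesis
    by (intro has_vector_derivative_transform[OF t, of "\<lambda>s. q 0 s x" "\<lambda>s. ?E s * (d 0 x + integral {0..s} (\<lambda>r. ?E (- r) * nn q 0 r x))"])
     (use eq in auto)
  qed
 qed
qed

end

lemma hcd_dx_funpow: "hcd I n F ==> j \<le> n ==> hcd I (n-j) (\<lambda>t. (dx ^^ j) (F t))"
proof (induction j)
 case (Suc j)
 then have "hcd I (Suc (n - Suc j)) (\<lambda>t. (dx ^^ j) (F t))" by (simp add: Suc_diff_Suc)
 from hcd_dx(1)[OF this] show ?case by simp
qed simp

text \<open>The existence time depends on \<open>B\<close>, \<sigma> and \<open>J\<close> only, so
  it is the same for every restart that obeys the a priori bounds.\<close>

lemma local_solution:
 fixes B \<sigma> :: real
 assumes "B > 0" "\<sigma> > 0"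
 obtains \<tau> where "\<tau> > 0"
  "!!q0. hcd {0} J (\<lambda>_. q0) ==> (!!j x. j \<le> J ==> norm ((dx ^^ j) q0 x) \<le> B * decay \<sigma> x) ==>
   \<exists>q. hcd {0..\<tau>} J q \<and> flow {0..\<tau>} q q \<and> q 0 = q0"
proof -
 \<comment> \<open>Half of the rate pays for the factor 1 + x^2 of the weight, at the price of the
   constant 1 + 2/\<sigma>'^2.\<close>
 define \<sigma>' where "\<sigma>' = \<sigma>/2"
 define B' where "B' = B*(1+2/\<sigma>'^2)"
 have s': "\<sigma>' > 0" using assms by (simp add: \<sigma>'_def)
 have B': "B' > 0" unfolding B'_def using assms s' by (intro mult_pos_pos add_pos_nonneg) auto
 obtain C where C: "C \<ge> 1" "!!i \<theta> x. i \<le> J ==> \<theta> \<in> {0..1} ==> x \<ge> 0 ==> norm (gauss_jet i \<theta> x) \<le> C * exp (\<theta>*x)"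
  using gauss_jet_bound[of J] by metis
 define \<rho> where "\<rho> = 2 ^ Suc J * C*B'"
 have \<rho>: "\<rho> > 0" unfolding \<rho>_def using C B' by simp
 define D where "D = (12*pi+J)*\<rho>^2"
 have D: "D > 0" unfolding D_def using \<rho> pi_gt_zero by (intro mult_pos_pos add_pos_nonneg) auto
 \<comment> \<open>The target for 1/(\<kappa> - 1) + J \<tau>: it makes the quadratic part D
   \<epsilon> = B'/2.\<close>
 define \<epsilon> where "\<epsilon> = B'/(2*D)"
 have \<epsilon>: "\<epsilon> > 0" using B' D by (simp add: \<epsilon>_def)
 \<comment> \<open>The summands secure \<kappa> \<ge> 2, the target \<epsilon>, and \<tau> \<le> 1
   through \<kappa> \<ge> \<sigma>'.\<close>
 define \<kappa> where "\<kappa> = 2+(1+J*\<sigma>')/\<epsilon>+\<sigma>'"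
 define \<tau> where "\<tau> = \<sigma>'/(2*\<kappa>)"
 have Je: "(1+J*\<sigma>')/\<epsilon> \<ge> 0" using s' \<epsilon> by simp
 have kk: "\<kappa> \<ge> 2" "\<kappa> \<ge> \<sigma>'" "\<kappa>-1 \<ge> (1+J*\<sigma>')/\<epsilon>" using Je s' by (auto simp: \<kappa>_def)
 have \<tau>1: "\<tau> \<le> 1" using kk by (simp add: \<tau>_def divide_le_eq)
 interpret picard \<sigma>' \<kappa> \<tau> C J by unfold_locales (use s' kk \<tau>1 C in \<open>auto simp: \<tau>_def\<close>)
 have "1/(\<kappa>-1)+J*\<tau> \<le> (1+J*\<sigma>')/(\<kappa>-1)"
 proof -
  have "\<tau> \<le> \<sigma>'/(\<kappa>-1)" unfolding \<tau>_def using kk s' by (intro divide_left_mono) auto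
  then have "J*\<tau> \<le> J*(\<sigma>'/(\<kappa>-1))" by (intro mult_left_mono) auto
  then show ?thesis by (simp add: add_divide_distrib)
 qed
 also have "... \<le> \<epsilon>"
 proof -
  have "1+J*\<sigma>' \<le> \<epsilon>*(\<kappa>-1)" using kk(3) \<epsilon> by (simp add: pos_divide_le_eq mult.commute)
  then show ?thesis by (subst pos_divide_le_eq) (use kk in auto)
 qed
 finally have "D*(1/(\<kappa>-1)+J*\<tau>) \<le> D*\<epsilon>" using D by (intro mult_left_mono) auto
 then have small: "(12*pi+J)*\<rho>^2*(1/(\<kappa>-1)+J*\<tau>) \<le> B'/2" using D by (simp add: D_def[symmetric] \<epsilon>_def)
 show ?thesis
 proof (rule that[OF \<tau>_pos])
  fix q0 assume h: "hcd {0} J (\<lambda>_. q0)" and b: "!!j x. j \<le> J ==> norm ((dx ^^ j) q0 x) \<le> B * decay \<sigma> x"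
  define d where "d j = (dx ^^ j) q0" for j
  have hj: "hcd {0} (J-j) (\<lambda>_. d j)" if "j \<le> J" for j using hcd_dx_funpow[OF h that] by (simp add: d_def)
  have dat: "data B' d" unfolding data_def
  proof (intro conjI allI impI)
   fix j assume j: "j \<le> J"
   show "continuous_on {0..} (d j)" using hc_slice_continuous[OF hcd_hc[OF hj[OF j]], of 0] by simp
   fix x :: real assume x: "x \<ge> 0"
   have e: "x^2 \<le> 2/\<sigma>'^2 * exp (\<sigma>'*x)"
    using power_div_fact_le_exp[of "\<sigma>'*x" 2] s' x by (simp add: power_mult_distrib field_simps fact_2)
   have e': "1 \<le> exp (\<sigma>'*x)" using s' x by simp
   have "1+x^2 \<le> (1+2/\<sigma>'^2) * exp (\<sigma>'*x)" unfolding distrib_right using e e' by linarith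
   then have "(1+x^2) * exp (\<sigma>'*x) \<le> (1+2/\<sigma>'^2) * exp (\<sigma>'*x) * exp (\<sigma>'*x)" by (rule mult_right_mono) simp
   also have "... = (1+2/\<sigma>'^2) * exp (\<sigma>*x)" by (simp add: mult.assoc mult_exp_exp \<sigma>'_def)
   finally have "norm (d j x) * ((1+x^2) * exp (\<sigma>'*x)) \<le> (B * decay \<sigma> x)*((1+2/\<sigma>'^2) * exp (\<sigma>*x))"
    unfolding d_def by (rule mult_mono[OF b[OF j]]) (use assms in auto)
   also have "... = B'*(decay \<sigma> x * exp (\<sigma>*x))" by (simp add: B'_def)
   also have "decay \<sigma> x * exp (\<sigma>*x) = 1" using x by (simp add: mult_exp_exp)
   finally show "norm (d j x) * ((1+x^2) * exp (\<sigma>'*x)) \<le> B'" by simp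
  next
   fix j x assume j: "j < J" and x: "x \<ge> (0::real)"
   have "hcd {0} (Suc (J - Suc j)) (\<lambda>_. d j)" using hj[of j] j by (simp add: Suc_diff_Suc)
   from hcd_dx(2)[OF this, of 0 x] x show "(d j hvd d (Suc j) x) (at_half x)" by (simp add: d_def)
  qed
  show "\<exists>q. hcd {0..\<tau>} J q \<and> flow {0..\<tau>} q q \<and> q 0 = q0"
  proof (rule fixed_point[OF B' dat \<rho>_def small])
   fix q assume q: "!!j. j \<le> J ==> hc {0..\<tau>} (q j)"
    "!!j t x. j < J ==> t \<in> {0..\<tau>} ==> x \<ge> 0 ==> (q j t hvd q (Suc j) t x) (at_half x)"
    "!!j t x. j \<le> J ==> t \<in> {0..\<tau>} ==> q j t x = Phi d q j t x"
   have "q 0 0 = q0"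
   proof
    fix x show "q 0 0 x = q0 x"
    proof (cases "x \<ge> 0")
     case True then show ?thesis using fixed_point_flow(3)[of q d x, OF q] by (simp add: d_def)
    next
     case False
     then show ?thesis using hcD(2)[OF q(1)[of 0], of 0] hcD(2)[OF hcd_hc[OF h], of 0] \<tau>_pos by (simp add: causal_def)
    qed
   qed
   with fixed_point_flow(1,2)[of q d, OF q] show ?thesis by blast
  qed
 qed
qed

section \<open>Global solutions and boundary values\<close>

lemma expd_Un: assumes "expd I F" "expd K F" shows "expd (I \<union> K) F"
proof -
 obtain C \<sigma> where 1: "C > 0" "\<sigma> > 0" "!!t x. t \<in> I ==> norm (F t x) \<le> C * decay \<sigma> x" using expdE[OF assms(1)] by metis
 obtain D \<rho> where 2: "D > 0" "\<rho> > 0" "!!t x. t \<in> K ==> norm (F t x) \<le> D * decay \<rho> x" using expdE[OF assms(2)] by metis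
 show ?thesis
 proof (rule expdI)
  show "meas (F t)" if "t \<in> I \<union> K" for t using that assms by (auto simp: expd_def)
  show "min \<sigma> \<rho> > 0" using 1 2 by simp
  fix t x assume t: "t \<in> I \<union> K"
  have "C * decay \<sigma> x \<le> max C D * decay (min \<sigma> \<rho>) x" "D * decay \<rho> x \<le> max C D * decay (min \<sigma> \<rho>) x"
   using 1 2 by (auto intro!: mult_mono mult_right_mono)
  then show "norm (F t x) \<le> max C D * decay (min \<sigma> \<rho>) x" using t 1(3)[of t x] 2(3)[of t x] by fastforce
 qed
qed

lemma expd_reparam: "expd I F ==> \<phi> ` K \<subseteq> I ==> expd K (\<lambda>t. F (\<phi> t))" unfolding expd_def by (meson image_subset_iff)

lemma hc_Un: assumes "closed I" "closed K" "hc I F" "hc K F" shows "hc (I \<union> K) F"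
proof (rule hcI)
 show "expd (I \<union> K) F" using assms by (intro expd_Un hcD(1))
 show "causal (F t)" if "t \<in> I \<union> K" for t using that assms by (auto simp: hc_def)
 have "continuous_on (I \<times> {0..} \<union> K \<times> {0..}) (\<lambda>(t, x). F t x)"
  by (intro continuous_on_closed_Un closed_Times assms hcD(3)) auto
 then show "continuous_on ((I \<union> K) \<times> {0..}) (\<lambda>(t, x). F t x)" by (simp add: Sigma_Un_distrib1)
qed

lemma hcd_Un: "closed I ==> closed K ==> hcd I n F ==> hcd K n F ==> hcd (I \<union> K) n F"
proof (induction n arbitrary: F)
 case (Suc n)
 note h = hcd_dx[OF Suc.prems(3)] hcd_dx[OF Suc.prems(4)]
 show ?case
 proof (rule hcd_SucI[where G = "\<lambda>t. dx (F t)"])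
  show "hc (I \<union> K) F" by (intro hc_Un Suc.prems hcd_hc[OF Suc.prems(3)] hcd_hc[OF Suc.prems(4)])
  show "hcd (I \<union> K) n (\<lambda>t. dx (F t))" by (intro Suc.IH Suc.prems h)
  show "(F t hvd dx (F t) x) (at_half x)" if "t \<in> I \<union> K" "x \<ge> 0" for t x using that h(2,4) by auto
 qed
qed (simp add: hc_Un)

lemma hc_reparam:
 assumes "hc I F" "\<phi> ` K \<subseteq> I" "continuous_on K \<phi>" shows "hc K (\<lambda>t. F (\<phi> t))"
proof (rule hcI)
 show "expd K (\<lambda>t. F (\<phi> t))" by (rule expd_reparam[OF hcD(1)[OF assms(1)] assms(2)])
 show "causal (F (\<phi> t))" if "t \<in> K" for t using assms that by (auto simp: hc_def)
 have "continuous_on (K \<times> {0..}) (\<lambda>z. (\<phi> (fst z), snd z))" by (intro continuous_intros continuous_on_compose2[OF assms(3)]) auto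
 then have "continuous_on (K \<times> {0..}) (\<lambda>z. (\<lambda>(t, x). F t x) (\<phi> (fst z), snd z))"
  by (rule continuous_on_compose2[OF hcD(3)[OF assms(1)]]) (use assms(2) in auto)
 then show "continuous_on (K \<times> {0..}) (\<lambda>(t, x). F (\<phi> t) x)" by (simp add: case_prod_unfold)
qed

lemma hcd_reparam: "hcd I n F ==> \<phi> ` K \<subseteq> I ==> continuous_on K \<phi> ==> hcd K n (\<lambda>t. F (\<phi> t))"
proof (induction n arbitrary: F)
 case (Suc n)
 note h = hcd_dx[OF Suc.prems(1)]
 show ?case
 proof (rule hcd_SucI[where G = "\<lambda>t. dx (F (\<phi> t))"])
  show "hc K (\<lambda>t. F (\<phi> t))" by (rule hc_reparam[OF hcd_hc[OF Suc.prems(1)] Suc.prems(2,3)])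
  show "hcd K n (\<lambda>t. dx (F (\<phi> t)))" by (intro Suc.IH[where F = "\<lambda>t. dx (F t)"] Suc.prems h)
  show "(F (\<phi> t) hvd dx (F (\<phi> t)) x) (at_half x)" if "t \<in> K" "x \<ge> 0" for t x using that h(2) Suc.prems(2) by auto
 qed
qed (simp add: hc_reparam)

lemma has_vector_derivative_bot: "(f hvd D) bot"
 by (auto simp: has_vector_derivative_def has_derivative_def bounded_linear_scaleR_left)

lemma flow_Un:
 assumes "closed I" "closed K" "flow I p h" "flow K p h" shows "flow (I \<union> K) p h" unfolding flow_def
proof (intro conjI ballI allI)
 show "expd (I \<union> K) h" by (intro expd_Un flowD(1)[OF assms(3)] flowD(1)[OF assms(4)])
 fix t assume t: "t \<in> I \<union> K"
 show "causal (h t)" using t flowD(2)[OF assms(3)] flowD(2)[OF assms(4)] by blast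
 fix x
 have *: "((\<lambda>s. h s x) hvd flow_op (p t) (h t) x) (at t within S)" if "closed S" "flow S p h" for S
 proof (cases "t \<in> S")
  case True then show ?thesis by (rule flowD(4)[OF that(2)])
 next
  case False
  \<comment> \<open>Away from a closed set the filter is trivial, and every derivative statement
    holds.\<close>
  then have "t \<notin> closure (S - {t})" using that(1) by (simp add: closure_closed)
  then have "at t within S = bot" using at_within_eq_bot_iff by blast
  then show ?thesis by (simp only: has_vector_derivative_bot)
 qed
 show "((\<lambda>s. h s x) hvd flow_op (p t) (h t) x) (at t within I \<union> K)"
  using *[OF assms(1,3)] *[OF assms(2,4)] unfolding has_vector_derivative_iff_quotient by (rule Lim_Un)
qed

lemma flow_cong:
 assumes "flow I p h" "!!t. t \<in> I ==> p t = p' t" "!!t. t \<in> I ==> h t = h' t" shows "flow I p' h'" unfolding flow_def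
proof (intro conjI ballI allI)
 show "expd I h'" by (rule expd_cong[OF flowD(1)[OF assms(1)] assms(3)])
 fix t assume t: "t \<in> I"
 show "causal (h' t)" using flowD(2)[OF assms(1) t] assms(3)[OF t] by simp
 show "((\<lambda>s. h' s x) hvd flow_op (p' t) (h' t) x) (at t within I)" for x
  by (rule has_vector_derivative_transform[OF t _ flowD(4)[OF assms(1) t, unfolded assms(2)[OF t] assms(3)[OF t]]])
   (simp add: assms(3))
qed

lemma flow_subset: assumes "flow I p h" "K \<subseteq> I" shows "flow K p h" unfolding flow_def
proof (intro conjI ballI allI)
 show "expd K h" by (rule expd_subset[OF flowD(1)[OF assms(1)] assms(2)])
 fix t assume t: "t \<in> K"
 then have t': "t \<in> I" using assms(2) by blast
 show "causal (h t)" by (rule flowD(2)[OF assms(1) t'])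
 show "((\<lambda>s. h s x) hvd flow_op (p t) (h t) x) (at t within K)" for x
  by (rule has_vector_derivative_within_subset[OF flowD(4)[OF assms(1) t'] assms(2)])
qed

lemma flow_shift:
 assumes "flow {0..b} p h" shows "flow {a..a+b} (\<lambda>t. p (t-a)) (\<lambda>t. h (t-a))" unfolding flow_def
proof (intro conjI ballI allI)
 have im: "(\<lambda>t. t-a) ` {a..a+b} \<subseteq> {0..b}" by auto
 show "expd {a..a+b} (\<lambda>t. h (t-a))" by (rule expd_reparam[OF flowD(1)[OF assms] im])
 fix t assume "t \<in> {a..a+b}"
 then have t: "t-a \<in> {0..b}" by auto
 show "causal (h (t-a))" by (rule flowD(2)[OF assms t])
 fix x
 have "((\<lambda>s. h s x) hvd flow_op (p (t-a)) (h (t-a)) x) (at (t-a) within (\<lambda>t. t-a) ` {a..a+b})"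
  by (rule has_vector_derivative_within_subset[OF flowD(4)[OF assms t] im])
 then have "((\<lambda>s. h s x) \<circ> (\<lambda>t. t-a) hvd (1 *\<^sub>R flow_op (p (t-a)) (h (t-a)) x)) (at t within {a..a+b})"
  by (intro vector_diff_chain_within) (auto intro!: derivative_eq_intros)
 then show "((\<lambda>s. h (s-a) x) hvd flow_op (p (t-a)) (h (t-a)) x) (at t within {a..a+b})" by (simp add: o_def)
qed

section \<open>A priori bounds for derivatives, and continuation\<close>

definition bo_flow :: "nat => real => cfun => (real => cfun) => bool" where
 "bo_flow J s p0 p \<longleftrightarrow> flow {0..s} p p \<and> hcd {0..s} J p \<and> p 0 = p0"

text \<open>\<open>True\<close> stands for \<open>galilei_op\<close> and \<open>False\<close> for \<open>lax_op\<close>.\<close>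
fun word :: "bool list => real => cfun => cfun" where
 "word [] t p = p"
| "word (True # w) t p = galilei_op t p (word w t p)"
| "word (False # w) t p = lax_op p (word w t p)"

text \<open>Each Galilei letter consumes one frequency derivative; Lax letters are free.\<close>

lemma word_flow:
 assumes "flow {a..b} p p" "hcd {a..b} J p" "count_list w True \<le> J"
 shows "flow {a..b} p (\<lambda>t. word w t (p t)) \<and> hcd {a..b} (J - count_list w True) (\<lambda>t. word w t (p t))" using assms(3)
proof (induction w)
 case Nil then show ?case using assms by simp
next
 case (Cons c w)
 show ?case
 proof (cases c)
  case True
  with Cons.prems have le: "Suc (count_list w True) \<le> J" by simp
  with Cons.IH have IH: "flow {a..b} p (\<lambda>t. word w t (p t))" "hcd {a..b} (J - count_list w True) (\<lambda>t. word w t (p t))" by auto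
  have "hcd {a..b} (Suc (J - Suc (count_list w True))) (\<lambda>t. word w t (p t))" using IH(2) le by (simp add: Suc_diff_Suc)
  moreover have "hcd {a..b} 1 (\<lambda>t. word w t (p t))" "hcd {a..b} 1 p" "hcd {a..b} (J - Suc (count_list w True)) p"
   by (rule hcd_mono[OF IH(2)], use le in simp) (rule hcd_mono[OF assms(2)], use le in simp)+
  ultimately show ?thesis using True by (auto intro!: hcd_galilei_op flow_galilei_op assms IH)
 next
  case False
  with Cons have IH: "flow {a..b} p (\<lambda>t. word w t (p t))" "hcd {a..b} (J - count_list w True) (\<lambda>t. word w t (p t))" by auto
  have "hcd {a..b} (J - count_list w True) p" by (rule hcd_mono[OF assms(2)]) simp
  with False IH show ?thesis by (auto intro!: hcd_lax_op flow_lax_op assms)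
 qed
qed

lemma word_initial:
 assumes "hcd {0} J (\<lambda>_. p0)" "count_list w True \<le> J"
 shows "edec (word w 0 p0)"
proof -
 have "hcd {0} (J - count_list w True) (\<lambda>t. word w t p0)" using assms(2)
 proof (induction w)
  case (Cons c w)
  show ?case
  proof (cases c)
   case True
   with Cons have "hcd {0} (Suc (J - Suc (count_list w True))) (\<lambda>t. word w t p0)" by (simp add: Suc_diff_Suc)
   with True show ?thesis by (auto intro!: hcd_galilei_op hcd_mono[OF assms(1)])
  next
   case False
   with Cons show ?thesis by (auto intro!: hcd_lax_op hcd_mono[OF assms(1)])
  qed
 qed (use assms in simp)
 from hcD(4)[OF hcd_hc[OF this], of 0] show ?thesis by simp
qed

lemma dx_linear:
 assumes "hcd {t} (Suc n) (\<lambda>_. f)" "hcd {t} (Suc n) (\<lambda>_. g)"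
 shows "dx (\<lambda>x. a * f x + b * g x) = (\<lambda>x. a * dx f x + b * dx g x)"
proof
 fix x
 show "dx (\<lambda>x. a * f x + b * g x) x = a * dx f x + b * dx g x"
 proof (cases "x \<ge> 0")
  case True
  note d = hcd_dx(2)[OF assms(1) _ True, of t] hcd_dx(2)[OF assms(2) _ True, of t]
  show ?thesis by (rule dx_eqI[OF True]) (intro has_vector_derivative_add has_vector_derivative_mult_right d singletonI)
 qed (simp add: dx_def)
qed

lemma dx_funpow_linear:
 assumes "hcd {t} n (\<lambda>_. f)" "hcd {t} n (\<lambda>_. g)" "j \<le> n"
 shows "(dx ^^ j) (\<lambda>x. a * f x + b * g x) = (\<lambda>x. a*(dx ^^ j) f x + b*(dx ^^ j) g x)" using assms(3)
proof (induction j)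
 case (Suc j)
 have "hcd {t} (Suc (n - Suc j)) (\<lambda>_. (dx ^^ j) f)" "hcd {t} (Suc (n - Suc j)) (\<lambda>_. (dx ^^ j) g)"
  using hcd_dx_funpow[OF assms(1), of j] hcd_dx_funpow[OF assms(2), of j] Suc.prems by (auto simp: Suc_diff_Suc)
 from dx_linear[OF this, of a b] Suc show ?case by simp
qed simp

text \<open>The Galilei operator solved for the derivative: decay of \<open>A h\<close> and
  \<open>L h\<close> gives decay of h'.\<close>

lemma dx_galilei_op: "dx h = (\<lambda>x. - \<i> * galilei_op t p h x + (- 2*\<i> * of_real t) * lax_op p h x)"
 by (simp add: galilei_op_def fun_eq_iff algebra_simps)

text \<open>The derivative of a word is a combination of the two words with one more letter, so j
  derivatives reduce to words with j more letters and no derivative. Those solve the linear flow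
  with initial values that depend on \<open>p0\<close> alone, and \<open>flow_apriori\<close> bounds
  them uniformly over all solutions.\<close>

lemma word_derivative_bound:
 assumes p0: "hcd {0} J (\<lambda>_. p0)" and T: "T \<ge> 0"
 shows "count_list w True + j \<le> J ==> \<exists>B \<sigma>. B > 0 \<and> \<sigma> > 0 \<and> (\<forall>s p t x. s \<le> T \<longrightarrow> bo_flow J s p0 p \<longrightarrow> t \<in> {0..s} \<longrightarrow>
  norm ((dx ^^ j) (word w t (p t)) x) \<le> B * decay \<sigma> x)"
proof (induction j arbitrary: w)
 case 0
 then have c: "count_list w True \<le> J" by simp
 have e0: "edec p0" using hcD(4)[OF hcd_hc[OF p0]] by simp
 obtain B \<sigma> where B: "B > 0" "\<sigma> > 0"
  "!!s p h t x. s \<le> T ==> flow {0..s} p p ==> flow {0..s} p h ==> p 0 = p0 ==> h 0 = word w 0 p0 ==> t \<in> {0..s} ==>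
   norm (h t x) \<le> B * decay \<sigma> x" by (rule flow_apriori[OF e0 word_initial[OF p0 c] T]) blast
 have "norm (word w t (p t) x) \<le> B * decay \<sigma> x" if "s \<le> T" "bo_flow J s p0 p" "t \<in> {0..s}" for s p t x
 proof (rule B(3)[of s p "\<lambda>t. word w t (p t)", OF that(1) _ _ _ _ that(3)])
  show "flow {0..s} p p" "p 0 = p0" using that(2) by (auto simp: bo_flow_def)
  then show "word w 0 (p 0) = word w 0 p0" by simp
  show "flow {0..s} p (\<lambda>t. word w t (p t))" using word_flow[of 0 s p J w] that(2) c by (auto simp: bo_flow_def)
 qed
 with B(1,2) show ?case by (intro exI[of _ B] exI[of _ \<sigma>]) auto
next
 case (Suc j)
 from Suc.IH[of "True # w"] Suc.prems obtain B \<sigma> where A: "B > 0" "\<sigma> > 0"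
  "!!s p t x. s \<le> T ==> bo_flow J s p0 p ==> t \<in> {0..s} ==> norm ((dx ^^ j) (galilei_op t (p t) (word w t (p t))) x) \<le> B * decay \<sigma> x"
  by auto
 from Suc.IH[of "False # w"] Suc.prems obtain C \<rho> where L: "C > 0" "\<rho> > 0"
  "!!s p t x. s \<le> T ==> bo_flow J s p0 p ==> t \<in> {0..s} ==> norm ((dx ^^ j) (lax_op (p t) (word w t (p t))) x) \<le> C * decay \<rho> x"
  by auto
 have "norm ((dx ^^ Suc j) (word w t (p t)) x) \<le> (B+2*T*C) * decay (min \<sigma> \<rho>) x"
  if s: "s \<le> T" "bo_flow J s p0 p" "t \<in> {0..s}" for s p t x
 proof -
  let ?f = "galilei_op t (p t) (word w t (p t))" and ?g = "lax_op (p t) (word w t (p t))"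
  have fl: "flow {0..s} p p" "hcd {0..s} J p" using s(2) by (auto simp: bo_flow_def)
  have "hcd {0..s} (J - Suc (count_list w True)) (\<lambda>t. word (True # w) t (p t))" using word_flow[OF fl, of "True # w"] Suc.prems by simp
  then have f: "hcd {0} (J - Suc (count_list w True)) (\<lambda>_. ?f)"
   using hcd_reparam[where \<phi> = "\<lambda>_. t" and K = "{0}"] s(3) by fastforce
  have "hcd {0..s} (J - count_list w True) (\<lambda>t. word (False # w) t (p t))" using word_flow[OF fl, of "False # w"] Suc.prems by simp
  then have "hcd {0} (J - count_list w True) (\<lambda>_. ?g)" using hcd_reparam[where \<phi> = "\<lambda>_. t" and K = "{0}"] s(3) by fastforce
  then have g: "hcd {0} (J - Suc (count_list w True)) (\<lambda>_. ?g)" by (rule hcd_mono) simp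
  have "(dx ^^ Suc j) (word w t (p t)) = (dx ^^ j) (\<lambda>x. - \<i> * ?f x + (- 2*\<i> * of_real t) * ?g x)"
   by (simp only: funpow_Suc_right o_def dx_galilei_op[of "word w t (p t)" t "p t", symmetric])
  also have "... = (\<lambda>x. - \<i>*(dx ^^ j) ?f x + (- 2*\<i> * of_real t)*(dx ^^ j) ?g x)"
   by (rule dx_funpow_linear[OF f g]) (use Suc.prems in simp)
  finally have "norm ((dx ^^ Suc j) (word w t (p t)) x) = norm (- \<i>*(dx ^^ j) ?f x + (- 2*\<i> * of_real t)*(dx ^^ j) ?g x)" by simp
  also have "... \<le> norm ((dx ^^ j) ?f x) + 2*t * norm ((dx ^^ j) ?g x)"
   by (rule order_trans[OF norm_triangle_ineq]) (use s(3) in \<open>simp add: norm_mult\<close>)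
  also have "... \<le> B * decay \<sigma> x + 2*T*(C * decay \<rho> x)"
   using A(1,2) L(1,2) s T by (intro add_mono mult_mono A(3)[OF s] L(3)[OF s]) auto
  also have "... \<le> B * decay (min \<sigma> \<rho>) x + 2*T*(C * decay (min \<sigma> \<rho>) x)"
   using A(1,2) L(1,2) T by (intro add_mono mult_left_mono) (auto intro!: mult_right_mono)
  finally show ?thesis by (simp add: algebra_simps)
 qed
 moreover have "B+2*T*C > 0" using A L T by (intro add_pos_nonneg) auto
 ultimately show ?case using A(2) L(2) by (intro exI[of _ "B+2*T*C"] exI[of _ "min \<sigma> \<rho>"]) auto
qed

lemma apriori_derivatives:
 assumes p0: "hcd {0} J (\<lambda>_. p0)" and T: "T \<ge> 0"
 obtains B \<sigma> where "B > 0" "\<sigma> > 0"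
  "!!s p t x j. s \<le> T ==> bo_flow J s p0 p ==> t \<in> {0..s} ==> j \<le> J ==> norm ((dx ^^ j) (p t) x) \<le> B * decay \<sigma> x"
proof -
 have "\<exists>B \<sigma>. B > 0 \<and> \<sigma> > 0 \<and> (\<forall>s p t x. s \<le> T \<longrightarrow> bo_flow J s p0 p \<longrightarrow> t \<in> {0..s} \<longrightarrow>
  norm ((dx ^^ j) (p t) x) \<le> B * decay \<sigma> x)" if "j \<le> J" for j using word_derivative_bound[OF p0 T, of "[]" j] that by simp
 then obtain B \<sigma> where B: "!!j. j \<le> J ==> B j > 0" "!!j. j \<le> J ==> \<sigma> j > 0"
  "!!j s p t x. j \<le> J ==> s \<le> T ==> bo_flow J s p0 p ==> t \<in> {0..s} ==> norm ((dx ^^ j) (p t) x) \<le> B j * exp (- \<sigma> j * \<bar>x\<bar>)"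
  by metis
 define B' where "B' = Max (B ` {..J})"
 define \<sigma>' where "\<sigma>' = Min (\<sigma> ` {..J})"
 have le: "B j \<le> B'" "\<sigma>' \<le> \<sigma> j" if "j \<le> J" for j using that by (auto simp: B'_def \<sigma>'_def)
 have "B' > 0" using less_le_trans[OF B(1)[of 0] le(1)[of 0]] by simp
 moreover have "\<sigma>' > 0" using B(2) by (auto simp: \<sigma>'_def)
 ultimately show ?thesis
 proof (rule that)
  fix s p t x j assume h: "s \<le> T" "bo_flow J s p0 p" "t \<in> {0..s}" "j \<le> J"
  have "norm ((dx ^^ j) (p t) x) \<le> B j * exp (- \<sigma> j * \<bar>x\<bar>)" by (rule B(3)[OF h(4,1,2,3)])
  also have "... \<le> B' * decay \<sigma>' x" using le[OF h(4)] \<open>B' > 0\<close> by (intro mult_mono) (auto intro: mult_right_mono)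
  finally show "norm ((dx ^^ j) (p t) x) \<le> B' * decay \<sigma>' x" .
 qed
qed

lemma bo_flow_subset: "bo_flow J s p0 p ==> 0 \<le> r ==> r \<le> s ==> bo_flow J r p0 p"
 unfolding bo_flow_def by (auto intro: flow_subset hcd_subset)

text \<open>The equation does not depend on time explicitly, so a shifted solution can be appended.
  At the joint both one-sided equations hold, which is the equation within the union.\<close>

lemma bo_flow_append:
 assumes p: "bo_flow J s p0 p" and q: "bo_flow J \<tau> (p s) q" and s: "s \<ge> 0" "\<tau> \<ge> 0"
 shows "bo_flow J (s+\<tau>) p0 (\<lambda>t. if t \<le> s then p t else q (t-s))" (is "bo_flow _ _ _ ?r")
proof -
 have eq1: "p t = ?r t" if "t \<in> {0..s}" for t using that by simp
 have eq2: "q (t-s) = ?r t" if "t \<in> {s..s+\<tau>}" for t using that q by (auto simp: bo_flow_def fun_eq_iff)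
 have un: "{0..s+\<tau>} = {0..s} \<union> {s..s+\<tau>}" using s by auto
 have f1: "flow {0..s} ?r ?r" by (rule flow_cong[of _ p p]) (use p in \<open>auto simp: bo_flow_def\<close>)
 have "flow {s..s+\<tau>} (\<lambda>t. q (t-s)) (\<lambda>t. q (t-s))" using q by (intro flow_shift) (simp add: bo_flow_def)
 then have f2: "flow {s..s+\<tau>} ?r ?r" by (rule flow_cong) (rule eq2, assumption)+
 have h1: "hcd {0..s} J ?r" by (rule hcd_cong[of _ _ p]) (use p in \<open>auto simp: bo_flow_def\<close>)
 have "hcd {s..s+\<tau>} J (\<lambda>t. q (t-s))"
  by (rule hcd_reparam[of "{0..\<tau>}"]) (use q in \<open>auto simp: bo_flow_def intro!: continuous_intros\<close>)
 then have h2: "hcd {s..s+\<tau>} J ?r" by (rule hcd_cong) (rule eq2)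
 show ?thesis unfolding bo_flow_def un using flow_Un[OF _ _ f1 f2] hcd_Un[OF _ _ h1 h2] p s by (auto simp: bo_flow_def)
qed

text \<open>The a priori bounds hold for every solution up to time \<open>T\<close>. Hence one step
  length \<tau> serves all restarts, and finitely many steps reach \<open>T\<close>.\<close>

lemma bo_flow_extend:
 assumes p0: "hcd {0} J (\<lambda>_. p0)" and p: "bo_flow J s p0 p" and "0 \<le> s" "s \<le> T"
 obtains q where "bo_flow J T p0 q" "!!t. t \<le> s ==> q t = p t"
proof -
 have T: "T \<ge> 0" using assms by simp
 obtain B \<sigma> where B: "B > 0" "\<sigma> > 0"
  "!!s p t x j. s \<le> T ==> bo_flow J s p0 p ==> t \<in> {0..s} ==> j \<le> J ==> norm ((dx ^^ j) (p t) x) \<le> B * decay \<sigma> x"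
  using apriori_derivatives[OF p0 T] by metis
 obtain \<tau> where \<tau>: "\<tau> > 0"
  "!!q0. hcd {0} J (\<lambda>_. q0) ==> (!!j x. j \<le> J ==> norm ((dx ^^ j) q0 x) \<le> B * decay \<sigma> x) ==>
   \<exists>q. hcd {0..\<tau>} J q \<and> flow {0..\<tau>} q q \<and> q 0 = q0" using local_solution[OF B(1,2)] by metis
 have "\<exists>q. bo_flow J (min T (s + real k * \<tau>)) p0 q \<and> (\<forall>t\<le>s. q t = p t)" for k
 proof (induction k)
  case 0 show ?case using p assms by (intro exI[of _ p]) (simp add: min_absorb2)
 next
  case (Suc k)
  then obtain q where q: "bo_flow J (min T (s + real k * \<tau>)) p0 q" "\<forall>t\<le>s. q t = p t" by blast
  define r where "r = min T (s + real k * \<tau>)"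
  have r: "0 \<le> r" "r \<le> T" "s \<le> r" using assms \<tau> by (auto simp: r_def)
  have q': "bo_flow J r p0 q" using q(1) by (simp add: r_def)
  have "hcd {0} J (\<lambda>_. q r)"
   using hcd_reparam[where \<phi> = "\<lambda>_. r" and K = "{0}" and F = q and I = "{0..r}"] q' r by (auto simp: bo_flow_def)
  from \<tau>(2)[OF this B(3)[OF r(2) q']] r obtain q2 where "bo_flow J \<tau> (q r) q2" by (auto simp: bo_flow_def)
  from bo_flow_append[OF q' this] r \<tau>
  have *: "bo_flow J (r+\<tau>) p0 (\<lambda>t. if t \<le> r then q t else q2 (t-r))" by simp
  show ?case
  proof (intro exI[of _ "\<lambda>t. if t \<le> r then q t else q2 (t-r)"] conjI)
   show "bo_flow J (min T (s + real (Suc k) * \<tau>)) p0 (\<lambda>t. if t \<le> r then q t else q2 (t-r))"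
    by (rule bo_flow_subset[OF *]) (use assms \<tau> in \<open>auto simp: r_def min_def algebra_simps\<close>)
  qed (use q(2) r in auto)
 qed
 moreover obtain k where "T-s \<le> real k * \<tau>" using reals_Archimedean3[OF \<tau>(1)] less_imp_le by blast
 then have "min T (s + real k * \<tau>) = T" by simp
 ultimately show ?thesis using that by metis
qed

lemma global_half_line:
 assumes p0: "hcd {0} J (\<lambda>_. p0)"
 obtains p where "!!s. s \<ge> 0 ==> bo_flow J s p0 p"
proof -
 have "\<exists>f. \<forall>n. bo_flow J (real n) p0 (f n) \<and> (\<forall>t\<le>real n. f (Suc n) t = f n t)"
 proof (rule dependent_nat_choice)
  \<comment> \<open>On a one-point interval the differential equation is vacuous.\<close>
  have "at 0 within {0..0::real} = bot" using at_within_eq_bot_iff[of 0 "{0..0::real}"] by simp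
  then have "bo_flow J (real 0) p0 (\<lambda>_. p0)"
   using p0 hcD(1,2)[OF hcd_hc[OF p0]] by (auto simp: bo_flow_def flow_def has_vector_derivative_bot)
  then show "\<exists>x. bo_flow J (real 0) p0 x" by blast
  show "\<exists>y. bo_flow J (real (Suc n)) p0 y \<and> (\<forall>t\<le>real n. y t = x t)" if "bo_flow J (real n) p0 x" for x n
   by (rule bo_flow_extend[OF p0 that, of "real (Suc n)"]) auto
 qed
 then obtain f where f: "!!n. bo_flow J (real n) p0 (f n)" "!!n t. t \<le> real n ==> f (Suc n) t = f n t" by blast
 have mono: "f (n+k) t = f n t" if "t \<le> real n" for n k t using that by (induction k) (auto simp: f(2))
 \<comment> \<open>All members of the chain that reach \<open>t\<close> agree there; the first of
   them is taken.\<close>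
 define p where "p t = f (nat \<lceil>t\<rceil>) t" for t
 have eq: "f n t = p t" if "t \<in> {0..real n}" for n t
 proof -
  have "nat \<lceil>t\<rceil> \<le> n" using that by (simp add: nat_le_iff ceiling_le_iff)
  then obtain k where "n = nat \<lceil>t\<rceil> + k" by (metis le_add_diff_inverse)
  then show ?thesis using mono[of t "nat \<lceil>t\<rceil>" k] by (simp add: p_def real_nat_ceiling_ge)
 qed
 show ?thesis
 proof (rule that[of p])
  fix s :: real assume "s \<ge> 0"
  define n where "n = nat \<lceil>s\<rceil>"
  have "bo_flow J (real n) p0 p" unfolding bo_flow_def
   using f(1)[of n] eq[of 0 n] by (auto simp: bo_flow_def intro: flow_cong[where p = "f n" and h = "f n"] hcd_cong[where F = "f n"] eq)
  then show "bo_flow J s p0 p" by (rule bo_flow_subset) (use \<open>s \<ge> 0\<close> in \<open>auto simp: n_def real_nat_ceiling_ge\<close>)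
 qed
qed

section \<open>Time reversal\<close>

lemma conv_cnj: "conv (\<lambda>x. cnj (f x)) (\<lambda>x. cnj (g x)) x = cnj (conv f g x)" unfolding conv_def by (simp flip: L_integral_cnj)

lemma crefl_cnj: "crefl (\<lambda>x. cnj (f x)) = (\<lambda>x. cnj (crefl f x))" by (simp add: crefl_def fun_eq_iff)

lemma herm_cnj: "herm (\<lambda>x. cnj (f x)) = (\<lambda>x. cnj (herm f x))" by (simp add: herm_def crefl_def fun_eq_iff)

lemma mulx_cnj: "mulx (\<lambda>x. cnj (f x)) = (\<lambda>x. cnj (mulx f x))" by (simp add: mulx_def fun_eq_iff)

lemma toep_cnj: "toep (\<lambda>x. cnj (f x)) (\<lambda>x. cnj (g x)) = (\<lambda>x. cnj (toep f g x))"
 by (simp add: toep_def pos_def conv_cnj fun_eq_iff)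

lemma lax_op_cnj: "lax_op (\<lambda>x. cnj (p x)) (\<lambda>x. cnj (h x)) = (\<lambda>x. cnj (lax_op p h x))"
 by (simp add: lax_op_def herm_cnj mulx_cnj toep_cnj fun_eq_iff)

text \<open>Conjugation on the frequency side is reflection in physical space. The sign change
  expresses the symmetry u(t, x) -> u(- t, - x).\<close>

lemma flow_op_cnj: "flow_op (\<lambda>x. cnj (p x)) (\<lambda>x. cnj (h x)) = (\<lambda>x. - cnj (flow_op p h x))"
 by (simp add: flow_op_def herm_cnj crefl_cnj mulx_cnj toep_cnj fun_eq_iff)

lemma expd_cnj: "expd I F ==> expd I (\<lambda>t x. cnj (F t x))" unfolding expd_def by auto

lemma causal_cnj: "causal f ==> causal (\<lambda>x. cnj (f x))" by (simp add: causal_def)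

lemma cnj_has_vector_derivative: "(f hvd D) F ==> ((\<lambda>x. cnj (f x)) hvd cnj D) F"
 by (rule bounded_linear.has_vector_derivative[OF bounded_linear_cnj])

lemma hc_cnj: assumes "hc I F" shows "hc I (\<lambda>t x. cnj (F t x))"
proof (rule hcI)
 show "continuous_on (I \<times> {0..}) (\<lambda>(t, x). cnj (F t x))" using hcD(3)[OF assms] unfolding case_prod_unfold by (rule continuous_on_cnj)
qed (use assms in \<open>auto simp: hc_def intro: expd_cnj causal_cnj\<close>)

lemma hcd_cnj: "hcd I n F ==> hcd I n (\<lambda>t x. cnj (F t x))"
proof (induction n arbitrary: F)
 case (Suc n)
 note h = hcd_dx[OF Suc.prems]
 show ?case by (rule hcd_SucI[where G = "\<lambda>t x. cnj (dx (F t) x)"])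
   (use h in \<open>auto intro: hc_cnj hcd_hc[OF Suc.prems] Suc.IH cnj_has_vector_derivative\<close>)
qed (simp add: hc_cnj)

lemma dx_cnj:
 assumes "hcd {t} (Suc n) (\<lambda>_. f)" shows "dx (\<lambda>x. cnj (f x)) = (\<lambda>x. cnj (dx f x))"
proof
 fix x
 show "dx (\<lambda>x. cnj (f x)) x = cnj (dx f x)"
 proof (cases "x \<ge> 0")
  case True
  then show ?thesis using hcd_dx(2)[OF assms, of t x] by (intro dx_eqI cnj_has_vector_derivative) auto
 qed (simp add: dx_def)
qed

lemma flow_reverse:
 assumes "flow {0..s} p h" shows "flow {-s..0} (\<lambda>t x. cnj (p (- t) x)) (\<lambda>t x. cnj (h (- t) x))" unfolding flow_def
proof (intro conjI ballI allI)
 have im: "uminus ` {-s..0} \<subseteq> {0..s}" by auto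
 show "expd {-s..0} (\<lambda>t x. cnj (h (- t) x))" by (intro expd_cnj expd_reparam[OF flowD(1)[OF assms] im])
 fix t assume "t \<in> {-s..0}"
 then have t: "- t \<in> {0..s}" by auto
 show "causal (\<lambda>x. cnj (h (- t) x))" by (intro causal_cnj flowD(2)[OF assms t])
 fix x
 have "((\<lambda>s. h s x) hvd flow_op (p (- t)) (h (- t)) x) (at (- t) within uminus ` {-s..0})"
  by (rule has_vector_derivative_within_subset[OF flowD(4)[OF assms t] im])
 then have "((\<lambda>s. h s x) \<circ> uminus hvd ((- 1) *\<^sub>R flow_op (p (- t)) (h (- t)) x)) (at t within {-s..0})"
  by (intro vector_diff_chain_within) (auto intro!: derivative_eq_intros)
 then have "((\<lambda>s. cnj (h (- s) x)) hvd cnj (- flow_op (p (- t)) (h (- t)) x)) (at t within {-s..0})"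
  by (intro cnj_has_vector_derivative) (simp add: o_def)
 then show "((\<lambda>s. cnj (h (- s) x)) hvd flow_op (\<lambda>x. cnj (p (- t) x)) (\<lambda>x. cnj (h (- t) x)) x) (at t within {-s..0})"
  by (simp add: flow_op_cnj)
qed

section \<open>Boundary values at frequency 0\<close>

lemma halfline_integral_derivative:
 assumes g: "edec g" and g': "edec g'" "causal g'" "continuous_on {0..} g'"
  and der: "!!x. x \<ge> 0 ==> (g hvd g' x) (at_half x)"
 shows "(LBINT x. g' x) = - g 0"
proof -
 have gb: "(\<lambda>n. g (real n)) \<longlonglongrightarrow> 0"
 proof -
  obtain C \<sigma> where C: "C > 0" "\<sigma> > 0" "!!x. norm (g x) \<le> C * decay \<sigma> x" using edecE[OF g] by metis
  have "(\<lambda>n. C * decay \<sigma> (real n)) \<longlonglongrightarrow> 0" using C(2) by real_asymp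
  then show ?thesis by (rule Lim_null_comparison[rotated]) (intro always_eventually allI C(3))
 qed
 have "(\<lambda>n. LBINT x. indicator {0..real n} x *\<^sub>R g' x) \<longlonglongrightarrow> (LBINT x. g' x)"
 proof (rule integral_dominated_convergence[where w = "\<lambda>x. norm (g' x)"])
  have [measurable]: "meas g'" using g' by (simp add: expd_def)
  show "g' \<in> borel_measurable lborel" "(\<lambda>x. indicator {0..real n} x *\<^sub>R g' x) \<in> borel_measurable lborel" for n by measurable
  show "integrable lborel (\<lambda>x. norm (g' x))" using edec_integrable[OF g'(1)] by simp
  show "AE x in lborel. (\<lambda>n. indicator {0..real n} x *\<^sub>R g' x) \<longlonglongrightarrow> g' x"
  proof (rule AE_I2)
   fix x :: real
   have "eventually (\<lambda>n. indicator {0..real n} x *\<^sub>R g' x = g' x) sequentially" using eventually_ge_at_top[of "nat \<lceil>x\<rceil>"]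
    by eventually_elim (use g'(2) in \<open>auto simp: causal_def indicator_def nat_ceiling_le_eq\<close>)
   then show "(\<lambda>n. indicator {0..real n} x *\<^sub>R g' x) \<longlonglongrightarrow> g' x" by (rule tendsto_eventually)
  qed
  show "AE x in lborel. norm (indicator {0..real n} x *\<^sub>R g' x) \<le> norm (g' x)" for n by (auto simp: indicator_def)
 qed
 moreover have "(LBINT x. indicator {0..real n} x *\<^sub>R g' x) = g (real n) - g 0" for n
 proof (rule integral_FTC_atLeastAtMost)
  show "(g hvd g' x) (at x within {0..real n})" if "0 \<le> x" "x \<le> real n" for x
   by (rule has_vector_derivative_within_subset[OF der]) (use that in auto)
  show "continuous_on {0..real n} g'" by (rule continuous_on_subset[OF g'(3)]) auto
 qed simp
 ultimately have "(\<lambda>n. g (real n) - g 0) \<longlonglongrightarrow> (LBINT x. g' x)" by simp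
 moreover have "(\<lambda>n. g (real n) - g 0) \<longlonglongrightarrow> 0 - g 0" by (intro tendsto_diff gb tendsto_const)
 ultimately show ?thesis using LIMSEQ_unique by fastforce
qed

text \<open>At 0 the multiplication part vanishes. On the support of \<open>h\<close> only the
  anticausal half of the reflected symbol contributes, so the convolution becomes a pairing with
  \<open>p\<close>.\<close>

lemma lax_op_zero:
 assumes "edec p" "causal p" "edec h" "causal h" shows "lax_op p h 0 = inn h p"
proof -
 have [measurable]: "meas p" "meas h" using assms by (auto simp: expd_def)
 have "conv (herm p) h 0 = inn h p" unfolding conv_def inn_def
 proof (rule L_integral_cong_AE)
  have "AE y in lborel. y \<noteq> (0::real)" by (rule AE_lborel_singleton)
  then show "AE y in lborel. herm p (0-y) * h y = h y * cnj (p y)"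
   by eventually_elim (use assms in \<open>auto simp: herm_def crefl_def causal_def neq_iff\<close>)
 qed (auto simp: herm_def crefl_def)
 then show ?thesis by (simp add: lax_op_def toep_def pos_def mulx_def)
qed

text \<open>The boundary value of each word equals that at time 0. Words with at most two letters
  determine p'(t, 0) and p''(t, 0), and reality of \<open>p0\<close> decides which of the
  coefficients are real.\<close>

lemma bo_flow_boundary:
 assumes p0: "hcd {0} 2 (\<lambda>_. p0)" "!!x. cnj (p0 x) = p0 x" "p0 0 = 0" "dx p0 0 = 0"
  and p: "bo_flow 2 t p0 p" and t: "t \<ge> 0"
 shows "p t 0 = 0" "Re (dx (p t) 0) = 0" "Im (dx (dx (p t)) 0) = 0"
proof -
 have fl: "flow {0..t} p p" "hcd {0..t} 2 p" "p 0 = p0" using p by (auto simp: bo_flow_def)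
 have W: "word w t (p t) 0 = word w 0 p0 0" if "count_list w True \<le> 2" for w
  using flow_zero_const[OF _ fl(1), of "\<lambda>t. word w t (p t)" t 0] word_flow[OF fl(1,2) that] fl(3) t by simp
 have at: "hcd {t} n (\<lambda>_. F t)" if "hcd {0..t} n F" for n F using hcd_reparam[OF that, of "\<lambda>_. t" "{t}"] t by simp
 have e: "edec (p t)" "causal (p t)" using flowD(2,3)[OF fl(1), of t] t by auto
 show "p t 0 = 0" using W[of "[]"] p0(3) by simp
 \<comment> \<open>One letter: p'(t, 0) is - 2 i t times the squared norm of
   \<open>p\<close>.\<close>
 have "galilei_op t (p t) (p t) 0 = galilei_op 0 p0 p0 0" using W[of "[True]"] by simp
 then have 1: "\<i> * dx (p t) 0 = 2 * of_real t * lax_op (p t) (p t) 0" by (simp add: galilei_op_def p0(4))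
 have "Im (lax_op (p t) (p t) 0) = 0" using lax_op_zero[OF e e] inn_self_real by simp
 then show "Re (dx (p t) 0) = 0" using arg_cong[OF 1, of Im] by simp
 have hp0: "hc {0} (\<lambda>_. p0)" "hcd {0} 1 (\<lambda>_. dx p0)" using hcd_hc[OF p0(1)] hcd_dx(1)[of "{0}" 1 "\<lambda>_. p0"] p0(1) by (auto simp: numeral_2_eq_2)
 note hd0 = hcd_hc[OF hp0(2)]
 have d0: "(p0 hvd dx p0 x) (at_half x)" if "x \<ge> 0" for x
  using hcd_dx(2)[of "{0}" 1 "\<lambda>_. p0"] p0(1) that by (auto simp: numeral_2_eq_2)
 have e0: "edec p0" "causal p0" "edec (dx p0)" "causal (dx p0)" "continuous_on {0..} (dx p0)" "continuous_on {0..} p0"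
  using hcD[OF hp0(1)] hcD[OF hd0] hc_slice_continuous[OF hd0, of 0] hc_slice_continuous[OF hp0(1), of 0] by auto
 have rd: "cnj (dx p0 x) = dx p0 x" for x using fun_cong[OF dx_cnj[of 0 1 p0], of x] p0(1,2) by (simp add: numeral_2_eq_2)
 have rdd: "cnj (dx (dx p0) x) = dx (dx p0) x" for x using fun_cong[OF dx_cnj[of 0 0 "dx p0"], of x] hp0(2) rd by simp
 \<comment> \<open>For real \<open>p0\<close> the integrand is half the derivative of p0^2, and p0
   vanishes at 0.\<close>
 have I0: "inn (dx p0) p0 = 0"
 proof -
  have "(LBINT x. dx p0 x * p0 x + p0 x * dx p0 x) = - (p0 0 * p0 0)"
  proof (rule halfline_integral_derivative)
   show "edec (\<lambda>x. p0 x * p0 x)" "edec (\<lambda>x. dx p0 x * p0 x + p0 x * dx p0 x)" by (intro expd_add expd_mult e0)+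
   show "causal (\<lambda>x. dx p0 x * p0 x + p0 x * dx p0 x)" using e0 by (simp add: causal_def)
   show "continuous_on {0..} (\<lambda>x. dx p0 x * p0 x + p0 x * dx p0 x)" by (intro continuous_intros e0)
   show "((\<lambda>x. p0 x * p0 x) hvd dx p0 x * p0 x + p0 x * dx p0 x) (at_half x)" if "x \<ge> 0" for x
    by (rule has_vector_derivative_eq_rhs, rule has_vector_derivative_mult[OF d0[OF that] d0[OF that]]) simp
  qed
  then have "(LBINT x. 2*(dx p0 x * p0 x)) = 0" using p0(3) by (simp add: mult.commute)
  then have "2*(LBINT x. dx p0 x * p0 x) = 0" by (subst (asm) integral_mult_right_zero)
  then show ?thesis by (simp add: inn_def p0(2))
 qed
 \<comment> \<open>Up to terms with the factor p0(0), the derivative of \<open>L p0\<close> at 0 is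
   L applied to p0', which is the pairing just computed.\<close>
 have dL0: "dx (lax_op p0 p0) 0 = 0"
 proof -
  have "(toep (\<lambda>x. p0 x + crefl p0 x) p0 hvd toep (\<lambda>x. p0 x + crefl p0 x) (dx p0) 0 + p0 0 * p0 0) (at 0 within {0..})"
   using toep_hc_has_derivative[OF hp0(1) hp0(1) hp0(1) hd0, of 0 0] d0 by simp
  then have "((\<lambda>x. mulx p0 x + toep (herm p0) p0 x) hvd (p0 0 + of_real 0 * dx p0 0) + (toep (herm p0) (dx p0) 0 + p0 0 * p0 0)) (at 0 within {0..})"
   unfolding herm_def[abs_def] by (intro has_vector_derivative_add mulx_has_vector_derivative d0) auto
  then have "dx (lax_op p0 p0) 0 = p0 0 + toep (herm p0) (dx p0) 0 + p0 0 * p0 0"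
   unfolding lax_op_def[abs_def] by (subst dx_eqI) (auto simp: add.assoc)
  also have "... = lax_op p0 (dx p0) 0" using p0(3) by (simp add: lax_op_def mulx_def)
  finally show ?thesis using lax_op_zero[OF e0(1,2,3,4)] I0 by simp
 qed
 define c where "c = lax_op p0 (lax_op p0 p0) 0"
 have "cnj c = c"
 proof -
  have e: "(\<lambda>x. cnj (p0 x)) = p0" using p0(2) by (rule ext)
  have l: "(\<lambda>x. cnj (lax_op p0 p0 x)) = lax_op p0 p0" using lax_op_cnj[of p0 p0] unfolding e by (rule sym)
  show ?thesis using fun_cong[OF lax_op_cnj[of p0 "lax_op p0 p0"], of 0] unfolding e l c_def by (rule sym)
 qed
 then have c: "Im c = 0" by (simp add: complex_eq_iff)
 have g0: "galilei_op 0 p0 p0 = (\<lambda>x. \<i> * dx p0 x)" by (simp add: galilei_op_def fun_eq_iff)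
 \<comment> \<open>At time 0 the word L A gives i times the pairing of p0' with p0, so its boundary
   value is 0 at all times.\<close>
 have 2: "lax_op (p t) (galilei_op t (p t) (p t)) 0 = 0" using W[of "[False, True]"] lax_op_zero[OF e0(1,2) expd_cmult[OF e0(3)], of \<i>] e0(4) I0
  by (simp add: g0 causal_def inn_cmult_left)
 have "galilei_op t (p t) (lax_op (p t) (p t)) 0 = galilei_op 0 p0 (lax_op p0 p0) 0" using W[of "[True, False]"] by simp
 then have 3: "\<i> * dx (lax_op (p t) (p t)) 0 = 2 * of_real t * c" using W[of "[False, False]"] dL0 by (simp add: galilei_op_def c_def)
 have "hcd {t} (Suc 0) (\<lambda>_. dx (p t))" using at[of "Suc 0" "\<lambda>s. dx (p s)"] hcd_dx(1)[of "{0..t}" "Suc 0" p] fl(2) by (auto simp: numeral_2_eq_2)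
 moreover have "hcd {t} (Suc 0) (\<lambda>_. lax_op (p t) (p t))"
  by (rule at[of "Suc 0" "\<lambda>s. lax_op (p s) (p s)"]) (intro hcd_lax_op compact_Icc hcd_mono[OF fl(2)]; simp)
 ultimately have 4: "dx (galilei_op t (p t) (p t)) 0 = \<i> * dx (dx (p t)) 0 + (- 2 * of_real t) * dx (lax_op (p t) (p t)) 0"
  unfolding galilei_op_def[abs_def] by (simp only: dx_linear[of t 0])
 have "hcd {0} (Suc 0) (\<lambda>_. dx p0)" using hp0(2) by simp
 then have 5: "dx (galilei_op 0 p0 p0) 0 = \<i> * dx (dx p0) 0" unfolding g0 using dx_linear[of 0 0 "dx p0" "dx p0" \<i> 0] by simp
 \<comment> \<open>Expanding A A p with the boundary values of L A p and A L p gives p''(t, 0) =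
   p0''(0) - 4 t^2 c with c real.\<close>
 have "galilei_op t (p t) (galilei_op t (p t) (p t)) 0 = galilei_op 0 p0 (galilei_op 0 p0 p0) 0" using W[of "[True, True]"] by simp
 then have "\<i> * dx (galilei_op t (p t) (p t)) 0 = \<i>*(\<i> * dx (dx p0) 0)" using 2 5 by (simp add: galilei_op_def[of _ _ "galilei_op _ _ _"])
 then have "dx (galilei_op t (p t) (p t)) 0 = \<i> * dx (dx p0) 0" by (simp only: mult_cancel_left complex_i_not_zero simp_thms)
 then have "\<i>*(\<i> * dx (dx (p t)) 0) = \<i>*(\<i> * dx (dx p0) 0)+2 * of_real t * (\<i> * dx (lax_op (p t) (p t)) 0)"
  using 4 by (simp add: algebra_simps)
 then have "- dx (dx (p t)) 0 = - dx (dx p0) 0 + 4 * of_real (t^2) * c" unfolding 3 by (simp add: power2_eq_square mult.assoc[symmetric])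
 from arg_cong[OF this, of Im] show "Im (dx (dx (p t)) 0) = 0" using rdd[of 0] c by (simp add: complex_eq_iff)
qed

text \<open>Reality of \<open>p0\<close> makes the conjugated backward half join at time 0, and
  conjugation keeps all three boundary conditions.\<close>

lemma global_flow:
 assumes p0: "hcd {0} J (\<lambda>_. p0)" "J \<ge> 2" "!!x. cnj (p0 x) = p0 x" "p0 0 = 0" "dx p0 0 = 0"
 obtains p where "p 0 = p0" "!!T. T \<ge> 0 ==> flow {-T..T} p p" "!!T. T \<ge> 0 ==> hcd {-T..T} J p"
  "!!t. p t 0 = 0" "!!t. Re (dx (p t) 0) = 0" "!!t. Im (dx (dx (p t)) 0) = 0"
proof -
 obtain q where q: "!!s. s \<ge> 0 ==> bo_flow J s p0 q" using global_half_line[OF p0(1)] by metis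
 define p where "p t = (if t \<ge> 0 then q t else (\<lambda>x. cnj (q (- t) x)))" for t
 have q0: "q 0 = p0" using q[of 0] by (simp add: bo_flow_def)
 have eq1: "q t = p t" if "t \<in> {0..s}" for t s using that by (simp add: p_def)
 have eq2: "(\<lambda>x. cnj (q (- t) x)) = p t" if "t \<in> {-s..0}" for t s using that p0(3) q0 by (cases "t = 0") (auto simp: p_def)
 have un: "{-T..T} = {-T..0} \<union> {0..T}" if "T \<ge> 0" for T :: real using that by auto
 have Q: "flow {0..T} q q" "hcd {0..T} J q" if "T \<ge> 0" for T using q[OF that] by (auto simp: bo_flow_def)
 have q2: "bo_flow 2 s p0 q" if "s \<ge> 0" for s using q[OF that] p0(2) by (auto simp: bo_flow_def intro: hcd_mono)
 have p02: "hcd {0} 2 (\<lambda>_. p0)" by (rule hcd_mono[OF p0(1,2)])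
 note b = bo_flow_boundary[OF p02 p0(3,4,5) q2]
 have d: "dx (\<lambda>x. cnj (q t x)) = (\<lambda>x. cnj (dx (q t) x))" "dx (\<lambda>x. cnj (dx (q t) x)) = (\<lambda>x. cnj (dx (dx (q t)) x))" if "t \<ge> 0" for t
 proof -
  have "hcd {t} 2 (\<lambda>_. q t)" using hcd_reparam[OF hcd_mono[OF Q(2)[OF that] p0(2)], of "\<lambda>_. t" "{t}"] that by simp
  then have 1: "hcd {t} (Suc (Suc 0)) (\<lambda>_. q t)" by (simp only: numeral_2_eq_2)
  show "dx (\<lambda>x. cnj (q t x)) = (\<lambda>x. cnj (dx (q t) x))" by (rule dx_cnj[OF 1])
  show "dx (\<lambda>x. cnj (dx (q t) x)) = (\<lambda>x. cnj (dx (dx (q t)) x))" by (rule dx_cnj[OF hcd_dx(1)[OF 1]])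
 qed
 show ?thesis
 proof (rule that[of p])
  show "p 0 = p0" by (simp add: p_def q0)
  show "flow {-T..T} p p" if T: "T \<ge> 0" for T unfolding un[OF T]
  proof (intro flow_Un closed_atLeastAtMost)
   show "flow {-T..0} p p" by (rule flow_cong[OF flow_reverse[OF Q(1)[OF T]]]) (rule eq2, assumption)+
   show "flow {0..T} p p" by (rule flow_cong[OF Q(1)[OF T]]) (rule eq1, assumption)+
  qed
  show "hcd {-T..T} J p" if T: "T \<ge> 0" for T unfolding un[OF T]
  proof (intro hcd_Un closed_atLeastAtMost)
   have "hcd {-T..0} J (\<lambda>t x. cnj (q (- t) x))" by (intro hcd_cnj hcd_reparam[OF Q(2)[OF T]]) (auto intro!: continuous_intros)
   then show "hcd {-T..0} J p" by (rule hcd_cong) (rule eq2)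
   show "hcd {0..T} J p" by (rule hcd_cong[OF Q(2)[OF T]]) (rule eq1)
  qed
  fix t :: real
  show "p t 0 = 0" "Re (dx (p t) 0) = 0" "Im (dx (dx (p t)) 0) = 0" using b[of t] b[of "- t"] d[of "- t"] by (cases "t \<ge> 0"; simp add: p_def)+
 qed
qed

section \<open>Fourier inversion and Plancherel\<close>

definition four :: "cfun => cfun" where
 "four f x = (LBINT \<xi>. f \<xi> * phase (x*\<xi>))"

lemma norm_exp_imaginary [simp]: "norm (exp (\<i> * complex_of_real r)) = 1" using norm_exp_i_times[of r] by (simp add: mult.commute)

lemma four_integrable:
 assumes "integrable lborel f" shows "integrable lborel (\<lambda>\<xi>. f \<xi> * phase (x*\<xi>))"
proof (rule L_integrable_bound[OF assms])
 have [measurable]: "meas f" using borel_measurable_integrable[OF assms] by simp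
 show "(\<lambda>\<xi>. f \<xi> * phase (x*\<xi>)) \<in> borel_measurable lborel" by measurable
qed (simp add: norm_mult)

lemma four_norm_le: "integrable lborel f ==> norm (four f x) \<le> (LBINT \<xi>. norm (f \<xi>))"
 unfolding four_def by (rule order_trans[OF integral_norm_bound]) (simp add: norm_mult)

lemma four_measurable [measurable]:
 assumes [measurable]: "meas f" shows "meas (four f)" unfolding four_def[abs_def] by measurable

lemma integrable_pair_bound:
 fixes f :: "real => cfun" and a b :: "real => real"
 assumes [measurable]: "(\<lambda>z. f (fst z) (snd z)) \<in> borel_measurable (borel \<Otimes>\<^sub>M borel)"
  and a: "integrable lborel a" and b: "integrable lborel b"
  and bd: "!!x y. norm (f x y) \<le> a x * b y"
 shows "integrable lborel2 (\<lambda>z. f (fst z) (snd z))"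
proof (rule L_integrable_bound)
 have [measurable]: "meas a" "meas b" using a b borel_measurable_integrable by fastforce+
 have "integrable lborel2 (\<lambda>(x, y). a x * b y)" using a b by (intro lborel_pair.Fubini_integrable) (auto simp: abs_mult)
 then show "integrable lborel2 (\<lambda>z. a (fst z) * b (snd z))" by (simp add: case_prod_unfold)
 show "AE z in lborel2. norm (f (fst z) (snd z)) \<le> norm (a (fst z) * b (snd z))"
  by (intro AE_I2) (metis abs_of_nonneg bd norm_ge_zero order_trans real_norm_def)
qed measurable

section \<open>Gaussian regularisation\<close>

definition gau :: "real => real => real" where "gau s x = exp (- (s*x)\<^sup>2/2)"

lemma gau_measurable [measurable]: "meas (gau s)" unfolding gau_def[abs_def] by measurable

lemma gau_bounds: "0 \<le> gau s x" "gau s x \<le> 1" by (auto simp: gau_def)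

lemma gau_normal_density: "s > 0 ==> gau s x = sqrt (2*pi*(1/s)^2) * normal_density 0 (1/s) x"
proof -
 assume s: "s > 0"
 have e: "- (x-0)\<^sup>2/(2*(1/s)^2) = - (s*x)\<^sup>2/2" by (simp add: power_mult_distrib power_divide)
 have "sqrt (2*pi*(1/s)^2) > 0" using s by simp
 then have "sqrt (2*pi*(1/s)^2) \<noteq> 0" by linarith
 then show "gau s x = sqrt (2*pi*(1/s)^2) * normal_density 0 (1/s) x"
  unfolding gau_def normal_density_def e by (simp only: mult.assoc[symmetric] times_divide_eq_right mult_1_right divide_self mult_1_left simp_thms)
qed

lemma gau_integrable: assumes "s > 0" shows "integrable lborel (gau s)"
proof -
 have "integrable lborel (\<lambda>x. sqrt (2*pi*(1/s)^2) * normal_density 0 (1/s) x)"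
  using assms by (intro integrable_mult_right integrable_normal_density) simp
 then show ?thesis unfolding gau_normal_density[OF assms, symmetric] .
qed

lemma gau_tendsto: "(\<lambda>n. gau (1 / Suc n) x) \<longlonglongrightarrow> 1"
proof -
 have "(\<lambda>n. exp (- (1 / real (Suc n) * x)\<^sup>2/2)) \<longlonglongrightarrow> exp (- (0*x)\<^sup>2/2)"
  by (intro tendsto_intros) (use LIMSEQ_inverse_real_of_nat in \<open>simp_all add: inverse_eq_divide\<close>)
 then show ?thesis by (simp add: gau_def)
qed

text \<open>From the characteristic function of the standard normal distribution, by
  rescaling.\<close>

lemma four_gau:
 assumes s: "s > 0" shows "four (\<lambda>\<xi>. of_real (gau s \<xi>)) a = of_real (2*pi * normal_density 0 s a)"
proof -
 have "of_real (exp (- (a/s)\<^sup>2/2)) = char std_normal_distribution (a/s)" by (simp add: char_std_normal_distribution)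
 also have "... = (LBINT x. std_normal_density x *\<^sub>R iexp (a/s*x))" unfolding char_def by (subst integral_density) auto
 also have "... = (LBINT x. of_real (1 / sqrt (2*pi)) * (of_real (gau s (0+(1/s)*x)) * phase (a*(0+(1/s)*x))))"
  using s by (intro L_integral_cong) (simp_all add: std_normal_density_def gau_def scaleR_conv_of_real)
 also have "... = of_real (1 / sqrt (2*pi)) * (LBINT x. of_real (gau s (0+(1/s)*x)) * phase (a*(0+(1/s)*x)))" by (rule integral_mult_right_zero)
 also have "four (\<lambda>\<xi>. of_real (gau s \<xi>)) a = \<bar>1/s\<bar> *\<^sub>R (LBINT x. of_real (gau s (0+(1/s)*x)) * phase (a*(0+(1/s)*x)))"
  unfolding four_def using s by (intro lborel_integral_real_affine) simp
 then have "(LBINT x. of_real (gau s (0+(1/s)*x)) * phase (a*(0+(1/s)*x))) = of_real s * four (\<lambda>\<xi>. of_real (gau s \<xi>)) a"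
  using s by (simp add: scaleR_conv_of_real)
 finally have *: "of_real (exp (- (a/s)\<^sup>2/2)) = of_real (1 / sqrt (2*pi)) * (of_real s * four (\<lambda>\<xi>. of_real (gau s \<xi>)) a)" .
 have r: "sqrt (2*pi) / s * exp (- (a/s)\<^sup>2/2) = 2*pi * normal_density 0 s a"
 proof -
  have "2*pi = sqrt (2*pi) * sqrt (2*pi)" by simp
  then have f: "2*pi / sqrt (2*pi * s^2) = sqrt (2*pi) / s" using s by (simp add: real_sqrt_mult del: real_sqrt_mult_self)
  have "2*pi * normal_density 0 s a = 2*pi / sqrt (2*pi * s^2) * exp (- (a/s)\<^sup>2/2)" by (simp add: normal_density_def power_divide)
  then show ?thesis unfolding f by simp
 qed
 have "four (\<lambda>\<xi>. of_real (gau s \<xi>)) a = of_real (sqrt (2*pi) / s) * (of_real (1 / sqrt (2*pi)) * (of_real s * four (\<lambda>\<xi>. of_real (gau s \<xi>)) a))"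
  using s by simp
 also have "... = of_real (sqrt (2*pi) / s * exp (- (a/s)\<^sup>2/2))" unfolding *[symmetric] by simp
 finally show ?thesis unfolding r .
qed

text \<open>A Gaussian factor before inverting replaces point evaluation by an average against a
  normal density. This is the common source of the L2 bound and of the inversion formula.\<close>

lemma four_gau_regularized:
 assumes g: "integrable lborel g" and s: "s > 0"
 shows "(LBINT \<xi>. four g \<xi> * of_real (gau s \<xi>) * exp (- \<i> * of_real (y*\<xi>))) = (LBINT x. g x * of_real (2*pi * normal_density 0 s (x-y)))"
proof -
 have [measurable]: "meas g" using borel_measurable_integrable[OF g] by simp
 let ?f = "\<lambda>\<xi> x. g x * phase (\<xi>*x) * of_real (gau s \<xi>) * exp (- \<i> * of_real (y*\<xi>))"
 have int: "integrable lborel2 (\<lambda>z. ?f (fst z) (snd z))"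
 proof (rule integrable_pair_bound[where a = "gau s" and b = "\<lambda>x. norm (g x)"])
  have n: "norm (exp (- \<i> * of_real (y*\<xi>))) = 1" for \<xi> using norm_exp_imaginary[of "- (y*\<xi>)"] by simp
  show "norm (?f \<xi> x) \<le> gau s \<xi> * norm (g x)" for \<xi> x
   using n[of \<xi>] norm_exp_imaginary[of "\<xi>*x"] gau_bounds(1)[of s \<xi>] by (simp only: norm_mult norm_of_real) simp
 qed (use g gau_integrable[OF s] in auto)
 have "(LBINT \<xi>. four g \<xi> * of_real (gau s \<xi>) * exp (- \<i> * of_real (y*\<xi>))) = (LBINT \<xi>. LBINT x. ?f \<xi> x)"
  unfolding four_def by (simp only: integral_mult_left_zero)
 also have "... = (LBINT x. LBINT \<xi>. ?f \<xi> x)" by (rule lborel_fubini[OF int, symmetric])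
 also have "... = (LBINT x. g x * four (\<lambda>\<xi>. of_real (gau s \<xi>)) (x-y))"
 proof (rule L_integral_cong[OF refl])
  fix x
  have e: "phase (\<xi>*x) * exp (- \<i> * of_real (y*\<xi>)) = phase ((x-y)*\<xi>)" for \<xi> by (simp add: mult_exp_exp algebra_simps)
  have "?f \<xi> x = g x * (of_real (gau s \<xi>) * phase ((x-y)*\<xi>))" for \<xi> unfolding e[symmetric] by (simp only: mult_ac)
  then show "(LBINT \<xi>. ?f \<xi> x) = g x * four (\<lambda>\<xi>. of_real (gau s \<xi>)) (x-y)"
   unfolding four_def by (simp only: integral_mult_right_zero)
 qed
 finally show ?thesis by (simp only: four_gau[OF s])
qed

lemma normal_density_nn_integral:
 assumes "s > 0" shows "(\<integral>\<^sup>+ x. ennreal (normal_density 0 s (x-y)) \<partial>lborel) = 1"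
proof -
 have "normal_density 0 s (x-y) = normal_density y s x" for x by (simp add: normal_density_def)
 then show ?thesis using assms by (simp add: nn_integral_eq_integral)
qed

lemma norm_integral_le_nn_integral:
 fixes f :: "'a => 'b::{banach, second_countable_topology}"
 shows "ennreal (norm (integral\<^sup>L M f)) \<le> (\<integral>\<^sup>+ x. ennreal (norm (f x)) \<partial>M)"
 by (cases "integrable M f") (auto intro: integral_norm_bound_ennreal simp: not_integrable_integral_eq)

text \<open>Expanding the square and integrating out \<xi> leaves 2 \<pi> times a normal density in
  x - y as kernel. Bound |g x g y| by the mean of the squares and use that the density has mass 1 in
  either variable: Schur's test.\<close>

lemma four_square_gau_le:
 assumes g: "integrable lborel g" "integrable lborel (\<lambda>x. (norm (g x))^2)" and s: "s > 0"
 shows "(\<integral>\<^sup>+ \<xi>. ennreal ((norm (four g \<xi>))^2 * gau s \<xi>) \<partial>lborel) \<le> ennreal (2*pi*(LBINT x. (norm (g x))^2))"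
proof -
 have [measurable]: "meas g" using borel_measurable_integrable[OF g(1)] by simp
 define M where "M = (LBINT \<xi>. norm (g \<xi>))"
 have M: "norm (four g \<xi>) \<le> M" for \<xi> unfolding M_def by (rule four_norm_le[OF g(1)])
 have M0: "M \<ge> 0" by (rule order_trans[OF norm_ge_zero M])
 let ?K = "\<lambda>x y. 2*pi * normal_density 0 s (x-y)"
 let ?f = "\<lambda>\<xi> y. four g \<xi> * of_real (gau s \<xi>) * (cnj (g y) * exp (- \<i> * of_real (y*\<xi>)))"
 have sq_int: "integrable lborel (\<lambda>\<xi>. (norm (four g \<xi>))^2 * gau s \<xi>)"
 proof (rule L_integrable_bound[OF integrable_mult_right[OF gau_integrable[OF s], of "M^2"]])
  show "AE \<xi> in lborel. norm ((norm (four g \<xi>))^2 * gau s \<xi>) \<le> norm (M^2 * gau s \<xi>)"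
   using gau_bounds M by (auto simp: abs_mult intro!: mult_right_mono power_mono)
 qed measurable
 have cnj_four: "cnj (four g \<xi>) = (LBINT y. cnj (g y) * exp (- \<i> * of_real (y*\<xi>)))" for \<xi>
  unfolding four_def by (subst L_integral_cnj[symmetric]) (simp add: exp_cnj mult.commute)
 have int: "integrable lborel2 (\<lambda>z. ?f (fst z) (snd z))"
 proof (rule integrable_pair_bound[where a = "\<lambda>\<xi>. M * gau s \<xi>" and b = "\<lambda>y. norm (g y)"])
  have n: "norm (exp (- \<i> * of_real (y*\<xi>))) = 1" for \<xi> y using norm_exp_imaginary[of "- (y*\<xi>)"] by simp
  show "norm (?f \<xi> y) \<le> (M * gau s \<xi>) * norm (g y)" for \<xi> y
   unfolding norm_mult n complex_mod_cnj norm_of_real using M gau_bounds(1)[of s \<xi>] by (auto intro!: mult_right_mono)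
 qed (use g gau_integrable[OF s] in auto)
 have "complex_of_real (LBINT \<xi>. (norm (four g \<xi>))^2 * gau s \<xi>) = (LBINT \<xi>. four g \<xi> * of_real (gau s \<xi>) * cnj (four g \<xi>))"
  unfolding L_integral_of_real[OF sq_int, symmetric] by (intro L_integral_cong refl) (simp only: of_real_mult complex_norm_square mult_ac)
 also have "... = (LBINT \<xi>. LBINT y. ?f \<xi> y)" unfolding cnj_four by (simp only: integral_mult_right_zero)
 also have "... = (LBINT y. LBINT \<xi>. ?f \<xi> y)" by (rule lborel_fubini[OF int, symmetric])
 also have "... = (LBINT y. cnj (g y) * (LBINT x. g x * of_real (?K x y)))"
 proof (rule L_integral_cong[OF refl])
  fix y
  have "?f \<xi> y = cnj (g y) * (four g \<xi> * of_real (gau s \<xi>) * exp (- \<i> * of_real (y*\<xi>)))" for \<xi> by (simp only: mult_ac)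
  then show "(LBINT \<xi>. ?f \<xi> y) = cnj (g y) * (LBINT x. g x * of_real (?K x y))"
   using four_gau_regularized[OF g(1) s, of y] by (simp only: integral_mult_right_zero)
 qed
 finally have eq: "complex_of_real (LBINT \<xi>. (norm (four g \<xi>))^2 * gau s \<xi>) = ..." .
 have "(\<integral>\<^sup>+ \<xi>. ennreal ((norm (four g \<xi>))^2 * gau s \<xi>) \<partial>lborel) = ennreal (LBINT \<xi>. (norm (four g \<xi>))^2 * gau s \<xi>)"
  by (rule nn_integral_eq_integral[OF sq_int]) (simp add: gau_bounds)
 also have "... \<le> ennreal (norm (complex_of_real (LBINT \<xi>. (norm (four g \<xi>))^2 * gau s \<xi>)))" by (simp add: ennreal_leI)
 also have "... \<le> (\<integral>\<^sup>+ y. ennreal (norm (cnj (g y) * (LBINT x. g x * of_real (?K x y)))) \<partial>lborel)"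
  unfolding eq by (rule norm_integral_le_nn_integral)
 also have "... \<le> (\<integral>\<^sup>+ y. (\<integral>\<^sup>+ x. ennreal (norm (g y) * norm (g x) * ?K x y) \<partial>lborel) \<partial>lborel)"
 proof (rule nn_integral_mono)
  fix y
  have "ennreal (norm (cnj (g y) * (LBINT x. g x * of_real (?K x y)))) = ennreal (norm (LBINT x. cnj (g y) * (g x * of_real (?K x y))))"
   by (simp only: integral_mult_right_zero)
  also have "... \<le> (\<integral>\<^sup>+ x. ennreal (norm (cnj (g y) * (g x * of_real (?K x y)))) \<partial>lborel)" by (rule norm_integral_le_nn_integral)
  finally show "ennreal (norm (cnj (g y) * (LBINT x. g x * of_real (?K x y)))) \<le> (\<integral>\<^sup>+ x. ennreal (norm (g y) * norm (g x) * ?K x y) \<partial>lborel)"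
   by (simp add: norm_mult mult.assoc)
 qed
 also have "... \<le> (\<integral>\<^sup>+ y. (\<integral>\<^sup>+ x. ennreal (pi*(norm (g y))^2) * ennreal (normal_density 0 s (x-y)) + ennreal (pi*(norm (g x))^2) * ennreal (normal_density 0 s (x-y)) \<partial>lborel) \<partial>lborel)"
 proof (intro nn_integral_mono)
  fix x y :: real
  have "norm (g y) * norm (g x) * ?K x y \<le> (((norm (g y))^2+(norm (g x))^2)/2) * ?K x y"
   using sum_squares_bound[of "norm (g y)" "norm (g x)"] by (intro mult_right_mono) auto
  also have "... = pi*(norm (g y))^2 * normal_density 0 s (x-y) + pi*(norm (g x))^2 * normal_density 0 s (x-y)" by (simp add: algebra_simps)
  finally show "ennreal (norm (g y) * norm (g x) * ?K x y) \<le> ennreal (pi*(norm (g y))^2) * ennreal (normal_density 0 s (x-y)) + ennreal (pi*(norm (g x))^2) * ennreal (normal_density 0 s (x-y))"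
   by (simp add: ennreal_mult'[symmetric] ennreal_plus[symmetric] ennreal_leI del: ennreal_plus)
 qed
 also have "... = (\<integral>\<^sup>+ y. (\<integral>\<^sup>+ x. ennreal (pi*(norm (g y))^2) * ennreal (normal_density 0 s (x-y)) \<partial>lborel) \<partial>lborel)
   + (\<integral>\<^sup>+ y. (\<integral>\<^sup>+ x. ennreal (pi*(norm (g x))^2) * ennreal (normal_density 0 s (x-y)) \<partial>lborel) \<partial>lborel)"
  by (simp add: nn_integral_add)
 also have "(\<integral>\<^sup>+ y. (\<integral>\<^sup>+ x. ennreal (pi*(norm (g x))^2) * ennreal (normal_density 0 s (x-y)) \<partial>lborel) \<partial>lborel)
   = (\<integral>\<^sup>+ x. (\<integral>\<^sup>+ y. ennreal (pi*(norm (g x))^2) * ennreal (normal_density 0 s (y-x)) \<partial>lborel) \<partial>lborel)"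
  by (subst lborel_pair.Fubini') (auto simp: normal_density_def power2_commute)
 also have "(\<integral>\<^sup>+ y. (\<integral>\<^sup>+ x. ennreal (pi*(norm (g y))^2) * ennreal (normal_density 0 s (x-y)) \<partial>lborel) \<partial>lborel) = (\<integral>\<^sup>+ y. ennreal (pi*(norm (g y))^2) \<partial>lborel)"
  by (simp add: nn_integral_cmult normal_density_nn_integral[OF s])
 also have "... = ennreal (pi*(LBINT x. (norm (g x))^2))" using g(2) by (subst nn_integral_eq_integral) auto
 also have "...+... = ennreal (2*pi*(LBINT x. (norm (g x))^2))" by (subst ennreal_plus[symmetric]) (auto intro!: L_integral_nonneg mult_nonneg_nonneg)
 finally show ?thesis .
qed

text \<open>The Gaussian factor tends to 1, and Fatou's lemma removes it.\<close>

lemma bessel_inequality: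
 assumes g: "integrable lborel g" "integrable lborel (\<lambda>x. (norm (g x))^2)"
 shows "(\<integral>\<^sup>+ \<xi>. ennreal ((norm (four g \<xi>))^2) \<partial>lborel) \<le> ennreal (2*pi*(LBINT x. (norm (g x))^2))"
proof -
 have [measurable]: "meas g" using borel_measurable_integrable[OF g(1)] by simp
 have lim: "(\<lambda>n. ennreal ((norm (four g \<xi>))^2 * gau (1 / Suc n) \<xi>)) \<longlonglongrightarrow> ennreal ((norm (four g \<xi>))^2)" for \<xi>
  using tendsto_ennrealI[OF tendsto_mult_left[OF gau_tendsto[of \<xi>], of "(norm (four g \<xi>))^2"]] by simp
 have "(\<integral>\<^sup>+ \<xi>. ennreal ((norm (four g \<xi>))^2) \<partial>lborel) = (\<integral>\<^sup>+ \<xi>. liminf (\<lambda>n. ennreal ((norm (four g \<xi>))^2 * gau (1 / Suc n) \<xi>)) \<partial>lborel)"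
  by (intro nn_integral_cong) (rule lim_imp_Liminf[OF sequentially_bot lim, symmetric])
 also have "... \<le> liminf (\<lambda>n. \<integral>\<^sup>+ \<xi>. ennreal ((norm (four g \<xi>))^2 * gau (1 / Suc n) \<xi>) \<partial>lborel)"
  by (rule nn_integral_liminf) measurable
 also have "... \<le> ennreal (2*pi*(LBINT x. (norm (g x))^2))" by (rule Liminf_le) (auto intro!: always_eventually four_square_gau_le[OF g])
 finally show ?thesis .
qed

lemma bessel_inequality_integrable:
 assumes g: "integrable lborel g" "integrable lborel (\<lambda>x. (norm (g x))^2)"
 shows "square_integrable (four g)" "L2_norm (four g) \<le> sqrt (2*pi) * L2_norm g"
proof -
 have [measurable]: "meas g" using borel_measurable_integrable[OF g(1)] by simp
 have b: "(\<integral>\<^sup>+ \<xi>. ennreal ((norm (four g \<xi>))^2) \<partial>lborel) < \<infinity>"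
  by (rule le_less_trans[OF bessel_inequality[OF g]]) simp
 have i: "integrable lborel (\<lambda>\<xi>. (norm (four g \<xi>))^2)" by (rule integrableI_bounded) (use b in auto)
 then show "square_integrable (four g)" by (simp add: square_integrable_def)
 have "ennreal (LBINT \<xi>. (norm (four g \<xi>))^2) \<le> ennreal (2*pi*(LBINT x. (norm (g x))^2))"
  using bessel_inequality[OF g] nn_integral_eq_integral[OF i] by simp
 then have "(LBINT \<xi>. (norm (four g \<xi>))^2) \<le> 2*pi*(LBINT x. (norm (g x))^2)"
  by (subst (asm) ennreal_le_iff) (auto intro!: L_integral_nonneg mult_nonneg_nonneg)
 then show "L2_norm (four g) \<le> sqrt (2*pi) * L2_norm g" unfolding L2_norm_def real_sqrt_mult[symmetric] by simp
qed

text \<open>Regularised by Gaussians, the double transform is an average of \<open>q\<close> against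
  normal densities that concentrate at \<eta>; continuity there identifies the limit.\<close>

lemma fourier_inversion:
 fixes q :: "real => complex"
 assumes q: "integrable lborel q" and b: "!!\<xi>. norm (q \<xi>) \<le> B" and c: "isCont q \<eta>" and f: "integrable lborel (four q)"
 shows "four (four q) (- \<eta>) = 2*pi * q \<eta>"
proof -
 have [measurable]: "meas q" using borel_measurable_integrable[OF q] by simp
 let ?s = "\<lambda>n. 1 / real (Suc n)"
 have pos: "0 < ?s n" for n by simp
 have "(\<lambda>n. LBINT x. four q x * of_real (gau (?s n) x) * exp (- \<i> * of_real (\<eta>*x))) \<longlonglongrightarrow> (LBINT x. four q x * phase (- \<eta>*x))"
 proof (rule integral_dominated_convergence[where w = "\<lambda>x. norm (four q x)"])
  have n: "norm (exp (- \<i> * of_real (\<eta>*x))) = 1" for x using norm_exp_imaginary[of "- (\<eta>*x)"] by simp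
  show "AE x in lborel. norm (four q x * of_real (gau (?s n) x) * exp (- \<i> * of_real (\<eta>*x))) \<le> norm (four q x)" for n
   unfolding norm_mult n using gau_bounds by (auto intro!: mult_left_le)
  show "AE x in lborel. (\<lambda>n. four q x * of_real (gau (?s n) x) * exp (- \<i> * of_real (\<eta>*x))) \<longlonglongrightarrow> four q x * phase (- \<eta>*x)"
  proof (rule AE_I2)
   fix x
   have "(\<lambda>n. four q x * of_real (gau (?s n) x) * exp (- \<i> * of_real (\<eta>*x))) \<longlonglongrightarrow> four q x * of_real 1 * exp (- \<i> * of_real (\<eta>*x))"
    by (intro tendsto_mult tendsto_of_real gau_tendsto tendsto_const)
   then show "(\<lambda>n. four q x * of_real (gau (?s n) x) * exp (- \<i> * of_real (\<eta>*x))) \<longlonglongrightarrow> four q x * phase (- \<eta>*x)" by simp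
  qed
 qed (use f in auto)
 then have 1: "(\<lambda>n. LBINT x. q x * of_real (2*pi * normal_density 0 (?s n) (x-\<eta>))) \<longlonglongrightarrow> four (four q) (- \<eta>)"
  unfolding four_def[of "four q"] by (simp only: four_gau_regularized[OF q pos])
 have eq: "(LBINT x. q x * of_real (2*pi * normal_density 0 s (x-\<eta>))) = (LBINT z. q (\<eta> + s*z) * of_real (2*pi * std_normal_density z))" if s: "s > 0" for s
 proof -
  have d: "s * normal_density 0 s (s*z) = std_normal_density z" for z using s by (simp add: normal_density_def real_sqrt_mult power_mult_distrib)
  have "(LBINT x. q x * of_real (2*pi * normal_density 0 s (x-\<eta>))) = \<bar>s\<bar> *\<^sub>R (LBINT z. q (\<eta> + s*z) * of_real (2*pi * normal_density 0 s (\<eta> + s*z-\<eta>)))"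
   using s by (intro lborel_integral_real_affine) simp
  also have "... = (LBINT z. of_real s * (q (\<eta> + s*z) * of_real (2*pi * normal_density 0 s (s*z))))"
   using s by (simp only: integral_mult_right_zero) (simp add: scaleR_conv_of_real)
  finally show ?thesis by (simp add: d[symmetric] mult_ac)
 qed
 have "(\<lambda>n. LBINT z. q (\<eta> + ?s n * z) * of_real (2*pi * std_normal_density z)) \<longlonglongrightarrow> (LBINT z. q \<eta> * of_real (2*pi * std_normal_density z))"
 proof (rule integral_dominated_convergence[where w = "\<lambda>z. B*(2*pi) * std_normal_density z"])
  show "AE z in lborel. norm (q (\<eta> + ?s n * z) * of_real (2*pi * std_normal_density z)) \<le> B*(2*pi) * std_normal_density z" for n
  proof (rule AE_I2)
   fix z
   have "norm (q (\<eta> + ?s n * z)) * (2*pi * std_normal_density z) \<le> B*(2*pi * std_normal_density z)" by (intro mult_right_mono b) auto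
   then show "norm (q (\<eta> + ?s n * z) * of_real (2*pi * std_normal_density z)) \<le> B*(2*pi) * std_normal_density z"
    by (simp add: norm_mult mult.assoc)
  qed
  show "AE z in lborel. (\<lambda>n. q (\<eta> + ?s n * z) * of_real (2*pi * std_normal_density z)) \<longlonglongrightarrow> q \<eta> * of_real (2*pi * std_normal_density z)"
  proof (intro AE_I2 tendsto_mult tendsto_const isCont_tendsto_compose[OF c])
   fix z
   have "(\<lambda>n. \<eta> + ?s n * z) \<longlonglongrightarrow> \<eta>+0*z"
    by (intro tendsto_intros) (use LIMSEQ_inverse_real_of_nat in \<open>simp add: inverse_eq_divide\<close>)
   then show "(\<lambda>n. \<eta> + ?s n * z) \<longlonglongrightarrow> \<eta>" by simp
  qed
 qed auto
 moreover have "(LBINT z. q \<eta> * of_real (2*pi * std_normal_density z)) = q \<eta> * of_real (LBINT z. 2*pi * std_normal_density z)"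
  by (subst L_integral_of_real[symmetric]) (auto simp only: integral_mult_right_zero intro!: integrable_mult_right integrable_normal_density)
 ultimately have 2: "(\<lambda>n. LBINT x. q x * of_real (2*pi * normal_density 0 (?s n) (x-\<eta>))) \<longlonglongrightarrow> q \<eta> * of_real (2*pi)"
  unfolding eq[OF pos] by simp
 show ?thesis using LIMSEQ_unique[OF 1 2] by (simp add: mult.commute)
qed

lemma four_conv:
 assumes "edec f" "edec g" shows "four (conv f g) x = four f x * four g x"
proof -
 have [measurable]: "meas f" "meas g" using assms by (auto simp: expd_def)
 obtain C \<sigma> where *: "C > 0" "\<sigma> > 0" "!!x. norm (f x) \<le> C * decay \<sigma> x" "!!x. norm (g x) \<le> C * decay \<sigma> x"
  using edec_common[OF assms] by metis
 let ?f = "\<lambda>\<xi> y. f (\<xi>-y) * g y * phase (x*\<xi>)"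
 have int: "integrable lborel2 (\<lambda>z. ?f (fst z) (snd z))"
 proof (rule integrable_pair_exp[where \<sigma> = "\<sigma>/2" and C = "C*C"])
  show "norm (?f \<xi> y) \<le> C*C * decay (\<sigma>/2) \<xi> * decay (\<sigma>/2) y" for \<xi> y
   using conv_dom[OF *(3,4,2,1), of \<xi> y] by (simp add: norm_mult)
 qed (use *(2) in auto)
 have "four (conv f g) x = (LBINT \<xi>. LBINT y. ?f \<xi> y)" unfolding four_def conv_def by (simp only: integral_mult_left_zero)
 also have "... = (LBINT y. LBINT \<xi>. ?f \<xi> y)" by (rule lborel_fubini[OF int, symmetric])
 also have "... = (LBINT y. four f x * (g y * phase (x*y)))"
 proof (rule L_integral_cong[OF refl])
  fix y
  have "(LBINT \<xi>. ?f \<xi> y) = \<bar>1\<bar> *\<^sub>R (LBINT \<xi>. ?f (y+1*\<xi>) y)" by (rule lborel_integral_real_affine) simp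
  also have "... = (LBINT \<xi>. (f \<xi> * phase (x*\<xi>))*(g y * phase (x*y)))" by (simp add: mult_exp_exp[symmetric] algebra_simps exp_add)
  also have "... = four f x * (g y * phase (x*y))" unfolding four_def by (rule integral_mult_left_zero)
  finally show "(LBINT \<xi>. ?f \<xi> y) = four f x * (g y * phase (x*y))" .
 qed
 also have "... = four f x * four g x" unfolding four_def[of g] by (rule integral_mult_right_zero)
 finally show ?thesis .
qed

lemma four_add: "integrable lborel f ==> integrable lborel g ==> four (\<lambda>x. f x + g x) x = four f x + four g x"
 by (simp only: four_def distrib_right L_integral_add[OF four_integrable four_integrable])

lemma four_diff: "integrable lborel f ==> integrable lborel g ==> four (\<lambda>x. f x - g x) x = four f x - four g x"
 by (simp only: four_def left_diff_distrib L_integral_diff[OF four_integrable four_integrable])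

lemma four_cmult: "four (\<lambda>x. c * f x) x = c * four f x" unfolding four_def by (simp only: mult.assoc integral_mult_right_zero)

lemma L2_norm_reflect:
 fixes f :: "real => complex"
 assumes "square_integrable f"
 shows "square_integrable (\<lambda>x. f (a-x))" "L2_norm (\<lambda>x. f (a-x)) = L2_norm f"
proof -
 have [measurable]: "meas f" using assms by (simp add: square_integrable_def)
 have i: "integrable lborel (\<lambda>x. (norm (f x))^2)" using assms by (simp add: square_integrable_def)
 show "square_integrable (\<lambda>x. f (a-x))" using lborel_integrable_real_affine[OF i, of "- 1" a] by (simp add: square_integrable_def)
 show "L2_norm (\<lambda>x. f (a-x)) = L2_norm f"
  using lborel_integral_real_affine[of "- 1" "\<lambda>x. (norm (f x))^2" a] by (simp add: L2_norm_def)
qed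

section \<open>The Plancherel transform: uniqueness and injectivity\<close>

definition window :: "real => (real => real) => real => complex" where
 "window R f x = of_real (indicator {-R..R} x * f x)"

lemma window_integrable:
 assumes "square_integrable f"
 shows "integrable lborel (window R f)" "integrable lborel (\<lambda>x. (norm (window R f x))^2)"
proof -
 have [measurable]: "meas f" using assms by (simp add: square_integrable_def)
 have i: "integrable lborel (\<lambda>x. (f x)^2)" using assms by (simp add: square_integrable_def)
 have m: "meas (window R f)" unfolding window_def[abs_def] by measurable
 show "integrable lborel (window R f)"
 proof (rule L_integrable_bound)
  show "integrable lborel (\<lambda>x. indicator {-R..R} x+(f x)^2)" using i by (intro L_integrable_add integrable_real_indicator) (auto simp: emeasure_lborel_Icc_eq)
  have "\<bar>y\<bar> \<le> 1+y^2" for y :: real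
  proof (cases "\<bar>y\<bar> \<le> 1")
   case False
   then have "\<bar>y\<bar>*1 \<le> \<bar>y\<bar>*\<bar>y\<bar>" by (intro mult_left_mono) auto
   then show ?thesis by (simp add: power2_eq_square)
  qed (simp add: add_increasing2)
  then show "AE x in lborel. norm (window R f x) \<le> norm (indicator {-R..R} x+(f x)^2)" by (auto simp: window_def indicator_def)
 qed (use m in simp)
 show "integrable lborel (\<lambda>x. (norm (window R f x))^2)"
  by (rule L_integrable_bound[OF i]) (use m in \<open>auto simp: window_def indicator_def\<close>)
qed

lemma has_fourier_transform_iff:
 "has_fourier_transform f F \<longleftrightarrow> square_integrable f \<and> square_integrable F \<and>
  ((\<lambda>R. \<integral>\<^sup>+ \<xi>. ennreal ((norm (of_real (1 / sqrt (2*pi)) * four (window R f) (- \<xi>) - F \<xi>))^2) \<partial>lborel) \<longlongrightarrow> 0) at_top"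
proof -
 have "(LINT x:{-R..R}|lborel. exp (- \<i> * complex_of_real (x*\<xi>)) * complex_of_real (f x)) = four (window R f) (- \<xi>)" for R \<xi>
  unfolding four_def set_lebesgue_integral_def window_def by (intro L_integral_cong refl) (simp add: indicator_def mult.commute)
 then show ?thesis by (simp only: has_fourier_transform_def)
qed

lemma four_window_measurable [measurable]: "square_integrable f ==> meas (four (window R f))"
 using borel_measurable_integrable[OF window_integrable(1)] by (intro four_measurable) simp

lemma nn_integral_square_triangle:
 fixes A B F :: "real => complex"
 assumes [measurable]: "meas A" "meas B" "meas F"
 shows "(\<integral>\<^sup>+ x. ennreal ((norm (A x - B x))^2) \<partial>lborel) \<le> 2*((\<integral>\<^sup>+ x. ennreal ((norm (A x - F x))^2) \<partial>lborel)+(\<integral>\<^sup>+ x. ennreal ((norm (B x - F x))^2) \<partial>lborel))"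
proof -
 have "(\<integral>\<^sup>+ x. ennreal ((norm (A x - B x))^2) \<partial>lborel) \<le> (\<integral>\<^sup>+ x. 2*(ennreal ((norm (A x - F x))^2) + ennreal ((norm (B x - F x))^2)) \<partial>lborel)"
 proof (rule nn_integral_mono)
  fix x
  have "norm (A x - B x) \<le> norm (A x - F x) + norm (B x - F x)" by (rule norm_triangle_ineq4[of "A x - F x" "B x - F x", simplified])
  then have "(norm (A x - B x))^2 \<le> (norm (A x - F x) + norm (B x - F x))^2" by (intro power_mono) auto
  also have "... \<le> 2*((norm (A x - F x))^2+(norm (B x - F x))^2)"
   using sum_squares_bound[of "norm (A x - F x)" "norm (B x - F x)"] by (simp add: power2_sum)
  finally have "ennreal ((norm (A x - B x))^2) \<le> ennreal (2*((norm (A x - F x))^2+(norm (B x - F x))^2))" by (rule ennreal_leI)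
  then show "ennreal ((norm (A x - B x))^2) \<le> 2*(ennreal ((norm (A x - F x))^2) + ennreal ((norm (B x - F x))^2))" by (simp add: ennreal_mult)
 qed
 then show ?thesis by (simp add: nn_integral_cmult nn_integral_add)
qed

lemma has_fourier_transform_unique:
 assumes "has_fourier_transform f F" "has_fourier_transform f G" shows "AE \<xi> in lborel. F \<xi> = G \<xi>"
proof -
 have f: "square_integrable f" using assms(1) by (simp add: has_fourier_transform_def)
 have [measurable]: "meas F" "meas G" using assms by (auto simp: has_fourier_transform_def square_integrable_def)
 let ?T = "\<lambda>R \<xi>. of_real (1 / sqrt (2*pi)) * four (window R f) (- \<xi>)"
 have [measurable]: "meas (?T R)" for R using four_window_measurable[OF f, of R] by measurable
 let ?a = "\<lambda>R. \<integral>\<^sup>+ \<xi>. ennreal ((norm (?T R \<xi> - F \<xi>))^2) \<partial>lborel" and ?b = "\<lambda>R. \<integral>\<^sup>+ \<xi>. ennreal ((norm (?T R \<xi> - G \<xi>))^2) \<partial>lborel"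
 have ab: "(?a \<longlongrightarrow> 0) at_top" "(?b \<longlongrightarrow> 0) at_top" using assms by (auto simp: has_fourier_transform_iff)
 have "((\<lambda>R. 2*(?a R + ?b R)) \<longlongrightarrow> 2*(0+0)) at_top" by (intro ennreal_tendsto_cmult tendsto_add ab) simp
 moreover have "(\<integral>\<^sup>+ x. ennreal ((norm (F x - G x))^2) \<partial>lborel) \<le> 2*(?a R + ?b R)" for R
 proof -
  have "(\<integral>\<^sup>+ \<xi>. ennreal ((norm (H \<xi> - ?T R \<xi>))^2) \<partial>lborel) = (\<integral>\<^sup>+ \<xi>. ennreal ((norm (?T R \<xi> - H \<xi>))^2) \<partial>lborel)" for H
   by (intro nn_integral_cong) (simp only: norm_minus_commute)
  moreover have "meas F" "meas G" "meas (?T R)" by measurable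
  note nn_integral_square_triangle[OF this]
  ultimately show ?thesis by (simp only:)
 qed
 ultimately have "(\<integral>\<^sup>+ x. ennreal ((norm (F x - G x))^2) \<partial>lborel) \<le> 0"
  by (intro tendsto_lowerbound[where F = "at_top :: real filter"]) auto
 then have "AE x in lborel. ennreal ((norm (F x - G x))^2) = 0" by (subst nn_integral_0_iff_AE[symmetric]) auto
 then show ?thesis by eventually_elim simp
qed

lemma has_fourier_transform_cong_AE:
 assumes "has_fourier_transform f F" "AE \<xi> in lborel. F \<xi> = G \<xi>" "square_integrable G" shows "has_fourier_transform f G"
proof -
 have "(\<integral>\<^sup>+ \<xi>. ennreal ((norm (H \<xi> - F \<xi>))^2) \<partial>lborel) = (\<integral>\<^sup>+ \<xi>. ennreal ((norm (H \<xi> - G \<xi>))^2) \<partial>lborel)" for H :: "real => complex"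
  by (rule nn_integral_cong_AE) (use assms(2) in auto)
 with assms show ?thesis by (simp add: has_fourier_transform_iff)
qed

text \<open>The positive and negative parts have the same mass, read off from the transform at 0.
  Normalised, they are probability measures with equal characteristic functions, and Levy's theorem
  identifies them.\<close>

lemma real_fourier_zero_imp_AE_zero:
 fixes d :: "real => real"
 assumes d: "integrable lborel d" and z: "!!\<eta>. four (\<lambda>x. of_real (d x)) \<eta> = 0"
 shows "AE x in lborel. d x = 0"
proof -
 have [measurable]: "meas d" using borel_measurable_integrable[OF d] by simp
 define p where "p x = max 0 (d x)" for x
 define n where "n x = max 0 (- d x)" for x
 have [measurable]: "meas p" "meas n" unfolding p_def[abs_def] n_def[abs_def] by measurable
 have ip: "integrable lborel p" "integrable lborel n" unfolding p_def[abs_def] n_def[abs_def] using d by (auto intro!: L_integrable_max)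
 have dpn: "d x = p x - n x" for x by (simp add: p_def n_def)
 define m where "m = (LBINT x. p x)"
 have m0: "m \<ge> 0" unfolding m_def by (intro L_integral_nonneg) (simp add: p_def)
 have icp: "integrable lborel (\<lambda>x. complex_of_real (p x))" "integrable lborel (\<lambda>x. complex_of_real (n x))" using ip by auto
 have fe: "four (\<lambda>x. of_real (p x)) \<eta> = four (\<lambda>x. of_real (n x)) \<eta>" for \<eta>
  using z[of \<eta>] four_diff[OF icp, of \<eta>] by (simp add: dpn)
 have mn: "m = (LBINT x. n x)" using fe[of 0] unfolding four_def m_def by (simp add: integral_complex_of_real)
 show ?thesis
 proof (cases "m = 0")
  case True
  have "AE x in lborel. p x = 0" "AE x in lborel. n x = 0"
   using integral_nonneg_eq_0_iff_AE[OF ip(1)] integral_nonneg_eq_0_iff_AE[OF ip(2)] True m_def mn by (auto simp: p_def n_def)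
  then show ?thesis by eventually_elim (simp add: dpn)
 next
  case False
  then have m: "m > 0" using m0 by simp
  let ?D = "\<lambda>q. density lborel (\<lambda>x. ennreal (q x / m))"
  have rd: "real_distribution (?D q)"
   if q: "integrable lborel q" "!!x. q x \<ge> 0" "(LBINT x. q x) = m" for q
  proof -
   have [measurable]: "meas q" using borel_measurable_integrable[OF q(1)] by simp
   have "(\<integral>\<^sup>+ x. ennreal (q x / m) \<partial>lborel) = ennreal (LBINT x. q x / m)" by (rule nn_integral_eq_integral) (use q m in auto)
   also have "... = 1" using q(3) m by simp
   finally have "prob_space (?D q)" by (intro prob_spaceI) (simp add: emeasure_density)
   then show ?thesis by (simp add: real_distribution_def real_distribution_axioms_def)
  qed
  have ch: "char (?D q) \<eta> = four (\<lambda>x. of_real (q x)) \<eta> / of_real m"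
   if q: "integrable lborel q" "!!x. q x \<ge> 0" for q \<eta>
  proof -
   have [measurable]: "meas q" using borel_measurable_integrable[OF q(1)] by simp
   have "char (?D q) \<eta> = (LBINT x. (q x / m) *\<^sub>R iexp (\<eta>*x))" unfolding char_def by (subst integral_density) (use q m in auto)
   also have "... = (LBINT x. (of_real (q x) * phase (\<eta>*x)) / of_real m)" by (intro L_integral_cong refl) (simp add: scaleR_conv_of_real)
   finally show ?thesis unfolding four_def by simp
  qed
  have "?D p = ?D n"
  proof (rule Levy_uniqueness)
   show "real_distribution (?D p)" by (rule rd[OF ip(1)]) (auto simp: p_def m_def)
   show "real_distribution (?D n)" by (rule rd[OF ip(2)]) (auto simp: n_def mn)
   show "char (?D p) = char (?D n)" using ch[OF ip(1)] ch[OF ip(2)] fe by (auto simp: p_def n_def fun_eq_iff)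
  qed
  then have "AE x in lborel. ennreal (p x / m) = ennreal (n x / m)"
   by (subst (asm) sigma_finite_measure.density_unique_iff[OF sigma_finite_lborel]) auto
  then show ?thesis
  proof eventually_elim
   case (elim x)
   then have "p x / m = n x / m" using m by (subst (asm) ennreal_inj) (auto simp: p_def n_def)
   then show ?case using m dpn[of x] by simp
  qed
 qed
qed

text \<open>Writes the transform of the damped window as an average of the undamped transform, so
  that smallness of the latter in L2 gives smallness at every point.\<close>

lemma four_window_gau:
 assumes d: "square_integrable d"
 shows "four (\<lambda>x. window R d x * of_real (gau 1 x)) (- \<eta>) = of_real (1 / sqrt (2*pi)) * (LBINT \<xi>. of_real (gau 1 \<xi>) * four (window R d) (- \<eta>-\<xi>))"
proof -
 note ci = window_integrable[OF d, of R]
 have [measurable]: "meas (window R d)" using borel_measurable_integrable[OF ci(1)] by simp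
 have g: "of_real (gau 1 x) = of_real (1 / sqrt (2*pi)) * four (\<lambda>\<xi>. of_real (gau 1 \<xi>)) (- x)" for x
 proof -
  have "1 / sqrt (2*pi) * (2*pi * normal_density 0 1 (- x)) = gau 1 x"
  proof -
   have "1 / sqrt (2*pi) * (2*pi / sqrt (2*pi)) = 1" by simp
   then show ?thesis by (simp add: normal_density_def gau_def field_simps)
  qed
  then show ?thesis unfolding four_gau[OF zero_less_one] of_real_mult[symmetric] by (simp only:)
 qed
 let ?f = "\<lambda>x \<xi>. window R d x * phase (- \<eta>*x) * (of_real (gau 1 \<xi>) * phase (- x*\<xi>))"
 have int: "integrable lborel2 (\<lambda>z. ?f (fst z) (snd z))"
 proof (rule integrable_pair_bound[where a = "\<lambda>x. norm (window R d x)" and b = "gau 1"])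
  show "norm (?f x \<xi>) \<le> norm (window R d x) * gau 1 \<xi>" for x \<xi> unfolding norm_mult norm_exp_imaginary using gau_bounds by simp
 qed (use ci gau_integrable[of 1] in auto)
 have "four (\<lambda>x. window R d x * of_real (gau 1 x)) (- \<eta>) = (LBINT x. of_real (1 / sqrt (2*pi)) * (LBINT \<xi>. ?f x \<xi>))"
  unfolding four_def[of _ "- \<eta>"]
 proof (rule L_integral_cong[OF refl])
  fix x
  have "(LBINT \<xi>. ?f x \<xi>) = window R d x * phase (- \<eta>*x) * four (\<lambda>\<xi>. of_real (gau 1 \<xi>)) (- x)"
   unfolding four_def by (rule integral_mult_right_zero)
  moreover have "a*(b*c)*d = b*(a*d*c)" for a b c d :: complex by (simp only: mult_ac)
  ultimately show "window R d x * of_real (gau 1 x) * phase (- \<eta>*x) = of_real (1 / sqrt (2*pi)) * (LBINT \<xi>. ?f x \<xi>)"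
   unfolding g[of x] by metis
 qed
 also have "... = of_real (1 / sqrt (2*pi)) * (LBINT x. LBINT \<xi>. ?f x \<xi>)" by (rule integral_mult_right_zero)
 also have "(LBINT x. LBINT \<xi>. ?f x \<xi>) = (LBINT \<xi>. LBINT x. ?f x \<xi>)" by (rule lborel_fubini[OF int, symmetric])
 also have "... = (LBINT \<xi>. of_real (gau 1 \<xi>) * four (window R d) (- \<eta>-\<xi>))"
 proof (rule L_integral_cong[OF refl])
  fix \<xi>
  have e: "phase (- \<eta>*x) * phase (- x*\<xi>) = phase ((- \<eta>-\<xi>)*x)" for x by (simp add: mult_exp_exp algebra_simps)
  have r: "a*b*(c*d) = c*(a*(b*d))" for a b c d :: complex by (simp only: mult_ac)
  have "?f x \<xi> = of_real (gau 1 \<xi>) * (window R d x * phase ((- \<eta>-\<xi>)*x))" for x unfolding e[symmetric] by (rule r)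
  then have "(LBINT x. ?f x \<xi>) = (LBINT x. of_real (gau 1 \<xi>) * (window R d x * phase ((- \<eta>-\<xi>)*x)))"
   by (rule L_integral_cong[OF refl])
  also have "... = of_real (gau 1 \<xi>) * four (window R d) (- \<eta>-\<xi>)" unfolding four_def by (rule integral_mult_right_zero)
  finally show "(LBINT x. ?f x \<xi>) = of_real (gau 1 \<xi>) * four (window R d) (- \<eta>-\<xi>)" .
 qed
 finally show ?thesis .
qed

text \<open>The transforms of the windows of d = f - g tend to 0 in L2. Damping by a Gaussian makes
  \<open>d\<close> integrable with a transform that vanishes everywhere, hence zero almost
  everywhere; and the Gaussian has no zeros.\<close>

lemma has_fourier_transform_inj:
 assumes "has_fourier_transform f F" "has_fourier_transform g F" shows "AE x in lborel. f x = g x"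
proof -
 have f: "square_integrable f" "square_integrable g" using assms by (auto simp: has_fourier_transform_def)
 have [measurable]: "meas F" "meas f" "meas g" using assms by (auto simp: has_fourier_transform_def square_integrable_def)
 define d where "d x = f x - g x" for x
 have [measurable]: "meas d" unfolding d_def[abs_def] by measurable
 have d: "square_integrable d" using L2_triangle(1)[OF f(1), of "\<lambda>x. - g x"] f(2) by (simp add: d_def[abs_def] square_integrable_def)
 note E = bessel_inequality_integrable(1)[OF window_integrable[OF d]]
 let ?c = "complex_of_real (1 / sqrt (2*pi))"
 let ?A = "\<lambda>f R \<xi>. ?c * four (window R f) (- \<xi>)"
 let ?a = "\<lambda>f R. \<integral>\<^sup>+ \<xi>. ennreal ((norm (?A f R \<xi> - F \<xi>))^2) \<partial>lborel"
 have [measurable]: "meas (?A f R)" "meas (?A g R)" for R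
  using four_window_measurable[OF f(1), of R] four_window_measurable[OF f(2), of R] by measurable
 have ab: "(?a f \<longlongrightarrow> 0) at_top" "(?a g \<longlongrightarrow> 0) at_top" using assms by (auto simp: has_fourier_transform_iff)
 have dA: "?A f R \<xi> - ?A g R \<xi> = ?c * four (window R d) (0-\<xi>)" for R \<xi>
 proof -
  have "window R d = (\<lambda>x. window R f x - window R g x)" by (simp add: window_def d_def fun_eq_iff right_diff_distrib)
  then show ?thesis using four_diff[OF window_integrable(1)[OF f(1)] window_integrable(1)[OF f(2)], of R R "- \<xi>"] by (simp add: right_diff_distrib)
 qed
 have nE: "(\<integral>\<^sup>+ \<xi>. ennreal ((norm (?A f R \<xi> - ?A g R \<xi>))^2) \<partial>lborel) = ennreal ((norm ?c * L2_norm (four (window R d)))^2)" for R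
 proof -
  have "(norm ?c * L2_norm (four (window R d)))^2 = (LBINT \<xi>. (norm (?c * four (window R d) (0-\<xi>)))^2)"
   unfolding L2_norm_reflect(2)[OF E, of R 0, symmetric] L2_norm_cmult[symmetric] by (rule L2_norm_squared)
  moreover have "integrable lborel (\<lambda>\<xi>. (norm (?c * four (window R d) (0-\<xi>)))^2)"
  proof -
   have "integrable lborel (\<lambda>\<xi>. (norm ?c)^2*(norm (four (window R d) (0-\<xi>)))^2)"
    using L2_norm_reflect(1)[OF E, of R 0] by (intro integrable_mult_right) (simp add: square_integrable_def)
   then show ?thesis by (simp only: norm_mult power_mult_distrib)
  qed
  ultimately show ?thesis unfolding dA by (subst nn_integral_eq_integral) auto
 qed
 have up: "((\<lambda>R. 2*(?a f R + ?a g R)) \<longlongrightarrow> 2*(0+0)) at_top" by (intro ennreal_tendsto_cmult tendsto_add ab) simp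
 have mF: "meas F" "meas (?A f R)" "meas (?A g R)" for R by measurable
 have le: "ennreal ((norm ?c * L2_norm (four (window R d)))^2) \<le> 2*(?a f R + ?a g R)" for R
  unfolding nE[symmetric] by (rule nn_integral_square_triangle[OF mF(2,3,1)])
 have "((\<lambda>R. ennreal ((norm ?c * L2_norm (four (window R d)))^2)) \<longlongrightarrow> 2*(0+0)) at_top"
  by (rule tendsto_sandwich[OF _ _ _ up, of "\<lambda>_. 0"]) (use le in \<open>simp_all del: mult_eq_0_iff\<close>)
 then have "((\<lambda>R. ennreal ((norm ?c * L2_norm (four (window R d)))^2)) \<longlongrightarrow> 0) at_top" by simp
 then have "((\<lambda>R. (norm ?c * L2_norm (four (window R d)))^2) \<longlongrightarrow> 0) at_top"
  by (subst (asm) tendsto_ennreal_iff[where x = 0, simplified]) auto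
 then have "((\<lambda>R. sqrt ((norm ?c * L2_norm (four (window R d)))^2)) \<longlongrightarrow> sqrt 0) at_top" by (rule tendsto_real_sqrt)
 then have "((\<lambda>R. norm ?c * L2_norm (four (window R d))) \<longlongrightarrow> 0) at_top" by (simp add: abs_mult)
 then have lim0: "((\<lambda>R. norm ?c * L2_norm (four (window R d)) * L2_norm (\<lambda>\<xi>. complex_of_real (gau 1 \<xi>))) \<longlongrightarrow> 0) at_top"
  by (rule tendsto_mult_left_zero)
 have gsq: "square_integrable (\<lambda>\<xi>. complex_of_real (gau 1 \<xi>))"
 proof -
  have "integrable lborel (\<lambda>x. (gau 1 x)^2)"
   by (rule L_integrable_bound[OF gau_integrable[of 1]]) (use gau_bounds in \<open>auto simp: power2_eq_square mult_left_le\<close>)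
  then show ?thesis using gau_bounds by (simp add: square_integrable_def)
 qed
 have gsq': "square_integrable (gau 1)" using gsq by (simp add: square_integrable_def)
 define e where "e x = d x * gau 1 x" for x
 have e: "integrable lborel e"
  using square_integrable_norm_mult[OF d gsq'] by (subst integrable_norm_iff[symmetric]) (auto simp: e_def[abs_def] abs_mult)
 have "four (\<lambda>x. of_real (e x)) (- \<eta>) = 0" for \<eta>
 proof -
  have "norm (four (\<lambda>x. window R d x * of_real (gau 1 x)) (- \<eta>)) \<le> norm ?c * L2_norm (four (window R d)) * L2_norm (\<lambda>\<xi>. complex_of_real (gau 1 \<xi>))" for R
  proof -
   have "norm (LBINT \<xi>. of_real (gau 1 \<xi>) * four (window R d) (- \<eta>-\<xi>)) \<le> (LBINT \<xi>. norm (complex_of_real (gau 1 \<xi>)) * norm (four (window R d) (- \<eta>-\<xi>)))"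
    by (rule order_trans[OF integral_norm_bound]) (simp add: norm_mult)
   also have "... \<le> L2_norm (\<lambda>\<xi>. complex_of_real (gau 1 \<xi>)) * L2_norm (four (window R d))"
    using L2_Cauchy_Schwarz[OF gsq L2_norm_reflect(1)[OF E[of R], of "- \<eta>"]] L2_norm_reflect(2)[OF E[of R], of "- \<eta>"] by simp
   finally have "norm ?c * norm (LBINT \<xi>. of_real (gau 1 \<xi>) * four (window R d) (- \<eta>-\<xi>)) \<le> norm ?c * (L2_norm (\<lambda>\<xi>. complex_of_real (gau 1 \<xi>)) * L2_norm (four (window R d)))"
    by (rule mult_left_mono) simp
   then show ?thesis unfolding four_window_gau[OF d] norm_mult by (simp only: mult_ac)
  qed
  then have 1: "((\<lambda>R. four (\<lambda>x. window R d x * of_real (gau 1 x)) (- \<eta>)) \<longlongrightarrow> 0) at_top"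
   by (intro Lim_null_comparison[OF _ lim0] always_eventually allI)
  have "((\<lambda>R. four (\<lambda>x. window R d x * of_real (gau 1 x)) (- \<eta>)) \<longlongrightarrow> four (\<lambda>x. of_real (e x)) (- \<eta>)) at_top"
   unfolding four_def
  proof (rule integral_dominated_convergence_at_top[where w = "\<lambda>x. norm (e x)"])
   show "integrable lborel (\<lambda>x. norm (e x))" using e by simp
   have [measurable]: "meas e" using borel_measurable_integrable[OF e] by simp
   have [measurable]: "meas (window R d)" for R unfolding window_def[abs_def] by measurable
   show "(\<lambda>x. complex_of_real (e x) * phase (- \<eta>*x)) \<in> borel_measurable lborel"
    "(\<lambda>x. window R d x * of_real (gau 1 x) * phase (- \<eta>*x)) \<in> borel_measurable lborel" for R by measurable
   show "\<forall>\<^sub>F R in at_top. AE x in lborel. norm (window R d x * of_real (gau 1 x) * phase (- \<eta>*x)) \<le> norm (e x)"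
    unfolding norm_mult norm_exp_imaginary by (auto simp: window_def e_def indicator_def abs_mult intro!: always_eventually)
   show "AE x in lborel. ((\<lambda>R. window R d x * of_real (gau 1 x) * phase (- \<eta>*x)) \<longlongrightarrow> complex_of_real (e x) * phase (- \<eta>*x)) at_top"
   proof (intro AE_I2 tendsto_eventually)
    fix x :: real
    show "\<forall>\<^sub>F R in at_top. window R d x * of_real (gau 1 x) * phase (- \<eta>*x) = complex_of_real (e x) * phase (- \<eta>*x)"
     using eventually_ge_at_top[of "\<bar>x\<bar>"] by eventually_elim (auto simp: window_def e_def indicator_def)
   qed
  qed
  from tendsto_unique[OF _ this 1] show ?thesis by simp
 qed
 then have "four (\<lambda>x. of_real (e x)) \<eta> = 0" for \<eta> using minus_minus[of \<eta>] by metis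
 then have "AE x in lborel. e x = 0" by (rule real_fourier_zero_imp_AE_zero[OF e])
 then show ?thesis by eventually_elim (auto simp: e_def d_def gau_def)
qed

section \<open>Weighted Sobolev spaces\<close>

abbreviation halfdiff :: "nat => cfun => bool" where
 "halfdiff n q \<equiv> hcd {0} n (\<lambda>_. q)"

lemma halfdiffD:
 assumes "halfdiff n q"
 shows "edec q" "causal q" "continuous_on {0..} q" "integrable lborel q" "meas q" "square_integrable q"
proof -
 note h = hcd_hc[OF assms]
 show e: "edec q" and "causal q" and "continuous_on {0..} q" using hcD[OF h] hc_slice_continuous[OF h, of 0] by auto
 show "integrable lborel q" by (rule edec_integrable[OF e])
 show "meas q" using e by (simp add: expd_def)
 show "square_integrable q" by (rule edec_square_integrable[OF e])
qed

lemma halfdiff_dx: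
 assumes "halfdiff (Suc n) q"
 shows "halfdiff n (dx q)" "x \<ge> 0 ==> (q hvd dx q x) (at_half x)" using hcd_dx[OF assms] by auto

section \<open>Real synthesis and weights\<close>

text \<open>Taking twice the real part adds the negative frequencies: this is the inverse transform
  of \<open>herm q\<close> without its normalising constant.\<close>

definition synth :: "cfun => real => real" where
 "synth q x = 2 * Re (four q x)"

lemma four_crefl: "four (crefl q) x = cnj (four q x)"
proof -
 have "four (crefl q) x = \<bar>- 1\<bar> *\<^sub>R (LBINT \<xi>. crefl q (0 + - 1*\<xi>) * phase (x*(0 + - 1*\<xi>)))"
  unfolding four_def by (rule lborel_integral_real_affine) simp
 also have "... = (LBINT \<xi>. cnj (q \<xi> * phase (x*\<xi>)))" by (simp add: crefl_def exp_cnj)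
 finally show ?thesis unfolding four_def by (simp only: L_integral_cnj)
qed

lemma synth_eq_four:
 assumes "edec q" shows "of_real (synth q x) = four (herm q) x"
proof -
 have "four (herm q) x = four q x + four (crefl q) x" unfolding herm_def[abs_def] by (intro four_add edec_integrable assms edec_crefl)
 then show ?thesis by (simp add: four_crefl synth_def complex_add_cnj)
qed

lemma synth_measurable: "meas q ==> meas (synth q)" unfolding synth_def[abs_def] by measurable

lemma norm_synth_le: "\<bar>synth q x\<bar> \<le> 2 * norm (four q x)" using abs_Re_le_cmod[of "four q x"] by (simp add: synth_def abs_mult)

lemma L2_norm_synth_le:
 assumes "edec q" shows "square_integrable (synth q)" "L2_norm (synth q) \<le> 2 * sqrt (2*pi) * L2_norm q"
proof -
 have [measurable]: "meas q" using assms by (simp add: expd_def)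
 have "integrable lborel q" "integrable lborel (\<lambda>x. (norm (q x))^2)"
  using edec_integrable[OF assms] edec_square_integrable[OF assms] by (auto simp: square_integrable_def)
 note b = bessel_inequality_integrable[OF this]
 have "square_integrable (\<lambda>x. 2 * four q x)" using b(1) by (auto simp: square_integrable_def norm_mult power_mult_distrib)
 note m = L2_norm_mono[OF this synth_measurable, of q, unfolded real_norm_def]
 show "square_integrable (synth q)" by (rule m) (use norm_synth_le[of q] in \<open>auto simp: norm_mult\<close>)
 have "L2_norm (synth q) \<le> L2_norm (\<lambda>x. 2 * four q x)" by (rule m) (use norm_synth_le[of q] in \<open>auto simp: norm_mult\<close>)
 also have "... \<le> 2*(sqrt (2*pi) * L2_norm q)" using b(2) by (simp add: L2_norm_cmult)
 finally show "L2_norm (synth q) \<le> 2 * sqrt (2*pi) * L2_norm q" by simp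
qed

lemma edec_modulate:
 assumes "edec q" shows "edec (\<lambda>\<xi>. q \<xi> * phase (x*\<xi>))"
proof -
 have [measurable]: "meas q" using assms by (simp add: expd_def)
 obtain C \<sigma> where C: "C > 0" "\<sigma> > 0" "!!x. norm (q x) \<le> C * decay \<sigma> x" using edecE[OF assms] by metis
 show ?thesis
 proof (rule expdI)
  show "norm (q \<xi> * phase (x*\<xi>)) \<le> C * decay \<sigma> \<xi>" for \<xi> unfolding norm_mult norm_exp_imaginary using C(3)[of \<xi>] by simp
 qed (use C(2) in auto)
qed

lemma modulate_has_vector_derivative:
 "((\<lambda>\<xi>. phase (x*\<xi>)) hvd phase (x*\<xi>) * (\<i> * of_real x)) (at \<xi> within S)"
proof -
 have e: "(\<lambda>\<xi>. phase (x*\<xi>)) = (\<lambda>\<xi>. exp (\<xi> *\<^sub>R (\<i> * of_real x)))" by (simp add: scaleR_conv_of_real mult_ac)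
 show ?thesis unfolding e by (rule has_vector_derivative_eq_rhs, rule exp_scaleR_has_vector_derivative_right) (simp add: scaleR_conv_of_real mult_ac)
qed

text \<open>The only boundary term sits at 0, where the half-line begins; such terms govern the tail
  in x.\<close>

lemma four_by_parts:
 assumes "halfdiff (Suc n) q" shows "\<i> * of_real x * four q x = - q 0 - four (dx q) x"
proof -
 note q = halfdiffD[OF assms] and q' = halfdiffD[OF halfdiff_dx(1)[OF assms]]
 let ?e = "\<lambda>\<xi>. phase (x*\<xi>)"
 have "(LBINT \<xi>. q \<xi> * (?e \<xi> * (\<i> * of_real x)) + dx q \<xi> * ?e \<xi>) = - (q 0 * ?e 0)"
 proof (rule halfline_integral_derivative)
  show "edec (\<lambda>\<xi>. q \<xi> * ?e \<xi>)" by (rule edec_modulate[OF q(1)])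
  have "edec (\<lambda>\<xi>. \<i> * of_real x * (q \<xi> * ?e \<xi>) + dx q \<xi> * ?e \<xi>)" by (intro expd_intros edec_modulate q(1) q'(1))
  then show "edec (\<lambda>\<xi>. q \<xi> * (?e \<xi> * (\<i> * of_real x)) + dx q \<xi> * ?e \<xi>)" by (simp only: mult_ac)
  show "causal (\<lambda>\<xi>. q \<xi> * (?e \<xi> * (\<i> * of_real x)) + dx q \<xi> * ?e \<xi>)" using q(2) q'(2) by (simp add: causal_def)
  show "continuous_on {0..} (\<lambda>\<xi>. q \<xi> * (?e \<xi> * (\<i> * of_real x)) + dx q \<xi> * ?e \<xi>)" by (intro continuous_intros q(3) q'(3))
  show "((\<lambda>\<xi>. q \<xi> * ?e \<xi>) hvd q \<xi> * (?e \<xi> * (\<i> * of_real x)) + dx q \<xi> * ?e \<xi>) (at \<xi> within {0..})" if "\<xi> \<ge> 0" for \<xi>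
   by (intro has_vector_derivative_mult halfdiff_dx(2)[OF assms that] modulate_has_vector_derivative)
 qed
 moreover have "(LBINT \<xi>. q \<xi> * (?e \<xi> * (\<i> * of_real x)) + dx q \<xi> * ?e \<xi>) = \<i> * of_real x * four q x + four (dx q) x"
 proof -
  have "(LBINT \<xi>. \<i> * of_real x * (q \<xi> * ?e \<xi>) + dx q \<xi> * ?e \<xi>) = \<i> * of_real x * four q x + four (dx q) x"
   unfolding four_def using four_integrable[OF q(4), of x] four_integrable[OF q'(4), of x]
   by (subst L_integral_add) (auto simp only: integral_mult_right_zero intro!: integrable_mult_right)
  then show ?thesis by (simp only: mult_ac)
 qed
 ultimately show ?thesis by (simp add: algebra_simps add_eq_0_iff2)
qed

lemma four_by_parts2:
 assumes "halfdiff (Suc (Suc n)) q"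
 shows "of_real (x^2) * four q x = \<i> * of_real x * q 0 - dx q 0 - four (dx (dx q)) x"
proof -
 have "\<i> * of_real x * (\<i> * of_real x * four q x) = (\<i>*\<i>)*(of_real (x^2) * four q x)"
  by (simp only: power2_eq_square of_real_mult mult_ac)
 then have "of_real (x^2) * four q x = - (\<i> * of_real x * (\<i> * of_real x * four q x))"
  by (simp only: i_squared complex_i_mult_minus minus_mult_left[symmetric] mult_1 minus_minus)
 also have "... = \<i> * of_real x * q 0 + \<i> * of_real x * four (dx q) x" unfolding four_by_parts[OF assms] by (simp add: algebra_simps)
 finally show ?thesis unfolding four_by_parts[OF halfdiff_dx(1)[OF assms]] by (simp add: algebra_simps)
qed

text \<open>Two integrations by parts leave the boundary terms i x q(0) - q'(0). The first is 0, and
  the second has no real part.\<close>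

lemma synth_weight2:
 assumes q: "halfdiff (Suc (Suc n)) q" "q 0 = 0" "Re (dx q 0) = 0"
 shows "x^2 * synth q x = - synth (dx (dx q)) x"
proof -
 have "Re (of_real (x^2) * four q x) = Re (- four (dx (dx q)) x)" unfolding four_by_parts2[OF q(1)] using q(2,3) by simp
 then have "x^2 * Re (four q x) = - Re (four (dx (dx q)) x)"
  by (simp only: Re_complex_of_real Im_complex_of_real times_complex.sel mult_zero_left diff_zero uminus_complex.sel)
 then show ?thesis by (simp only: synth_def mult_ac mult_minus_right)
qed

text \<open>Since q(0) = q'(0) = 0, the first two integrations by parts leave no boundary term. The
  next two leave i x q''(0) - q'''(0) up to sign, and its real part vanishes.\<close>

lemma synth_weight4:
 assumes q: "halfdiff (Suc (Suc (Suc (Suc n)))) q" "q 0 = 0" "dx q 0 = 0" "Im (dx (dx q) 0) = 0" "Re (dx (dx (dx q)) 0) = 0"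
 shows "x^4 * synth q x = synth (dx (dx (dx (dx q)))) x"
proof -
 have q2: "halfdiff (Suc (Suc n)) (dx (dx q))" by (intro halfdiff_dx q(1))
 have "x^4 = x^2*x^2" by (simp add: power2_eq_square power4_eq_xxxx)
 then have "of_real (x^4) * four q x = of_real (x^2) * (of_real (x^2) * four q x)" by (simp only: of_real_mult mult.assoc)
 also have "... = - (of_real (x^2) * four (dx (dx q)) x)" unfolding four_by_parts2[OF q(1)] using q(2,3) by simp
 also have "... = - (\<i> * of_real x * dx (dx q) 0 - dx (dx (dx q)) 0 - four (dx (dx (dx (dx q)))) x)" unfolding four_by_parts2[OF q2] ..
 finally have "Re (of_real (x^4) * four q x) = Re (four (dx (dx (dx (dx q)))) x)" using q(4,5) by (simp del: of_real_power)
 then show ?thesis by (simp add: synth_def del: of_real_power)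
qed

text \<open>Decay like x^-2 makes the synthesis integrable, as Fourier inversion requires; it also
  serves to exclude periodicity at the end.\<close>

lemma synth_decay:
 assumes q: "halfdiff (Suc (Suc n)) q" "q 0 = 0"
 obtains C where "!!x. \<bar>synth q x\<bar> \<le> C*(1/(1+x^2))"
proof -
 note i = halfdiffD(4)[OF q(1)] halfdiffD(4)[OF halfdiff_dx(1)[OF halfdiff_dx(1)[OF q(1)]]]
 define M where "M = (LBINT \<xi>. norm (q \<xi>))+(norm (dx q 0) + (LBINT \<xi>. norm (dx (dx q) \<xi>)))"
 show ?thesis
 proof (rule that[of "2*M"])
  fix x :: real
  have "(1+x^2) * norm (four q x) = norm (four q x) + norm (of_real (x^2) * four q x)" by (simp add: norm_mult distrib_right del: of_real_power)
  also have "norm (of_real (x^2) * four q x) \<le> norm (dx q 0) + norm (four (dx (dx q)) x)"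
   unfolding four_by_parts2[OF q(1)] using q(2) norm_triangle_ineq4[of "- dx q 0" "four (dx (dx q)) x"] by simp
  finally have "(1+x^2) * norm (four q x) \<le> M" using four_norm_le[OF i(1), of x] four_norm_le[OF i(2), of x] unfolding M_def by linarith
  moreover have "1+x^2 > 0" by (intro add_pos_nonneg) auto
  ultimately have "norm (four q x) \<le> M/(1+x^2)" by (simp add: pos_le_divide_eq mult.commute)
  then show "\<bar>synth q x\<bar> \<le> 2*M*(1/(1+x^2))" using norm_synth_le[of q x] by simp
 qed
qed

lemma synth_integrable:
 assumes q: "halfdiff (Suc (Suc n)) q" "q 0 = 0" shows "integrable lborel (synth q)"
proof -
 obtain C where C: "!!x. \<bar>synth q x\<bar> \<le> C*(1/(1+x^2))" using synth_decay[OF q] by metis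
 show ?thesis
 proof (rule L_integrable_bound[OF integrable_mult_right[OF integrable_inverse_1_plus_square', of C]])
  show "synth q \<in> borel_measurable lborel" using synth_measurable[OF halfdiffD(5)[OF q(1)]] by simp
  show "AE x in lborel. norm (synth q x) \<le> norm (C*(1/(1+x^2)))" using C by (intro AE_I2) (metis abs_ge_self order_trans real_norm_def)
 qed
qed

lemma herm_isCont:
 assumes "continuous_on {0..} q" "causal q" "\<eta> \<noteq> 0" shows "isCont (herm q) \<eta>"
proof (cases "\<eta> > 0")
 case True
 have "continuous_on {0<..} (herm q)" by (rule continuous_on_eq[OF continuous_on_subset[OF assms(1)]])
   (use assms(2) in \<open>auto simp: herm_def crefl_def causal_def\<close>)
 then show ?thesis using True by (simp add: continuous_on_eq_continuous_at)
next
 case False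
 have "continuous_on {..<0} (\<lambda>x. cnj (q (- x)))" by (intro continuous_on_cnj continuous_on_compose2[OF assms(1)] continuous_intros) auto
 then have "continuous_on {..<0} (herm q)" by (rule continuous_on_eq) (use assms(2) in \<open>auto simp: herm_def crefl_def causal_def\<close>)
 then show ?thesis using False assms(3) by (simp add: continuous_on_eq_continuous_at)
qed

lemma nn_integral_scaled_reflection:
 fixes E :: "real => complex"
 assumes "square_integrable E"
 shows "(\<integral>\<^sup>+ \<xi>. ennreal ((norm (c * E (- \<xi>)))^2) \<partial>lborel) = ennreal ((norm c * L2_norm E)^2)"
proof -
 have r: "square_integrable (\<lambda>\<xi>. E (- \<xi>))" "L2_norm (\<lambda>\<xi>. E (- \<xi>)) = L2_norm E" using L2_norm_reflect[OF assms, of 0] by auto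
 have "integrable lborel (\<lambda>\<xi>. (norm c)^2*(norm (E (- \<xi>)))^2)"
  using r(1) by (intro integrable_mult_right) (simp add: square_integrable_def)
 then have i: "integrable lborel (\<lambda>\<xi>. (norm (c * E (- \<xi>)))^2)" by (simp only: norm_mult power_mult_distrib)
 have "(norm c * L2_norm E)^2 = (LBINT \<xi>. (norm (c * E (- \<xi>)))^2)"
  unfolding r(2)[symmetric] L2_norm_cmult[symmetric] by (rule L2_norm_squared)
 with i show ?thesis by (subst nn_integral_eq_integral) auto
qed

lemma square_integrable_cmult:
 fixes f :: "real => complex"
 assumes "square_integrable f" shows "square_integrable (\<lambda>x. c * f x)"
proof -
 have "integrable lborel (\<lambda>x. (norm c)^2*(norm (f x))^2)" using assms by (intro integrable_mult_right) (simp add: square_integrable_def)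
 moreover have [measurable]: "meas f" using assms by (simp add: square_integrable_def)
 ultimately show ?thesis by (simp add: square_integrable_def norm_mult power_mult_distrib)
qed

text \<open>By inversion, the error made by truncating to a window is the transform of the tail
  outside it. The Bessel inequality bounds that by the L2 norm of the tail.\<close>

lemma has_fourier_transform_synth:
 assumes q: "halfdiff (Suc (Suc n)) q" "q 0 = 0"
 shows "has_fourier_transform (synth q) (\<lambda>\<xi>. of_real (sqrt (2*pi)) * herm q \<xi>)" unfolding has_fourier_transform_iff
proof (intro conjI)
 note h = halfdiffD[OF q(1)]
 note hh = edec_herm[OF h(1)]
 show sq: "square_integrable (synth q)" by (rule L2_norm_synth_le[OF h(1)])
 show "square_integrable (\<lambda>\<xi>. complex_of_real (sqrt (2*pi)) * herm q \<xi>)" by (intro square_integrable_cmult edec_square_integrable hh)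
 have [measurable]: "meas (synth q)" by (rule synth_measurable[OF h(5)])
 let ?c = "complex_of_real (1 / sqrt (2*pi))"
 let ?D = "\<lambda>R \<xi>. ?c * four (window R (synth q)) (- \<xi>) - of_real (sqrt (2*pi)) * herm q \<xi>"
 define tail where "tail R x = four (herm q) x - window R (synth q) x" for R x
 have fe: "four (herm q) = (\<lambda>x. of_real (synth q x))" by (simp add: fun_eq_iff synth_eq_four[OF h(1)])
 have fi: "integrable lborel (four (herm q))" unfolding fe using synth_integrable[OF q] by simp
 note wi = window_integrable[OF sq]
 have ti: "integrable lborel (tail R)" for R unfolding tail_def[abs_def] by (intro L_integrable_diff fi wi)
 have s2: "integrable lborel (\<lambda>x. (synth q x)^2)" using sq by (simp add: square_integrable_def)
 have tn: "(norm (tail R x))^2 = indicator (- {-R..R}) x * (synth q x)^2" for R x by (auto simp: tail_def fe window_def indicator_def)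
 have ti2: "integrable lborel (\<lambda>x. (norm (tail R x))^2)" for R unfolding tn by (rule integrable_mult_indicator[OF _ s2, simplified]) simp
 have fsq: "square_integrable (four (tail R))" "L2_norm (four (tail R)) \<le> sqrt (2*pi) * L2_norm (tail R)" for R
  using bessel_inequality_integrable[OF ti ti2] by auto
 obtain B where B: "!!\<xi>. norm (herm q \<xi>) \<le> B" using edec_bounded[OF hh] by metis
 have bound: "(\<integral>\<^sup>+ \<xi>. ennreal ((norm (?D R \<xi>))^2) \<partial>lborel)
  \<le> ennreal (LBINT x. (norm (tail R x))^2)" for R
 proof -
  have "AE \<xi> in lborel. \<xi> \<noteq> (0::real)" by (rule AE_lborel_singleton)
  then have "AE \<xi> in lborel. ennreal ((norm (?D R \<xi>))^2) = ennreal ((norm (?c * four (tail R) (- \<xi>)))^2)"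
  proof eventually_elim
   case (elim \<xi>)
   have "four (four (herm q)) (- \<xi>) = 2*pi * herm q \<xi>" by (rule fourier_inversion[OF edec_integrable[OF hh] B herm_isCont[OF h(3,2) elim] fi])
   then have "four (tail R) (- \<xi>) = 2*pi * herm q \<xi> - four (window R (synth q)) (- \<xi>)"
    unfolding tail_def[abs_def] by (subst four_diff[OF fi wi(1)]) simp
   moreover have "?c*(2*pi * herm q \<xi>) = of_real (sqrt (2*pi)) * herm q \<xi>"
   proof -
    have "1 / sqrt (2*pi) * (2*pi) = sqrt (2*pi)" by (simp add: real_div_sqrt)
    then have "?c * of_real (2*pi) = of_real (sqrt (2*pi))" by (simp only: of_real_mult[symmetric])
    then show ?thesis by (metis mult.assoc of_real_mult of_real_numeral)
   qed
   ultimately show ?case by (simp only: right_diff_distrib norm_minus_commute)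
  qed
  then have "(\<integral>\<^sup>+ \<xi>. ennreal ((norm (?D R \<xi>))^2) \<partial>lborel)
   = (\<integral>\<^sup>+ \<xi>. ennreal ((norm (?c * four (tail R) (- \<xi>)))^2) \<partial>lborel)" by (rule nn_integral_cong_AE)
  also have "... = ennreal ((norm ?c * L2_norm (four (tail R)))^2)" by (rule nn_integral_scaled_reflection[OF fsq(1)])
  also have "... \<le> ennreal ((norm ?c * (sqrt (2*pi) * L2_norm (tail R)))^2)" by (intro ennreal_leI power_mono mult_left_mono fsq(2)) auto
  also have "norm ?c * (sqrt (2*pi) * L2_norm (tail R)) = L2_norm (tail R)" by (simp add: norm_divide)
  finally show ?thesis by (simp only: L2_norm_squared)
 qed
 have "((\<lambda>R. LBINT x. (norm (tail R x))^2) \<longlongrightarrow> (LINT x::real|lborel. (0::real))) at_top"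
 proof (rule integral_dominated_convergence_at_top[where w = "\<lambda>x. (synth q x)^2" and f = "\<lambda>_. 0" and s = "\<lambda>R x. (norm (tail R x))^2"])
  show "AE x in lborel. ((\<lambda>R. (norm (tail R x))^2) \<longlongrightarrow> 0) at_top"
  proof (intro AE_I2 tendsto_eventually)
   fix x :: real
   show "\<forall>\<^sub>F R in at_top. (norm (tail R x))^2 = 0"
    using eventually_ge_at_top[of "\<bar>x\<bar>"] by eventually_elim (auto simp: tn indicator_def)
  qed
  show "\<forall>\<^sub>F R in at_top. AE x in lborel. norm ((norm (tail R x))^2) \<le> (synth q x)^2"
   by (auto simp: tn indicator_def intro!: always_eventually)
  show "(\<lambda>x. (norm (tail R x))^2) \<in> borel_measurable lborel" for R unfolding tn by measurable
 qed (use s2 in auto)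
 then have "((\<lambda>R. ennreal (LBINT x. (norm (tail R x))^2)) \<longlongrightarrow> 0) at_top" using tendsto_ennrealI by fastforce
 then show "((\<lambda>R. \<integral>\<^sup>+ \<xi>. ennreal ((norm (?D R \<xi>))^2) \<partial>lborel) \<longlongrightarrow> 0) at_top"
  by (rule tendsto_sandwich[OF _ _ tendsto_const, rotated 2]) (intro always_eventually allI zero_le bound)+
qed

section \<open>Sobolev norms of synthesised functions\<close>

text \<open>The Fourier multiplier of \<open>(1 - \<partial>\<^sub>x\<^sup>2)\<^sup>2\<close>.\<close>
definition bracket4 :: "cfun => cfun" where
 "bracket4 q \<xi> = of_real ((1+\<xi>^2)^2) * q \<xi>"

lemma bracket4_eq: "bracket4 q = (\<lambda>\<xi>. q \<xi> + (2 * mulx (mulx q) \<xi> + mulx (mulx (mulx (mulx q))) \<xi>))"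
 by (simp add: fun_eq_iff bracket4_def mulx_def power2_eq_square algebra_simps)

lemma hcd_bracket4: "hcd I n F ==> hcd I n (\<lambda>t. bracket4 (F t))" unfolding bracket4_eq by (intro hcd_add hcd_cmult hcd_mulx)

lemma is_bessel_potential_synth:
 assumes q: "halfdiff (Suc (Suc n)) q" "q 0 = 0"
 shows "is_bessel_potential 4 (synth (bracket4 q)) (synth q)" unfolding is_bessel_potential_def
proof (intro exI conjI AE_I2)
 have b: "halfdiff (Suc (Suc n)) (bracket4 q)" by (rule hcd_bracket4[OF q(1)])
 show "has_fourier_transform (synth (bracket4 q)) (\<lambda>\<xi>. of_real (sqrt (2*pi)) * herm (bracket4 q) \<xi>)"
  by (rule has_fourier_transform_synth[OF b]) (simp add: bracket4_def q)
 show "has_fourier_transform (synth q) (\<lambda>\<xi>. of_real (sqrt (2*pi)) * herm q \<xi>)" by (rule has_fourier_transform_synth[OF q])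
 fix \<xi> :: real
 have pos: "1+\<xi>^2 > 0" by (intro add_pos_nonneg) auto
 have "herm (bracket4 q) \<xi> = of_real ((1+\<xi>^2)^2) * herm q \<xi>" by (simp add: herm_def crefl_def bracket4_def distrib_left)
 moreover have "(1+\<xi>^2) powr (- 4/2) * (1+\<xi>^2)^2 = 1" using pos by (simp add: powr_minus powr_numeral)
 ultimately show "of_real (sqrt (2*pi)) * herm q \<xi> = complex_of_real ((1+\<xi>^2) powr (- 4/2)) * (of_real (sqrt (2*pi)) * herm (bracket4 q) \<xi>)"
 proof -
  assume h: "herm (bracket4 q) \<xi> = of_real ((1+\<xi>^2)^2) * herm q \<xi>"
   and 1: "(1+\<xi>^2) powr (- 4/2) * (1+\<xi>^2)^2 = 1"
  have "complex_of_real ((1+\<xi>^2) powr (- 4/2)) * (of_real (sqrt (2*pi)) * herm (bracket4 q) \<xi>)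
   = of_real ((1+\<xi>^2) powr (- 4/2) * (1+\<xi>^2)^2) * (of_real (sqrt (2*pi)) * herm q \<xi>)" unfolding h of_real_mult by (simp only: mult_ac)
  then show ?thesis unfolding 1 by simp
 qed
qed

text \<open>The choice made in \<open>sobolev_norm\<close> is harmless: transforms are unique and
  injective almost everywhere, so the chosen function agrees with the explicit one almost
  everywhere.\<close>

lemma sobolev_norm_synth:
 assumes q: "halfdiff (Suc (Suc n)) q" "q 0 = 0"
 shows "sobolev_norm 4 (synth q) = L2_norm (synth (bracket4 q))"
proof -
 define g where "g = (SOME g. is_bessel_potential 4 g (synth q))"
 have "is_bessel_potential 4 g (synth q)" unfolding g_def by (rule someI[where P = "\<lambda>g. is_bessel_potential 4 g (synth q)"], rule is_bessel_potential_synth[OF q])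
 then obtain G F where G: "has_fourier_transform g G" "has_fourier_transform (synth q) F"
  "AE \<xi> in lborel. F \<xi> = complex_of_real ((1+\<xi>^2) powr (- 4/2)) * G \<xi>" unfolding is_bessel_potential_def by blast
 from is_bessel_potential_synth[OF q] obtain G' F' where G': "has_fourier_transform (synth (bracket4 q)) G'" "has_fourier_transform (synth q) F'"
  "AE \<xi> in lborel. F' \<xi> = complex_of_real ((1+\<xi>^2) powr (- 4/2)) * G' \<xi>" unfolding is_bessel_potential_def by blast
 have "AE \<xi> in lborel. G' \<xi> = G \<xi>" using has_fourier_transform_unique[OF G(2) G'(2)] G(3) G'(3)
 proof eventually_elim
  case (elim \<xi>)
  have "1+\<xi>^2 > 0" by (intro add_pos_nonneg) auto
  then have "(1+\<xi>^2) powr (- 4/2) \<noteq> 0" by simp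
  then show ?case using elim by (metis mult_cancel_left of_real_eq_0_iff)
 qed
 then have "has_fourier_transform (synth (bracket4 q)) G" using has_fourier_transform_cong_AE[OF G'(1)] G(1) by (simp add: has_fourier_transform_def)
 from has_fourier_transform_inj[OF G(1) this] have "AE x in lborel. g x = synth (bracket4 q) x" .
 then have "AE x in lborel. (norm (g x))^2 = (norm (synth (bracket4 q) x))^2" by eventually_elim simp
 moreover have "g \<in> borel_measurable lborel" "synth (bracket4 q) \<in> borel_measurable lborel"
  using G(1) G'(1) by (auto simp: has_fourier_transform_def square_integrable_def)
 ultimately have "L2_norm g = L2_norm (synth (bracket4 q))"
  unfolding L2_norm_def by (subst integral_cong_AE[where g = "\<lambda>x. (norm (synth (bracket4 q) x))^2"]) auto
 then show ?thesis by (simp add: sobolev_norm_def g_def)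
qed

text \<open>The sign \<open>c\<close> covers both weights: two integrations by parts produce a
  minus, four do not.\<close>

lemma weighted_sobolev_synth:
 assumes q: "halfdiff (Suc (Suc n)) q" "q 0 = 0" and r: "edec r" "!!x. \<bar>x\<bar> powr k * synth q x = c * synth r x" "\<bar>c\<bar> = 1"
 shows "synth q \<in> weighted_sobolev 4 k"
  "weighted_sobolev_norm 4 k (synth q) \<le> 2 * sqrt (2*pi) * (L2_norm (bracket4 q) + L2_norm r)"
proof -
 have b: "edec (bracket4 q)" by (rule halfdiffD(1)[OF hcd_bracket4[OF q(1)]])
 note sr = L2_norm_synth_le[OF r(1)]
 have "\<bar>c\<bar>^2 = 1" using r(3) by simp
 then have c: "c^2 = 1" by simp
 have w: "square_integrable (\<lambda>x. c * synth r x)" "L2_norm (\<lambda>x. c * synth r x) = L2_norm (synth r)"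
  using sr(1) by (auto simp: square_integrable_def L2_norm_def power_mult_distrib c)
 show "synth q \<in> weighted_sobolev 4 k" using is_bessel_potential_synth[OF q] w(1) by (auto simp: weighted_sobolev_def sobolev_def r(2))
 show "weighted_sobolev_norm 4 k (synth q) \<le> 2 * sqrt (2*pi) * (L2_norm (bracket4 q) + L2_norm r)"
  unfolding weighted_sobolev_norm_def r(2) w(2) sobolev_norm_synth[OF q] distrib_left by (intro add_mono L2_norm_synth_le b r(1))
qed

lemma weighted_sobolev_norm_nonneg: "weighted_sobolev_norm s r f \<ge> 0" by (simp add: weighted_sobolev_norm_def sobolev_norm_def)

lemma weighted_sobolev_synth2:
 assumes q: "halfdiff (Suc (Suc n)) q" "q 0 = 0" "Re (dx q 0) = 0"
 shows "synth q \<in> weighted_sobolev 4 2"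
  "weighted_sobolev_norm 4 2 (synth q) \<le> 2 * sqrt (2*pi) * (L2_norm (bracket4 q) + L2_norm (dx (dx q)))"
proof -
 have e: "edec (dx (dx q))" by (rule halfdiffD(1)[OF halfdiff_dx(1)[OF halfdiff_dx(1)[OF q(1)]]])
 have "\<bar>x\<bar> powr 2 * synth q x = - 1 * synth (dx (dx q)) x" for x
  using synth_weight2[OF q, of x] by (cases "x = 0") (auto simp: powr_numeral)
 from weighted_sobolev_synth[OF q(1,2) e this] show "synth q \<in> weighted_sobolev 4 2"
  "weighted_sobolev_norm 4 2 (synth q) \<le> 2 * sqrt (2*pi) * (L2_norm (bracket4 q) + L2_norm (dx (dx q)))" by auto
qed

lemma weighted_sobolev_synth4:
 assumes q: "halfdiff (Suc (Suc (Suc (Suc n)))) q" "q 0 = 0" "dx q 0 = 0" "Im (dx (dx q) 0) = 0" "Re (dx (dx (dx q)) 0) = 0"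
 shows "synth q \<in> weighted_sobolev 4 4"
  "weighted_sobolev_norm 4 4 (synth q) \<le> 2 * sqrt (2*pi) * (L2_norm (bracket4 q) + L2_norm (dx (dx (dx (dx q)))))"
proof -
 have e: "edec (dx (dx (dx (dx q))))" by (rule halfdiffD(1)[where n = n]) (intro halfdiff_dx q(1))
 have "\<bar>x\<bar> powr 4 * synth q x = 1 * synth (dx (dx (dx (dx q)))) x" for x
  using synth_weight4[OF q, of x] by (cases "x = 0") (auto simp: powr_numeral)
 from weighted_sobolev_synth[OF q(1,2) e this] show "synth q \<in> weighted_sobolev 4 4"
  "weighted_sobolev_norm 4 4 (synth q) \<le> 2 * sqrt (2*pi) * (L2_norm (bracket4 q) + L2_norm (dx (dx (dx (dx q)))))" by auto
qed

section \<open>The Benjamin-Ono equation in physical space\<close>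

lemma edec_imult: "edec q ==> edec (\<lambda>\<xi>. \<i> * mulx q \<xi>)" by (intro expd_cmult edec_mulx)

lemma expd_modulate:
 assumes "expd I F" "!!t. t \<in> I ==> meas (\<lambda>\<xi>. \<theta> t \<xi>)"
 shows "expd I (\<lambda>t \<xi>. F t \<xi> * phase (\<theta> t \<xi>))"
proof -
 obtain C \<sigma> where C: "C > 0" "\<sigma> > 0" "!!t x. t \<in> I ==> norm (F t x) \<le> C * decay \<sigma> x" using expdE[OF assms(1)] by metis
 show ?thesis
 proof (rule expdI)
  fix t assume t: "t \<in> I"
  have [measurable]: "meas (F t)" "meas (\<theta> t)" using assms t by (auto simp: expd_def)
  show "meas (\<lambda>\<xi>. F t \<xi> * phase (\<theta> t \<xi>))" by measurable
  show "norm (F t \<xi> * phase (\<theta> t \<xi>)) \<le> C * decay \<sigma> \<xi>" for \<xi>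
   unfolding norm_mult norm_exp_imaginary using C(3)[OF t, of \<xi>] by simp
 qed (use C(2) in auto)
qed

lemma four_has_vector_derivative:
 assumes "edec q" shows "(four q hvd four (\<lambda>\<xi>. \<i> * mulx q \<xi>) x) (at x)"
proof -
 have "((\<lambda>s. LBINT \<xi>. q \<xi> * phase (s*\<xi>)) hvd (LBINT \<xi>. \<i> * mulx q \<xi> * phase (x*\<xi>))) (at x within UNIV)"
 proof (rule expd_integral_derivative)
  show "expd UNIV (\<lambda>s \<xi>. q \<xi> * phase (s*\<xi>))" by (rule expd_modulate[OF expd_const[OF assms]]) measurable
  show "expd UNIV (\<lambda>s \<xi>. \<i> * mulx q \<xi> * phase (s*\<xi>))" by (rule expd_modulate[OF expd_const[OF edec_imult[OF assms]]]) measurable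
  fix s \<xi> :: real
  have "((\<lambda>s. q \<xi> * phase (\<xi> * s)) hvd q \<xi> * (phase (\<xi> * s) * (\<i> * of_real \<xi>))) (at s within UNIV)"
   by (intro has_vector_derivative_mult_right modulate_has_vector_derivative)
  then show "((\<lambda>s. q \<xi> * phase (s*\<xi>)) hvd \<i> * mulx q \<xi> * phase (s*\<xi>)) (at s within UNIV)"
   by (simp only: mulx_def mult_ac)
 qed auto
 then show ?thesis by (simp only: four_def[abs_def])
qed

lemma synth_has_real_derivative:
 assumes "edec q" shows "(synth q has_real_derivative synth (\<lambda>\<xi>. \<i> * mulx q \<xi>) x) (at x)"
 unfolding has_real_derivative_iff_has_vector_derivative synth_def[abs_def]
 by (intro has_vector_derivative_mult_right bounded_linear.has_vector_derivative[OF bounded_linear_Re] four_has_vector_derivative assms)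

lemma synth_flow_has_real_derivative:
 assumes fl: "flow {-T..T} p p" and t: "\<bar>t\<bar> < T"
 shows "((\<lambda>s. synth (\<lambda>\<xi>. 2 * p s \<xi>) x) has_real_derivative synth (\<lambda>\<xi>. 2 * flow_op (p t) (p t) \<xi>) x) (at t)"
proof -
 note p = flowD(1)[OF fl]
 have "((\<lambda>s. LBINT \<xi>. 2 * p s \<xi> * phase (x*\<xi>)) hvd (LBINT \<xi>. 2 * flow_op (p t) (p t) \<xi> * phase (x*\<xi>))) (at t within {-T..T})"
 proof (rule expd_integral_derivative)
  show "expd {-T..T} (\<lambda>s \<xi>. 2 * p s \<xi> * phase (x*\<xi>))" by (rule expd_modulate[OF expd_cmult[OF p]]) measurable
  show "expd {-T..T} (\<lambda>s \<xi>. 2 * flow_op (p s) (p s) \<xi> * phase (x*\<xi>))"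
   by (rule expd_modulate[OF expd_cmult[OF expd_flow_op[OF p p]]]) measurable
  show "((\<lambda>s. 2 * p s \<xi> * phase (x*\<xi>)) hvd 2 * flow_op (p s) (p s) \<xi> * phase (x*\<xi>)) (at s within {-T..T})"
   if "s \<in> {-T..T}" for s \<xi> by (intro has_vector_derivative_mult_left has_vector_derivative_mult_right flowD(4)[OF fl that])
 qed (use t in auto)
 \<comment> \<open>\<open>t\<close> is an interior point, so the derivative within the interval is
   two-sided.\<close>
 moreover have "at t within {-T..T} = at t" using t by (intro at_within_Icc_at) auto
 ultimately show ?thesis unfolding has_real_derivative_iff_has_vector_derivative synth_def four_def
  by (intro has_vector_derivative_mult_right bounded_linear.has_vector_derivative[OF bounded_linear_Re]) simp
qed

lemma synth_add: "edec f ==> edec g ==> synth (\<lambda>\<xi>. f \<xi> + g \<xi>) x = synth f x + synth g x"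
 unfolding synth_def by (subst four_add) (auto intro: edec_integrable)

lemma four_cong_nonzero:
 assumes [measurable]: "meas f" "meas g" and "!!\<xi>. \<xi> \<noteq> 0 ==> f \<xi> = g \<xi>"
 shows "four f x = four g x" unfolding four_def
proof (rule L_integral_cong_AE)
 have "AE \<xi> in lborel. \<xi> \<noteq> (0::real)" by (rule AE_lborel_singleton)
 then show "AE \<xi> in lborel. f \<xi> * phase (x*\<xi>) = g \<xi> * phase (x*\<xi>)" by eventually_elim (simp add: assms(3))
qed measurable

lemma herm_pos:
 "cnj (k (- \<xi>)) = - k \<xi> ==> \<xi> \<noteq> 0 ==> herm (\<lambda>\<xi>. 4*\<i> * pos k \<xi>) \<xi> = 4*\<i> * k \<xi>"
 by (cases "\<xi> > 0") (auto simp: herm_def crefl_def pos_def)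

text \<open>Products become convolutions. As v D v changes sign under \<open>crefl\<close>, the
  whole convolution is recovered from its positive half, up to the null set \<xi> = 0.\<close>

lemma synth_product:
 assumes p: "edec p" "causal p"
 shows "synth (\<lambda>\<xi>. 2 * p \<xi>) x * synth (\<lambda>\<xi>. \<i> * mulx (\<lambda>\<xi>. 2 * p \<xi>) \<xi>) x
  = synth (\<lambda>\<xi>. 4*\<i> * toep (herm p) (mulx (herm p)) \<xi>) x"
proof -
 let ?V = "herm p"
 note [simp] = p edec_intros expd_cmult
 have V: "edec ?V" "edec (mulx ?V)" by simp_all
 have 1: "herm (\<lambda>\<xi>. 2 * p \<xi>) = (\<lambda>\<xi>. 2 * ?V \<xi>)" by (simp add: fun_eq_iff herm_def crefl_def)
 have 2: "herm (\<lambda>\<xi>. \<i> * mulx (\<lambda>\<xi>. 2 * p \<xi>) \<xi>) = (\<lambda>\<xi>. 2*\<i> * mulx ?V \<xi>)"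
  by (simp add: fun_eq_iff herm_def crefl_def mulx_def algebra_simps)
 have e1: "edec (\<lambda>\<xi>. 2 * p \<xi>)" "edec (\<lambda>\<xi>. \<i> * mulx (\<lambda>\<xi>. 2 * p \<xi>) \<xi>)" by (intro expd_intros p)+
 have e2: "edec (\<lambda>\<xi>. 4*\<i> * toep ?V (mulx ?V) \<xi>)" by (intro expd_cmult edec_toep V)
 have mc: "meas (conv ?V (mulx ?V))" using edec_conv[OF V] by (simp add: expd_def)
 have "complex_of_real (synth (\<lambda>\<xi>. 2 * p \<xi>) x * synth (\<lambda>\<xi>. \<i> * mulx (\<lambda>\<xi>. 2 * p \<xi>) \<xi>) x) = four (\<lambda>\<xi>. 2 * ?V \<xi>) x * four (\<lambda>\<xi>. 2*\<i> * mulx ?V \<xi>) x"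
  unfolding of_real_mult synth_eq_four[OF e1(1)] synth_eq_four[OF e1(2)] 1 2 ..
 also have "... = 4*\<i> * four (conv ?V (mulx ?V)) x" unfolding four_cmult four_conv[OF V] by simp
 also have "... = four (\<lambda>\<xi>. 4*\<i> * conv ?V (mulx ?V) \<xi>) x" by (rule four_cmult[symmetric])
 also have "... = four (herm (\<lambda>\<xi>. 4*\<i> * toep ?V (mulx ?V) \<xi>)) x"
 proof (rule four_cong_nonzero)
  show "meas (\<lambda>\<xi>. 4*\<i> * conv ?V (mulx ?V) \<xi>)" using mc by measurable
  show "meas (herm (\<lambda>\<xi>. 4*\<i> * toep ?V (mulx ?V) \<xi>))" using edec_herm[OF e2] by (simp add: expd_def)
  fix \<xi> :: real assume nz: "\<xi> \<noteq> 0"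
  have "crefl (conv ?V (mulx ?V)) \<xi> = - conv ?V (mulx ?V) \<xi>"
  proof -
   have "crefl (mulx ?V) = (\<lambda>x. - mulx ?V x)" by (simp add: crefl_mulx crefl_herm fun_eq_iff)
   then show ?thesis by (simp add: crefl_conv crefl_herm conv_uminus_right)
  qed
  then have "cnj (conv ?V (mulx ?V) (- \<xi>)) = - conv ?V (mulx ?V) \<xi>" by (simp only: crefl_def)
  from herm_pos[OF this nz, symmetric]
  show "4*\<i> * conv ?V (mulx ?V) \<xi> = herm (\<lambda>\<xi>. 4*\<i> * toep ?V (mulx ?V) \<xi>) \<xi>" by (simp only: toep_def)
 qed
 also have "... = of_real (synth (\<lambda>\<xi>. 4*\<i> * toep ?V (mulx ?V) \<xi>) x)" by (rule synth_eq_four[OF e2, symmetric])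
 finally show ?thesis by (simp only: of_real_eq_iff)
qed

section \<open>The Hilbert transform as a principal value\<close>

text \<open>The odd kernel \<open>1 / y\<close> truncated to \<open>\<epsilon> \<le> \<bar>y\<bar> \<le> R\<close>.\<close>
definition hkernel :: "real => real => real => real" where
 "hkernel \<epsilon> R y = indicator {\<epsilon>..R} y/y+indicator {\<epsilon>..R} (- y)/y"

lemma hkernel_eq: "\<epsilon> > 0 ==> hkernel \<epsilon> R y = indicator {-R..R} y*(indicator {y. \<epsilon> \<le> \<bar>y\<bar>} y/y)"
 by (auto simp: hkernel_def indicator_def)

lemma Si_neg': "Si (- x) = - Si x" using Si_neg[of x] Si_neg[of "- x"] by (cases "x \<ge> 0") auto

lemma integrable_indicator_divide:
 assumes "\<epsilon> > 0" shows "integrable lborel (\<lambda>y. indicator {\<epsilon>..R} y/y :: real)"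
proof (rule L_integrable_bound)
 show "integrable lborel (\<lambda>y::real. 1/\<epsilon>*indicator {\<epsilon>..R} y)"
  by (intro integrable_mult_right integrable_real_indicator) (auto simp: emeasure_lborel_Icc_eq)
 show "AE y in lborel. norm (indicator {\<epsilon>..R} y/y) \<le> norm (1/\<epsilon>*indicator {\<epsilon>..R} y)"
  using assms by (intro AE_I2) (auto simp: indicator_def intro!: divide_left_mono)
qed measurable

lemma integral_sin_divide:
 assumes "\<epsilon> > 0" "\<epsilon> \<le> R"
 shows "(LBINT y. indicator {\<epsilon>..R} y/y * sin (y*\<xi>)) = Si (R*\<xi>) - Si (\<epsilon>*\<xi>)"
proof -
 have "(LBINT y. indicator {\<epsilon>..R} y *\<^sub>R (sin (y*\<xi>) / y)) = Si (R*\<xi>) - Si (\<epsilon>*\<xi>)"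
 proof (rule integral_FTC_atLeastAtMost[OF assms(2)])
  fix y assume y: "\<epsilon> \<le> y" "y \<le> R"
  have "((\<lambda>y. Si (y*\<xi>)) has_real_derivative sinc (y*\<xi>) * \<xi>) (at y within {\<epsilon>..R})"
   by (intro DERIV_chain2[OF DERIV_Si]) (auto intro!: derivative_eq_intros)
  moreover have "sinc (y*\<xi>) * \<xi> = sin (y*\<xi>) / y" using y assms by auto
  ultimately show "((\<lambda>y. Si (y*\<xi>)) hvd sin (y*\<xi>) / y) (at y within {\<epsilon>..R})"
   by (simp add: has_real_derivative_iff_has_vector_derivative)
 next
  show "continuous_on {\<epsilon>..R} (\<lambda>y. sin (y*\<xi>) / y)" using assms by (intro continuous_intros) auto
 qed
 then show ?thesis by (simp add: mult.commute)
qed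

lemma hkernel_integrable:
 assumes "\<epsilon> > 0" shows "integrable lborel (hkernel \<epsilon> R)"
proof -
 have "integrable lborel (\<lambda>y. indicator {\<epsilon>..R} (0 + - 1*y)/(0 + - 1*y) :: real)"
  by (rule lborel_integrable_real_affine[OF integrable_indicator_divide[OF assms]]) simp
 from L_integrable_diff[OF integrable_indicator_divide[OF assms, of R] this]
 show ?thesis by (simp add: hkernel_def[abs_def])
qed

text \<open>An odd kernel sees only the sine in the phase, and the sine integral appears.\<close>

lemma hkernel_transform:
 assumes "\<epsilon> > 0" "\<epsilon> \<le> R"
 shows "(LBINT y. of_real (hkernel \<epsilon> R y) * phase (- y*\<xi>)) = - 2*\<i> * of_real (Si (R*\<xi>) - Si (\<epsilon>*\<xi>))"
proof -
 let ?a = "\<lambda>y. complex_of_real (indicator {\<epsilon>..R} y/y)"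
 have ia: "integrable lborel ?a" using integrable_indicator_divide[OF assms(1), of R] by (simp del: of_real_divide)
 have i1: "integrable lborel (\<lambda>y. ?a y * phase (c*y))" for c by (rule four_integrable[OF ia])
 have i2: "integrable lborel (\<lambda>y. ?a (- y) * phase (c*y))" for c using lborel_integrable_real_affine[OF i1[of "- c"], of "- 1" 0] by simp
 have r: "(LBINT y. ?a (- y) * phase (- \<xi>*y)) = (LBINT y. ?a y * phase (\<xi>*y))"
  using lborel_integral_real_affine[of "- 1" "\<lambda>y. ?a y * phase (\<xi>*y)" 0] by simp
 have "(LBINT y. of_real (hkernel \<epsilon> R y) * phase (- y*\<xi>)) = (LBINT y. ?a y * phase (- \<xi>*y) - ?a (- y) * phase (- \<xi>*y))"
  by (intro L_integral_cong refl) (simp add: hkernel_def distrib_left distrib_right mult.commute)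
 also have "... = (LBINT y. ?a y * phase (- \<xi>*y))-(LBINT y. ?a y * phase (\<xi>*y))" unfolding r[symmetric] by (rule L_integral_diff[OF i1 i2])
 also have "... = (LBINT y. ?a y * phase (- \<xi>*y) - ?a y * phase (\<xi>*y))" by (rule L_integral_diff[OF i1 i1, symmetric])
 also have "... = (LBINT y. - 2*\<i> * of_real (indicator {\<epsilon>..R} y/y * sin (y*\<xi>)))"
 proof (rule L_integral_cong[OF refl])
  fix y
  have "phase (- \<xi>*y) - phase (\<xi>*y) = - 2*\<i> * of_real (sin (y*\<xi>))" by (simp add: complex_eq_iff Re_exp Im_exp mult.commute)
  then show "?a y * phase (- \<xi>*y) - ?a y * phase (\<xi>*y) = - 2*\<i> * of_real (indicator {\<epsilon>..R} y/y * sin (y*\<xi>))"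
   unfolding right_diff_distrib[symmetric] of_real_mult by (simp only: mult_ac)
 qed
 also have "... = - 2*\<i> * of_real (Si (R*\<xi>) - Si (\<epsilon>*\<xi>))"
  unfolding integral_mult_right_zero integral_complex_of_real integral_sin_divide[OF assms] ..
 finally show ?thesis .
qed

abbreviation sinint :: "cfun => real => (real => real) => complex" where
 "sinint H x g \<equiv> LBINT \<xi>. H \<xi> * phase (x*\<xi>) * (- 2*\<i> * of_real (g \<xi>))"

lemma truncated_hilbert:
 assumes r: "edec r" and e: "\<epsilon> > 0" "\<epsilon> \<le> R"
 shows "of_real (LBINT y. hkernel \<epsilon> R y * synth r (x-y)) =
  sinint (herm r) x (\<lambda>\<xi>. Si (R*\<xi>) - Si (\<epsilon>*\<xi>))"
proof -
 let ?H = "herm r"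
 note hr = edec_herm[OF r]
 have [measurable]: "meas ?H" "meas (hkernel \<epsilon> R)"
  using hr borel_measurable_integrable[OF hkernel_integrable[OF e(1), of R]] by (auto simp: expd_def)
 let ?f = "\<lambda>y \<xi>. of_real (hkernel \<epsilon> R y) * (?H \<xi> * phase ((x-y)*\<xi>))"
 have int: "integrable lborel2 (\<lambda>z. ?f (fst z) (snd z))"
 proof (rule integrable_pair_bound[where a = "\<lambda>y. \<bar>hkernel \<epsilon> R y\<bar>" and b = "\<lambda>\<xi>. norm (?H \<xi>)"])
  show "norm (?f y \<xi>) \<le> \<bar>hkernel \<epsilon> R y\<bar> * norm (?H \<xi>)" for y \<xi> unfolding norm_mult norm_exp_imaginary by simp
 qed (use hkernel_integrable[OF e(1), of R] edec_integrable[OF hr] in auto)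
 have "complex_of_real (LBINT y. hkernel \<epsilon> R y * synth r (x-y)) = (LBINT y. of_real (hkernel \<epsilon> R y) * four ?H (x-y))"
  unfolding integral_complex_of_real[symmetric] by (simp add: synth_eq_four[OF r])
 also have "... = (LBINT y. LBINT \<xi>. ?f y \<xi>)" unfolding four_def by (simp only: integral_mult_right_zero)
 also have "... = (LBINT \<xi>. LBINT y. ?f y \<xi>)" by (rule lborel_fubini[OF int, symmetric])
 also have "... = sinint ?H x (\<lambda>\<xi>. Si (R*\<xi>) - Si (\<epsilon>*\<xi>))"
 proof (rule L_integral_cong[OF refl])
  fix \<xi>
  have ee: "phase ((x-y)*\<xi>) = phase (x*\<xi>) * phase (- y*\<xi>)" for y by (simp add: mult_exp_exp algebra_simps)
  have rr: "a*(b*(c*d)) = (b*c)*(a*d)" for a b c d :: complex by (simp only: mult_ac)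
  have "(LBINT y. ?f y \<xi>) = (LBINT y. (?H \<xi> * phase (x*\<xi>))*(of_real (hkernel \<epsilon> R y) * phase (- y*\<xi>)))"
   unfolding ee by (intro L_integral_cong refl rr)
  also have "... = ?H \<xi> * phase (x*\<xi>) * (LBINT y. of_real (hkernel \<epsilon> R y) * phase (- y*\<xi>))" by (rule integral_mult_right_zero)
  finally show "(LBINT y. ?f y \<xi>) = ?H \<xi> * phase (x*\<xi>) * (- 2*\<i> * of_real (Si (R*\<xi>) - Si (\<epsilon>*\<xi>)))"
   unfolding hkernel_transform[OF e] .
 qed
 finally show ?thesis .
qed

text \<open>The sine integral is bounded, so both limits, R to infinity and \<epsilon> to 0, can be
  taken under the integral over \<xi>.\<close>

lemma dominated_Si_limit:
 fixes g :: "real => real => real"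
 assumes H: "edec H" and [measurable]: "!!R. meas (g R)"
  and b: "!!R \<xi>. \<bar>g R \<xi>\<bar> \<le> B" and lim: "!!\<xi>. \<xi> \<noteq> 0 ==> ((\<lambda>R. g R \<xi>) \<longlongrightarrow> g' \<xi>) at_top" and [measurable]: "meas g'"
 shows "((\<lambda>R. sinint H x (g R)) \<longlongrightarrow>
  sinint H x g') at_top"
proof (rule integral_dominated_convergence_at_top[where w = "\<lambda>\<xi>. norm (H \<xi>) * (2*B)"])
 have [measurable]: "meas H" using H by (simp add: expd_def)
 show "integrable lborel (\<lambda>\<xi>. norm (H \<xi>) * (2*B))" using edec_integrable[OF H] by auto
 show "(\<lambda>\<xi>. H \<xi> * phase (x*\<xi>) * (- 2*\<i> * of_real (g R \<xi>))) \<in> borel_measurable lborel"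
  "(\<lambda>\<xi>. H \<xi> * phase (x*\<xi>) * (- 2*\<i> * of_real (g' \<xi>))) \<in> borel_measurable lborel" for R by measurable
 show "\<forall>\<^sub>F R in at_top. AE \<xi> in lborel. norm (H \<xi> * phase (x*\<xi>) * (- 2*\<i> * of_real (g R \<xi>))) \<le> norm (H \<xi>) * (2*B)"
  unfolding norm_mult norm_exp_imaginary by (intro always_eventually allI AE_I2) (simp add: mult.commute[of B] mult_left_mono b)
 have "AE \<xi> in lborel. \<xi> \<noteq> (0::real)" by (rule AE_lborel_singleton)
 then show "AE \<xi> in lborel. ((\<lambda>R. H \<xi> * phase (x*\<xi>) * (- 2*\<i> * of_real (g R \<xi>))) \<longlongrightarrow> H \<xi> * phase (x*\<xi>) * (- 2*\<i> * of_real (g' \<xi>))) at_top"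
  by eventually_elim (intro tendsto_mult tendsto_const tendsto_of_real lim)
qed

lemma Si_at_top_scaled:
 assumes "\<xi> \<noteq> 0" shows "((\<lambda>R. Si (R*\<xi>)) \<longlongrightarrow> sgn \<xi> * (pi/2)) at_top"
proof -
 have pos: "((\<lambda>R. Si (R*c)) \<longlongrightarrow> pi/2) at_top" if "c > 0" for c
  by (rule filterlim_compose[OF Si_at_top]) (use that in \<open>real_asymp\<close>)
 show ?thesis
 proof (cases "\<xi> > 0")
  case False
  with assms have "((\<lambda>R. - Si (R*(- \<xi>))) \<longlongrightarrow> - (pi/2)) at_top" by (intro tendsto_minus pos) simp
  then show ?thesis using False assms by (simp add: Si_neg')
 qed (use pos in simp)
qed

text \<open>For fixed \<epsilon> the limit in R identifies the truncated integral with the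
  multiplier - 2 i (sgn \<xi> \<pi>/2 - Si (\<epsilon> \<xi>)). As \<epsilon> tends to 0 and after
  division by \<pi>, - i sgn \<xi> is left, which on the causal half is - i.\<close>

lemma has_hilbert_transform_synth:
 assumes r: "edec r" "causal r"
 shows "has_hilbert_transform (synth r) (synth (\<lambda>\<xi>. - \<i> * r \<xi>) x) x" unfolding has_hilbert_transform_def
proof (intro conjI allI impI)
 let ?H = "herm r"
 note hr = edec_herm[OF r(1)]
 have [measurable]: "meas (synth r)" using r(1) by (intro synth_measurable) (simp add: expd_def)
 have si: "set_integrable lborel {y. \<epsilon> \<le> \<bar>y\<bar>} (\<lambda>y. synth r (x-y) / y)" if e: "\<epsilon> > 0" for \<epsilon>
  unfolding set_integrable_def
 proof (rule L_integrable_bound)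
  have "integrable lborel (\<lambda>y. (synth r y)^2)" using L2_norm_synth_le(1)[OF r(1)] by (simp add: square_integrable_def)
  from lborel_integrable_real_affine[OF this, of "- 1" x]
  show "integrable lborel (\<lambda>y. (synth r (x-y))^2+(1+1/\<epsilon>^2)*(1/(1+y^2)))"
   by (intro L_integrable_add integrable_mult_right integrable_inverse_1_plus_square') simp
  \<comment> \<open>|f / y| \<le> f^2 + 1/y^2, and for |y| \<ge> \<epsilon> the second term is at
    most (1 + 1/\<epsilon>^2) / (1 + y^2).\<close>
  show "AE y in lborel. norm (indicator {y. \<epsilon> \<le> \<bar>y\<bar>} y *\<^sub>R (synth r (x-y) / y)) \<le> norm ((synth r (x-y))^2+(1+1/\<epsilon>^2)*(1/(1+y^2)))"
  proof (rule AE_I2)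
   fix y :: real
   have p: "1+y^2 > 0" by (intro add_pos_nonneg) auto
   then have nn: "(synth r (x-y))^2+(1+1/\<epsilon>^2)*(1/(1+y^2)) \<ge> 0" by (intro add_nonneg_nonneg mult_nonneg_nonneg) auto
   show "norm (indicator {y. \<epsilon> \<le> \<bar>y\<bar>} y *\<^sub>R (synth r (x-y) / y)) \<le> norm ((synth r (x-y))^2+(1+1/\<epsilon>^2)*(1/(1+y^2)))"
   proof (cases "\<epsilon> \<le> \<bar>y\<bar>")
    case True
    then have y0: "y \<noteq> 0" using e by auto
    have "\<epsilon>^2 \<le> y^2" using True e by (metis abs_le_square_iff abs_of_pos)
    then have "1 \<le> y^2/\<epsilon>^2" using e by (simp add: pos_le_divide_eq)
    then have "1+y^2 \<le> (1+1/\<epsilon>^2)*y^2" by (simp add: distrib_right)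
    then have "1 \<le> ((1+1/\<epsilon>^2)*(1/(1+y^2)))*y^2" using p by (simp add: pos_le_divide_eq)
    then have "1/y^2 \<le> (1+1/\<epsilon>^2)*(1/(1+y^2))" using y0 by (simp add: pos_divide_le_eq)
    moreover have "\<bar>synth r (x-y) / y\<bar> \<le> (synth r (x-y))^2+1/y^2"
    proof -
     have "2*\<bar>synth r (x-y) / y\<bar> \<le> (synth r (x-y))^2+1/y^2"
      using sum_squares_bound[of "\<bar>synth r (x-y)\<bar>" "\<bar>1/y\<bar>"] by (simp add: abs_mult power_divide)
     then show ?thesis using abs_ge_zero[of "synth r (x-y) / y"] by linarith
    qed
    ultimately show ?thesis using True nn by (simp del: times_divide_eq_right)
   qed (use nn in simp)
  qed
 qed measurable
 then show "set_integrable lborel {y. \<epsilon> \<le> \<bar>y\<bar>} (\<lambda>y. synth r (x-y) / y)" if "\<epsilon> > 0" for \<epsilon> using that .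
 obtain B where B: "!!T. \<bar>Si T\<bar> \<le> B" using bounded_Si by blast
 let ?I = "\<lambda>\<epsilon>. LINT y:{y. \<epsilon> \<le> \<bar>y\<bar>}|lborel. synth r (x-y) / y"
 have I: "of_real (?I \<epsilon>) = sinint ?H x (\<lambda>\<xi>. sgn \<xi> * (pi/2) - Si (\<epsilon>*\<xi>))" if e: "\<epsilon> > 0" for \<epsilon>
 proof -
  have "((\<lambda>R. LBINT y. hkernel \<epsilon> R y * synth r (x-y)) \<longlongrightarrow> ?I \<epsilon>) at_top"
   unfolding set_lebesgue_integral_def
  proof (rule integral_dominated_convergence_at_top[where w = "\<lambda>y. \<bar>indicator {y. \<epsilon> \<le> \<bar>y\<bar>} y *\<^sub>R (synth r (x-y) / y)\<bar>"])
   show "integrable lborel (\<lambda>y. \<bar>indicator {y. \<epsilon> \<le> \<bar>y\<bar>} y *\<^sub>R (synth r (x-y) / y)\<bar>)"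
    using si[OF e] unfolding set_integrable_def by (rule integrable_abs)
   show "(\<lambda>y. hkernel \<epsilon> R y * synth r (x-y)) \<in> borel_measurable lborel" for R unfolding hkernel_def by measurable
   show "\<forall>\<^sub>F R in at_top. AE y in lborel. norm (hkernel \<epsilon> R y * synth r (x-y)) \<le> \<bar>indicator {y. \<epsilon> \<le> \<bar>y\<bar>} y *\<^sub>R (synth r (x-y) / y)\<bar>"
    by (intro always_eventually allI AE_I2) (auto simp: hkernel_eq[OF e] indicator_def)
   show "AE y in lborel. ((\<lambda>R. hkernel \<epsilon> R y * synth r (x-y)) \<longlongrightarrow> indicator {y. \<epsilon> \<le> \<bar>y\<bar>} y *\<^sub>R (synth r (x-y) / y)) at_top"
   proof (intro AE_I2 tendsto_eventually)
    fix y :: real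
    show "\<forall>\<^sub>F R in at_top. hkernel \<epsilon> R y * synth r (x-y) = indicator {y. \<epsilon> \<le> \<bar>y\<bar>} y *\<^sub>R (synth r (x-y) / y)"
     using eventually_ge_at_top[of "\<bar>y\<bar>"] by eventually_elim (auto simp: hkernel_eq[OF e] indicator_def)
   qed
  qed measurable
  then have "((\<lambda>R. complex_of_real (LBINT y. hkernel \<epsilon> R y * synth r (x-y))) \<longlongrightarrow> of_real (?I \<epsilon>)) at_top" by (rule tendsto_of_real)
  moreover have "\<forall>\<^sub>F R in at_top. complex_of_real (LBINT y. hkernel \<epsilon> R y * synth r (x-y)) =
    sinint ?H x (\<lambda>\<xi>. Si (R*\<xi>) - Si (\<epsilon>*\<xi>))"
   using eventually_ge_at_top[of \<epsilon>] by eventually_elim (rule truncated_hilbert[OF r(1) e])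
  ultimately have 1: "((\<lambda>R. sinint ?H x (\<lambda>\<xi>. Si (R*\<xi>) - Si (\<epsilon>*\<xi>))) \<longlongrightarrow> of_real (?I \<epsilon>)) at_top"
   using tendsto_cong by fast
  have 2: "((\<lambda>R. sinint ?H x (\<lambda>\<xi>. Si (R*\<xi>) - Si (\<epsilon>*\<xi>))) \<longlongrightarrow>
   sinint ?H x (\<lambda>\<xi>. sgn \<xi> * (pi/2) - Si (\<epsilon>*\<xi>))) at_top"
  proof (rule dominated_Si_limit[OF hr])
   show "\<bar>Si (R*\<xi>) - Si (\<epsilon>*\<xi>)\<bar> \<le> B+B" for R \<xi> using B[of "R*\<xi>"] B[of "\<epsilon>*\<xi>"] by linarith
   show "((\<lambda>R. Si (R*\<xi>) - Si (\<epsilon>*\<xi>)) \<longlongrightarrow> sgn \<xi> * (pi/2) - Si (\<epsilon>*\<xi>)) at_top" if "\<xi> \<noteq> 0" for \<xi>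
    by (intro tendsto_diff Si_at_top_scaled[OF that] tendsto_const)
  qed measurable
  show ?thesis by (rule tendsto_unique[OF _ 1 2]) simp
 qed
 \<comment> \<open>The substitution \<epsilon> = 1/R turns the limit at 0 into one at infinity, to
   which the dominated limit applies.\<close>
 have lim: "((\<lambda>R. sinint ?H x (\<lambda>\<xi>. sgn \<xi> * (pi/2) - Si (inverse R * \<xi>))) \<longlongrightarrow>
   sinint ?H x (\<lambda>\<xi>. sgn \<xi> * (pi/2))) at_top"
 proof (rule dominated_Si_limit[OF hr])
  show "\<bar>sgn \<xi> * (pi/2) - Si (inverse R * \<xi>)\<bar> \<le> pi/2+B" for R \<xi>
  proof -
   have "\<bar>sgn \<xi> * (pi/2)\<bar> \<le> pi/2" by (simp add: sgn_real_def)
   with B[of "inverse R * \<xi>"] show ?thesis by linarith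
  qed
  show "((\<lambda>R. sgn \<xi> * (pi/2) - Si (inverse R * \<xi>)) \<longlongrightarrow> sgn \<xi> * (pi/2)) at_top" for \<xi>
  proof -
   have "((\<lambda>R. inverse R * \<xi>) \<longlongrightarrow> 0*\<xi>) at_top" by (intro tendsto_mult tendsto_inverse_0_at_top filterlim_ident tendsto_const)
   then have "((\<lambda>R. Si (inverse R * \<xi>)) \<longlongrightarrow> Si 0) at_top" by (intro isCont_tendsto_compose[OF isCont_Si]) simp
   moreover have "Si 0 = 0" using Si_neg'[of 0] by simp
   ultimately have "((\<lambda>R. sgn \<xi> * (pi/2) - Si (inverse R * \<xi>)) \<longlongrightarrow> sgn \<xi> * (pi/2)-0) at_top" by (intro tendsto_diff tendsto_const) simp
   then show ?thesis by simp
  qed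
 qed measurable
 have val: "sinint ?H x (\<lambda>\<xi>. sgn \<xi> * (pi/2)) = of_real (pi * synth (\<lambda>\<xi>. - \<i> * r \<xi>) x)"
 proof -
  let ?S = "\<lambda>\<xi>. - \<i> * of_real (sgn \<xi>) * ?H \<xi>"
  have [measurable]: "meas ?H" using hr by (simp add: expd_def)
  have e: "edec (\<lambda>\<xi>. - \<i> * r \<xi>)" by (rule expd_cmult[OF r(1)])
  have "sinint ?H x (\<lambda>\<xi>. sgn \<xi> * (pi/2)) = (LBINT \<xi>. of_real pi * (?S \<xi> * phase (x*\<xi>)))"
   by (intro L_integral_cong refl) simp
  also have "... = of_real pi * four ?S x" unfolding four_def by (rule integral_mult_right_zero)
  also have "four ?S x = four (herm (\<lambda>\<xi>. - \<i> * r \<xi>)) x"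
  proof (rule four_cong_nonzero)
   show "meas (herm (\<lambda>\<xi>. - \<i> * r \<xi>))" using edec_herm[OF e] by (simp add: expd_def)
   show "?S \<xi> = herm (\<lambda>\<xi>. - \<i> * r \<xi>) \<xi>" if "\<xi> \<noteq> 0" for \<xi>
    using that r(2) by (cases "\<xi> > 0") (auto simp: herm_def crefl_def causal_def)
  qed measurable
  finally show ?thesis by (simp only: synth_eq_four[OF e] of_real_mult)
 qed
 have "((\<lambda>R. complex_of_real (?I (inverse R))) \<longlongrightarrow> of_real (pi * synth (\<lambda>\<xi>. - \<i> * r \<xi>) x)) at_top"
 proof (rule Lim_transform_eventually[OF lim[unfolded val]])
  show "\<forall>\<^sub>F R in at_top. sinint ?H x (\<lambda>\<xi>. sgn \<xi> * (pi/2) - Si (inverse R * \<xi>)) = complex_of_real (?I (inverse R))"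
   using eventually_gt_at_top[of 0] by eventually_elim (rule I[symmetric], simp)
 qed
 then have "((\<lambda>R. ?I (inverse R)) \<longlongrightarrow> pi * synth (\<lambda>\<xi>. - \<i> * r \<xi>) x) at_top" by (simp only: tendsto_of_real_iff)
 then have "((\<lambda>R. 1/pi * ?I (inverse R)) \<longlongrightarrow> 1/pi*(pi * synth (\<lambda>\<xi>. - \<i> * r \<xi>) x)) at_top" by (rule tendsto_mult_left)
 then show "((\<lambda>\<epsilon>. 1/pi * ?I \<epsilon>) \<longlongrightarrow> synth (\<lambda>\<xi>. - \<i> * r \<xi>) x) (at_right 0)"
  unfolding filterlim_at_right_to_top by simp
qed

section \<open>Solutions in physical space\<close>

text \<open>With u = 2 v, the product u u_x has positive part 4 i P(v D v), and i \<xi> applied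
  twice followed by - i gives the dispersive term 2 i \<xi>^2 p. Both cancel against 2
  \<open>flow_op p p\<close>.\<close>

lemma benjamin_ono_synth:
 assumes fl: "!!T. T \<ge> 0 ==> flow {-T..T} p p"
 shows "benjamin_ono_solution (\<lambda>t. synth (\<lambda>\<xi>. 2 * p t \<xi>))" unfolding benjamin_ono_solution_def
proof (intro exI allI conjI)
 fix t x :: real
 let ?q = "\<lambda>t \<xi>. 2 * p t \<xi>"
 let ?q1 = "\<lambda>t \<xi>. \<i> * mulx (?q t) \<xi>"
 let ?q2 = "\<lambda>t \<xi>. \<i> * mulx (?q1 t) \<xi>"
 have f: "flow {-(\<bar>t\<bar>+1)..\<bar>t\<bar>+1} p p" by (rule fl) simp
 have "t \<in> {-(\<bar>t\<bar>+1)..\<bar>t\<bar>+1}" using abs_ge_self[of t] abs_ge_minus_self[of t] by auto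
 then have p: "edec (p t)" "causal (p t)" by (rule flowD[OF f])+
 have q: "edec (?q t)" "edec (?q1 t)" "edec (?q2 t)" by (intro edec_imult expd_cmult p)+
 show "((\<lambda>\<tau>. synth (?q \<tau>) x) has_real_derivative synth (\<lambda>\<xi>. 2 * flow_op (p t) (p t) \<xi>) x) (at t)"
  by (rule synth_flow_has_real_derivative[OF f]) simp
 show "(synth (?q t) has_real_derivative synth (?q1 t) x) (at x)" by (rule synth_has_real_derivative[OF q(1)])
 show "(synth (?q1 t) has_real_derivative synth (?q2 t) x) (at x)" by (rule synth_has_real_derivative[OF q(2)])
 have "causal (?q2 t)" using p(2) by (simp add: causal_def mulx_def)
 then show "has_hilbert_transform (synth (?q2 t)) (synth (\<lambda>\<xi>. - \<i> * ?q2 t \<xi>) x) x" by (rule has_hilbert_transform_synth[OF q(3)])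
 let ?V = "herm (p t)"
 let ?N = "\<lambda>\<xi>. 4*\<i> * toep ?V (mulx ?V) \<xi>"
 have V: "edec ?V" "edec (mulx ?V)" by (intro edec_intros p)+
 have e: "edec (\<lambda>\<xi>. 2 * flow_op (p t) (p t) \<xi>)" "edec (\<lambda>\<xi>. - \<i> * ?q2 t \<xi>)" "edec ?N"
  by (intro expd_cmult edec_flow_op edec_toep p q V)+
 have "synth (\<lambda>\<xi>. 2 * flow_op (p t) (p t) \<xi>) x + synth (\<lambda>\<xi>. - \<i> * ?q2 t \<xi>) x + synth (?q t) x * synth (?q1 t) x
  = synth (\<lambda>\<xi>. 2 * flow_op (p t) (p t) \<xi> + - \<i> * ?q2 t \<xi> + ?N \<xi>) x"
  unfolding synth_product[OF p] by (subst synth_add[OF expd_add[OF e(1,2)] e(3)], subst synth_add[OF e(1,2)]) (rule refl)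
 also have "(\<lambda>\<xi>. 2 * flow_op (p t) (p t) \<xi> + - \<i> * ?q2 t \<xi> + ?N \<xi>) = (\<lambda>_. 0)"
 proof
  fix \<xi>
  have "?q2 t \<xi> = - (2 * mulx (mulx (p t)) \<xi>)" by (simp add: mulx_def)
  then show "2 * flow_op (p t) (p t) \<xi> + - \<i> * ?q2 t \<xi> + ?N \<xi> = 0"
   unfolding flow_op_self[OF p] by (simp only:) (simp add: algebra_simps)
 qed
 finally show "synth (\<lambda>\<xi>. 2 * flow_op (p t) (p t) \<xi>) x + synth (\<lambda>\<xi>. - \<i> * ?q2 t \<xi>) x + synth (?q t) x * synth (?q1 t) x = 0"
  by (simp add: synth_def four_def)
qed

lemma benjamin_ono_translate:
 assumes "benjamin_ono_solution u" shows "benjamin_ono_solution (\<lambda>t x. u t (x+a))"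
proof -
 from assms obtain ut ux uxx h where u: "!!t x. ((\<lambda>\<tau>. u \<tau> x) has_real_derivative ut t x) (at t)"
  "!!t x. (u t has_real_derivative ux t x) (at x)" "!!t x. (ux t has_real_derivative uxx t x) (at x)"
  "!!t x. has_hilbert_transform (uxx t) (h t x) x" "!!t x. ut t x + h t x + u t x * ux t x = 0" unfolding benjamin_ono_solution_def by blast
 show ?thesis unfolding benjamin_ono_solution_def
 proof (intro exI allI conjI)
  fix t x
  show "((\<lambda>\<tau>. u \<tau> (x+a)) has_real_derivative ut t (x+a)) (at t)" by (rule u)
  show "((\<lambda>x. u t (x+a)) has_real_derivative ux t (x+a)) (at x)" using u(2)[of t "x+a"] by (simp add: DERIV_shift)
  show "((\<lambda>x. ux t (x+a)) has_real_derivative uxx t (x+a)) (at x)" using u(3)[of t "x+a"] by (simp add: DERIV_shift)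
  have eq: "(\<lambda>y. uxx t (x-y+a) / y) = (\<lambda>y. uxx t (x+a-y) / y)" by (simp add: algebra_simps)
  show "has_hilbert_transform (\<lambda>x. uxx t (x+a)) (h t (x+a)) x" using u(4)[of t "x+a"] unfolding has_hilbert_transform_def eq by blast
  show "ut t (x+a) + h t (x+a) + u t (x+a) * ux t (x+a) = 0" by (rule u)
 qed
qed

section \<open>Solution curves and the translate\<close>

lemma exp_square_integrable:
 assumes "\<sigma> > (0::real)" shows "square_integrable (\<lambda>x. C * decay \<sigma> x :: real)"
proof -
 have "(C * decay \<sigma> x)^2 = C^2 * decay (2*\<sigma>) x" for x by (simp add: power_mult_distrib exp_double[symmetric] mult.assoc)
 moreover have "integrable lborel (\<lambda>x. C^2 * decay (2*\<sigma>) x)" by (intro integrable_mult_right integrable_exp_abs) (use assms in simp)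
 ultimately show ?thesis by (simp add: square_integrable_def)
qed

lemma expd_L2_bounded:
 assumes "expd I F" obtains B where "!!t. t \<in> I ==> L2_norm (F t) \<le> B"
proof -
 obtain C \<sigma> where C: "C > 0" "\<sigma> > 0" "!!t x. t \<in> I ==> norm (F t x) \<le> C * decay \<sigma> x" using expdE[OF assms] by metis
 show ?thesis
 proof (rule that)
  fix t assume t: "t \<in> I"
  show "L2_norm (F t) \<le> L2_norm (\<lambda>x. C * decay \<sigma> x)"
   by (rule L2_norm_mono(2)[OF exp_square_integrable[OF C(2)]]) (use C t assms in \<open>auto simp: expd_def\<close>)
 qed
qed

text \<open>Pointwise continuity in time becomes continuity in L2 through the uniform exponential
  bound.\<close>

lemma hc_L2_isCont:
 assumes F: "hc {-T..T} F" and t: "\<bar>t\<bar> < T" shows "isCont (\<lambda>s. L2_norm (\<lambda>x. F s x - F t x)) t"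
proof -
 obtain C \<sigma> where C: "C > 0" "\<sigma> > 0" "!!t x. t \<in> {-T..T} ==> norm (F t x) \<le> C * decay \<sigma> x" using expdE[OF hcD(1)[OF F]] by metis
 have t': "t \<in> {-T..T}" using t by auto
 have "((\<lambda>s. L2_norm (\<lambda>x. F s x - F t x)) \<longlongrightarrow> 0) (at t within {-T..T})" unfolding tendsto_at_iff_sequentially
 proof (intro allI impI)
  fix X assume X: "\<forall>i. X i \<in> {-T..T} - {t}" "X \<longlonglongrightarrow> t"
  have "(\<lambda>n. LBINT x. (norm (F (X n) x - F t x))^2) \<longlonglongrightarrow> (LINT x::real|lborel. (0::real))"
  proof (rule integral_dominated_convergence[where w = "\<lambda>x. (2*C * decay \<sigma> x)^2"])
   have m: "meas (F s)" if "s \<in> {-T..T}" for s using hcD(1)[OF F] that by (auto simp: expd_def)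
   have [measurable]: "meas (F (X n))" for n using X(1) by (intro m) blast
   have [measurable]: "meas (F t)" by (rule m[OF t'])
   show "(\<lambda>x. (norm (F (X n) x - F t x))^2) \<in> borel_measurable lborel" for n by measurable
   show "integrable lborel (\<lambda>x. (2*C * decay \<sigma> x)^2)"
    using exp_square_integrable[OF C(2), of "2*C"] by (simp add: square_integrable_def)
   show "AE x in lborel. norm ((norm (F (X n) x - F t x))^2) \<le> (2*C * decay \<sigma> x)^2" for n
   proof (rule AE_I2)
    fix x
    have "norm (F (X n) x - F t x) \<le> C * decay \<sigma> x + C * decay \<sigma> x"
     using X(1) t' by (intro order_trans[OF norm_triangle_ineq4] add_mono C(3)) auto
    then show "norm ((norm (F (X n) x - F t x))^2) \<le> (2*C * decay \<sigma> x)^2" by (simp add: power_mono)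
   qed
   show "AE x in lborel. (\<lambda>n. (norm (F (X n) x - F t x))^2) \<longlonglongrightarrow> 0"
   proof (rule AE_I2)
    fix x
    have "(\<lambda>n. F (X n) x) \<longlonglongrightarrow> F t x"
    proof (cases "x \<ge> 0")
     case True
     then show ?thesis using X by (intro hc_tendsto[OF F _ t', where Y = "\<lambda>_. x"]) auto
    next
     case False
     then show ?thesis using X(1) t' hcD(2)[OF F] by (auto simp: causal_def)
    qed
    then have "(\<lambda>n. (norm (F (X n) x - F t x))^2) \<longlonglongrightarrow> (norm (F t x - F t x))^2" by (intro tendsto_intros)
    then show "(\<lambda>n. (norm (F (X n) x - F t x))^2) \<longlonglongrightarrow> 0" by simp
   qed
  qed simp
  then have "(\<lambda>n. sqrt (LBINT x. (norm (F (X n) x - F t x))^2)) \<longlonglongrightarrow> sqrt 0" by (intro tendsto_real_sqrt) simp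
  then show "((\<lambda>s. L2_norm (\<lambda>x. F s x - F t x)) \<circ> X) \<longlonglongrightarrow> 0" by (simp add: o_def L2_norm_def)
 qed
 moreover have "at t within {-T..T} = at t" using t by (intro at_within_Icc_at) auto
 ultimately show ?thesis by (simp add: isCont_def L2_norm_def)
qed

lemma dx_funpow_diff:
 assumes "halfdiff n f" "halfdiff n g" "j \<le> n"
 shows "(dx ^^ j) (\<lambda>x. f x - g x) = (\<lambda>x. (dx ^^ j) f x - (dx ^^ j) g x)" using dx_funpow_linear[OF assms, of 1 "- 1"] by simp

lemma halfdiff_slice: "hcd I n F ==> t \<in> I ==> halfdiff n (F t)" using hcd_reparam[of I n F "\<lambda>_. t" "{0}"] by simp

lemma halfdiff_diff: assumes "halfdiff n f" "halfdiff n g" shows "halfdiff n (\<lambda>x. f x - g x)"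
 using hcd_add[OF assms(1) hcd_cmult[OF assms(2), of "- 1"]] by simp

lemma synth_diff: "edec f ==> edec g ==> synth (\<lambda>\<xi>. f \<xi> - g \<xi>) x = synth f x - synth g x"
 unfolding synth_def by (subst four_diff) (auto intro: edec_integrable)

lemma bracket4_diff: "bracket4 (\<lambda>\<xi>. f \<xi> - g \<xi>) = (\<lambda>\<xi>. bracket4 f \<xi> - bracket4 g \<xi>)"
 by (simp add: bracket4_def fun_eq_iff right_diff_distrib)

lemma L2_distance_isCont:
 assumes G: "!!T. T \<ge> 0 ==> hcd {-T..T} n G" and j: "j \<le> n"
 shows "isCont (\<lambda>s. 2 * sqrt (2*pi) * (L2_norm (\<lambda>\<xi>. bracket4 (G s) \<xi> - bracket4 (G t) \<xi>) + L2_norm (\<lambda>\<xi>. (dx ^^ j) (G s) \<xi> - (dx ^^ j) (G t) \<xi>))) t"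
proof -
 have g: "hcd {-(\<bar>t\<bar>+1)..\<bar>t\<bar>+1} n G" by (rule G) simp
 have "isCont (\<lambda>s. L2_norm (\<lambda>\<xi>. bracket4 (G s) \<xi> - bracket4 (G t) \<xi>)) t"
  by (rule hc_L2_isCont[where F = "\<lambda>t. bracket4 (G t)", OF hcd_hc[OF hcd_bracket4[OF g]]]) simp
 moreover have "isCont (\<lambda>s. L2_norm (\<lambda>\<xi>. (dx ^^ j) (G s) \<xi> - (dx ^^ j) (G t) \<xi>)) t"
  by (rule hc_L2_isCont[where F = "\<lambda>t. (dx ^^ j) (G t)", OF hcd_hc[OF hcd_dx_funpow[OF g j]]]) simp
 ultimately show ?thesis by (intro continuous_intros)
qed

text \<open>The boundary conditions are real-linear, so differences of two times satisfy them as
  well. The weighted norm of a difference is therefore bounded by L2 distances on the frequency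
  side.\<close>

lemma continuous_curve_synth:
 assumes G: "!!T. T \<ge> 0 ==> hcd {-T..T} n G" and n: "n \<ge> 2" and b: "!!t. G t 0 = 0" "!!t. Re (dx (G t) 0) = 0"
 shows "continuous_curve (weighted_sobolev 4 2) (weighted_sobolev_norm 4 2) (\<lambda>t. synth (G t))"
proof -
 have h: "halfdiff 2 (G t)" for t by (rule hcd_mono[OF halfdiff_slice[OF G[of "\<bar>t\<bar>"]] n]) (auto simp: abs_if)
 have h': "halfdiff (Suc (Suc 0)) (G t)" for t using h[of t] unfolding numeral_2_eq_2 .
 show ?thesis unfolding continuous_curve_def
 proof (intro conjI allI)
  show "synth (G t) \<in> weighted_sobolev 4 2" for t by (rule weighted_sobolev_synth2(1)[OF h' b])
  fix t
  let ?B = "\<lambda>s. 2 * sqrt (2*pi) * (L2_norm (\<lambda>\<xi>. bracket4 (G s) \<xi> - bracket4 (G t) \<xi>) + L2_norm (\<lambda>\<xi>. (dx ^^ 2) (G s) \<xi> - (dx ^^ 2) (G t) \<xi>))"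
  have "(?B \<longlongrightarrow> ?B t) (at t)" using L2_distance_isCont[OF G n, of t] by (simp only: isCont_def)
  then have B0: "(?B \<longlongrightarrow> 0) (at t)" by (simp add: L2_norm_def)
  have "weighted_sobolev_norm 4 2 (\<lambda>x. synth (G s) x - synth (G t) x) \<le> ?B s" for s
  proof -
   let ?q = "\<lambda>\<xi>. G s \<xi> - G t \<xi>"
   have e: "edec (G s)" "edec (G t)" by (rule halfdiffD(1)[OF h])+
   have dq: "(dx ^^ 1) ?q = (\<lambda>\<xi>. (dx ^^ 1) (G s) \<xi> - (dx ^^ 1) (G t) \<xi>)" "(dx ^^ 2) ?q = (\<lambda>\<xi>. (dx ^^ 2) (G s) \<xi> - (dx ^^ 2) (G t) \<xi>)"
    by (rule dx_funpow_diff[OF h h]; simp)+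
   have "weighted_sobolev_norm 4 2 (synth ?q) \<le> 2 * sqrt (2*pi) * (L2_norm (bracket4 ?q) + L2_norm (dx (dx ?q)))"
    by (rule weighted_sobolev_synth2(2)[OF halfdiff_diff[OF h' h']]) (use b dq(1) in \<open>simp_all\<close>)
   also have "dx (dx ?q) = (dx ^^ 2) ?q" by (simp add: numeral_2_eq_2)
   finally show ?thesis unfolding dq(2) bracket4_diff by (simp add: synth_diff[OF e, abs_def])
  qed
  then show "((\<lambda>s. weighted_sobolev_norm 4 2 (\<lambda>x. synth (G s) x - synth (G t) x)) \<longlongrightarrow> 0) (at t)"
   by (intro tendsto_sandwich[OF _ _ tendsto_const B0] always_eventually allI weighted_sobolev_norm_nonneg)
 qed
qed

section \<open>Strong measurability and boundedness of the difference\<close>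

text \<open>A simple function close to the identity on \<open>{- T..T}\<close>: composing a continuous curve with it gives the
simple functions that witness strong measurability.\<close>
definition clip_round :: "real => nat => real => real" where
 "clip_round T n t = max (- T) (min T (of_int \<lfloor>real (Suc n) * t\<rfloor> / real (Suc n)))"

lemma clip_round_tendsto: assumes "t \<in> {-T..T}" shows "(\<lambda>n. clip_round T n t) \<longlonglongrightarrow> t"
proof -
 have "(\<lambda>n. of_int \<lfloor>real (Suc n) * t\<rfloor> / real (Suc n)) \<longlonglongrightarrow> t"
 proof (rule real_tendsto_sandwich)
  show "\<forall>\<^sub>F n in sequentially. t-1 / real (Suc n) \<le> of_int \<lfloor>real (Suc n) * t\<rfloor> / real (Suc n)"
  proof (intro always_eventually allI)
   fix n
   have "real (Suc n) * t-1 \<le> of_int \<lfloor>real (Suc n) * t\<rfloor>" by linarith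
   then have "(real (Suc n) * t-1) / real (Suc n) \<le> of_int \<lfloor>real (Suc n) * t\<rfloor> / real (Suc n)" by (rule divide_right_mono) simp
   then show "t-1 / real (Suc n) \<le> of_int \<lfloor>real (Suc n) * t\<rfloor> / real (Suc n)" by (simp add: diff_divide_distrib del: of_nat_Suc)
  qed
  show "\<forall>\<^sub>F n in sequentially. of_int \<lfloor>real (Suc n) * t\<rfloor> / real (Suc n) \<le> t"
  proof (intro always_eventually allI)
   fix n
   have "of_int \<lfloor>real (Suc n) * t\<rfloor> \<le> real (Suc n) * t" by linarith
   then show "of_int \<lfloor>real (Suc n) * t\<rfloor> / real (Suc n) \<le> t" by (simp add: pos_divide_le_eq mult.commute del: of_nat_Suc)
  qed
  have "(\<lambda>n. t-1 / real (Suc n)) \<longlonglongrightarrow> t-0"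
   by (intro tendsto_diff tendsto_const) (use LIMSEQ_inverse_real_of_nat in \<open>simp add: inverse_eq_divide\<close>)
  then show "(\<lambda>n. t-1 / real (Suc n)) \<longlonglongrightarrow> t" by simp
 qed simp
 then have "(\<lambda>n. clip_round T n t) \<longlonglongrightarrow> max (- T) (min T t)"
  unfolding clip_round_def by (intro tendsto_max tendsto_min tendsto_const)
 then show ?thesis using assms by simp
qed

lemma clip_round_simple: "simple_function (lebesgue_on {-T..T}) (clip_round T n)"
proof (rule simple_function_borel_measurable)
 have "clip_round T n \<in> borel_measurable lborel" unfolding clip_round_def[abs_def] by measurable
 then show "clip_round T n \<in> borel_measurable (lebesgue_on {-T..T})" by (intro measurable_restrict_space1 measurable_completion)
 let ?A = "{\<lfloor>real (Suc n) * (- T)\<rfloor>..\<lfloor>real (Suc n) * T\<rfloor>}"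
 have "clip_round T n ` space (lebesgue_on {-T..T}) \<subseteq> (\<lambda>k. max (- T) (min T (of_int k / real (Suc n)))) ` ?A"
 proof
  fix y assume "y \<in> clip_round T n ` space (lebesgue_on {-T..T})"
  then obtain t where t: "t \<in> {-T..T}" "y = clip_round T n t" by auto
  have "real (Suc n) * (- T) \<le> real (Suc n) * t" "real (Suc n) * t \<le> real (Suc n) * T" using t(1) by (intro mult_left_mono; simp)+
  then have "\<lfloor>real (Suc n) * t\<rfloor> \<in> ?A" by (auto intro: floor_mono)
  then show "y \<in> (\<lambda>k. max (- T) (min T (of_int k / real (Suc n)))) ` ?A" using t(2) by (auto simp: clip_round_def)
 qed
 then show "finite (clip_round T n ` space (lebesgue_on {-T..T}))" by (rule finite_subset) simp
qed

lemma Linfty_curve_synth: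
 assumes G: "!!T. T \<ge> 0 ==> hcd {-T..T} 4 G" and b: "!!t. G t 0 = 0" "!!t. (dx ^^ 1) (G t) 0 = 0"
  "!!t. Im ((dx ^^ 2) (G t) 0) = 0" "!!t. Re ((dx ^^ 3) (G t) 0) = 0" and T: "T > 0"
 shows "Linfty_curve {-T..T} (weighted_sobolev 4 4) (weighted_sobolev_norm 4 4) (\<lambda>t. synth (G t))"
proof -
 let ?K = "2 * sqrt (2*pi)"
 have n4: "4 = Suc (Suc (Suc (Suc 0)))" by simp
 have e: "(dx ^^ 1) q = dx q" "(dx ^^ 2) q = dx (dx q)" "(dx ^^ 3) q = dx (dx (dx q))" "(dx ^^ 4) q = dx (dx (dx (dx q)))" for q
  by (simp_all add: eval_nat_numeral)
 have w: "synth q \<in> weighted_sobolev 4 4" "weighted_sobolev_norm 4 4 (synth q) \<le> ?K*(L2_norm (bracket4 q) + L2_norm ((dx ^^ 4) q))"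
  if "halfdiff 4 q" "q 0 = 0" "(dx ^^ 1) q 0 = 0" "Im ((dx ^^ 2) q 0) = 0" "Re ((dx ^^ 3) q 0) = 0" for q
 proof -
  show "synth q \<in> weighted_sobolev 4 4" by (rule weighted_sobolev_synth4(1)[of 0, folded n4]) (use that in \<open>simp_all only: e\<close>)
  show "weighted_sobolev_norm 4 4 (synth q) \<le> ?K*(L2_norm (bracket4 q) + L2_norm ((dx ^^ 4) q))"
   unfolding e by (rule weighted_sobolev_synth4(2)[of 0, folded n4]) (use that in \<open>simp_all only: e\<close>)
 qed
 have h: "halfdiff 4 (G t)" for t by (rule halfdiff_slice[OF G[of "\<bar>t\<bar>"]]) (auto simp: abs_if)
 show ?thesis unfolding Linfty_curve_def
 proof (intro conjI ballI exI[of _ "\<lambda>n t. synth (G (clip_round T n t))"] allI)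
  show "synth (G t) \<in> weighted_sobolev 4 4" for t by (rule w(1)[OF h b])
  \<comment> \<open>The second time for the values of the simple functions, which lie on the same
    curve.\<close>
  show "synth (G t) \<in> weighted_sobolev 4 4" for t by (rule w(1)[OF h b])
  show "simple_function (lebesgue_on {-T..T}) (\<lambda>t. synth (G (clip_round T n t)))" for n
   using simple_function_compose[OF clip_round_simple, where g = "\<lambda>t. synth (G t)"] by (simp add: o_def)
  show "AE t in lebesgue_on {-T..T}. (\<lambda>n. weighted_sobolev_norm 4 4 (\<lambda>x. synth (G (clip_round T n t)) x - synth (G t) x)) \<longlonglongrightarrow> 0"
  proof (rule AE_I2)
   fix t assume "t \<in> space (lebesgue_on {-T..T})"
   then have t: "t \<in> {-T..T}" by simp
   let ?B = "\<lambda>s. ?K*(L2_norm (\<lambda>\<xi>. bracket4 (G s) \<xi> - bracket4 (G t) \<xi>) + L2_norm (\<lambda>\<xi>. (dx ^^ 4) (G s) \<xi> - (dx ^^ 4) (G t) \<xi>))"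
   have "(\<lambda>n. ?B (clip_round T n t)) \<longlonglongrightarrow> ?B t"
    by (rule isCont_tendsto_compose[OF L2_distance_isCont[OF G order_refl, of t] clip_round_tendsto[OF t]])
   then have B0: "(\<lambda>n. ?B (clip_round T n t)) \<longlonglongrightarrow> 0" by (simp add: L2_norm_def)
   have "weighted_sobolev_norm 4 4 (\<lambda>x. synth (G s) x - synth (G t) x) \<le> ?B s" for s
   proof -
    let ?q = "\<lambda>\<xi>. G s \<xi> - G t \<xi>"
    have e: "edec (G s)" "edec (G t)" by (rule halfdiffD(1)[OF h])+
    have dq: "(dx ^^ j) ?q = (\<lambda>\<xi>. (dx ^^ j) (G s) \<xi> - (dx ^^ j) (G t) \<xi>)" if "j \<le> 4" for j
     by (rule dx_funpow_diff[OF h h that])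
    have le: "(1::nat) \<le> 4" "(2::nat) \<le> 4" "(3::nat) \<le> 4" by simp_all
    have q0: "?q 0 = 0" "(dx ^^ 1) ?q 0 = 0" "Im ((dx ^^ 2) ?q 0) = 0" "Re ((dx ^^ 3) ?q 0) = 0"
     unfolding dq[OF le(1)] dq[OF le(2)] dq[OF le(3)] by (simp_all only: b minus_complex.sel diff_self)
    have "weighted_sobolev_norm 4 4 (synth ?q) \<le> ?K*(L2_norm (bracket4 ?q) + L2_norm ((dx ^^ 4) ?q))" by (rule w(2)[OF halfdiff_diff[OF h h] q0])
    then show ?thesis unfolding dq[OF order_refl] bracket4_diff by (simp only: synth_diff[OF e, abs_def])
   qed
   then show "(\<lambda>n. weighted_sobolev_norm 4 4 (\<lambda>x. synth (G (clip_round T n t)) x - synth (G t) x)) \<longlonglongrightarrow> 0"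
    by (intro tendsto_sandwich[OF _ _ tendsto_const B0] always_eventually allI weighted_sobolev_norm_nonneg)
  qed
  have g: "hcd {-T..T} 4 G" using T by (intro G) simp
  obtain B1 where B1: "!!t. t \<in> {-T..T} ==> L2_norm (bracket4 (G t)) \<le> B1"
   using expd_L2_bounded[OF hcD(1)[OF hcd_hc[OF hcd_bracket4[OF g]]]] by metis
  obtain B2 where B2: "!!t. t \<in> {-T..T} ==> L2_norm ((dx ^^ 4) (G t)) \<le> B2"
   using expd_L2_bounded[OF hcD(1)[OF hcd_hc[OF hcd_dx_funpow[OF g order_refl]]]] by metis
  show "\<exists>B. AE t in lebesgue_on {-T..T}. weighted_sobolev_norm 4 4 (synth (G t)) \<le> B"
  proof (intro exI[of _ "?K*(B1+B2)"] AE_I2)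
   fix t assume "t \<in> space (lebesgue_on {-T..T})"
   then have t: "t \<in> {-T..T}" by simp
   show "weighted_sobolev_norm 4 4 (synth (G t)) \<le> ?K*(B1+B2)"
    by (rule order_trans[OF w(2)[OF h b]]) (intro mult_left_mono add_mono B1[OF t] B2[OF t]; simp)
  qed
 qed
qed

section \<open>Modulation in frequency and the difference of translates\<close>

lemma hc_modulate:
 assumes F: "hc I F" shows "hc I (\<lambda>t \<xi>. F t \<xi> * phase (a*\<xi>))"
proof (rule hcI)
 show "expd I (\<lambda>t \<xi>. F t \<xi> * phase (a*\<xi>))" by (rule expd_modulate[OF hcD(1)[OF F]]) measurable
 show "causal (\<lambda>\<xi>. F t \<xi> * phase (a*\<xi>))" if "t \<in> I" for t using hcD(2)[OF F that] by (simp add: causal_def)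
 show "continuous_on (I \<times> {0..}) (\<lambda>(t, \<xi>). F t \<xi> * phase (a*\<xi>))"
  using hcD(3)[OF F] unfolding case_prod_unfold by (intro continuous_intros)
qed

lemma hcd_modulate: "hcd I n F ==> hcd I n (\<lambda>t \<xi>. F t \<xi> * phase (a*\<xi>))"
proof (induction n arbitrary: F)
 case 0 then show ?case by (simp only: hcd.simps hc_modulate)
next
 case (Suc n)
 note d = hcd_dx[OF Suc.prems]
 show ?case
 proof (rule hcd_SucI[where G = "\<lambda>t \<xi>. \<i> * of_real a * (F t \<xi> * phase (a*\<xi>)) + dx (F t) \<xi> * phase (a*\<xi>)"])
  show "hc I (\<lambda>t \<xi>. F t \<xi> * phase (a*\<xi>))" by (rule hc_modulate[OF hcd_hc[OF Suc.prems]])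
  show "hcd I n (\<lambda>t \<xi>. \<i> * of_real a * (F t \<xi> * phase (a*\<xi>)) + dx (F t) \<xi> * phase (a*\<xi>))"
   by (intro hcd_add hcd_cmult Suc.IH d(1) hcd_mono[OF Suc.prems]) simp
  show "((\<lambda>\<xi>. F t \<xi> * phase (a*\<xi>)) hvd
    \<i> * of_real a * (F t x * phase (a*x)) + dx (F t) x * phase (a*x)) (at_half x)"
   if "t \<in> I" "x \<ge> 0" for t x
  proof -
   have "((\<lambda>\<xi>. F t \<xi> * phase (a*\<xi>)) hvd F t x * (phase (a*x) * (\<i> * of_real a)) + dx (F t) x * phase (a*x)) (at_half x)"
    by (intro has_vector_derivative_mult d(2)[OF that] modulate_has_vector_derivative)
   then show ?thesis by (simp only: mult_ac)
  qed
 qed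
qed

text \<open>The derivative of \<open>e\<^sup>i\<^sup>a\<^sup>\<xi> f(\<xi>)\<close> without the phase factor.\<close>
definition twist :: "real => cfun => cfun" where
 "twist a f \<xi> = \<i> * of_real a * f \<xi> + dx f \<xi>"

lemma halfdiff_twist: assumes "halfdiff (Suc n) f" shows "halfdiff n (twist a f)"
 unfolding twist_def[abs_def] by (intro hcd_add hcd_cmult halfdiff_dx(1)[OF assms] hcd_mono[OF assms]) simp

lemma dx_modulate:
 assumes "halfdiff (Suc n) f"
 shows "dx (\<lambda>\<xi>. f \<xi> * phase (a*\<xi>)) = (\<lambda>\<xi>. twist a f \<xi> * phase (a*\<xi>))"
proof
 fix x
 show "dx (\<lambda>\<xi>. f \<xi> * phase (a*\<xi>)) x = twist a f x * phase (a*x)"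
 proof (cases "x \<ge> 0")
  case True
  have "((\<lambda>\<xi>. f \<xi> * phase (a*\<xi>)) hvd f x * (phase (a*x) * (\<i> * of_real a)) + dx f x * phase (a*x)) (at_half x)"
   by (intro has_vector_derivative_mult halfdiff_dx(2)[OF assms True] modulate_has_vector_derivative)
  from dx_eqI[OF True this] show ?thesis by (simp add: twist_def algebra_simps)
 next
  case False
  then show ?thesis using halfdiffD(2)[OF assms] by (simp add: dx_def twist_def causal_def)
 qed
qed

lemma dx_twist:
 assumes "halfdiff (Suc (Suc n)) f" shows "dx (twist a f) = (\<lambda>\<xi>. \<i> * of_real a * dx f \<xi> + dx (dx f) \<xi>)"
proof -
 have "dx (\<lambda>\<xi>. \<i> * of_real a * f \<xi> + 1 * dx f \<xi>) = (\<lambda>\<xi>. \<i> * of_real a * dx f \<xi> + 1 * dx (dx f) \<xi>)"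
  by (rule dx_linear[OF hcd_mono[OF assms] halfdiff_dx(1)[OF assms]]) simp
 then show ?thesis by (simp add: twist_def[abs_def])
qed

text \<open>The third derivative of \<open>f\<close> at 0 cancels. What is left is g''(0) = - 2 i a
  f'(0) and g'''(0) = 3 a^2 f'(0) - 3 i a f''(0); the first is real and the second imaginary,
  because f'(0) is imaginary and f''(0) real.\<close>

lemma translation_difference_jet:
 fixes a :: real
 assumes f: "halfdiff 4 f" "f 0 = 0" "Re (dx f 0) = 0" "Im (dx (dx f) 0) = 0"
 defines "g \<equiv> \<lambda>\<xi>. f \<xi> - f \<xi> * phase (a*\<xi>)"
 shows "halfdiff 4 g" "g 0 = 0" "(dx ^^ 1) g 0 = 0" "Im ((dx ^^ 2) g 0) = 0" "Re ((dx ^^ 3) g 0) = 0"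
proof -
 let ?m = "\<lambda>f \<xi>. f \<xi> * phase (a*\<xi>)"
 have h: "halfdiff 4 (?m f)" by (rule hcd_modulate[OF f(1)])
 show "halfdiff 4 g" unfolding g_def by (rule halfdiff_diff[OF f(1) h])
 show "g 0 = 0" by (simp add: g_def)
 have n4: "4 = Suc (Suc (Suc (Suc 0)))" by simp
 note f4 = f(1)[unfolded n4]
 note f3 = hcd_mono[OF f4, of "Suc (Suc (Suc 0))", simplified] and t3 = halfdiff_twist[OF f4, of a]
 note t2 = halfdiff_twist[OF t3, of a]
 have d1: "dx (?m f) = ?m (twist a f)" by (rule dx_modulate[OF f4])
 have d2: "dx (dx (?m f)) = ?m (twist a (twist a f))" unfolding d1 by (rule dx_modulate[OF t3])
 have d3: "dx (dx (dx (?m f))) = ?m (twist a (twist a (twist a f)))" unfolding d2 by (rule dx_modulate[OF t2])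
 have dd: "(dx ^^ j) g = (\<lambda>\<xi>. (dx ^^ j) f \<xi> - (dx ^^ j) (?m f) \<xi>)" if "j \<le> 4" for j
  unfolding g_def by (rule dx_funpow_diff[OF f(1) h that])
 have t1v: "twist a f 0 = dx f 0" by (simp add: twist_def f(2))
 have dt: "dx (twist a f) = (\<lambda>\<xi>. \<i> * of_real a * dx f \<xi> + dx (dx f) \<xi>)" by (rule dx_twist[OF f4])
 have t2v: "twist a (twist a f) 0 = 2*\<i> * of_real a * dx f 0 + dx (dx f) 0" by (simp add: twist_def[of a "twist a f"] t1v dt)
 have ddt: "dx (dx (twist a f)) 0 = \<i> * of_real a * dx (dx f) 0 + dx (dx (dx f)) 0"
 proof -
  have h1: "halfdiff (Suc (Suc (Suc 0))) (dx f)" "halfdiff (Suc (Suc 0)) (dx (dx f))"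
   using halfdiff_dx(1)[OF f4] halfdiff_dx(1)[OF halfdiff_dx(1)[OF f4]] by auto
  have "dx (\<lambda>\<xi>. \<i> * of_real a * dx f \<xi> + 1 * dx (dx f) \<xi>) = (\<lambda>\<xi>. \<i> * of_real a * dx (dx f) \<xi> + 1 * dx (dx (dx f)) \<xi>)"
   by (rule dx_linear[OF hcd_mono[OF h1(1)] h1(2)]) simp
  then show ?thesis unfolding dt by (simp add: fun_eq_iff)
 qed
 have t3v: "twist a (twist a (twist a f)) 0 = 3*(\<i> * of_real a)*(\<i> * of_real a) * dx f 0 + 3*\<i> * of_real a * dx (dx f) 0 + dx (dx (dx f)) 0"
 proof -
  have "dx (twist a (twist a f)) 0 = \<i> * of_real a * dx (twist a f) 0 + dx (dx (twist a f)) 0" by (simp add: dx_twist[OF t3])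
  then show ?thesis unfolding twist_def[of a "twist a (twist a f)"] t2v ddt by (simp add: dt algebra_simps)
 qed
 have e: "(dx ^^ 1) q = dx q" "(dx ^^ 2) q = dx (dx q)" "(dx ^^ 3) q = dx (dx (dx q))" for q by (simp_all add: eval_nat_numeral)
 have le: "(1::nat) \<le> 4" "(2::nat) \<le> 4" "(3::nat) \<le> 4" by simp_all
 show "(dx ^^ 1) g 0 = 0" unfolding dd[OF le(1)] unfolding e d1 by (simp add: t1v)
 have "(dx ^^ 2) g 0 = - 2*\<i> * of_real a * dx f 0" unfolding dd[OF le(2)] unfolding e d2 by (simp add: t2v)
 then show "Im ((dx ^^ 2) g 0) = 0" using f(3) by simp
 have "(dx ^^ 3) g 0 = - (3*(\<i> * of_real a)*(\<i> * of_real a) * dx f 0 + 3*\<i> * of_real a * dx (dx f) 0)"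
  unfolding dd[OF le(3)] unfolding e d3 by (simp add: t3v)
 then show "Re ((dx ^^ 3) g 0) = 0" using f(3,4) by simp
qed

section \<open>The initial datum and the two solutions\<close>

definition exp_half :: "real => complex" where
 "exp_half \<xi> = (if 0 \<le> \<xi> then of_real (exp (- \<xi>)) else 0)"

lemma exp_half_derivative:
 assumes "x \<ge> 0" shows "(exp_half hvd - exp_half x) (at_half x)"
proof -
 have "((\<lambda>\<xi>. exp (- \<xi>)) has_real_derivative - exp (- x)) (at_half x)" by (auto intro!: derivative_eq_intros)
 then have "((\<lambda>\<xi>. complex_of_real (exp (- \<xi>))) hvd complex_of_real (- exp (- x))) (at_half x)"
  by (intro bounded_linear.has_vector_derivative[OF bounded_linear_of_real]) (simp add: has_real_derivative_iff_has_vector_derivative)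
 then have "((\<lambda>\<xi>. complex_of_real (exp (- \<xi>))) hvd - exp_half x) (at_half x)" using assms by (simp add: exp_half_def)
 then show ?thesis by (rule has_vector_derivative_transform[rotated 2]) (use assms in \<open>auto simp: exp_half_def\<close>)
qed

lemma halfdiff_exp_half: "halfdiff n exp_half"
proof (induction n)
 have hc: "hc {0} (\<lambda>_. exp_half)"
 proof (rule hcI)
  have [measurable]: "meas exp_half" unfolding exp_half_def[abs_def] by measurable
  show "edec exp_half" by (rule expdI[where C = 1 and \<sigma> = 1]) (auto simp: exp_half_def)
  show "causal exp_half" by (simp add: causal_def exp_half_def)
  have "continuous_on ({0} \<times> {0..}) (\<lambda>z. complex_of_real (exp (- snd z)))" for A :: "real set" by (intro continuous_intros)
  then show "continuous_on ({0::real} \<times> {0..}) (\<lambda>(t, x). exp_half x)" by (rule continuous_on_eq) (auto simp: exp_half_def)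
 qed
 case 0 then show ?case using hc by simp
 case (Suc n)
 show ?case by (rule hcd_SucI[where G = "\<lambda>_ x. - 1 * exp_half x", OF hc hcd_cmult[OF Suc]]) (use exp_half_derivative in simp)
qed

theorem theorem1:
  "\<exists>u\<^sub>1 u\<^sub>2 :: real \<Rightarrow> real \<Rightarrow> real.
     continuous_curve (weighted_sobolev 4 2) (weighted_sobolev_norm 4 2) u\<^sub>1 \<and>
     continuous_curve (weighted_sobolev 4 2) (weighted_sobolev_norm 4 2) u\<^sub>2 \<and>
     u\<^sub>1 \<noteq> (\<lambda>t x. 0) \<and> u\<^sub>2 \<noteq> (\<lambda>t x. 0) \<and>
     benjamin_ono_solution u\<^sub>1 \<and> benjamin_ono_solution u\<^sub>2 \<and>
     u\<^sub>1 \<noteq> u\<^sub>2 \<and>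
     (\<forall>T>0. Linfty_curve {-T..T} (weighted_sobolev 4 4) (weighted_sobolev_norm 4 4)
              (\<lambda>t x. u\<^sub>1 t x - u\<^sub>2 t x))"
proof -
 define p0 where "p0 = mulx (mulx exp_half)"
 have hp0: "halfdiff n p0" for n unfolding p0_def by (intro hcd_mulx halfdiff_exp_half)
 have p00: "p0 0 = 0" by (simp add: p0_def mulx_def)
 have d1: "(mulx exp_half hvd (exp_half x + of_real x * - exp_half x)) (at_half x)" if "x \<ge> 0" for x
  by (intro mulx_has_vector_derivative exp_half_derivative that)
 have d2: "(p0 hvd (mulx exp_half x + of_real x * (exp_half x + of_real x * - exp_half x))) (at_half x)" if "x \<ge> 0" for x
  unfolding p0_def by (intro mulx_has_vector_derivative d1 that)
 have dp0: "dx p0 0 = 0" using dx_eqI[OF _ d2[of 0]] by (simp add: mulx_def)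
 have cp0: "cnj (p0 x) = p0 x" for x by (simp add: p0_def mulx_def exp_half_def)
 \<comment> \<open>This value of the integral of the datum gives u(0, 0) \<noteq> 0, hence
   nontriviality of both solutions.\<close>
 have int_p0: "four p0 0 = 2"
 proof -
  have e: "edec exp_half" by (rule halfdiffD(1)[OF halfdiff_exp_half[of 0]])
  \<comment> \<open>The antiderivative is - (\<xi>^2 + 2 \<xi> + 2) exp (- \<xi>).\<close>
  have "(LBINT x. p0 x) = - (- 1*(p0 0 + (2 * mulx exp_half 0 + 2 * exp_half 0)))"
  proof (rule halfline_integral_derivative[where g = "\<lambda>x. - 1*(p0 x + (2 * mulx exp_half x + 2 * exp_half x))"])
   show "edec (\<lambda>x. - 1*(p0 x + (2 * mulx exp_half x + 2 * exp_half x)))" unfolding p0_def by (intro expd_cmult expd_add edec_mulx e)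
   show "edec p0" "causal p0" "continuous_on {0..} p0" by (rule halfdiffD[OF hp0[of 0]])+
   fix x :: real assume x: "x \<ge> 0"
   have "((\<lambda>x. - 1*(p0 x + (2 * mulx exp_half x + 2 * exp_half x))) hvd
     - 1*((mulx exp_half x + of_real x * (exp_half x + of_real x * - exp_half x))+(2*(exp_half x + of_real x * - exp_half x)+2 * - exp_half x))) (at_half x)"
    by (intro has_vector_derivative_mult_right has_vector_derivative_add d1 d2 exp_half_derivative x)
   then show "((\<lambda>x. - 1*(p0 x + (2 * mulx exp_half x + 2 * exp_half x))) hvd p0 x) (at_half x)"
    by (rule has_vector_derivative_eq_rhs) (simp add: p0_def mulx_def algebra_simps)
  qed
  then show ?thesis by (simp add: four_def p00 mulx_def exp_half_def)
 qed
 obtain p where p: "p 0 = p0" "!!T. T \<ge> 0 ==> flow {-T..T} p p" "!!T. T \<ge> 0 ==> hcd {-T..T} 4 p"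
  "!!t. p t 0 = 0" "!!t. Re (dx (p t) 0) = 0" "!!t. Im (dx (dx (p t)) 0) = 0"
  using global_flow[OF hp0[of 4] _ cp0 p00 dp0] by (metis numeral_le_iff semiring_norm(69) semiring_norm(71) semiring_norm(68) numeral_Bit0)
 define P where "P t \<xi> = 2 * p t \<xi>" for t \<xi>
 \<comment> \<open>Multiplication by exp (i \<xi>) is translation by 1 in physical space.\<close>
 define Q where "Q t \<xi> = P t \<xi> * phase (1*\<xi>)" for t \<xi>
 have hp: "halfdiff 4 (p t)" for t by (rule halfdiff_slice[OF p(3)[of "\<bar>t\<bar>"]]) (auto simp: abs_if)
 have hP: "hcd {-T..T} 4 P" if "T \<ge> 0" for T unfolding P_def[abs_def] by (intro hcd_cmult p(3) that)
 have hQ: "hcd {-T..T} 4 Q" if "T \<ge> 0" for T unfolding Q_def[abs_def] by (intro hcd_modulate hP that)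
 have sP: "halfdiff 4 (P t)" for t unfolding P_def[abs_def] by (rule hcd_cmult[OF hp])
 have sQ: "halfdiff 4 (Q t)" for t unfolding Q_def[abs_def] by (rule hcd_modulate[OF sP])
 have jP: "(dx ^^ j) (P t) = (\<lambda>x. 2*(dx ^^ j) (p t) x)" if "j \<le> 4" for j t
  using dx_funpow_linear[OF hp[of t] hp[of t] that, of 2 0] by (simp add: P_def[abs_def])
 have bP: "P t 0 = 0" "Re (dx (P t) 0) = 0" "Im (dx (dx (P t)) 0) = 0" for t
  using p(4,5,6)[of t] jP[of 1 t] jP[of 2 t] by (auto simp: P_def eval_nat_numeral)
 have bQ: "Q t 0 = 0" "Re (dx (Q t) 0) = 0" for t
 proof -
  have "dx (Q t) = (\<lambda>\<xi>. twist 1 (P t) \<xi> * phase (1*\<xi>))"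
   unfolding Q_def[abs_def] by (rule dx_modulate[OF hcd_mono[OF sP[of t], of "Suc 0"]]) simp
  then show "Q t 0 = 0" "Re (dx (Q t) 0) = 0" using bP[of t] by (auto simp: Q_def twist_def)
 qed
 define u where "u t = synth (P t)" for t
 have u2: "synth (Q t) = (\<lambda>x. u t (x+1))" for t
  by (simp add: fun_eq_iff u_def synth_def four_def Q_def mult_exp_exp[symmetric] mult.assoc distrib_right distrib_left exp_add mult_ac)
 have nz: "u 0 0 \<noteq> 0"
 proof -
  have "u 0 0 = 2 * Re (2 * four p0 0)" unfolding u_def synth_def P_def[abs_def] p(1) four_cmult ..
  then show ?thesis by (simp add: int_p0)
 qed
 have ne: "u \<noteq> (\<lambda>t x. u t (x+1))"
 proof
  assume eq: "u = (\<lambda>t x. u t (x+1))"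
  \<comment> \<open>Equality would make the initial value 1-periodic, against its decay and u(0, 0)
    \<noteq> 0.\<close>
  have per: "u 0 (real n) = u 0 0" for n
  proof (induction n)
   case (Suc n)
   have "u 0 (real n) = u 0 (real n + 1)" using fun_cong[OF fun_cong[OF eq, of 0], of "real n"] .
   with Suc show ?case by (simp add: add.commute)
  qed simp
  have "halfdiff (Suc (Suc 0)) (P 0)" by (rule hcd_mono[OF sP]) simp
  then obtain C where C: "!!x. \<bar>synth (P 0) x\<bar> \<le> C*(1/(1+x^2))" using synth_decay[of 0 "P 0"] bP(1) by metis
  have "(\<lambda>n. C*(1/(1+(real n)^2))) \<longlonglongrightarrow> 0" by real_asymp
  then have "(\<lambda>n. u 0 (real n)) \<longlonglongrightarrow> 0" by (rule Lim_null_comparison[rotated]) (use C in \<open>auto simp: u_def\<close>)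
  then show False using nz by (simp add: per LIMSEQ_const_iff)
 qed
 show ?thesis
 proof (rule exI[of _ u], rule exI[of _ "\<lambda>t x. u t (x+1)"], intro conjI allI impI)
  show "continuous_curve (weighted_sobolev 4 2) (weighted_sobolev_norm 4 2) u"
   using continuous_curve_synth[OF hP _ bP(1,2)] by (simp add: u_def[abs_def])
  show "continuous_curve (weighted_sobolev 4 2) (weighted_sobolev_norm 4 2) (\<lambda>t x. u t (x+1))"
   using continuous_curve_synth[OF hQ _ bQ] by (simp add: u2)
  show "u \<noteq> (\<lambda>t x. 0)" using nz by (auto simp: fun_eq_iff)
  show "(\<lambda>t x. u t (x+1)) \<noteq> (\<lambda>t x. 0)"
  proof
   assume "(\<lambda>t x. u t (x+1)) = (\<lambda>t x. 0)"
   from fun_cong[OF fun_cong[OF this, of 0], of "- 1"] show False using nz by simp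
  qed
  show bo: "benjamin_ono_solution u" unfolding u_def[abs_def] P_def[abs_def] by (rule benjamin_ono_synth[OF p(2)])
  show "benjamin_ono_solution (\<lambda>t x. u t (x+1))" by (rule benjamin_ono_translate[OF bo])
  show "u \<noteq> (\<lambda>t x. u t (x+1))" by (rule ne)
  fix T :: real assume T: "T > 0"
  define G where "G t \<xi> = P t \<xi> - P t \<xi> * phase (1*\<xi>)" for t \<xi>
  have "hcd {-T..T} 4 G" if "T \<ge> 0" for T using hcd_add[OF hP[OF that] hcd_cmult[OF hQ[OF that], of "- 1"]] by (simp add: G_def[abs_def] Q_def)
  moreover note translation_difference_jet[OF sP bP, of _ 1, folded G_def]
  ultimately have "Linfty_curve {-T..T} (weighted_sobolev 4 4) (weighted_sobolev_norm 4 4) (\<lambda>t. synth (G t))"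
   using T by (intro Linfty_curve_synth) auto
  moreover have "synth (G t) = (\<lambda>x. u t x - u t (x+1))" for t
  proof
   fix x
   have "G t = (\<lambda>\<xi>. P t \<xi> - Q t \<xi>)" by (simp add: G_def Q_def fun_eq_iff)
   then show "synth (G t) x = u t x - u t (x+1)" using synth_diff[OF halfdiffD(1)[OF sP] halfdiffD(1)[OF sQ]] u2[of t] by (simp add: u_def)
  qed
  ultimately show "Linfty_curve {-T..T} (weighted_sobolev 4 4) (weighted_sobolev_norm 4 4) (\<lambda>t x. u t x - u t (x+1))" by simp
 qed
qed

end
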